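(* (1) Let $\alpha>0$ and let $p_0$ be a probability density supported on $(0,\infty)$. Consider the problem $$p_t=\tfrac12 p_{xx}+\alpha N(t)p_x \text{ on } [0,T)\times(0,\infty),\quad N(t)=\tfrac12 p_x(t,0),\quad p(t,0)=0,\quad p(0,x)=p_0(x). \qquad (\mathrm{A})$$ If there exists $\mu>0$ such that $$\mu\alpha\int_0^\infty e^{-\mu x}p_0(x)\,dx\ge 1,$$ then there is no weak solution to (A) for all time $t\ge0$ (i.e. on $[0,\infty)$). In this case, a weak solution can only exist before time $$T:=\frac{2}{\mu^2}\ln\frac{\int_0^\infty p_0(x)\,dx}{\int_0^\infty e^{-\mu x}p_0(x)\,dx},$$ i.e. if there is a weak solution on $[0,T')$ then $T'\le T$. In particular, if $\alpha>2\int_0^\infty x\,p_0(x)\,dx$, or if $\alpha>\big(\mu\int_0^\infty e^{-\mu x}p_0(x)\,dx\big)^{-1}$ for some $\mu>0$, then there is no weak solution to (A) for all time $t\ge 0$. (2) Let $\alpha>0$, $\beta\in\mathbb R$, and let $q_0$ be a probability density supported on $(0,\infty)$. Consider the problem $$q_t=\tfrac12 q_{xx}-(\alpha\lambda(t)+\beta)q_x \text{ on } [0,T)\times(0,\infty),\quad \lambda(t)=-\frac12\frac{q_x(t,0)}{\int_0^\infty q(t,y)\,dy},\quad q(t,0)=0,\quad q(0,x)=q_0(x). \qquad (\mathrm{B})$$ If there exists a positive number $\mu>2\beta$ such that $$(1+\alpha\mu)\int_0^\infty e^{-\mu x}q_0(x)\,dx\ge\int_0^\infty q_0(x)\,dx,$$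 then there is no generalized solution to (B) for all time $t\ge0$. In this case, a generalized solution can only exist before time $$T:=\frac{2}{\mu(\mu-2\beta)}\ln\left(\frac{\int_0^\infty q_0(x)\,dx}{\int_0^\infty e^{-\mu x}q_0(x)\,dx}\right),$$ i.e. if there is a generalized solution on $[0,T')$ then $T'\le T$.
   Context: Weak solution of (A): a pair of non-negative functions $(p,N)$ is a weak solution in $[0,T)$ if $p\in L^\infty([0,T);L^1(\mathbb R^+))$ (i.e. $p(t,\cdot)\in L^1(\mathbb R^+)$ for all $t\in[0,T)$ and $\sup_{t\in[0,T)}\|p(t,\cdot)\|_{L^1(\mathbb R^+)}<\infty$), $N\in L^1_{loc}([0,T))$, and for every $T'<T$ and every $\phi\in C^\infty([0,T']\times[0,\infty))$ with $\phi,\phi_t,\phi_x,\phi_{xx}\in L^\infty([0,T']\times[0,\infty))$, $$\int_0^{T'}\!\!\int_0^\infty p\left[-\phi_t+\alpha N(t)\phi_x-\tfrac12\phi_{xx}\right]dx\,dt=-\int_0^{T'}N(t)\phi(t,0)\,dt+\int_0^\infty p_0(x)\phi(0,x)\,dx-\int_0^\infty p(T',x)\phi(T',x)\,dx.$$ Generalized solution of (B): a pair $(q,\lambda)$ is a generalized solution in $[0,T)$ if $\lambda\in L^2_{loc}([0,T))$ and, for every $T'<T$, the unique solution in $W_2^{1,2}([0,T']\times[0,\infty))$ of $$q_t=\tfrac12q_{xx}-(\alpha\lambda(t)+\beta)q_x,\quad q(t,0)=0,\quad q(0,x)=q_0(x)$$ satisfies $\lambda(t)=-\frac12\frac{q_x(t,0)}{\int_0^\infty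 q(t,y)\,dy}$ for almost every $t\in[0,T']$. Here $W_2^{1,2}([0,T']\times[0,\infty))$ is the Sobolev space of functions in $L^2$ whose first weak time derivative and first two weak space derivatives belong to $L^2$. $L^1_{loc}([0,T))$ and $L^2_{loc}([0,T))$ denote functions that are $L^1$, respectively $L^2$, on $[0,T']$ for every $T'<T$. *)

theory Defs
  imports "HOL-Analysis.Analysis"
begin

text \<open>
  Functions of time and space are curried, time first. Membership in a Lebesgue space is stated for
  representatives, so sign conditions and the like are imposed up to null sets. The end of a time
  interval \<open>[0,T)\<close> is an extended real, so that \<open>T = \<infinity>\<close> means global existence.
\<close>

definition pd_t :: "real set \<Rightarrow> (real \<Rightarrow> real \<Rightarrow> real) \<Rightarrow> real \<Rightarrow> real \<Rightarrow> real" where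
  "pd_t I \<phi> t x = vector_derivative (\<lambda>s. \<phi> s x) (at t within I)"

definition pd_x :: "real set \<Rightarrow> (real \<Rightarrow> real \<Rightarrow> real) \<Rightarrow> real \<Rightarrow> real \<Rightarrow> real" where
  "pd_x J \<phi> t x = vector_derivative (\<phi> t) (at x within J)"

text \<open>
  \<open>C_k k I J \<phi>\<close>: all iterated partial derivatives of order at most \<open>k\<close> exist and are continuous on
  \<open>I \<times> J\<close>. Derivatives at end points of the intervals \<open>I\<close>, \<open>J\<close> are one-sided, so this is smoothness
  up to the boundary.
\<close>

primrec C_k :: "nat \<Rightarrow> real set \<Rightarrow> real set \<Rightarrow> (real \<Rightarrow> real \<Rightarrow> real) \<Rightarrow> bool" where
  "C_k 0 I J \<phi> = continuous_on (I \<times> J) (\<lambda>(t, x). \<phi> t x)"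
| "C_k (Suc k) I J \<phi> =
     (continuous_on (I \<times> J) (\<lambda>(t, x). \<phi> t x) \<and>
      (\<forall>t\<in>I. \<forall>x\<in>J. (\<lambda>s. \<phi> s x) differentiable (at t within I) \<and>
                  \<phi> t differentiable (at x within J)) \<and>
      C_k k I J (pd_t I \<phi>) \<and> C_k k I J (pd_x J \<phi>))"

definition C_infinity :: "real set \<Rightarrow> real set \<Rightarrow> (real \<Rightarrow> real \<Rightarrow> real) \<Rightarrow> bool" where
  "C_infinity I J \<phi> \<longleftrightarrow> (\<forall>k. C_k k I J \<phi>)"

definition bounded_on :: "(real \<times> real) set \<Rightarrow> (real \<Rightarrow> real \<Rightarrow> real) \<Rightarrow> bool" where
  "bounded_on S \<phi> \<longleftrightarrow> bounded ((\<lambda>(t, x). \<phi> t x) ` S)"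

definition L2_on :: "'a::euclidean_space set \<Rightarrow> ('a \<Rightarrow> real) \<Rightarrow> bool" where
  "L2_on S f \<longleftrightarrow>
     set_borel_measurable lebesgue S f \<and> set_integrable lebesgue S (\<lambda>z. (f z)\<^sup>2)"

definition density_on_pos :: "(real \<Rightarrow> real) \<Rightarrow> bool" where
  "density_on_pos f \<longleftrightarrow>
     has_bochner_integral lebesgue f 1 \<and>
     (AE x in lebesgue. 0 \<le> f x \<and> (x \<le> 0 \<longrightarrow> f x = 0))"


section \<open>Weak solutions of problem (A)\<close>

definition weak_test_function :: "real \<Rightarrow> (real \<Rightarrow> real \<Rightarrow> real) \<Rightarrow> bool" where
  "weak_test_function T' \<phi> \<longleftrightarrow>
     C_infinity {0..T'} {0..} \<phi> \<and>
     bounded_on ({0..T'} \<times> {0..}) \<phi> \<and>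
     bounded_on ({0..T'} \<times> {0..}) (pd_t {0..T'} \<phi>) \<and>
     bounded_on ({0..T'} \<times> {0..}) (pd_x {0..} \<phi>) \<and>
     bounded_on ({0..T'} \<times> {0..}) (pd_x {0..} (pd_x {0..} \<phi>))"

text \<open>
  Joint measurability of \<open>p\<close> is part of \<open>p \<in> L\<^sup>\<infinity>([0,T); L\<^sup>1)\<close> and gives a meaning to
  the double integral.
\<close>

definition weak_solution_A ::
  "real \<Rightarrow> (real \<Rightarrow> real) \<Rightarrow> ereal \<Rightarrow> (real \<Rightarrow> real \<Rightarrow> real) \<Rightarrow> (real \<Rightarrow> real) \<Rightarrow> bool" where
  "weak_solution_A \<alpha> p0 T p N \<longleftrightarrow>
     0 < T \<and>
     set_borel_measurable lebesgue ({t. 0 \<le> t \<and> ereal t < T} \<times> {0<..}) (\<lambda>(t, x). p t x) \<and>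
     (\<forall>t. 0 \<le> t \<and> ereal t < T \<longrightarrow> set_integrable lebesgue {0<..} (p t)) \<and>
     (\<exists>C. \<forall>t. 0 \<le> t \<and> ereal t < T \<longrightarrow> (LINT x:{0<..}|lebesgue. \<bar>p t x\<bar>) \<le> C) \<and>
     (\<forall>t. 0 \<le> t \<and> ereal t < T \<longrightarrow> (AE x in lebesgue. 0 < x \<longrightarrow> 0 \<le> p t x)) \<and>
     (\<forall>T'. 0 < T' \<and> ereal T' < T \<longrightarrow> set_integrable lebesgue {0..T'} N) \<and>
     (AE t in lebesgue. 0 \<le> t \<and> ereal t < T \<longrightarrow> 0 \<le> N t) \<and>
     (\<forall>T' \<phi>. 0 < T' \<and> ereal T' < T \<and> weak_test_function T' \<phi> \<longrightarrow>
        (LINT t:{0..T'}|lebesgue. LINT x:{0<..}|lebesgue.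
           p t x * (- pd_t {0..T'} \<phi> t x + \<alpha> * N t * pd_x {0..} \<phi> t x
                    - 1 / 2 * pd_x {0..} (pd_x {0..} \<phi>) t x))
        = - (LINT t:{0..T'}|lebesgue. N t * \<phi> t 0)
          + (LINT x:{0<..}|lebesgue. p0 x * \<phi> 0 x)
          - (LINT x:{0<..}|lebesgue. p T' x * \<phi> T' x))"


section \<open>Generalized solutions of problem (B)\<close>

definition space_time :: "real \<Rightarrow> (real \<times> real) set" where
  "space_time T' = {0<..<T'} \<times> {0<..}"

definition cc_test_function :: "(real \<times> real) set \<Rightarrow> (real \<Rightarrow> real \<Rightarrow> real) \<Rightarrow> bool" where
  "cc_test_function \<Omega> \<psi> \<longleftrightarrow>
     C_infinity UNIV UNIV \<psi> \<and>
     (\<exists>K. compact K \<and> K \<subseteq> \<Omega> \<and> (\<forall>t x. (t, x) \<notin> K \<longrightarrow> \<psi> t x = 0))"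

definition weak_pd_t ::
  "(real \<times> real) set \<Rightarrow> (real \<Rightarrow> real \<Rightarrow> real) \<Rightarrow> (real \<Rightarrow> real \<Rightarrow> real) \<Rightarrow> bool" where
  "weak_pd_t \<Omega> u v \<longleftrightarrow> (\<forall>\<psi>. cc_test_function \<Omega> \<psi> \<longrightarrow>
     (LINT (t, x):\<Omega>|lebesgue. u t x * pd_t UNIV \<psi> t x) =
     - (LINT (t, x):\<Omega>|lebesgue. v t x * \<psi> t x))"

definition weak_pd_x ::
  "(real \<times> real) set \<Rightarrow> (real \<Rightarrow> real \<Rightarrow> real) \<Rightarrow> (real \<Rightarrow> real \<Rightarrow> real) \<Rightarrow> bool" where
  "weak_pd_x \<Omega> u v \<longleftrightarrow> (\<forall>\<psi>. cc_test_function \<Omega> \<psi> \<longrightarrow>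
     (LINT (t, x):\<Omega>|lebesgue. u t x * pd_x UNIV \<psi> t x) =
     - (LINT (t, x):\<Omega>|lebesgue. v t x * \<psi> t x))"

text \<open>
  \<open>u\<close> belongs to \<open>W\<^sub>2\<^sup>1\<^sup>,\<^sup>2([0,T'] \<times> [0,\<infinity>))\<close>, with weak derivatives \<open>ut\<close>, \<open>ux\<close>, \<open>uxx\<close>.
\<close>

definition W122_with ::
  "real \<Rightarrow> (real \<Rightarrow> real \<Rightarrow> real) \<Rightarrow> (real \<Rightarrow> real \<Rightarrow> real) \<Rightarrow> (real \<Rightarrow> real \<Rightarrow> real) \<Rightarrow>
   (real \<Rightarrow> real \<Rightarrow> real) \<Rightarrow> bool" where
  "W122_with T' u ut ux uxx \<longleftrightarrow>
     (\<forall>v \<in> {u, ut, ux, uxx}. L2_on (space_time T') (\<lambda>(t, x). v t x)) \<and>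
     weak_pd_t (space_time T') u ut \<and>
     weak_pd_x (space_time T') u ux \<and>
     weak_pd_x (space_time T') ux uxx"

text \<open>
  Every element of \<open>W\<^sub>2\<^sup>1\<^sup>,\<^sup>2\<close> has a unique representative that is continuous on
  \<open>[0,T'] \<times> [0,\<infinity>)\<close>, and a solution is identified with it: the traces at \<open>t = 0\<close> and at \<open>x = 0\<close> are
  then its values there.
\<close>

definition W122_solution_B ::
  "real \<Rightarrow> real \<Rightarrow> (real \<Rightarrow> real) \<Rightarrow> (real \<Rightarrow> real) \<Rightarrow> real \<Rightarrow> (real \<Rightarrow> real \<Rightarrow> real) \<Rightarrow> bool" where
  "W122_solution_B \<alpha> \<beta> q0 \<Lambda> T' q \<longleftrightarrow>
     continuous_on ({0..T'} \<times> {0..}) (\<lambda>(t, x). q t x) \<and>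
     (\<exists>qt qx qxx. W122_with T' q qt qx qxx \<and>
        (AE (t, x) in lebesgue. (t, x) \<in> space_time T' \<longrightarrow>
           qt t x = 1 / 2 * qxx t x - (\<alpha> * \<Lambda> t + \<beta>) * qx t x)) \<and>
     (\<forall>t\<in>{0..T'}. q t 0 = 0) \<and>
     (AE x in lebesgue. 0 < x \<longrightarrow> q 0 x = q0 x)"

text \<open>
  For almost every \<open>t\<close> the function \<open>q t\<close> is in \<open>H\<^sup>2\<close>, hence \<open>C\<^sup>1\<close> up to the boundary, so that the
  trace \<open>q\<^sub>x(t,0)\<close> is the one-sided derivative \<open>d\<close> below. The feedback relation includes that the
  integral converges and that the quotient is defined (division by \<open>0\<close> and divergent integrals
  would otherwise silently have value \<open>0\<close>). Uniqueness of the solution of the linear problem in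
  \<open>W\<^sub>2\<^sup>1\<^sup>,\<^sup>2\<close> is a theorem about that problem, and is not made a requirement on \<open>(q, \<Lambda>)\<close>.
\<close>

definition generalized_solution_B ::
  "real \<Rightarrow> real \<Rightarrow> (real \<Rightarrow> real) \<Rightarrow> ereal \<Rightarrow> (real \<Rightarrow> real \<Rightarrow> real) \<Rightarrow> (real \<Rightarrow> real) \<Rightarrow> bool" where
  "generalized_solution_B \<alpha> \<beta> q0 T q \<Lambda> \<longleftrightarrow>
     0 < T \<and>
     (\<forall>T'. 0 < T' \<and> ereal T' < T \<longrightarrow>
        L2_on {0..T'} \<Lambda> \<and>
        W122_solution_B \<alpha> \<beta> q0 \<Lambda> T' q \<and>
        (AE t in lebesgue. t \<in> {0..T'} \<longrightarrow>
           (\<exists>d. (q t has_real_derivative d) (at 0 within {0..}) \<and>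
                set_integrable lebesgue {0<..} (q t) \<and>
                (LINT y:{0<..}|lebesgue. q t y) \<noteq> 0 \<and>
                \<Lambda> t = - (1 / 2) * (d / (LINT y:{0<..}|lebesgue. q t y)))))"

end

(*
  Write Q for the mass and E for the integral of exp(-mu x) against the solution.

  Problem (A): testing with 1 and exp(-mu x) gives Q' = -N and E' = (alpha mu E - 1) N + mu^2/2 E.
  The condition alpha mu E >= 1 propagates by Gronwall, so E >= E(0) exp(mu^2 t/2), while E <= Q <= 1.
  If alpha exceeds twice the first moment X, the bound (Q - E)/mu <= X gives E >= Q - mu X, which keeps
  the mass, and then E, bounded below for small mu, whereas the integral of (mu/2) E over time is at
  most X.

  Problem (B): formally Q' = lambda Q and E' = lambda Q + (c - alpha mu lambda) E with
  c = mu (mu - 2 beta)/2 and lambda <= 0. Then G = (1 + alpha mu) E - Q satisfies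
  G' >= -alpha mu lambda G and stays nonnegative, so that H = E - E(0) exp(c t) Q satisfies
  H' >= (c + lambda) H, and E(0) exp(c t) Q <= E <= Q.

  The identities for Q and E come from the Sobolev regularity: almost every line parallel to an axis
  carries absolutely continuous representatives (in x, of q and of its slope), q stays nonnegative by
  an energy estimate for its negative part, and the mass is finite because the L^2 bound makes the
  mass on [0, 2R] of order sqrt R only, while the cutoff costs 1/R.
*)
theory Submission
  imports Defs
begin

section \<open>Absolutely continuous functions\<close>

text \<open>Derivatives of absolutely continuous functions are never taken pointwise. A calculus
  rule is verified on short intervals with an error quadratic in the increment of a continuous
  monotone function, and such errors disappear under refinement. This tolerates the corner of
  \<open>min y 0\<close>, so the energy estimate for the negative part needs no derivative of the
  truncation.

  For (B) the obstacle is that the feedback refers to a trace: \<lambda> involves the slope at x = 0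
  of a Sobolev function, at almost every time only. A slope continuous up to x = 0 is therefore
  built from the second weak derivative, by testing with smoothed ramps; the first weak derivative,
  fixed up to null sets, has no value at 0. Likewise q_x(t,0) is shown to be integrable in time
  before any limit in the cutoff is taken.

  The combination G arises by collecting the boundary terms: E' = c E + \<lambda> (Q - \<alpha>
  \<mu> E), hence H' = (c + \<lambda>) H - \<lambda> G, so that the sign of G is exactly what the
  comparison for H needs.\<close>

text \<open>On a partition whose cells each carry an increment of \<open>A\<close> below e, the
  squared increments sum to at most e * (A b - A a). The total possible loss of \<open>H\<close> is
  therefore arbitrarily small.\<close>

lemma mono_of_quadratic_defect:
  fixes H A :: "real \<Rightarrow> real"
  assumes ab: "a \<le> b" and contA: "continuous_on {a..b} A" and C: "0 \<le> C"
    and A: "\<And>s t. a \<le> s \<Longrightarrow> s \<le> t \<Longrightarrow> t \<le> b \<Longrightarrow> A s \<le> A t"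
    and H: "\<And>s t. a \<le> s \<Longrightarrow> s \<le> t \<Longrightarrow> t \<le> b \<Longrightarrow> - (C * (A t - A s)\<^sup>2) \<le> H t - H s"
  shows "H a \<le> H b"
proof -
  have approx: "H a \<le> H b + C * e * (A b - A a)" if e: "e > 0" for e :: real
  proof -
    have "uniformly_continuous_on {a..b} A"
      using contA by (intro compact_uniformly_continuous) auto
    then obtain d where d: "d > 0"
      "\<And>x y. x \<in> {a..b} \<Longrightarrow> y \<in> {a..b} \<Longrightarrow> dist y x < d \<Longrightarrow> dist (A y) (A x) < e"
      using e unfolding uniformly_continuous_on_def by metis
    obtain n :: nat where n: "(b - a) / d < real n" using reals_Archimedean2 by blast
    have n0: "n > 0" using n ab d by (cases n) (auto simp: divide_less_0_iff)
    define p where "p i = a + real i * ((b - a) / real n)" for i :: nat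
    have step: "p (Suc i) - p i = (b - a) / real n" for i
      by (simp add: p_def algebra_simps add_divide_distrib diff_divide_distrib)
    have small: "(b - a) / real n < d"
      using n n0 d by (simp add: field_simps)
    have pa: "a \<le> p i" for i using ab by (auto simp: p_def intro!: mult_nonneg_nonneg divide_nonneg_nonneg)
    have pb: "p i \<le> b" if "i \<le> n" for i
    proof -
      have "real i * ((b - a) / real n) \<le> real n * ((b - a) / real n)"
        using that ab by (intro mult_right_mono) auto
      then show ?thesis using n0 by (simp add: p_def)
    qed
    have ple: "p i \<le> p (Suc i)" for i using step[of i] ab by (smt (verit) divide_nonneg_nonneg of_nat_0_le_iff)
    have "i \<le> n \<Longrightarrow> H a \<le> H (p i) + C * e * (A (p i) - A a)" for i
    proof (induction i)
      case 0 then show ?case by (simp add: p_def)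
    next
      case (Suc i)
      have i: "p i \<in> {a..b}" "p (Suc i) \<in> {a..b}" using Suc.prems pa pb by auto
      have mon: "A (p i) \<le> A (p (Suc i))" using A[OF pa ple pb] Suc.prems by blast
      have "dist (A (p (Suc i))) (A (p i)) < e"
        using d(2)[OF i] step[of i] small ple[of i] by (auto simp: dist_real_def)
      then have "(A (p (Suc i)) - A (p i))\<^sup>2 \<le> e * (A (p (Suc i)) - A (p i))"
        using mon by (auto simp: power2_eq_square dist_real_def intro!: mult_right_mono)
      then have "C * (A (p (Suc i)) - A (p i))\<^sup>2 \<le> C * (e * (A (p (Suc i)) - A (p i)))"
        using C by (rule mult_left_mono)
      moreover have "- (C * (A (p (Suc i)) - A (p i))\<^sup>2) \<le> H (p (Suc i)) - H (p i)"
        using H[OF pa ple pb] Suc.prems by blast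
      ultimately show ?case using Suc by (simp add: algebra_simps)
    qed
    from this[of n] show ?thesis using n0 by (simp add: p_def)
  qed
  show ?thesis
  proof (rule field_le_epsilon)
    fix e :: real assume e: "e > 0"
    define D where "D = C * (A b - A a)"
    have D: "D \<ge> 0" using C A[of a b] ab by (auto simp: D_def)
    \<comment> \<open>The divisor D + 1 covers the case D = 0 of a constant
      \<open>A\<close>.\<close>
    have "H a \<le> H b + (e / (D + 1)) * D"
      using approx[of "e / (D + 1)"] e D by (simp add: D_def mult.assoc mult.left_commute)
    also have "(e / (D + 1)) * D \<le> e" using e D by (simp add: field_simps)
    finally show "H a \<le> H b + e" by simp
  qed
qed

lemma eq_of_quadratic_defect:
  fixes H A :: "real \<Rightarrow> real"
  assumes ab: "a \<le> b" and contA: "continuous_on {a..b} A" and C: "0 \<le> C"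
    and A: "\<And>s t. a \<le> s \<Longrightarrow> s \<le> t \<Longrightarrow> t \<le> b \<Longrightarrow> A s \<le> A t"
    and H: "\<And>s t. a \<le> s \<Longrightarrow> s \<le> t \<Longrightarrow> t \<le> b \<Longrightarrow> \<bar>H t - H s\<bar> \<le> C * (A t - A s)\<^sup>2"
  shows "H a = H b"
proof -
  have "- (C * (A t - A s)\<^sup>2) \<le> H t - H s" "- (C * (A t - A s)\<^sup>2) \<le> - H t - - H s"
    if "a \<le> s" "s \<le> t" "t \<le> b" for s t
    using H[OF that] by linarith+
  note H' = this
  have "H a \<le> H b"
    using mono_of_quadratic_defect[of a b A C H, OF ab contA C A H'(1)] .
  moreover have "- H a \<le> - H b"
    using mono_of_quadratic_defect[of a b A C "\<lambda>x. - H x", OF ab contA C A H'(2)] .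
  ultimately show ?thesis by linarith
qed

section \<open>Calculus of absolutely continuous functions in integral form\<close>

text \<open>Absolute continuity with a chosen representative \<open>f\<close> of the derivative.
  Keeping \<open>f\<close> as an argument lets it be exchanged for an almost everywhere equal
  function, and no differentiability at points is involved.\<close>

definition ac_derivative :: "(real \<Rightarrow> real) \<Rightarrow> (real \<Rightarrow> real) \<Rightarrow> real \<Rightarrow> real \<Rightarrow> bool" where
  "ac_derivative F f a b \<longleftrightarrow>
     f absolutely_integrable_on {a..b} \<and> (\<forall>t\<in>{a..b}. F t = F a + integral {a..t} f)"

lemma absolutely_integrable_mult_continuous:
  fixes f k :: "real \<Rightarrow> real"
  assumes "f absolutely_integrable_on {a..b}" "continuous_on {a..b} k"
  shows "(\<lambda>x. f x * k x) absolutely_integrable_on {a..b}"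
proof -
  have "bounded (k ` {a..b})" using assms(2) by (intro compact_imp_bounded compact_continuous_image) auto
  moreover have "k \<in> borel_measurable (lebesgue_on {a..b})"
    using assms(2) by (intro continuous_imp_measurable_on_sets_lebesgue) auto
  ultimately have "(\<lambda>x. k x * f x) absolutely_integrable_on {a..b}"
    using assms(1) by (intro absolutely_integrable_bounded_measurable_product_real) auto
  then show ?thesis by (simp add: mult.commute)
qed

lemma absolutely_integrable_real_abs:
  fixes f :: "real \<Rightarrow> real"
  assumes "f absolutely_integrable_on S"
  shows "(\<lambda>x. \<bar>f x\<bar>) absolutely_integrable_on S" "(\<lambda>x. \<bar>f x\<bar>) integrable_on S"
  using absolutely_integrable_norm[OF assms] set_lebesgue_integral_eq_integral(1)
  by (auto simp: comp_def)

lemma abs_integral_mult_le: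
  fixes f k :: "real \<Rightarrow> real"
  assumes f: "f absolutely_integrable_on {s..t}" and k: "continuous_on {s..t} k"
    and c: "\<And>r. r \<in> {s..t} \<Longrightarrow> \<bar>k r\<bar> \<le> c"
  shows "\<bar>integral {s..t} (\<lambda>r. f r * k r)\<bar> \<le> c * integral {s..t} (\<lambda>r. \<bar>f r\<bar>)"
proof -
  have af: "(\<lambda>r. \<bar>f r\<bar>) integrable_on {s..t}"
    using f by (rule absolutely_integrable_real_abs)
  have "norm (integral {s..t} (\<lambda>r. f r * k r)) \<le> integral {s..t} (\<lambda>r. c * \<bar>f r\<bar>)"
  proof (rule integral_norm_bound_integral)
    show "(\<lambda>r. f r * k r) integrable_on {s..t}"
      using absolutely_integrable_mult_continuous[OF f k] set_lebesgue_integral_eq_integral(1) by blast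
    show "(\<lambda>r. c * \<bar>f r\<bar>) integrable_on {s..t}" using af by (rule integrable_on_mult_right)
    show "norm (f r * k r) \<le> c * \<bar>f r\<bar>" if "r \<in> {s..t}" for r
      using mult_right_mono[OF c[OF that], of "\<bar>f r\<bar>"] by (simp add: abs_mult mult.commute)
  qed
  then show ?thesis by simp
qed

context
  fixes F f :: "real \<Rightarrow> real" and a b :: real
  assumes ac: "ac_derivative F f a b"
begin

lemma ac_derivative_abs_integrable: "f absolutely_integrable_on {a..b}"
  using ac by (simp add: ac_derivative_def)

lemma ac_derivative_eq: "t \<in> {a..b} \<Longrightarrow> F t = F a + integral {a..t} f"
  using ac unfolding ac_derivative_def by blast

lemma ac_derivative_integrable_sub:
  assumes "a \<le> s" "t \<le> b"
  shows "f absolutely_integrable_on {s..t}" "f integrable_on {s..t}" "(\<lambda>r. \<bar>f r\<bar>) integrable_on {s..t}"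
proof -
  show *: "f absolutely_integrable_on {s..t}"
    using absolutely_integrable_on_subinterval[OF ac_derivative_abs_integrable, of s t] assms by auto
  then show "f integrable_on {s..t}" "(\<lambda>r. \<bar>f r\<bar>) integrable_on {s..t}"
    by (auto intro: absolutely_integrable_real_abs set_lebesgue_integral_eq_integral(1))
qed

lemma ac_derivative_diff:
  assumes "a \<le> s" "s \<le> t" "t \<le> b"
  shows "F t - F s = integral {s..t} f"
proof -
  have "integral {a..s} f + integral {s..t} f = integral {a..t} f"
    using assms ac_derivative_integrable_sub(2)[of a t]
    by (intro Henstock_Kurzweil_Integration.integral_combine) auto
  moreover have "F t = F a + integral {a..t} f" "F s = F a + integral {a..s} f"
    using assms by (auto intro: ac_derivative_eq)
  ultimately show ?thesis by simp
qed

lemma ac_derivative_continuous: "continuous_on {a..b} F"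
proof -
  have "continuous_on {a..b} (\<lambda>t. F a + integral {a..t} f)"
    using ac_derivative_integrable_sub(2)[of a b]
    by (intro continuous_intros indefinite_integral_continuous_1) auto
  then show ?thesis
    by (rule continuous_on_eq) (simp add: ac_derivative_eq[symmetric])
qed

lemma ac_derivative_sub:
  assumes "a \<le> s" "t \<le> b"
  shows "ac_derivative F f s t"
  unfolding ac_derivative_def
proof (intro conjI ballI)
  show "f absolutely_integrable_on {s..t}" by (rule ac_derivative_integrable_sub(1)[OF assms])
  fix u assume "u \<in> {s..t}"
  then show "F u = F s + integral {s..u} f" using ac_derivative_diff[of s u] assms by simp
qed

end

lemma ac_derivative_intro:
  assumes "f absolutely_integrable_on {a..b}" "\<And>t. a \<le> t \<Longrightarrow> t \<le> b \<Longrightarrow> F t = c + integral {a..t} f"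
  shows "ac_derivative F f a b"
  unfolding ac_derivative_def
proof (intro conjI ballI)
  fix t assume "t \<in> {a..b}"
  then show "F t = F a + integral {a..t} f" using assms(2)[of a] assms(2)[of t] by simp
qed (rule assms(1))

lemma ac_derivative_C1:
  assumes "\<And>x. x \<in> {a..b} \<Longrightarrow> (F has_real_derivative f x) (at x within {a..b})" "continuous_on {a..b} f"
  shows "ac_derivative F f a b"
  unfolding ac_derivative_def
proof (intro conjI ballI)
  show "f absolutely_integrable_on {a..b}"
    using assms(2) by (rule absolutely_integrable_continuous_real)
  fix t assume t: "t \<in> {a..b}"
  have "(f has_integral (F t - F a)) {a..t}"
    using t assms(1)
    by (intro fundamental_theorem_of_calculus)
      (auto simp flip: has_real_derivative_iff_has_vector_derivative
        intro: has_field_derivative_subset[where s = "{a..b}"])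
  then show "F t = F a + integral {a..t} f" by (simp add: integral_unique)
qed

text \<open>The primitive of |f| serves as the control function \<open>A\<close> of the
  quadratic-defect lemmas: it is continuous and monotone, and its increments bound those of every
  primitive of f.\<close>

lemma
  fixes f :: "real \<Rightarrow> real"
  assumes "a \<le> b" and f: "f absolutely_integrable_on {a..b}"
  shows abs_primitive_continuous: "continuous_on {a..b} (\<lambda>t. integral {a..t} (\<lambda>r. \<bar>f r\<bar>))"
    and abs_primitive_diff: "\<And>s t. a \<le> s \<Longrightarrow> s \<le> t \<Longrightarrow> t \<le> b \<Longrightarrow>
      integral {a..t} (\<lambda>r. \<bar>f r\<bar>) - integral {a..s} (\<lambda>r. \<bar>f r\<bar>) = integral {s..t} (\<lambda>r. \<bar>f r\<bar>)"
    and abs_primitive_mono: "\<And>s t. a \<le> s \<Longrightarrow> s \<le> t \<Longrightarrow> t \<le> b \<Longrightarrow>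
      integral {a..s} (\<lambda>r. \<bar>f r\<bar>) \<le> integral {a..t} (\<lambda>r. \<bar>f r\<bar>)"
proof -
  have ac: "ac_derivative (\<lambda>t. integral {a..t} (\<lambda>r. \<bar>f r\<bar>)) (\<lambda>r. \<bar>f r\<bar>) a b"
    using absolutely_integrable_norm[OF f] by (intro ac_derivative_intro[where c=0]) (auto simp: comp_def)
  show "continuous_on {a..b} (\<lambda>t. integral {a..t} (\<lambda>r. \<bar>f r\<bar>))"
    by (rule ac_derivative_continuous[OF ac])
  show *: "\<And>s t. a \<le> s \<Longrightarrow> s \<le> t \<Longrightarrow> t \<le> b \<Longrightarrow>
      integral {a..t} (\<lambda>r. \<bar>f r\<bar>) - integral {a..s} (\<lambda>r. \<bar>f r\<bar>) = integral {s..t} (\<lambda>r. \<bar>f r\<bar>)"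
    by (rule ac_derivative_diff[OF ac])
  fix s t assume st: "a \<le> s" "s \<le> t" "t \<le> b"
  have "0 \<le> integral {s..t} (\<lambda>r. \<bar>f r\<bar>)"
    using ac_derivative_integrable_sub(2)[OF ac st(1,3)] by (intro integral_nonneg) auto
  then show "integral {a..s} (\<lambda>r. \<bar>f r\<bar>) \<le> integral {a..t} (\<lambda>r. \<bar>f r\<bar>)" using *[OF st] by linarith
qed

lemma ac_derivative_abs_diff_le:
  assumes "ac_derivative F f a b" "a \<le> s" "s \<le> t" "t \<le> b"
  shows "\<bar>F t - F s\<bar> \<le> integral {s..t} (\<lambda>r. \<bar>f r\<bar>)"
proof -
  have "norm (integral {s..t} f) \<le> integral {s..t} (\<lambda>r. \<bar>f r\<bar>)"
    using ac_derivative_integrable_sub[OF assms(1,2,4)] by (intro integral_norm_bound_integral) auto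
  then show ?thesis using ac_derivative_diff[OF assms] by simp
qed

lemma ac_integral_mono:
  fixes f :: "real \<Rightarrow> real"
  assumes "f absolutely_integrable_on {s..t}" "s \<le> s'" "t' \<le> t"
  shows "integral {s'..t'} (\<lambda>r. \<bar>f r\<bar>) \<le> integral {s..t} (\<lambda>r. \<bar>f r\<bar>)"
proof -
  have "(\<lambda>r. \<bar>f r\<bar>) absolutely_integrable_on {s..t}"
    using absolutely_integrable_norm[OF assms(1)] by (simp add: comp_def)
  then show ?thesis
    using assms absolutely_integrable_on_subinterval[of "{s..t}" "\<lambda>r. \<bar>f r\<bar>" s' t']
    by (intro integral_subset_le) (auto simp: set_lebesgue_integral_eq_integral(1))
qed

text \<open>The splitting (F t - F s) * G t + (G t - G s) * F s of the increment of the product is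
  exact. Hence the error on [s,t] consists of the integrals of f r * (G t - G r) and g r * (F s - F
  r), each bounded by the product of the integrals of |f| and |g|.\<close>

lemma ac_derivative_mult:
  assumes F: "ac_derivative F f a b" and G: "ac_derivative G g a b"
  shows "ac_derivative (\<lambda>x. F x * G x) (\<lambda>x. f x * G x + F x * g x) a b"
proof -
  let ?h = "\<lambda>x. f x * G x + F x * g x"
  have h: "?h absolutely_integrable_on {a..b}"
    using absolutely_integrable_mult_continuous[OF ac_derivative_abs_integrable[OF F] ac_derivative_continuous[OF G]]
      absolutely_integrable_mult_continuous[OF ac_derivative_abs_integrable[OF G] ac_derivative_continuous[OF F]]
    by (intro set_integral_add) (auto simp: mult.commute)
  \<comment> \<open>The sum |f| + |g| gives one control function whose squared increment dominates
    both error terms.\<close>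
  define e where "e = (\<lambda>r. \<bar>f r\<bar> + \<bar>g r\<bar>)"
  have e: "e absolutely_integrable_on {a..b}"
    using absolutely_integrable_norm[OF ac_derivative_abs_integrable[OF F]]
      absolutely_integrable_norm[OF ac_derivative_abs_integrable[OF G]]
    unfolding e_def by (intro set_integral_add) (auto simp: comp_def)
  have ebs: "\<bar>e r\<bar> = e r" "\<bar>f r\<bar> \<le> e r" "\<bar>g r\<bar> \<le> e r" "0 \<le> e r" for r by (auto simp: e_def)
  define A where "A = (\<lambda>t. integral {a..t} (\<lambda>r. \<bar>e r\<bar>))"
  have eint: "e integrable_on {s..t}" if "a \<le> s" "t \<le> b" for s t
    using absolutely_integrable_on_subinterval[OF e, of s t] that by (auto simp: set_lebesgue_integral_eq_integral(1))
  have defect: "\<bar>F t * G t - F s * G s - integral {s..t} ?h\<bar> \<le> (A t - A s)\<^sup>2"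
    if st: "a \<le> s" "s \<le> t" "t \<le> b" for s t
  proof -
    have Adiff: "A t - A s = integral {s..t} e"
      using abs_primitive_diff[OF _ e st] st by (simp add: A_def ebs)
    have fi: "f absolutely_integrable_on {s..t}" and gi: "g absolutely_integrable_on {s..t}"
      using ac_derivative_integrable_sub(1) F G st by blast+
    have cF: "continuous_on {s..t} F" and cG: "continuous_on {s..t} G"
      using ac_derivative_continuous[OF ac_derivative_sub[OF F st(1,3)]]
        ac_derivative_continuous[OF ac_derivative_sub[OF G st(1,3)]] by auto
    have bF: "\<bar>F s - F r\<bar> \<le> integral {s..t} (\<lambda>r. \<bar>f r\<bar>)" if "r \<in> {s..t}" for r
      using ac_derivative_abs_diff_le[OF F, of s r] ac_integral_mono[OF fi, of s r] that st by (simp add: abs_minus_commute)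
    have bG: "\<bar>G t - G r\<bar> \<le> integral {s..t} (\<lambda>r. \<bar>g r\<bar>)" if "r \<in> {s..t}" for r
      using ac_derivative_abs_diff_le[OF G, of r t] ac_integral_mono[OF gi, of r t] that st by simp
    have i1: "(\<lambda>r. f r * (G t - G r)) integrable_on {s..t}" "(\<lambda>r. g r * (F s - F r)) integrable_on {s..t}"
      "(\<lambda>r. f r * G t) integrable_on {s..t}" "(\<lambda>r. g r * F s) integrable_on {s..t}" "?h integrable_on {s..t}"
      using fi gi cF cG
      by (auto intro!: set_lebesgue_integral_eq_integral(1) absolutely_integrable_mult_continuous
            continuous_intros absolutely_integrable_on_subinterval[OF h] simp: st)
        (use absolutely_integrable_on_subinterval[OF h] st in auto)
    have "integral {s..t} ?h = integral {s..t} (\<lambda>r. (f r * G t + g r * F s) - (f r * (G t - G r) + g r * (F s - F r)))"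
      by (intro integral_cong) (simp add: algebra_simps)
    also have "\<dots> = integral {s..t} (\<lambda>r. f r * G t) + integral {s..t} (\<lambda>r. g r * F s) -
         (integral {s..t} (\<lambda>r. f r * (G t - G r)) + integral {s..t} (\<lambda>r. g r * (F s - F r)))"
      using i1 by (simp add: integral_diff integral_add integrable_add)
    also have "integral {s..t} (\<lambda>r. f r * G t) = (F t - F s) * G t"
      using ac_derivative_diff[OF F st] by simp
    also have "integral {s..t} (\<lambda>r. g r * F s) = (G t - G s) * F s"
      using ac_derivative_diff[OF G st] by simp
    finally have eq: "F t * G t - F s * G s - integral {s..t} ?h =
       integral {s..t} (\<lambda>r. f r * (G t - G r)) + integral {s..t} (\<lambda>r. g r * (F s - F r))"
      by (simp add: algebra_simps)
    have "\<bar>integral {s..t} (\<lambda>r. f r * (G t - G r))\<bar> \<le> integral {s..t} (\<lambda>r. \<bar>g r\<bar>) * integral {s..t} (\<lambda>r. \<bar>f r\<bar>)"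
      using fi cG bG by (intro abs_integral_mult_le continuous_intros) auto
    moreover have "\<bar>integral {s..t} (\<lambda>r. g r * (F s - F r))\<bar> \<le> integral {s..t} (\<lambda>r. \<bar>f r\<bar>) * integral {s..t} (\<lambda>r. \<bar>g r\<bar>)"
      using gi cF bF by (intro abs_integral_mult_le continuous_intros) auto
    moreover have esum: "integral {s..t} e = integral {s..t} (\<lambda>r. \<bar>f r\<bar>) + integral {s..t} (\<lambda>r. \<bar>g r\<bar>)"
      unfolding e_def using fi gi by (intro integral_add absolutely_integrable_real_abs)
    ultimately have "\<bar>F t * G t - F s * G s - integral {s..t} ?h\<bar> \<le> (integral {s..t} (\<lambda>r. \<bar>f r\<bar>) + integral {s..t} (\<lambda>r. \<bar>g r\<bar>))\<^sup>2"
      unfolding eq power2_sum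
      using zero_le_power2[of "integral {s..t} (\<lambda>r. \<bar>f r\<bar>)"]
        zero_le_power2[of "integral {s..t} (\<lambda>r. \<bar>g r\<bar>)"]
        mult.commute[of "integral {s..t} (\<lambda>r. \<bar>f r\<bar>)" "integral {s..t} (\<lambda>r. \<bar>g r\<bar>)"]
      by linarith
    then show ?thesis using esum Adiff by simp
  qed
  have hI: "integral {a..t} ?h - integral {a..s} ?h = integral {s..t} ?h" if "a \<le> s" "s \<le> t" "t \<le> b" for s t
    using Henstock_Kurzweil_Integration.integral_combine[of a s t ?h]
      absolutely_integrable_on_subinterval[OF h, of a t] that by (auto simp: set_lebesgue_integral_eq_integral(1))
  show ?thesis
  proof (rule ac_derivative_intro[OF h, where c = "F a * G a"])
    fix t assume t: "a \<le> t" "t \<le> b"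
    have AA: "continuous_on {a..t} A" "\<And>s u. a \<le> s \<Longrightarrow> s \<le> u \<Longrightarrow> u \<le> t \<Longrightarrow> A s \<le> A u"
      using abs_primitive_continuous[OF _ e] abs_primitive_mono[OF _ e] t
      by (auto simp: A_def intro: continuous_on_subset)
    have d: "\<bar>(F u * G u - integral {a..u} ?h) - (F s * G s - integral {a..s} ?h)\<bar> \<le> 1 * (A u - A s)\<^sup>2"
      if "a \<le> s" "s \<le> u" "u \<le> t" for s u
      using defect[of s u] hI[of s u] that t by (simp add: algebra_simps)
    have "F a * G a - integral {a..a} ?h = F t * G t - integral {a..t} ?h"
      using eq_of_quadratic_defect[of a t A 1 "\<lambda>u. F u * G u - integral {a..u} ?h", OF t(1) AA(1) zero_le_one AA(2) d] .
    then show "F t * G t = F a * G a + integral {a..t} ?h" by simp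
  qed
qed

text \<open>The difference of \<open>H\<close> and the primitive of \<open>h\<close> has quadratic
  defect with respect to the primitive of |e|, so it is constant. Only an estimate on each interval
  [s,t] remains to be checked by the user of this criterion.\<close>

lemma ac_defect_zero:
  fixes H e :: "real \<Rightarrow> real"
  assumes e: "e absolutely_integrable_on {a..b}" and h: "h absolutely_integrable_on {a..b}" and C: "0 \<le> C"
    and H: "\<And>s t. a \<le> s \<Longrightarrow> s \<le> t \<Longrightarrow> t \<le> b \<Longrightarrow>
      \<bar>H t - H s - integral {s..t} h\<bar> \<le> C * (integral {s..t} (\<lambda>r. \<bar>e r\<bar>))\<^sup>2"
  shows "ac_derivative H h a b"
proof (rule ac_derivative_intro[OF h, where c = "H a"])
  fix t assume t: "a \<le> t" "t \<le> b"
  define A where "A = (\<lambda>t. integral {a..t} (\<lambda>r. \<bar>e r\<bar>))"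
  have A1: "continuous_on {a..t} A"
    using abs_primitive_continuous[OF _ e] t by (auto simp: A_def intro: continuous_on_subset)
  have A2: "A s \<le> A u" if "a \<le> s" "s \<le> u" "u \<le> t" for s u
    using abs_primitive_mono[OF _ e, of s u] that t by (auto simp: A_def)
  have d: "\<bar>(H u - integral {a..u} h) - (H s - integral {a..s} h)\<bar> \<le> C * (A u - A s)\<^sup>2"
    if su: "a \<le> s" "s \<le> u" "u \<le> t" for s u
  proof -
    have "h integrable_on {a..u}"
      using absolutely_integrable_on_subinterval[OF h, of a u] su t by (auto simp: set_lebesgue_integral_eq_integral(1))
    then have "integral {a..s} h + integral {s..u} h = integral {a..u} h"
      using su by (intro Henstock_Kurzweil_Integration.integral_combine)
    then show ?thesis using H[of s u] abs_primitive_diff[OF _ e, of s u] su t by (simp add: A_def algebra_simps)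
  qed
  have "H a - integral {a..a} h = H t - integral {a..t} h"
    using eq_of_quadratic_defect[of a t A C "\<lambda>u. H u - integral {a..u} h", OF t(1) A1 C A2 d] .
  then show "H t = H a + integral {a..t} h" by simp
qed

lemma lipschitz_continuous:
  fixes K :: "real \<Rightarrow> real"
  assumes "\<And>x y. \<bar>K y - K x\<bar> \<le> L * \<bar>y - x\<bar>"
  shows "0 \<le> L" "continuous_on S K"
proof -
  show L: "0 \<le> L" using assms[of 1 0] by simp
  have "L-lipschitz_on S K" using assms L by (intro lipschitz_onI) (auto simp: dist_real_def)
  then show "continuous_on S K" by (rule lipschitz_on_continuous_on)
qed

text \<open>\<open>J\<close> needs no second derivative: its Taylor remainder and the oscillation of
  \<open>K (F r)\<close> on [s,t] each contribute at most L times the square of the integral of |f|,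
  which explains the constant 2 * L. This regularity is just right for
  \<open>(min y 0)\<^sup>2\<close>.\<close>

lemma ac_derivative_chain:
  assumes F: "ac_derivative F f a b"
    and J: "\<And>x y. \<bar>J y - J x - K x * (y - x)\<bar> \<le> L * (y - x)\<^sup>2"
    and K: "\<And>x y. \<bar>K y - K x\<bar> \<le> L * \<bar>y - x\<bar>"
  shows "ac_derivative (\<lambda>x. J (F x)) (\<lambda>x. f x * K (F x)) a b"
proof (rule ac_defect_zero[where C = "2 * L"])
  note L = lipschitz_continuous(1)[OF K]
  have contK: "continuous_on {s..t} (\<lambda>x. K (F x))" if "a \<le> s" "t \<le> b" for s t
    using ac_derivative_continuous[OF ac_derivative_sub[OF F that]]
    by (rule continuous_on_compose2[OF lipschitz_continuous(2)[OF K, of UNIV]]) auto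
  show f: "f absolutely_integrable_on {a..b}" by (rule ac_derivative_abs_integrable[OF F])
  show "(\<lambda>x. f x * K (F x)) absolutely_integrable_on {a..b}"
    using f contK by (intro absolutely_integrable_mult_continuous) auto
  show "0 \<le> 2 * L" using L by simp
  fix s t assume st: "a \<le> s" "s \<le> t" "t \<le> b"
  define I where "I = integral {s..t} (\<lambda>r. \<bar>f r\<bar>)"
  note fi = ac_derivative_integrable_sub[OF F st(1,3)]
  have osc: "\<bar>F r - F s\<bar> \<le> I" if "r \<in> {s..t}" for r
    using ac_derivative_abs_diff_le[OF F, of s r] ac_integral_mono[OF fi(1), of s r] that st by (simp add: I_def)
  have Kosc: "\<bar>K (F r) - K (F s)\<bar> \<le> L * I" if "r \<in> {s..t}" for r
    using K[of "F s" "F r"] mult_left_mono[OF osc[OF that] L] by (smt (verit))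
  have cK: "continuous_on {s..t} (\<lambda>r. K (F r) - K (F s))" using contK[OF st(1,3)] by (intro continuous_intros)
  have "integral {s..t} (\<lambda>x. f x * K (F x)) =
      integral {s..t} (\<lambda>x. f x * (K (F x) - K (F s)) + f x * K (F s))"
    by (intro integral_cong) (simp add: algebra_simps)
  also have "\<dots> = integral {s..t} (\<lambda>x. f x * (K (F x) - K (F s))) + integral {s..t} (\<lambda>x. f x * K (F s))"
    using absolutely_integrable_mult_continuous[OF fi(1) cK]
      absolutely_integrable_mult_continuous[OF fi(1) continuous_on_const[of _ "K (F s)"]]
    by (intro integral_add set_lebesgue_integral_eq_integral(1))
  also have "integral {s..t} (\<lambda>x. f x * K (F s)) = (F t - F s) * K (F s)"
    using ac_derivative_diff[OF F st] by simp
  finally have eq: "integral {s..t} (\<lambda>x. f x * K (F x)) =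
     integral {s..t} (\<lambda>x. f x * (K (F x) - K (F s))) + (F t - F s) * K (F s)" .
  have "\<bar>integral {s..t} (\<lambda>x. f x * (K (F x) - K (F s)))\<bar> \<le> L * I * I"
    using abs_integral_mult_le[OF fi(1) cK Kosc] by (simp add: I_def)
  moreover have "L * (F t - F s)\<^sup>2 \<le> L * I\<^sup>2"
    using osc[of t] st L by (intro mult_left_mono) (auto simp: abs_le_square_iff[symmetric])
  moreover note J[of "F t" "F s"]
  ultimately show "\<bar>J (F t) - J (F s) - integral {s..t} (\<lambda>x. f x * K (F x))\<bar> \<le> 2 * L * (integral {s..t} (\<lambda>r. \<bar>f r\<bar>))\<^sup>2"
    unfolding eq I_def[symmetric] power2_eq_square mult.assoc mult.commute[of "K (F s)" "F t - F s"] by linarith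
qed

section \<open>Comparison principles\<close>

text \<open>Since \<open>k\<close> has no sign, the argument starts from the last zero s before a
  point where H is negative. On a stretch [s,v] where the integral of |k| stays below 1/2, the
  minimum H w would satisfy H w >= H w / 2, impossible for H w < 0.\<close>

lemma ac_gronwall:
  fixes H k :: "real \<Rightarrow> real"
  assumes k: "k absolutely_integrable_on {a..b}" and cont: "continuous_on {a..b} H" and a: "0 \<le> H a"
    and H: "\<And>s t. a \<le> s \<Longrightarrow> s \<le> t \<Longrightarrow> t \<le> b \<Longrightarrow> integral {s..t} (\<lambda>r. k r * H r) \<le> H t - H s"
    and t: "a \<le> t" "t \<le> b"
  shows "0 \<le> H t"
proof (rule ccontr)
  assume "\<not> 0 \<le> H t"
  then have neg: "H t < 0" by simp
  define Z where "Z = {r \<in> {a..t}. H r = 0}"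
  have contt: "continuous_on {a..t} H" using cont t by (auto intro: continuous_on_subset)
  have "closed Z"
    unfolding Z_def by (rule continuous_closed_preimage_constant[OF contt]) simp
  moreover have "bounded Z" unfolding Z_def by (rule bounded_subset[of "{a..t}"]) auto
  ultimately have cZ: "compact Z" by (simp add: compact_eq_bounded_closed)
  have "\<exists>r\<ge>a. r \<le> t \<and> H r = 0" using IVT2'[of H t 0 a] a neg contt t by auto
  then have "Z \<noteq> {}" by (auto simp: Z_def)
  then obtain s where s: "s \<in> Z" "\<And>r. r \<in> Z \<Longrightarrow> r \<le> s"
    using compact_attains_sup[OF cZ] by blast
  have s': "a \<le> s" "s \<le> t" "H s = 0" using s(1) by (auto simp: Z_def)
  then have "s \<noteq> t" using neg by auto
  with s' have s': "a \<le> s" "s < t" "H s = 0" by auto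
  have Hneg: "H r \<le> 0" if "s \<le> r" "r \<le> t" for r
  proof (rule ccontr)
    assume "\<not> H r \<le> 0"
    then have "\<exists>x\<ge>r. x \<le> t \<and> H x = 0"
      using IVT2'[of H t 0 r] neg that s' continuous_on_subset[OF contt, of "{r..t}"] by auto
    then obtain x where "x \<ge> r" "x \<le> t" "H x = 0" by blast
    with s(2)[of x] that s' have "x = s" by (auto simp: Z_def)
    with \<open>x \<ge> r\<close> that have "r = s" by simp
    with \<open>\<not> H r \<le> 0\<close> s' show False by simp
  qed
  define A where "A = (\<lambda>u. integral {s..u} (\<lambda>r. \<bar>k r\<bar>))"
  have ks: "k absolutely_integrable_on {s..t}"
    using absolutely_integrable_on_subinterval[OF k, of s t] s' t by auto
  have contA: "continuous_on {s..t} A" unfolding A_def by (rule abs_primitive_continuous[OF _ ks]) (use s' in simp)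
  have As: "A s = 0" by (simp add: A_def)
  have "uniformly_continuous_on {s..t} A" using contA by (intro compact_uniformly_continuous) auto
  then obtain d where d: "d > 0" "\<And>x y. x \<in> {s..t} \<Longrightarrow> y \<in> {s..t} \<Longrightarrow> dist y x < d \<Longrightarrow> dist (A y) (A x) < 1/2"
    unfolding uniformly_continuous_on_def by (metis half_gt_zero_iff zero_less_one)
  \<comment> \<open>Half of \<open>d\<close> keeps all of [s,v] strictly within the modulus of
    continuity.\<close>
  define v where "v = min t (s + d/2)"
  have v: "s < v" "v \<le> t" using s' d by (auto simp: v_def)
  have Av: "A u < 1/2" if "s \<le> u" "u \<le> v" for u
    using d(2)[of s u] that v d(1) As by (auto simp: dist_real_def v_def min_def split: if_splits)
  obtain w where w: "w \<in> {s..v}" "\<And>r. r \<in> {s..v} \<Longrightarrow> H w \<le> H r"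
    using continuous_attains_inf[of "{s..v}" H] v continuous_on_subset[OF contt, of "{s..v}"] s' by auto
  have "H v < 0"
  proof -
    have "H v \<noteq> 0"
    proof
      assume "H v = 0"
      then have "v \<in> Z" using v s' by (simp add: Z_def)
      then show False using s(2)[of v] v by simp
    qed
    then show ?thesis using Hneg[of v] v by linarith
  qed
  then have m: "H w < 0" using w(2)[of v] v by auto
  have wt: "w \<le> t" "s \<le> w" using w v by auto
  have "\<bar>integral {s..w} (\<lambda>r. k r * H r)\<bar> \<le> (- H w) * integral {s..w} (\<lambda>r. \<bar>k r\<bar>)"
  proof (rule abs_integral_mult_le)
    show "k absolutely_integrable_on {s..w}"
      using absolutely_integrable_on_subinterval[OF ks, of s w] wt by auto
    show "continuous_on {s..w} H" using continuous_on_subset[OF contt, of "{s..w}"] wt s' by auto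
    show "\<bar>H r\<bar> \<le> - H w" if "r \<in> {s..w}" for r using w(2)[of r] Hneg[of r] that w(1) v by auto
  qed
  also have "\<dots> \<le> (- H w) * (1/2)" using Av[of w] w m by (intro mult_left_mono) (auto simp: A_def)
  finally have "- (- H w) / 2 \<le> integral {s..w} (\<lambda>r. k r * H r)" by linarith
  also have "\<dots> \<le> H w - H s" using H[of s w] s' wt t by simp
  finally show False using m s' by simp
qed

text \<open>Formally this is integration by parts of (w g)' K(F) in which the non-negative integral
  of w K'(F) g^2 is dropped. As \<open>K\<close> is only Lipschitz and monotone, the sign of that
  term is recovered on each short interval from the increments of \<open>K\<close>, up to a
  quadratic error.\<close>

lemma ac_monotone_product:
  fixes K :: "real \<Rightarrow> real"
  assumes ab: "a \<le> b" and F: "ac_derivative F g a b" and g: "ac_derivative g g' a b"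
    and P: "ac_derivative (\<lambda>x. w x * g x) p a b"
    and chi: "\<And>x. x \<in> {a..b} \<Longrightarrow> 0 \<le> w x \<and> w x \<le> C"
    and K: "\<And>x y. \<bar>K y - K x\<bar> \<le> L * \<bar>y - x\<bar>" and mono: "mono K"
  shows "integral {a..b} (\<lambda>x. p x * K (F x)) \<le> K (F b) * (w b * g b) - K (F a) * (w a * g a)"
proof -
  note L = lipschitz_continuous(1)[OF K]
  have C: "0 \<le> C" using chi[of a] ab by auto
  have contK: "continuous_on {s..t} (\<lambda>x. K (F x))" if "a \<le> s" "t \<le> b" for s t
    using ac_derivative_continuous[OF ac_derivative_sub[OF F that]]
    by (rule continuous_on_compose2[OF lipschitz_continuous(2)[OF K, of UNIV]]) auto
  define e where "e = (\<lambda>r. \<bar>g r\<bar> + \<bar>g' r\<bar> + \<bar>p r\<bar>)"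
  note gi = ac_derivative_abs_integrable[OF F]
  note gi' = ac_derivative_abs_integrable[OF g]
  note pi = ac_derivative_abs_integrable[OF P]
  have e: "e absolutely_integrable_on {a..b}"
    unfolding e_def by (intro set_integral_add(1) absolutely_integrable_real_abs gi gi' pi)
  define A where "A = (\<lambda>t. integral {a..t} (\<lambda>r. \<bar>e r\<bar>))"
  have dom: "integral {s..t} (\<lambda>r. \<bar>f r\<bar>) \<le> A t - A s" "0 \<le> integral {s..t} (\<lambda>r. \<bar>f r\<bar>)"
    if st: "a \<le> s" "s \<le> t" "t \<le> b" and f: "f absolutely_integrable_on {a..b}" "\<And>r. \<bar>f r\<bar> \<le> e r" for s t f
  proof -
    have i: "f absolutely_integrable_on {s..t}" "e absolutely_integrable_on {s..t}"
      using absolutely_integrable_on_subinterval f(1) e st by (meson atLeastatMost_subset_iff)+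
    have "integral {s..t} (\<lambda>r. \<bar>f r\<bar>) \<le> integral {s..t} (\<lambda>r. \<bar>e r\<bar>)"
      using i absolutely_integrable_real_abs order_trans[OF f(2) abs_ge_self] by (intro integral_le) auto
    then show "integral {s..t} (\<lambda>r. \<bar>f r\<bar>) \<le> A t - A s"
      unfolding A_def using abs_primitive_diff[OF ab e st] by simp
    show "0 \<le> integral {s..t} (\<lambda>r. \<bar>f r\<bar>)" using i absolutely_integrable_real_abs by (intro integral_nonneg) auto
  qed
  define h where "h = (\<lambda>x. p x * K (F x))"
  have h: "h absolutely_integrable_on {a..b}"
    unfolding h_def by (rule absolutely_integrable_mult_continuous[OF pi contK]) auto
  define H where "H = (\<lambda>t. K (F t) * (w t * g t) - integral {a..t} h)"
  have "H a \<le> H b"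
  proof (rule mono_of_quadratic_defect[of a b A "L * C + L" H, OF ab])
    show "continuous_on {a..b} A" unfolding A_def by (rule abs_primitive_continuous[OF ab e])
    show "0 \<le> L * C + L" using L C by simp
    show "A s \<le> A t" if "a \<le> s" "s \<le> t" "t \<le> b" for s t
      unfolding A_def by (rule abs_primitive_mono[OF ab e that])
    fix s t assume st: "a \<le> s" "s \<le> t" "t \<le> b"
    define D where "D = A t - A s"
    have Ig: "integral {s..t} (\<lambda>r. \<bar>g r\<bar>) \<le> D" "integral {s..t} (\<lambda>r. \<bar>g' r\<bar>) \<le> D" "integral {s..t} (\<lambda>r. \<bar>p r\<bar>) \<le> D"
      "0 \<le> integral {s..t} (\<lambda>r. \<bar>p r\<bar>)"
      using dom[OF st gi] dom[OF st gi'] dom[OF st pi] by (auto simp: D_def e_def)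
    have D: "0 \<le> D" using Ig by linarith
    have Fosc: "\<bar>F t - F r\<bar> \<le> D" if "r \<in> {s..t}" for r
      using ac_derivative_abs_diff_le[OF F, of r t]
        ac_integral_mono[OF ac_derivative_integrable_sub(1)[OF F st(1,3)], of r t] that st Ig by simp
    have Kosc: "\<bar>K (F t) - K (F r)\<bar> \<le> L * D" if "r \<in> {s..t}" for r
      using K[of "F r" "F t"] mult_left_mono[OF Fosc[OF that] L] by (smt (verit))
    have gosc: "\<bar>g r - g s\<bar> \<le> D" if "r \<in> {s..t}" for r
      using ac_derivative_abs_diff_le[OF g, of s r]
        ac_integral_mono[OF ac_derivative_integrable_sub(1)[OF g st(1,3)], of s r] that st Ig by simp
    have chis: "0 \<le> w s" "w s \<le> C" using chi[of s] st by auto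
    have gint: "g integrable_on {s..t}" by (rule ac_derivative_integrable_sub(2)[OF F st(1,3)])
    \<comment> \<open>If F t - F s and g s have the same sign, monotonicity of \<open>K\<close>
      decides. Otherwise g, whose integral is F t - F s, meets a value r with g r * g s \<le> 0, so
      |g s| is at most the oscillation of g and the whole product is quadratically small.\<close>
    have main: "- (L * D * (C * D)) \<le> (K (F t) - K (F s)) * (w s * g s)"
    proof (cases "(F t - F s) * g s \<ge> 0")
      case True
      then have "0 \<le> (K (F t) - K (F s)) * g s"
        using monoD[OF mono, of "F t" "F s"] monoD[OF mono, of "F s" "F t"]
        by (auto simp: zero_le_mult_iff)
      then have "0 \<le> (K (F t) - K (F s)) * (w s * g s)"
        using chis by (metis mult.left_commute mult_nonneg_nonneg)
      moreover have "0 \<le> L * D * (C * D)" using L C D by simp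
      ultimately show ?thesis by linarith
    next
      case False
      have "\<exists>r\<in>{s..t}. g r * g s \<le> 0"
      proof (rule ccontr)
        assume *: "\<not> (\<exists>r\<in>{s..t}. g r * g s \<le> 0)"
        have "0 \<le> integral {s..t} (\<lambda>r. g r * g s)"
          using * absolutely_integrable_mult_continuous[OF ac_derivative_integrable_sub(1)[OF F st(1,3)]
              continuous_on_const[of _ "g s"]]
          by (intro integral_nonneg set_lebesgue_integral_eq_integral(1)) (auto simp: not_le intro: less_imp_le)
        then show False using False ac_derivative_diff[OF F st] by simp
      qed
      then obtain r where r: "r \<in> {s..t}" "g r * g s \<le> 0" by blast
      have "\<bar>g s\<bar> \<le> \<bar>g r - g s\<bar>" using r(2) by (auto simp: mult_le_0_iff)
      then have gs: "\<bar>g s\<bar> \<le> D" using gosc[OF r(1)] by simp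
      have "\<bar>(K (F t) - K (F s)) * (w s * g s)\<bar> \<le> L * D * (C * D)"
        unfolding abs_mult using Kosc[of s] chis gs st L D C
        by (intro mult_mono) auto
      then show ?thesis by linarith
    qed
    have cK: "continuous_on {s..t} (\<lambda>r. K (F t) - K (F r))" using contK[OF st(1,3)] by (intro continuous_intros)
    note ps = ac_derivative_integrable_sub[OF P st(1,3)]
    have rest: "\<bar>integral {s..t} (\<lambda>r. p r * (K (F t) - K (F r)))\<bar> \<le> L * D * D"
      using abs_integral_mult_le[OF ps(1) cK Kosc] mult_left_mono[OF Ig(3), of "L * D"] L D by simp
    have "integral {s..t} h = integral {s..t} (\<lambda>r. p r * K (F t) - p r * (K (F t) - K (F r)))"
      unfolding h_def by (intro integral_cong) (simp add: algebra_simps)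
    also have "\<dots> = integral {s..t} (\<lambda>r. p r * K (F t)) - integral {s..t} (\<lambda>r. p r * (K (F t) - K (F r)))"
      using absolutely_integrable_mult_continuous[OF ps(1) cK]
        absolutely_integrable_mult_continuous[OF ps(1) continuous_on_const[of _ "K (F t)"]]
      by (intro integral_diff set_lebesgue_integral_eq_integral(1))
    also have "integral {s..t} (\<lambda>r. p r * K (F t)) = (w t * g t - w s * g s) * K (F t)"
      using ac_derivative_diff[OF P st] by simp
    finally have hst: "integral {s..t} h = (w t * g t - w s * g s) * K (F t) - integral {s..t} (\<lambda>r. p r * (K (F t) - K (F r)))" .
    have "h integrable_on {a..t}"
      using absolutely_integrable_on_subinterval[OF h, of a t] st by (auto simp: set_lebesgue_integral_eq_integral(1))
    then have "integral {a..s} h + integral {s..t} h = integral {a..t} h"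
      using st by (intro Henstock_Kurzweil_Integration.integral_combine)
    then have "H t - H s = K (F t) * (w t * g t) - K (F s) * (w s * g s) - integral {s..t} h"
      by (simp add: H_def)
    also have "\<dots> = (K (F t) - K (F s)) * (w s * g s) + integral {s..t} (\<lambda>r. p r * (K (F t) - K (F r)))"
      unfolding hst by (simp add: algebra_simps)
    finally show "- ((L * C + L) * (A t - A s)\<^sup>2) \<le> H t - H s"
      using main rest unfolding D_def[symmetric] by (simp add: power2_eq_square algebra_simps abs_le_iff)
  qed
  then show ?thesis by (simp add: H_def h_def)
qed

text \<open>On a fine division Henstock's lemma bounds the sum of |measure k * h x - integral k h|.
  The cell integrals vanish, so this is a Riemann sum of |h|, and the integral of |h| is
  zero.\<close>

lemma AE_zero_of_integrals_zero:
  fixes h :: "real \<Rightarrow> real"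
  assumes h: "h absolutely_integrable_on {a..b}"
    and z: "\<And>s t. a \<le> s \<Longrightarrow> s \<le> t \<Longrightarrow> t \<le> b \<Longrightarrow> integral {s..t} h = 0"
  shows "AE x in lebesgue. x \<in> {a..b} \<longrightarrow> h x = 0"
proof -
  have hi: "h integrable_on cbox a b" and ahi: "(\<lambda>x. \<bar>h x\<bar>) integrable_on cbox a b"
    using h absolutely_integrable_real_abs set_lebesgue_integral_eq_integral(1) by auto
  have le: "integral (cbox a b) (\<lambda>x. \<bar>h x\<bar>) \<le> 0"
  proof (rule field_le_epsilon)
    fix e :: real assume e: "e > 0"
    obtain g1 where g1: "gauge g1" "\<And>p. p tagged_partial_division_of (cbox a b) \<Longrightarrow> g1 fine p \<Longrightarrow>
        (\<Sum>(x,k)\<in>p. norm (measure lborel k *\<^sub>R h x - integral k h)) < e/2"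
      using Henstock_lemma[OF hi, of "e/2"] e by auto
    obtain g2 where g2: "gauge g2" "\<And>p. p tagged_division_of (cbox a b) \<Longrightarrow> g2 fine p \<Longrightarrow>
        norm ((\<Sum>(x,k)\<in>p. measure lborel k *\<^sub>R \<bar>h x\<bar>) - integral (cbox a b) (\<lambda>x. \<bar>h x\<bar>)) < e/2"
      using integrable_integral[OF ahi, unfolded has_integral] e by (meson half_gt_zero)
    obtain p where p: "p tagged_division_of (cbox a b)" "(\<lambda>x. g1 x \<inter> g2 x) fine p"
      using fine_division_exists[OF gauge_Int[OF g1(1) g2(1)]] by blast
    have fine: "g1 fine p" "g2 fine p" using p(2) by (auto simp: fine_Int)
    have "(\<Sum>(x,k)\<in>p. measure lborel k *\<^sub>R \<bar>h x\<bar>) = (\<Sum>(x,k)\<in>p. norm (measure lborel k *\<^sub>R h x - integral k h))"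
    proof (intro sum.cong refl, clarify)
      fix x k assume xk: "(x, k) \<in> p"
      obtain u v where k: "k = cbox u v" using tagged_division_ofD(4)[OF p(1) xk] by blast
      have "integral k h = 0"
      proof (cases "u \<le> v")
        case True
        then have "{u..v} \<subseteq> {a..b}" using tagged_division_ofD(3)[OF p(1) xk] k by simp
        with True show ?thesis using z[of u v] k by simp
      qed (simp add: k)
      then show "measure lborel k *\<^sub>R \<bar>h x\<bar> = norm (measure lborel k *\<^sub>R h x - integral k h)"
        by (simp add: abs_mult)
    qed
    also have "\<dots> < e/2"
      using g1(2)[OF _ fine(1)] p(1)
      by (simp add: tagged_division_of_def)
    finally show "integral (cbox a b) (\<lambda>x. \<bar>h x\<bar>) \<le> 0 + e" using g2(2)[OF p(1) fine(2)] unfolding real_norm_def by linarith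
  qed
  have i: "set_integrable lebesgue {a..b} (\<lambda>x. \<bar>h x\<bar>)" using absolutely_integrable_real_abs(1)[OF h] .
  have "(LINT x:{a..b}|lebesgue. \<bar>h x\<bar>) = integral {a..b} (\<lambda>x. \<bar>h x\<bar>)"
    by (rule set_lebesgue_integral_eq_integral(2)[OF i])
  moreover have "0 \<le> integral {a..b} (\<lambda>x. \<bar>h x\<bar>)" using ahi by (intro integral_nonneg) auto
  ultimately have "(LINT x|lebesgue. indicator {a..b} x *\<^sub>R \<bar>h x\<bar>) = 0"
    using le by (simp add: set_lebesgue_integral_def)
  then have "AE x in lebesgue. indicator {a..b} x *\<^sub>R \<bar>h x\<bar> = 0"
    using i by (subst (asm) integral_nonneg_eq_0_iff_AE) (auto simp: set_integrable_def)
  then show ?thesis by eventually_elim (auto simp: indicator_def)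
qed

section \<open>Smooth test functions\<close>

text \<open>The derivative is quantified existentially, so that closure properties follow by
  induction on n from the differentiation rules alone; \<open>deriv\<close> enters only for
  \<open>smooth\<close> functions.\<close>

primrec diffable_times :: "nat \<Rightarrow> (real \<Rightarrow> real) \<Rightarrow> bool" where
  "diffable_times 0 f \<longleftrightarrow> True"
| "diffable_times (Suc n) f \<longleftrightarrow> (\<exists>f'. (\<forall>x. (f has_real_derivative f' x) (at x)) \<and> diffable_times n f')"

lemma diffable_times_Suc: "diffable_times (Suc n) f \<Longrightarrow> diffable_times n f"
  by (induction n arbitrary: f) auto

lemma diffable_times_const: "diffable_times n (\<lambda>x. c)"
  by (induction n arbitrary: c) (auto intro!: exI[where x = "\<lambda>_. 0"] derivative_eq_intros)

lemma diffable_times_add: "diffable_times n f \<Longrightarrow> diffable_times n g \<Longrightarrow> diffable_times n (\<lambda>x. f x + g x)"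
proof (induction n arbitrary: f g)
  case (Suc n)
  then obtain f' g' where "\<forall>x. (f has_real_derivative f' x) (at x)" "diffable_times n f'"
    "\<forall>x. (g has_real_derivative g' x) (at x)" "diffable_times n g'" by auto
  then show ?case
    by (auto intro!: exI[where x = "\<lambda>x. f' x + g' x"] derivative_eq_intros Suc.IH)
qed simp

lemma diffable_times_mult: "diffable_times n f \<Longrightarrow> diffable_times n g \<Longrightarrow> diffable_times n (\<lambda>x. f x * g x)"
proof (induction n arbitrary: f g)
  case (Suc n)
  note fg = Suc.prems[THEN diffable_times_Suc]
  from Suc.prems obtain f' g' where *: "\<forall>x. (f has_real_derivative f' x) (at x)" "diffable_times n f'"
    "\<forall>x. (g has_real_derivative g' x) (at x)" "diffable_times n g'" by auto
  have "diffable_times n (\<lambda>x. f' x * g x + g' x * f x)"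
    by (intro diffable_times_add Suc.IH * fg)
  with * show ?case
    by (auto intro!: exI[where x = "\<lambda>x. f' x * g x + g' x * f x"] derivative_eq_intros simp: mult.commute)
qed simp

lemma diffable_times_affine: "diffable_times n f \<Longrightarrow> diffable_times n (\<lambda>x. f (c * x + d))"
proof (induction n arbitrary: f)
  case (Suc n)
  then obtain f' where *: "\<And>x. (f has_real_derivative f' x) (at x)" "diffable_times n f'" by auto
  have "((\<lambda>x. c * x + d) has_real_derivative c) (at x)" for x
    by (auto intro!: derivative_eq_intros)
  from DERIV_chain2[OF *(1) this]
  have "((\<lambda>x. f (c * x + d)) has_real_derivative f' (c * x + d) * c) (at x)" for x .
  moreover have "diffable_times n (\<lambda>x. f' (c * x + d) * c)"
    by (intro diffable_times_mult diffable_times_const Suc.IH *(2))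
  ultimately show ?case
    unfolding diffable_times.simps by (intro exI[where x = "\<lambda>x. f' (c * x + d) * c"]) simp
qed simp

definition smooth :: "(real \<Rightarrow> real) \<Rightarrow> bool" where
  "smooth f \<longleftrightarrow> (\<forall>n. diffable_times n f)"

lemma smooth_const: "smooth (\<lambda>x. c)"
  and smooth_add: "smooth f \<Longrightarrow> smooth g \<Longrightarrow> smooth (\<lambda>x. f x + g x)"
  and smooth_mult: "smooth f \<Longrightarrow> smooth g \<Longrightarrow> smooth (\<lambda>x. f x * g x)"
  and smooth_affine: "smooth f \<Longrightarrow> smooth (\<lambda>x. f (c * x + d))"
  by (auto simp: smooth_def diffable_times_const diffable_times_add diffable_times_mult diffable_times_affine)

lemma smooth_deriv:
  assumes "smooth f"
  shows "(f has_real_derivative deriv f x) (at x)" "smooth (deriv f)"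
proof -
  have *: "(f has_real_derivative deriv f x) (at x) \<and> diffable_times n (deriv f)" for n x
  proof -
    have "diffable_times (Suc n) f" using assms smooth_def by blast
    then obtain f' where f': "\<And>x. (f has_real_derivative f' x) (at x)" "diffable_times n f'" by auto
    then have "deriv f = f'" by (auto intro: DERIV_imp_deriv)
    with f' show ?thesis by simp
  qed
  show "(f has_real_derivative deriv f x) (at x)" using * by blast
  show "smooth (deriv f)" unfolding smooth_def using * by blast
qed

lemma smooth_antiderivative:
  assumes "\<And>x. (F has_real_derivative f x) (at x)" "smooth f"
  shows "smooth F" "deriv F = f"
proof -
  show "smooth F" unfolding smooth_def
  proof
    fix n show "diffable_times n F"
      using assms by (cases n) (auto simp: smooth_def)
  qed
  show "deriv F = f" using assms(1) by (auto intro: DERIV_imp_deriv)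
qed

lemma smooth_continuous_on: "smooth f \<Longrightarrow> continuous_on S f"
  using smooth_deriv(1) by (meson DERIV_isCont continuous_at_imp_continuous_on)

lemma smooth_deriv_funpow: "smooth f \<Longrightarrow> smooth ((deriv ^^ n) f)"
  by (induction n) (auto intro: smooth_deriv(2))

lemma deriv_zero_outside:
  fixes a :: "real \<Rightarrow> real"
  assumes "\<forall>r. r \<notin> {s..t} \<longrightarrow> a r = 0"
  shows "\<forall>r. r \<notin> {s..t} \<longrightarrow> deriv a r = 0"
proof (intro allI impI)
  fix r assume r: "r \<notin> {s..t}"
  have "open (- {s..t})" by (intro open_Compl) simp
  then have "eventually (\<lambda>z. z \<in> - {s..t}) (nhds r)" using r by (intro eventually_nhds_in_open) auto
  then have "eventually (\<lambda>z. a z = 0) (nhds r)" by eventually_elim (use assms in auto)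
  then have "deriv a r = deriv (\<lambda>_. 0) r" by (rule deriv_cong_ev) simp
  then show "deriv a r = 0" by simp
qed

section \<open>A flat function, and the ramp, step and bump built from it\<close>

lemma poly_mult_exp_neg_tendsto_0: "((\<lambda>y::real. poly P y * exp (- y)) \<longlongrightarrow> 0) at_top"
proof -
  have *: "((\<lambda>y::real. coeff P i * (y ^ i / exp y)) \<longlongrightarrow> coeff P i * 0) at_top" for i
    by (intro tendsto_mult tendsto_const tendsto_power_div_exp_0)
  have "((\<lambda>y::real. \<Sum>i\<le>degree P. coeff P i * (y ^ i / exp y)) \<longlongrightarrow> (\<Sum>i\<le>degree P. coeff P i * 0)) at_top"
    by (intro tendsto_sum *)
  moreover have "(\<Sum>i\<le>degree P. coeff P i * (y ^ i / exp y)) = poly P y * exp (- y)" for y :: real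
    by (simp add: poly_altdef sum_distrib_right exp_minus field_simps sum_divide_distrib)
  ultimately show ?thesis by simp
qed

text \<open>A family closed under differentiation: with y = 1/x, the derivative of P(y) exp(-y) is
  (P - P')(y) * y^2 * exp(-y), which is where the factor \<open>[:0, 0, 1:]\<close> comes from.
  Smoothness for all P follows by one induction.\<close>

definition exp_flat :: "real poly \<Rightarrow> real \<Rightarrow> real" where
  "exp_flat P x = (if x > 0 then poly P (1 / x) * exp (- (1 / x)) else 0)"

lemma exp_flat_deriv:
  "(exp_flat P has_real_derivative exp_flat ((P - pderiv P) * [:0, 0, 1:]) x) (at x)"
proof -
  consider "x > 0" | "x < 0" | "x = 0" by linarith
  then show ?thesis
  proof cases
    case 1
    have "((\<lambda>x. poly P (1 / x) * exp (- (1 / x))) has_real_derivative exp_flat ((P - pderiv P) * [:0, 0, 1:]) x) (at x)"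
      using 1
      by (auto intro!: derivative_eq_intros DERIV_chain2[OF poly_DERIV]
          simp: exp_flat_def field_simps power2_eq_square)
    then show ?thesis
      by (rule DERIV_cong_ev[THEN iffD1, rotated -1])
        (use 1 in \<open>auto simp: exp_flat_def eventually_at_filter intro!: eventually_mono[OF eventually_nhds_in_open[of "{0<..}" x]]\<close>)
  next
    case 2
    have "((\<lambda>x. 0) has_real_derivative exp_flat ((P - pderiv P) * [:0, 0, 1:]) x) (at x)"
      using 2 by (auto simp: exp_flat_def)
    then show ?thesis
      by (rule DERIV_cong_ev[THEN iffD1, rotated -1])
        (use 2 in \<open>auto simp: exp_flat_def intro!: eventually_mono[OF eventually_nhds_in_open[of "{..<0}" x]]\<close>)
  next
    case 3
    \<comment> \<open>To the right of 0 the quotient is P(y) * y * exp(-y) with y = 1/h, again a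
      polynomial against an exponential.\<close>
    have "((\<lambda>h. exp_flat P h / h) \<longlongrightarrow> 0) (at 0)"
    proof (rule filterlim_split_at)
      have "((\<lambda>h::real. poly (P * [:0, 1:]) (1 / h) * exp (- (1 / h))) \<longlongrightarrow> 0) (at_right 0)"
        using filterlim_compose[OF poly_mult_exp_neg_tendsto_0 filterlim_inverse_at_top_right, of "P * [:0, 1:]"]
        by (simp add: field_simps)
      then show "((\<lambda>h. exp_flat P h / h) \<longlongrightarrow> 0) (at_right 0)"
        by (rule Lim_transform_eventually)
          (auto simp: exp_flat_def eventually_at_filter)
      show "((\<lambda>h. exp_flat P h / h) \<longlongrightarrow> 0) (at_left 0)"
        by (rule Lim_transform_eventually[OF tendsto_const])
          (auto simp: exp_flat_def eventually_at_filter)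
    qed
    then show ?thesis using 3 by (simp add: DERIV_def exp_flat_def)
  qed
qed

lemma smooth_exp_flat: "smooth (exp_flat P)"
proof -
  have "diffable_times n (exp_flat P)" for n
    by (induction n arbitrary: P) (use exp_flat_deriv in auto)
  then show ?thesis by (simp add: smooth_def)
qed

lemma continuous_antiderivative:
  fixes f :: "real \<Rightarrow> real"
  assumes "continuous_on UNIV f"
  obtains F where "\<And>x. (F has_real_derivative f x) (at x)"
proof -
  have "\<exists>F. \<forall>x. - \<infinity> < ereal x \<longrightarrow> ereal x < \<infinity> \<longrightarrow> (F has_vector_derivative f x) (at x)"
    using assms by (intro einterval_antiderivative) (auto simp: continuous_on_eq_continuous_at)
  then show ?thesis using that by (auto simp: has_real_derivative_iff_has_vector_derivative)
qed

lemma const_of_deriv_zero: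
  fixes F :: "real \<Rightarrow> real"
  assumes "\<And>x. (F has_real_derivative f x) (at x)" "x \<le> y" "\<And>z. x \<le> z \<Longrightarrow> z \<le> y \<Longrightarrow> f z = 0"
  shows "F x = F y"
proof (cases "x = y")
  case False
  then have "x < y" using assms(2) by simp
  moreover have "continuous_on {x..y} F"
    using assms(1) by (meson DERIV_isCont continuous_at_imp_continuous_on)
  moreover have "(F has_real_derivative 0) (at z)" if "x < z" "z < y" for z
    using assms(1)[of z] assms(3)[of z] that by simp
  ultimately show ?thesis using DERIV_isconst_end[of x y F] by simp
qed simp

text \<open>The flat function times its reflection is a bump on [0,1]; its normalized primitive is
  the step, and a primitive of the step is the ramp. The offset \<kappa> = 1 - P 1 is the area
  between the step and the constant 1 on [0,1].\<close>

lemma smooth_ramp_exists: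
  "\<exists>P \<kappa>. smooth P \<and> (\<forall>x\<le>0. P x = 0) \<and> (\<forall>x\<ge>1. P x = x - \<kappa>) \<and>
     (\<forall>x. 0 \<le> deriv P x \<and> deriv P x \<le> 1) \<and> (\<forall>x. 0 \<le> deriv (deriv P) x)"
proof -
  define b where "b = (\<lambda>x. exp_flat 1 x * exp_flat 1 (- 1 * x + 1))"
  have sb: "smooth b" unfolding b_def by (intro smooth_mult smooth_affine smooth_exp_flat)
  have b0: "b x = 0" if "x \<le> 0 \<or> 1 \<le> x" for x using that by (auto simp: b_def exp_flat_def)
  have bpos: "b x \<ge> 0" "0 < x \<Longrightarrow> x < 1 \<Longrightarrow> b x > 0" for x by (auto simp: b_def exp_flat_def)
  obtain F where F: "\<And>x. (F has_real_derivative b x) (at x)"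
    using continuous_antiderivative[OF smooth_continuous_on[OF sb]] by blast
  have "F 0 < F 1"
    by (rule DERIV_pos_imp_increasing_open) (use F bpos in \<open>auto intro: DERIV_isCont continuous_at_imp_continuous_on\<close>)
  define S where "S = (\<lambda>x. (F x - F 0) / (F 1 - F 0))"
  define r where "r = (\<lambda>x. b x * (1 / (F 1 - F 0)))"
  have S': "(S has_real_derivative r x) (at x)" for x
    unfolding S_def r_def using \<open>F 0 < F 1\<close> by (auto intro!: derivative_eq_intros F)
  have sr: "smooth r" unfolding r_def by (intro smooth_mult smooth_const sb)
  note sS = smooth_antiderivative[OF S' sr]
  have rpos: "0 \<le> r x" for x using bpos \<open>F 0 < F 1\<close> by (simp add: r_def)
  have S0: "S x = 0" if "x \<le> 0" for x
    using const_of_deriv_zero[OF S' that] b0 by (simp add: S_def r_def)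
  have S1: "S x = 1" if "x \<ge> 1" for x
    using const_of_deriv_zero[OF S' that] b0 \<open>F 0 < F 1\<close> by (simp add: S_def r_def)
  have Smono: "S x \<le> S y" if "x \<le> y" for x y
    by (rule DERIV_nonneg_imp_nondecreasing[OF that]) (use S' rpos in blast)
  have Sb: "0 \<le> S x \<and> S x \<le> 1" for x
    using Smono[of x "max x 1"] Smono[of "min x 0" x] S0[of "min x 0"] S1[of "max x 1"] by simp
  obtain P0 where P0: "\<And>x. (P0 has_real_derivative S x) (at x)"
    using continuous_antiderivative[OF smooth_continuous_on[OF sS(1)]] by blast
  define P where "P = (\<lambda>x. P0 x - P0 0)"
  have P': "(P has_real_derivative S x) (at x)" for x
    unfolding P_def by (auto intro!: derivative_eq_intros P0)
  note sP = smooth_antiderivative[OF P' sS(1)]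
  have Pm: "P x = 0" if "x \<le> 0" for x
    using const_of_deriv_zero[OF P' that] S0 by (simp add: P_def)
  have "((\<lambda>x. P x - x) has_real_derivative S x - 1) (at x)" for x
    by (auto intro!: derivative_eq_intros P')
  then have "P 1 - 1 = P x - x" if "x \<ge> 1" for x
    by (rule const_of_deriv_zero[OF _ that]) (use S1 in auto)
  then have Pp: "P x = x - (1 - P 1)" if "x \<ge> 1" for x using that by (simp add: algebra_simps)
  show ?thesis
    by (rule exI[where x = P], rule exI[where x = "1 - P 1"])
      (unfold sP(2) sS(2), intro conjI allI impI sP(1) Pm Pp rpos conjunct1[OF Sb] conjunct2[OF Sb])
qed

text \<open>Ramp, step and bump are smoothed versions of the positive part, the Heaviside function
  and the Dirac mass. Rescaled, they serve as test functions that turn weak identities into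
  identities between point values; the step also supplies the spatial cutoffs.\<close>

definition smooth_ramp :: "real \<Rightarrow> real" where
  "smooth_ramp = (SOME P. \<exists>\<kappa>. smooth P \<and> (\<forall>x\<le>0. P x = 0) \<and> (\<forall>x\<ge>1. P x = x - \<kappa>) \<and>
     (\<forall>x. 0 \<le> deriv P x \<and> deriv P x \<le> 1) \<and> (\<forall>x. 0 \<le> deriv (deriv P) x))"

definition smooth_step :: "real \<Rightarrow> real" where "smooth_step = deriv smooth_ramp"

definition smooth_bump :: "real \<Rightarrow> real" where "smooth_bump = deriv smooth_step"

lemma smooth_ramp_props:
  "\<exists>\<kappa>. smooth smooth_ramp \<and> (\<forall>x\<le>0. smooth_ramp x = 0) \<and> (\<forall>x\<ge>1. smooth_ramp x = x - \<kappa>) \<and>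
     (\<forall>x. 0 \<le> smooth_step x \<and> smooth_step x \<le> 1) \<and> (\<forall>x. 0 \<le> smooth_bump x)"
  unfolding smooth_step_def smooth_bump_def smooth_ramp_def
  using someI_ex[OF smooth_ramp_exists] .

lemma smooth_ramp: "smooth smooth_ramp" and smooth_step: "smooth smooth_step" and smooth_bump: "smooth smooth_bump"
  and smooth_ramp_0: "x \<le> 0 \<Longrightarrow> smooth_ramp x = 0"
  and smooth_step_bounds: "0 \<le> smooth_step x" "smooth_step x \<le> 1" and smooth_bump_nonneg: "0 \<le> smooth_bump x"
  and smooth_ramp_deriv: "(smooth_ramp has_real_derivative smooth_step x) (at x)"
  and smooth_step_deriv: "(smooth_step has_real_derivative smooth_bump x) (at x)"
  using smooth_ramp_props smooth_deriv unfolding smooth_bump_def smooth_step_def by blast+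

lemma smooth_ramp_1: "x \<ge> 1 \<Longrightarrow> smooth_ramp x = x - 1 + smooth_ramp 1"
  using smooth_ramp_props by force

lemma smooth_step_0: "x \<le> 0 \<Longrightarrow> smooth_step x = 0"
proof -
  have neg: "smooth_step x = 0" if "x < 0" for x
  proof -
    have "((\<lambda>x. 0) has_real_derivative smooth_step x) (at x)"
      by (rule DERIV_cong_ev[THEN iffD1, OF _ _ _ smooth_ramp_deriv])
        (use that in \<open>auto simp: smooth_ramp_0 intro!: eventually_mono[OF eventually_nhds_in_open[of "{..<0}" x]]\<close>)
    then show ?thesis using DERIV_const DERIV_unique by blast
  qed
  \<comment> \<open>The ramp is constant only on one side of 0, so the value at 0 itself is obtained
    from continuity.\<close>
  have "closed {x. smooth_step x = 0}"
    using smooth_continuous_on[OF smooth_step, of UNIV] by (intro closed_Collect_eq) auto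
  then have "closure {..<0} \<subseteq> {x. smooth_step x = 0}" by (intro closure_minimal) (use neg in auto)
  then show "x \<le> 0 \<Longrightarrow> smooth_step x = 0" by auto
qed

lemma smooth_step_1: "x \<ge> 1 \<Longrightarrow> smooth_step x = 1"
proof -
  have neg: "smooth_step x = 1" if "x > 1" for x
  proof -
    have "((\<lambda>x. x - 1 + smooth_ramp 1) has_real_derivative smooth_step x) (at x)"
      by (rule DERIV_cong_ev[THEN iffD1, OF _ _ _ smooth_ramp_deriv])
        (use that in \<open>auto intro!: smooth_ramp_1 eventually_mono[OF eventually_nhds_in_open[of "{1<..}" x]]\<close>)
    moreover have "((\<lambda>x. x - 1 + smooth_ramp 1) has_real_derivative 1) (at x)"
      by (auto intro!: derivative_eq_intros)
    ultimately show ?thesis using DERIV_unique by blast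
  qed
  have "closed {x. smooth_step x = 1}"
    using smooth_continuous_on[OF smooth_step, of UNIV] by (intro closed_Collect_eq) auto
  then have "closure {1<..} \<subseteq> {x. smooth_step x = 1}" by (intro closure_minimal) (use neg in auto)
  then show "x \<ge> 1 \<Longrightarrow> smooth_step x = 1" by auto
qed

lemma smooth_bump_0: "x \<le> 0 \<or> x \<ge> 1 \<Longrightarrow> smooth_bump x = 0"
proof -
  have neg: "smooth_bump x = 0" if x: "x < 0 \<or> x > 1" for x
  proof -
    have "((\<lambda>_. smooth_step x) has_real_derivative smooth_bump x) (at x)"
      by (rule DERIV_cong_ev[THEN iffD1, OF _ _ _ smooth_step_deriv])
        (use x in \<open>auto simp: smooth_step_0 smooth_step_1
          intro!: eventually_mono[OF eventually_nhds_in_open[of "{..<0} \<union> {1<..}" x]]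
            eventually_mono[OF eventually_nhds_in_open[of "if x < 0 then {..<0} else {1<..}" x]]\<close>)
    then show ?thesis using DERIV_const DERIV_unique by blast
  qed
  have "closed {x. smooth_bump x = 0}"
    using smooth_continuous_on[OF smooth_bump, of UNIV] by (intro closed_Collect_eq) auto
  then have "closure {..<0} \<subseteq> {x. smooth_bump x = 0}" "closure {1<..} \<subseteq> {x. smooth_bump x = 0}"
    using closure_minimal[of "{..<0}" "{x. smooth_bump x = 0}"] closure_minimal[of "{1<..}" "{x. smooth_bump x = 0}"] neg
    by blast+
  then show "x \<le> 0 \<or> x \<ge> 1 \<Longrightarrow> smooth_bump x = 0" by auto
qed

section \<open>Separable functions as test functions\<close>

text \<open>All derivatives in \<open>C_k\<close> are taken within I and J, so values elsewhere are
  irrelevant. This allows the partial derivatives to be replaced by formulas that are valid on I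
  \<times> J only.\<close>

lemma C_k_cong:
  assumes "\<And>t x. t \<in> I \<Longrightarrow> x \<in> J \<Longrightarrow> \<phi> t x = \<psi> t x"
  shows "C_k k I J \<phi> \<longleftrightarrow> C_k k I J \<psi>"
  using assms
proof (induction k arbitrary: \<phi> \<psi>)
  case 0
  then show ?case by (auto intro!: continuous_on_cong)
next
  case (Suc k)
  have t: "((\<lambda>s. \<phi> s x) differentiable (at t within I)) = ((\<lambda>s. \<psi> s x) differentiable (at t within I))"
      "pd_t I \<phi> t x = pd_t I \<psi> t x"
    and x: "(\<phi> t differentiable (at x within J)) = (\<psi> t differentiable (at x within J))"
      "pd_x J \<phi> t x = pd_x J \<psi> t x" if "t \<in> I" "x \<in> J" for t x
  proof -
    have 1: "((\<lambda>s. \<phi> s x) has_derivative D) (at t within I) = ((\<lambda>s. \<psi> s x) has_derivative D) (at t within I)" for D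
      using Suc.prems that by (intro iffI; elim has_derivative_transform[rotated -1]) auto
    show "((\<lambda>s. \<phi> s x) differentiable (at t within I)) = ((\<lambda>s. \<psi> s x) differentiable (at t within I))"
      by (simp add: differentiable_def 1)
    show "pd_t I \<phi> t x = pd_t I \<psi> t x"
      by (simp add: pd_t_def vector_derivative_def has_vector_derivative_def 1)
    have 2: "(\<phi> t has_derivative D) (at x within J) = (\<psi> t has_derivative D) (at x within J)" for D
      using Suc.prems that by (intro iffI; elim has_derivative_transform[rotated -1]) auto
    show "(\<phi> t differentiable (at x within J)) = (\<psi> t differentiable (at x within J))"
      by (simp add: differentiable_def 2)
    show "pd_x J \<phi> t x = pd_x J \<psi> t x"
      by (simp add: pd_x_def vector_derivative_def has_vector_derivative_def 2)
  qed
  have "continuous_on (I \<times> J) (\<lambda>(t, x). \<phi> t x) \<longleftrightarrow> continuous_on (I \<times> J) (\<lambda>(t, x). \<psi> t x)"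
    using Suc.prems by (auto intro!: continuous_on_cong)
  moreover have "C_k k I J (pd_t I \<phi>) \<longleftrightarrow> C_k k I J (pd_t I \<psi>)" "C_k k I J (pd_x J \<phi>) \<longleftrightarrow> C_k k I J (pd_x J \<psi>)"
    using t x by (auto intro!: Suc.IH)
  ultimately show ?case using t(1) x(1) by simp
qed

lemma
  assumes "at t within I \<noteq> bot" "(a has_real_derivative a') (at t within I)"
  shows pd_t_separable: "pd_t I (\<lambda>t x. a t * b x) t x = a' * b x"
  unfolding pd_t_def
  by (intro vector_derivative_within assms)
    (use assms(2) in \<open>auto simp flip: has_real_derivative_iff_has_vector_derivative intro!: derivative_eq_intros\<close>)

lemma
  assumes "at x within J \<noteq> bot" "(b has_real_derivative b') (at x within J)"
  shows pd_x_separable: "pd_x J (\<lambda>t x. a t * b x) t x = a t * b'"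
  unfolding pd_x_def
  by (intro vector_derivative_within assms)
    (use assms(2) in \<open>auto simp flip: has_real_derivative_iff_has_vector_derivative intro!: derivative_eq_intros\<close>)

text \<open>Every partial derivative of a product A i t * B j x is a product of the same kind with
  one order raised, so the induction on k runs for all i and j simultaneously.\<close>

lemma C_k_separable:
  assumes I: "\<And>t. t \<in> I \<Longrightarrow> at t within I \<noteq> bot" and J: "\<And>x. x \<in> J \<Longrightarrow> at x within J \<noteq> bot"
    and A: "\<And>n t. t \<in> I \<Longrightarrow> (A n has_real_derivative A (Suc n) t) (at t within I)"
    and B: "\<And>n x. x \<in> J \<Longrightarrow> (B n has_real_derivative B (Suc n) x) (at x within J)"
  shows "C_k k I J (\<lambda>t x. A i t * B j x)"
proof (induction k arbitrary: i j)
  have contA: "continuous_on I (A i)" for i using A DERIV_continuous continuous_on_eq_continuous_within by blast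
  have contB: "continuous_on J (B i)" for i using B DERIV_continuous continuous_on_eq_continuous_within by blast
  have cont: "continuous_on (I \<times> J) (\<lambda>(t, x). A i t * B j x)" for i j
    unfolding case_prod_beta
    by (intro continuous_on_mult continuous_on_compose2[OF contA] continuous_on_compose2[OF contB] continuous_intros) auto
  {
    case 0
    show ?case using cont by simp
  next
    case (Suc k)
    have "C_k k I J (pd_t I (\<lambda>t x. A i t * B j x)) \<longleftrightarrow> C_k k I J (\<lambda>t x. A (Suc i) t * B j x)"
      by (intro C_k_cong pd_t_separable I A)
    moreover have "C_k k I J (pd_x J (\<lambda>t x. A i t * B j x)) \<longleftrightarrow> C_k k I J (\<lambda>t x. A i t * B (Suc j) x)"
      by (intro C_k_cong pd_x_separable J B)
    moreover have "(\<lambda>s. A i s * B j x) differentiable (at t within I)" if "t \<in> I" for t x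
      using A[OF that, of i] unfolding real_differentiable_def
      by (intro exI[where x = "A (Suc i) t * B j x"]) (auto intro!: derivative_eq_intros)
    moreover have "(\<lambda>x. A i t * B j x) differentiable (at x within J)" if "x \<in> J" for t x
      using B[OF that, of j] unfolding real_differentiable_def
      by (intro exI[where x = "A i t * B (Suc j) x"]) (auto intro!: derivative_eq_intros)
    ultimately show ?case using cont Suc.IH by simp
  }
qed

lemma at_within_atLeast_not_bot: "x \<in> {0..} \<Longrightarrow> at (x::real) within {0..} \<noteq> bot"
  using islimpt_greaterThanLessThan1[of x "x + 1"]
  by (auto simp: trivial_limit_within intro: islimpt_subset)

lemma at_within_Icc_not_bot: "a < b \<Longrightarrow> x \<in> {a..b} \<Longrightarrow> at (x::real) within {a..b} \<noteq> bot"
  by (simp add: trivial_limit_within islimpt_Icc)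

lemma exp_test_function_derivatives:
  fixes \<mu> \<tau> :: real
  defines "\<phi> \<equiv> \<lambda>t x. exp (- \<mu> * x)"
  assumes "0 < \<tau>" "t \<in> {0..\<tau>}" "x \<in> {0..}"
  shows "pd_t {0..\<tau>} \<phi> t x = 0" "pd_x {0..} \<phi> t x = - \<mu> * exp (- \<mu> * x)"
    "pd_x {0..} (pd_x {0..} \<phi>) t x = \<mu>\<^sup>2 * exp (- \<mu> * x)"
proof -
  have x: "at x within {0..} \<noteq> bot" if "x \<in> {0..}" for x :: real
    using that by (rule at_within_atLeast_not_bot)
  show "pd_t {0..\<tau>} \<phi> t x = 0"
    unfolding pd_t_def \<phi>_def by (intro vector_derivative_within at_within_Icc_not_bot assms) (auto intro!: derivative_eq_intros)
  have 1: "pd_x {0..} \<phi> t x = - \<mu> * exp (- \<mu> * x)" if "x \<in> {0..}" for x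
    unfolding pd_x_def \<phi>_def
    by (intro vector_derivative_within x that)
      (auto simp flip: has_real_derivative_iff_has_vector_derivative intro!: derivative_eq_intros)
  show "pd_x {0..} \<phi> t x = - \<mu> * exp (- \<mu> * x)" by (rule 1) fact
  have "pd_x {0..} (pd_x {0..} \<phi>) t x = vector_derivative (pd_x {0..} \<phi> t) (at x within {0..})"
    by (simp add: pd_x_def)
  also have "\<dots> = \<mu>\<^sup>2 * exp (- \<mu> * x)"
  proof (intro vector_derivative_within x)
    show "x \<in> {0..}" by fact
    have "((\<lambda>x. - \<mu> * exp (- \<mu> * x)) has_vector_derivative \<mu>\<^sup>2 * exp (- \<mu> * x)) (at x within {0..})"
      by (auto simp: power2_eq_square simp flip: has_real_derivative_iff_has_vector_derivative intro!: derivative_eq_intros)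
    then show "(pd_x {0..} \<phi> t has_vector_derivative \<mu>\<^sup>2 * exp (- \<mu> * x)) (at x within {0..})"
      by (rule has_vector_derivative_transform[rotated -1]) (use 1 assms in auto)
  qed
  finally show "pd_x {0..} (pd_x {0..} \<phi>) t x = \<mu>\<^sup>2 * exp (- \<mu> * x)" .
qed

lemma bounded_onI:
  assumes "\<And>t x. (t, x) \<in> S \<Longrightarrow> \<bar>\<phi> t x\<bar> \<le> B"
  shows "bounded_on S \<phi>"
  unfolding bounded_on_def
proof (rule boundedI)
  fix y assume "y \<in> (\<lambda>(t, x). \<phi> t x) ` S"
  then show "norm y \<le> B" using assms by auto
qed

lemma exp_weak_test_function:
  fixes \<mu> \<tau> :: real
  assumes "0 < \<tau>" "0 \<le> \<mu>"
  shows "weak_test_function \<tau> (\<lambda>t x. exp (- \<mu> * x))"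
proof -
  note d = exp_test_function_derivatives[OF assms(1), of _ _ \<mu>]
  have le1: "c * exp (- \<mu> * x) \<le> c" if "0 \<le> x" "0 \<le> c" for x c :: real
    using that assms mult_left_mono[of "exp (- \<mu> * x)" 1 c] by simp
  \<comment> \<open>The factor in time is the constant 1, followed by zeros as its derivatives; the
    condition 0 = 0 is the instance of this sequence at order 0.\<close>
  have "C_k k {0..\<tau>} {0..} (\<lambda>t x. (if (0::nat) = 0 then 1 else 0) * ((- \<mu>) ^ 0 * exp (- \<mu> * x)))" for k
    by (rule C_k_separable[where A = "\<lambda>n t. if n = 0 then 1 else 0" and B = "\<lambda>n x. (- \<mu>) ^ n * exp (- \<mu> * x)"])
      (use assms at_within_Icc_not_bot[of 0 \<tau>] at_within_atLeast_not_bot in \<open>auto intro!: derivative_eq_intros\<close>)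
  then have "C_infinity {0..\<tau>} {0..} (\<lambda>t x. exp (- \<mu> * x))" by (simp add: C_infinity_def)
  moreover have "bounded_on ({0..\<tau>} \<times> {0..}) (\<lambda>t x. exp (- \<mu> * x))"
    using le1[of _ 1] by (intro bounded_onI[where B = 1]) simp
  moreover have "bounded_on ({0..\<tau>} \<times> {0..}) (pd_t {0..\<tau>} (\<lambda>t x. exp (- \<mu> * x)))"
  proof (rule bounded_onI)
    fix t x :: real assume "(t, x) \<in> {0..\<tau>} \<times> {0..}"
    then show "\<bar>pd_t {0..\<tau>} (\<lambda>t x. exp (- \<mu> * x)) t x\<bar> \<le> 0" using d(1)[of t x] by simp
  qed
  moreover have "bounded_on ({0..\<tau>} \<times> {0..}) (pd_x {0..} (\<lambda>t x. exp (- \<mu> * x)))"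
  proof (rule bounded_onI)
    fix t x :: real assume "(t, x) \<in> {0..\<tau>} \<times> {0..}"
    then show "\<bar>pd_x {0..} (\<lambda>t x. exp (- \<mu> * x)) t x\<bar> \<le> \<mu>"
      using d(2)[of t x] le1[of x \<mu>] assms by (simp add: abs_mult)
  qed
  moreover have "bounded_on ({0..\<tau>} \<times> {0..}) (pd_x {0..} (pd_x {0..} (\<lambda>t x. exp (- \<mu> * x))))"
  proof (rule bounded_onI)
    fix t x :: real assume "(t, x) \<in> {0..\<tau>} \<times> {0..}"
    then show "\<bar>pd_x {0..} (pd_x {0..} (\<lambda>t x. exp (- \<mu> * x))) t x\<bar> \<le> \<mu>\<^sup>2"
      using d(3)[of t x] le1[of x "\<mu>\<^sup>2"] by (simp add: abs_mult)
  qed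
  ultimately show ?thesis unfolding weak_test_function_def by blast
qed

section \<open>Measurability and integrals up to null sets\<close>

lemma lebesgue_measurable_AE:
  fixes f g :: "'a::euclidean_space \<Rightarrow> real"
  assumes g: "g \<in> borel_measurable lebesgue" and ae: "AE x in lebesgue. f x = g x"
  shows "f \<in> borel_measurable lebesgue"
proof (rule measurableI)
  fix A :: "real set" assume A: "A \<in> sets borel"
  have "g -` A \<inter> space lebesgue \<in> sets lebesgue" using measurable_sets[OF g A] .
  moreover have ae': "AE x in lebesgue. (x \<in> g -` A \<inter> space lebesgue) = (x \<in> f -` A \<inter> space lebesgue)"
    using ae by eventually_elim auto
  ultimately show "f -` A \<inter> space lebesgue \<in> sets lebesgue"
    using completion.in_sets_AE[OF ae'] by simp
qed simp

lemma AE_lborel_pair: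
  fixes P :: "real \<times> real \<Rightarrow> bool"
  assumes "AE z in lborel. P z"
  shows "AE t in lborel. AE x in lborel. P (t, x)"
  by (rule lborel_pair.AE_pair[of P, unfolded lborel_prod, OF assms])

text \<open>Measurability in the plane refers to the completed measure, so the theorem on
  parametrized integrals is applied to a Borel representative. For almost every t its slice agrees
  with the given one almost everywhere, and completeness carries measurability back.\<close>

lemma integral_slice_measurable:
  fixes P :: "real \<Rightarrow> real \<Rightarrow> real"
  assumes P: "(\<lambda>(t, x). P t x) \<in> borel_measurable lebesgue"
    and Pt: "\<And>t. P t \<in> borel_measurable lebesgue"
  shows "(\<lambda>t. LINT x|lebesgue. P t x) \<in> borel_measurable lebesgue"
proof -
  obtain Q where Q[measurable]: "Q \<in> borel_measurable lborel" and ae: "AE z in lborel. (\<lambda>(t, x). P t x) z = Q z"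
    using completion_ex_borel_measurable_real[OF P] by blast
  have Q2: "Q \<in> borel_measurable (lborel \<Otimes>\<^sub>M lborel)" using Q by (simp add: lborel_prod)
  then have Qt: "(\<lambda>x. Q (t, x)) \<in> borel_measurable lborel" for t by (rule measurable_Pair2) simp
  have "(\<lambda>t. LINT x|lborel. Q (t, x)) \<in> borel_measurable lborel"
    using Q2 by (intro lborel.borel_measurable_lebesgue_integral) simp
  then have m: "(\<lambda>t. LINT x|lborel. Q (t, x)) \<in> borel_measurable lebesgue"
    by (rule measurable_completion)
  have "AE t in lborel. (LINT x|lebesgue. P t x) = (LINT x|lborel. Q (t, x))"
    using AE_lborel_pair[OF ae]
  proof eventually_elim
    case (elim t)
    have "(LINT x|lebesgue. P t x) = (LINT x|lebesgue. Q (t, x))"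
      using elim Pt measurable_completion[OF Qt[of t]] by (intro integral_cong_AE) (auto intro: AE_completion)
    also have "\<dots> = (LINT x|lborel. Q (t, x))" by (rule integral_completion[OF Qt])
    finally show ?case .
  qed
  then show ?thesis by (intro lebesgue_measurable_AE[OF m] AE_completion)
qed

lemma integral_mono_AE_on:
  fixes f g :: "real \<Rightarrow> real"
  assumes "f absolutely_integrable_on S" "g absolutely_integrable_on S" "AE x in lebesgue. x \<in> S \<longrightarrow> f x \<le> g x"
  shows "integral S f \<le> integral S g"
proof -
  have "(LINT x:S|lebesgue. f x) \<le> (LINT x:S|lebesgue. g x)"
    using assms by (intro set_integral_mono_AE) auto
  then show ?thesis using set_lebesgue_integral_eq_integral(2) assms(1,2) by metis
qed

lemma integral_eq_AE_on:
  fixes f g :: "real \<Rightarrow> real"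
  assumes "f absolutely_integrable_on S" "g absolutely_integrable_on S" "AE x in lebesgue. x \<in> S \<longrightarrow> f x = g x"
  shows "integral S f = integral S g"
  using assms by (intro antisym integral_mono_AE_on) (auto elim: eventually_mono)

lemma absolutely_integrable_AE:
  fixes f g :: "real \<Rightarrow> real"
  assumes f: "f absolutely_integrable_on S" and ae: "AE x in lebesgue. x \<in> S \<longrightarrow> f x = g x"
  shows "g absolutely_integrable_on S" "integral S g = integral S f"
proof -
  have ae': "AE x in lebesgue. indicator S x *\<^sub>R g x = indicator S x *\<^sub>R f x"
    using ae by eventually_elim (auto simp: indicator_def)
  have m: "(\<lambda>x. indicator S x *\<^sub>R f x) \<in> borel_measurable lebesgue"
    using f by (auto simp: set_integrable_def)
  show g: "g absolutely_integrable_on S"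
    using f lebesgue_measurable_AE[OF m ae'] unfolding set_integrable_def
    by (subst integrable_cong_AE[OF _ m ae']) auto
  show "integral S g = integral S f"
    using ae by (intro integral_eq_AE_on f g) (auto elim: eventually_mono)
qed

lemma absolutely_integrable_const_mult:
  fixes f :: "real \<Rightarrow> real"
  shows "f absolutely_integrable_on S \<Longrightarrow> (\<lambda>x. c * f x) absolutely_integrable_on S"
  by (rule set_integrable_mult_right)

section \<open>Problem (A)\<close>

text \<open>Rewritten as M' = N (k M - 1) + c M, the equation shows that a non-negative N can only
  help once k M \<ge> 1. For H = k M - 1 the residual in H' = k N H + k c M is non-negative. It is
  applied with k = \<mu> \<alpha> and c = \<mu>^2 / 2.\<close>

lemma growth_bound:
  fixes N M :: "real \<Rightarrow> real"
  assumes \<tau>: "0 \<le> \<tau>" and k: "0 < k" and c: "0 \<le> c"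
    and M: "ac_derivative M (\<lambda>t. - N t + (k * N t + c) * M t) 0 \<tau>"
    and Ni: "N absolutely_integrable_on {0..\<tau>}" and Npos: "AE t in lebesgue. t \<in> {0..\<tau>} \<longrightarrow> 0 \<le> N t"
    and Mpos: "\<And>t. t \<in> {0..\<tau>} \<Longrightarrow> 0 \<le> M t" and init: "1 \<le> k * M 0"
  shows "M 0 * exp (c * \<tau>) \<le> M \<tau>"
proof -
  note contM = ac_derivative_continuous[OF M]
  have sub: "N absolutely_integrable_on {s..t}" "continuous_on {s..t} M" if "0 \<le> s" "t \<le> \<tau>" for s t
    using absolutely_integrable_on_subinterval[OF Ni, of s t] continuous_on_subset[OF contM, of "{s..t}"] that by auto
  have i1: "(\<lambda>r. (k * N r) * f r) absolutely_integrable_on {s..t}" if "0 \<le> s" "t \<le> \<tau>" "continuous_on {s..t} f" for s t f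
    by (intro absolutely_integrable_mult_continuous absolutely_integrable_const_mult sub that)
  have crit: "1 \<le> k * M t" if t: "0 \<le> t" "t \<le> \<tau>" for t
  proof -
    have "0 \<le> k * M t - 1"
    proof (rule ac_gronwall[where H = "\<lambda>t. k * M t - 1" and k = "\<lambda>t. k * N t" and a = 0 and b = \<tau>])
      show "(\<lambda>t. k * N t) absolutely_integrable_on {0..\<tau>}" by (intro absolutely_integrable_const_mult Ni)
      show "continuous_on {0..\<tau>} (\<lambda>t. k * M t - 1)" by (intro continuous_intros contM)
      show "0 \<le> k * M 0 - 1" using init by simp
      show "0 \<le> t" "t \<le> \<tau>" by fact+
      fix s t assume st: "0 \<le> s" "s \<le> t" "t \<le> \<tau>"
      have "integral {s..t} (\<lambda>r. k * N r * (k * M r - 1)) \<le> integral {s..t} (\<lambda>r. k * (- N r + (k * N r + c) * M r))"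
      proof (rule integral_le)
        show "(\<lambda>r. k * N r * (k * M r - 1)) integrable_on {s..t}"
          using st by (intro set_lebesgue_integral_eq_integral(1) i1 continuous_intros sub) auto
        show "(\<lambda>r. k * (- N r + (k * N r + c) * M r)) integrable_on {s..t}"
          using ac_derivative_integrable_sub(1)[OF M st(1,3)]
          by (intro set_lebesgue_integral_eq_integral(1) absolutely_integrable_const_mult)
        fix r assume "r \<in> {s..t}"
        then have "0 \<le> k * (c * M r)" using Mpos st k c by simp
        then show "k * N r * (k * M r - 1) \<le> k * (- N r + (k * N r + c) * M r)"
          by (simp add: algebra_simps)
      qed
      also have "\<dots> = k * (M t - M s)" using ac_derivative_diff[OF M st] by simp
      finally show "integral {s..t} (\<lambda>r. k * N r * (k * M r - 1)) \<le> (k * M t - 1) - (k * M s - 1)"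
        by (simp add: algebra_simps)
    qed
    then show ?thesis by simp
  qed
  have "0 \<le> M \<tau> - M 0 * exp (c * \<tau>)"
  proof (rule ac_gronwall[where H = "\<lambda>t. M t - M 0 * exp (c * t)" and k = "\<lambda>t. c" and a = 0 and b = \<tau>])
    show "(\<lambda>t. c) absolutely_integrable_on {0..\<tau>}" by (intro absolutely_integrable_continuous_real continuous_intros)
    show "continuous_on {0..\<tau>} (\<lambda>t. M t - M 0 * exp (c * t))" by (intro continuous_intros contM)
    show "0 \<le> M 0 - M 0 * exp (c * 0)" by simp
    show "0 \<le> \<tau>" "\<tau> \<le> \<tau>" using \<tau> by auto
    fix s t assume st: "0 \<le> s" "s \<le> t" "t \<le> \<tau>"
    have e: "ac_derivative (\<lambda>t. M 0 * exp (c * t)) (\<lambda>t. c * (M 0 * exp (c * t))) s t"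
      by (intro ac_derivative_C1 continuous_intros) (auto intro!: derivative_eq_intros)
    have cM: "(\<lambda>r. c * M r) absolutely_integrable_on {s..t}"
      using st by (intro absolutely_integrable_continuous_real continuous_intros sub) auto
    have "integral {s..t} (\<lambda>r. c * M r) \<le> integral {s..t} (\<lambda>r. - N r + (k * N r + c) * M r)"
    proof (rule integral_mono_AE_on[OF cM ac_derivative_integrable_sub(1)[OF M st(1,3)]])
      show "AE r in lebesgue. r \<in> {s..t} \<longrightarrow> c * M r \<le> - N r + (k * N r + c) * M r"
        using Npos
      proof eventually_elim
        case (elim r)
        show ?case
        proof
          assume r: "r \<in> {s..t}"
          then have "0 \<le> N r * (k * M r - 1)" using crit[of r] elim st by (intro mult_nonneg_nonneg) auto
          then show "c * M r \<le> - N r + (k * N r + c) * M r" by (simp add: algebra_simps)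
        qed
      qed
    qed
    also have "\<dots> = M t - M s" using ac_derivative_diff[OF M st] by simp
    finally have 1: "integral {s..t} (\<lambda>r. c * M r) \<le> M t - M s" .
    have "integral {s..t} (\<lambda>r. c * (M r - M 0 * exp (c * r))) =
        integral {s..t} (\<lambda>r. c * M r - c * (M 0 * exp (c * r)))"
      by (intro integral_cong) (simp add: algebra_simps)
    also have "\<dots> = integral {s..t} (\<lambda>r. c * M r) - integral {s..t} (\<lambda>r. c * (M 0 * exp (c * r)))"
      by (intro integral_diff set_lebesgue_integral_eq_integral(1) cM ac_derivative_abs_integrable[OF e])
    also have "integral {s..t} (\<lambda>r. c * (M 0 * exp (c * r))) = M 0 * exp (c * t) - M 0 * exp (c * s)"
      using ac_derivative_diff[OF e, of s t] st by simp
    finally show "integral {s..t} (\<lambda>r. c * (M r - M 0 * exp (c * r)))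
        \<le> M t - M 0 * exp (c * t) - (M s - M 0 * exp (c * s))" using 1 by linarith
  qed
  then show ?thesis by simp
qed

text \<open>The weak formulation never sees \<open>p 0\<close> (a test interval has \<open>0 < T'\<close>), so \<open>p0\<close> takes its place.\<close>

definition exp_moment :: "(real \<Rightarrow> real) \<Rightarrow> (real \<Rightarrow> real \<Rightarrow> real) \<Rightarrow> real \<Rightarrow> real \<Rightarrow> real" where
  "exp_moment p0 p \<mu> t = (LINT x:{0<..}|lebesgue. exp (- \<mu> * x) * (if t = 0 then p0 x else p t x))"

lemma integrable_exp_mult:
  assumes "set_integrable lebesgue {0<..} f" "0 \<le> \<mu>"
  shows "set_integrable lebesgue {0<..} (\<lambda>x. exp (- \<mu> * x) * f x :: real)"
proof (rule absolutely_integrable_bounded_measurable_product_real[OF _ _ _ assms(1)])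
  show "(\<lambda>x. exp (- \<mu> * x)) \<in> borel_measurable (lebesgue_on {0<..})"
    by (intro continuous_imp_measurable_on_sets_lebesgue continuous_intros) auto
  show "bounded ((\<lambda>x. exp (- \<mu> * x)) ` {0<..})"
    by (rule boundedI[where B = 1]) (use assms(2) in auto)
qed auto

lemma density_on_posD:
  assumes "density_on_pos f"
  shows "set_integrable lebesgue {0<..} f" "(LINT x:{0<..}|lebesgue. f x) = 1"
    "AE x in lebesgue. 0 < x \<longrightarrow> 0 \<le> f x"
proof -
  have b: "has_bochner_integral lebesgue f 1" and ae: "AE x in lebesgue. 0 \<le> f x \<and> (x \<le> 0 \<longrightarrow> f x = 0)"
    using assms by (auto simp: density_on_pos_def)
  have i: "integrable lebesgue f" using b by (simp add: has_bochner_integral_iff)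
  then show *: "set_integrable lebesgue {0<..} f"
    unfolding set_integrable_def by (intro integrable_mult_indicator) auto
  have "(LINT x:{0<..}|lebesgue. f x) = (LINT x|lebesgue. f x)"
    unfolding set_lebesgue_integral_def
  proof (rule integral_cong_AE)
    show "AE x in lebesgue. indicator {0<..} x *\<^sub>R f x = f x"
      using ae by eventually_elim (auto simp: indicator_def)
  qed (use * i in \<open>auto simp: set_integrable_def\<close>)
  then show "(LINT x:{0<..}|lebesgue. f x) = 1" using b by (simp add: has_bochner_integral_iff)
  show "AE x in lebesgue. 0 < x \<longrightarrow> 0 \<le> f x" using ae by eventually_elim auto
qed

text \<open>If the moment vanished, f would be zero almost everywhere, against its mass 1.
  Positivity keeps the quotients and logarithms of the final bounds away from the default values at
  0.\<close>

lemma density_exp_moment_pos: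
  assumes "density_on_pos f" "0 \<le> \<mu>"
  shows "0 < (LINT x:{0<..}|lebesgue. exp (- \<mu> * x) * f x)"
proof -
  note d = density_on_posD[OF assms(1)]
  note i = integrable_exp_mult[OF d(1) assms(2)]
  have "0 \<le> (LINT x:{0<..}|lebesgue. exp (- \<mu> * x) * f x)"
    unfolding set_lebesgue_integral_def
    using d(3) by (intro integral_nonneg_AE) (auto elim!: eventually_mono simp: indicator_def)
  moreover have "(LINT x:{0<..}|lebesgue. exp (- \<mu> * x) * f x) \<noteq> 0"
  proof
    assume z: "(LINT x:{0<..}|lebesgue. exp (- \<mu> * x) * f x) = 0"
    have "AE x in lebesgue. indicator {0<..} x *\<^sub>R (exp (- \<mu> * x) * f x) = 0"
      using z i d(3) unfolding set_integrable_def set_lebesgue_integral_def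
      by (subst (asm) integral_nonneg_eq_0_iff_AE) (auto elim!: eventually_mono simp: indicator_def)
    then have "AE x in lebesgue. indicator {0<..} x *\<^sub>R f x = 0" by eventually_elim (auto simp: indicator_def)
    then have "(LINT x:{0<..}|lebesgue. f x) = 0" unfolding set_lebesgue_integral_def by (rule integral_eq_zero_AE)
    then show False using d(2) by simp
  qed
  ultimately show ?thesis by linarith
qed

section \<open>Exponential moments of a weak solution of (A)\<close>

context
  fixes \<alpha> \<tau> :: real and T :: ereal and p0 N :: "real \<Rightarrow> real" and p :: "real \<Rightarrow> real \<Rightarrow> real"
  assumes sol: "weak_solution_A \<alpha> p0 T p N" and dens: "density_on_pos p0" and \<tau>: "0 < \<tau>" "ereal \<tau> < T"
begin

lemma lt_T: "t \<le> \<tau> \<Longrightarrow> ereal t < T"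
  using \<tau>(2) by (meson ereal_less_eq(3) le_less_trans)

lemma slice_integrable:
  assumes "0 \<le> t" "t \<le> \<tau>"
  shows "set_integrable lebesgue {0<..} (\<lambda>x. if t = 0 then p0 x else p t x)"
    "AE x in lebesgue. 0 < x \<longrightarrow> 0 \<le> (if t = 0 then p0 x else p t x)"
  using density_on_posD[OF dens] sol assms lt_T[OF assms(2)] unfolding weak_solution_A_def
  by (cases "t = 0"; auto)+

lemma exp_moment_nonneg:
  assumes "0 \<le> t" "t \<le> \<tau>" shows "0 \<le> exp_moment p0 p \<mu> t"
  unfolding exp_moment_def set_lebesgue_integral_def using slice_integrable(2)[OF assms]
  by (intro integral_nonneg_AE) (auto elim!: eventually_mono simp: indicator_def)

lemma exp_moment_antimono:
  assumes "0 \<le> t" "t \<le> \<tau>" "0 \<le> \<nu>" "\<nu> \<le> \<mu>" shows "exp_moment p0 p \<mu> t \<le> exp_moment p0 p \<nu> t"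
  unfolding exp_moment_def
proof (intro set_integral_mono_AE integrable_exp_mult slice_integrable assms)
  show "AE x in lebesgue. x \<in> {0<..} \<longrightarrow> exp (- \<mu> * x) * (if t = 0 then p0 x else p t x)
      \<le> exp (- \<nu> * x) * (if t = 0 then p0 x else p t x)"
    using slice_integrable(2)[OF assms(1,2)]
    by eventually_elim (use assms in \<open>auto intro!: mult_right_mono\<close>)
qed (use assms in auto)

text \<open>Measurability in t is what makes the product of the moment with the merely integrable N
  integrable; it has to be drawn from the joint measurability of p.\<close>

lemma exp_moment_measurable:
  assumes "0 \<le> \<mu>"
  shows "(\<lambda>t. indicator {0..\<tau>} t * (LINT x:{0<..}|lebesgue. exp (- \<mu> * x) * p t x)) \<in> borel_measurable lebesgue"
proof -
  define S where "S = {t. 0 \<le> t \<and> ereal t < T}"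
  \<comment> \<open>For each t this is either zero or the weighted slice over x > 0, whose
    measurability is contained in \<open>set_integrable\<close>.\<close>
  define P where "P = (\<lambda>t x. indicator {0..\<tau>} t * exp (- \<mu> * x) * (indicator (S \<times> {0<..}) (t, x) * p t x))"
  have "(\<lambda>z. indicator (S \<times> {0<..}) z *\<^sub>R (case z of (t, x) \<Rightarrow> p t x)) \<in> borel_measurable lebesgue"
    using sol unfolding weak_solution_A_def set_borel_measurable_def S_def by blast
  then have 1: "(\<lambda>z. indicator (S \<times> {0<..}) z * p (fst z) (snd z)) \<in> borel_measurable lebesgue"
    by (simp add: case_prod_beta)
  have 2: "(\<lambda>z. indicator {0..\<tau>} (fst z) * exp (- \<mu> * snd z) :: real) \<in> borel_measurable lebesgue"
  proof -
    have "(\<lambda>z::real \<times> real. indicator ({0..\<tau>} \<times> UNIV) z * exp (- \<mu> * snd z)) \<in> borel_measurable lborel"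
      by (simp, intro borel_measurable_times borel_measurable_indicator borel_measurable_continuous_onI
            borel_closed closed_Times continuous_intros)
    then have "(\<lambda>z::real \<times> real. indicator ({0..\<tau>} \<times> UNIV) z * exp (- \<mu> * snd z)) \<in> borel_measurable lebesgue"
      by (rule measurable_completion)
    then show ?thesis by (simp add: indicator_times)
  qed
  have "(\<lambda>z. (indicator {0..\<tau>} (fst z) * exp (- \<mu> * snd z)) * (indicator (S \<times> {0<..}) z * p (fst z) (snd z))) \<in> borel_measurable lebesgue"
    using 1 2 by (rule borel_measurable_times[rotated])
  then have P: "(\<lambda>(t, x). P t x) \<in> borel_measurable lebesgue"
    unfolding P_def case_prod_beta' prod.collapse .
  have sl: "P t = (\<lambda>x. indicator {0..\<tau>} t * (indicator {0<..} x *\<^sub>R (exp (- \<mu> * x) * p t x)))" for t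
    using lt_T by (auto simp: P_def S_def indicator_def fun_eq_iff)
  have Pt: "P t \<in> borel_measurable lebesgue" for t
  proof (cases "t \<in> {0..\<tau>}")
    case True
    then have "set_integrable lebesgue {0<..} (p t)" using sol lt_T unfolding weak_solution_A_def by auto
    from integrable_exp_mult[OF this assms] have "(\<lambda>x. indicator {0<..} x *\<^sub>R (exp (- \<mu> * x) * p t x)) \<in> borel_measurable lebesgue"
      unfolding set_integrable_def by auto
    then show ?thesis unfolding sl by (intro borel_measurable_times) auto
  qed (simp add: sl)
  have "(\<lambda>t. LINT x|lebesgue. P t x) \<in> borel_measurable lebesgue" by (rule integral_slice_measurable[OF P Pt])
  moreover have "(LINT x|lebesgue. P t x) = indicator {0..\<tau>} t * (LINT x:{0<..}|lebesgue. exp (- \<mu> * x) * p t x)" for t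
    unfolding sl set_lebesgue_integral_def by simp
  ultimately show ?thesis by simp
qed

lemma N_integrable: "N absolutely_integrable_on {0..\<tau>}"
  using sol \<tau> unfolding weak_solution_A_def by auto

lemma N_nonneg: "AE t in lebesgue. t \<in> {0..\<tau>} \<longrightarrow> 0 \<le> N t"
proof -
  have "AE t in lebesgue. 0 \<le> t \<and> ereal t < T \<longrightarrow> 0 \<le> N t" using sol unfolding weak_solution_A_def by auto
  then show ?thesis by eventually_elim (use lt_T in auto)
qed

text \<open>With the time-independent test function exp(-\<mu> x), the weak formulation on [0,t] is
  the integrated equation at t; every t > 0 serves as the end of its own test interval. The uniform
  L^1 bound on the slices makes the moment bounded, so its product with N is integrable.\<close>

lemma exp_moment_evolution:
  assumes \<mu>: "0 \<le> \<mu>"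
  shows "ac_derivative (exp_moment p0 p \<mu>) (\<lambda>t. - N t + (\<mu> * \<alpha> * N t + \<mu>\<^sup>2 / 2) * exp_moment p0 p \<mu> t) 0 \<tau>"
proof -
  define M where "M = (\<lambda>t. LINT x:{0<..}|lebesgue. exp (- \<mu> * x) * p t x)"
  define E where "E = exp_moment p0 p \<mu>"
  \<comment> \<open>The two functions differ at t = 0 alone, a null set for all integrals
    below.\<close>
  have EM: "E t = M t" if "t \<noteq> 0" for t using that by (simp add: E_def M_def exp_moment_def)
  obtain C where C: "\<And>t. 0 \<le> t \<Longrightarrow> ereal t < T \<Longrightarrow> (LINT x:{0<..}|lebesgue. \<bar>p t x\<bar>) \<le> C"
    using sol unfolding weak_solution_A_def by blast
  have Mb: "\<bar>M t\<bar> \<le> C" if t: "t \<in> {0..\<tau>}" for t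
  proof -
    have i: "set_integrable lebesgue {0<..} (p t)" using sol lt_T t unfolding weak_solution_A_def by auto
    have "\<bar>M t\<bar> \<le> (LINT x:{0<..}|lebesgue. \<bar>exp (- \<mu> * x) * p t x\<bar>)"
      unfolding M_def using set_integral_norm_bound[OF integrable_exp_mult[OF i \<mu>]] by simp
    also have "\<dots> \<le> (LINT x:{0<..}|lebesgue. \<bar>p t x\<bar>)"
    proof (rule set_integral_mono)
      show "\<bar>exp (- \<mu> * x) * p t x\<bar> \<le> \<bar>p t x\<bar>" if "x \<in> {0<..}" for x
        using that \<mu> by (auto simp: abs_mult intro!: mult_left_le_one_le)
    qed (intro absolutely_integrable_real_abs integrable_exp_mult i \<mu>)+
    also have "\<dots> \<le> C" using C t lt_T by auto
    finally show ?thesis .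
  qed
  have Mmeas: "M \<in> borel_measurable (lebesgue_on {0..\<tau>})"
    using exp_moment_measurable[OF \<mu>] unfolding M_def
    by (subst borel_measurable_restrict_space_iff) auto
  define k where "k = (\<lambda>t. \<mu> * \<alpha> * N t + \<mu>\<^sup>2 / 2)"
  have k: "k absolutely_integrable_on {0..\<tau>}"
    unfolding k_def by (intro set_integral_add absolutely_integrable_const_mult N_integrable absolutely_integrable_continuous_real continuous_intros)
  have kM: "(\<lambda>t. M t * k t) absolutely_integrable_on {0..\<tau>}"
    by (rule absolutely_integrable_bounded_measurable_product_real[OF Mmeas _ _ k])
      (use Mb in \<open>auto intro!: boundedI[where B = C]\<close>)
  have ae0: "AE t in lebesgue. t \<noteq> (0::real)" by (intro AE_completion AE_lborel_singleton)
  have kE: "(\<lambda>t. k t * E t) absolutely_integrable_on {0..\<tau>}"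
    by (rule absolutely_integrable_AE(1)[OF kM]) (use ae0 in \<open>auto elim!: eventually_mono simp: EM\<close>)
  have h: "(\<lambda>t. - N t + k t * E t) absolutely_integrable_on {0..\<tau>}"
    using set_integral_diff(1)[OF kE N_integrable] by simp
  have "ac_derivative E (\<lambda>t. - N t + k t * E t) 0 \<tau>"
  proof (rule ac_derivative_intro[OF h, where c = "E 0"])
    fix t assume t: "0 \<le> t" "t \<le> \<tau>"
    show "E t = E 0 + integral {0..t} (\<lambda>t. - N t + k t * E t)"
    proof (cases "t = 0")
      case False
      with t have t0: "0 < t" by simp
      let ?\<phi> = "\<lambda>(t::real) x. exp (- \<mu> * x)"
      have w: "(LINT s:{0..t}|lebesgue. LINT x:{0<..}|lebesgue.
           p s x * (- pd_t {0..t} ?\<phi> s x + \<alpha> * N s * pd_x {0..} ?\<phi> s x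
                    - 1 / 2 * pd_x {0..} (pd_x {0..} ?\<phi>) s x))
        = - (LINT s:{0..t}|lebesgue. N s * ?\<phi> s 0)
          + (LINT x:{0<..}|lebesgue. p0 x * ?\<phi> 0 x)
          - (LINT x:{0<..}|lebesgue. p t x * ?\<phi> t x)"
        using sol t0 lt_T[OF t(2)] exp_weak_test_function[OF t0 \<mu>] unfolding weak_solution_A_def by blast
      have "(LINT x:{0<..}|lebesgue. p s x * (- pd_t {0..t} ?\<phi> s x + \<alpha> * N s * pd_x {0..} ?\<phi> s x
                    - 1 / 2 * pd_x {0..} (pd_x {0..} ?\<phi>) s x)) = - (k s * M s)" if s: "s \<in> {0..t}" for s
      proof -
        have "(LINT x:{0<..}|lebesgue. p s x * (- pd_t {0..t} ?\<phi> s x + \<alpha> * N s * pd_x {0..} ?\<phi> s x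
                    - 1 / 2 * pd_x {0..} (pd_x {0..} ?\<phi>) s x)) = (LINT x:{0<..}|lebesgue. (- k s) * (exp (- \<mu> * x) * p s x))"
        proof (rule set_lebesgue_integral_cong)
          show "\<forall>x. x \<in> {0<..} \<longrightarrow> p s x * (- pd_t {0..t} ?\<phi> s x + \<alpha> * N s * pd_x {0..} ?\<phi> s x
                    - 1 / 2 * pd_x {0..} (pd_x {0..} ?\<phi>) s x) = (- k s) * (exp (- \<mu> * x) * p s x)"
            using exp_test_function_derivatives[OF t0 s, of _ \<mu>] by (simp add: k_def algebra_simps)
        qed simp
        also have "\<dots> = (- k s) * M s" unfolding M_def by (rule set_integral_mult_right)
        finally show ?thesis by simp
      qed
      then have "(LINT s:{0..t}|lebesgue. LINT x:{0<..}|lebesgue.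
           p s x * (- pd_t {0..t} ?\<phi> s x + \<alpha> * N s * pd_x {0..} ?\<phi> s x
                    - 1 / 2 * pd_x {0..} (pd_x {0..} ?\<phi>) s x)) = (LINT s:{0..t}|lebesgue. - (k s * M s))"
        by (intro set_lebesgue_integral_cong) auto
      moreover have "(LINT x:{0<..}|lebesgue. p0 x * ?\<phi> 0 x) = E 0"
        "(LINT x:{0<..}|lebesgue. p t x * ?\<phi> t x) = E t" using False by (simp_all add: E_def exp_moment_def mult.commute)
      ultimately have eq: "E t = E 0 - (LINT s:{0..t}|lebesgue. N s) + (LINT s:{0..t}|lebesgue. k s * M s)"
        using w by (simp add: set_lebesgue_integral_def)
      have sub: "f absolutely_integrable_on {0..t}" if "f absolutely_integrable_on {0..\<tau>}" for f :: "real \<Rightarrow> real"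
        using absolutely_integrable_on_subinterval[OF that, of 0 t] t by auto
      have kM': "(\<lambda>t. k t * M t) absolutely_integrable_on {0..t}" using sub[OF kM] by (simp add: mult.commute)
      have "(LINT s:{0..t}|lebesgue. k s * M s) = integral {0..t} (\<lambda>s. k s * E s)"
        unfolding set_lebesgue_integral_eq_integral(2)[OF kM']
        by (rule integral_eq_AE_on[OF kM' sub[OF kE]]) (use ae0 in \<open>auto elim!: eventually_mono simp: EM\<close>)
      moreover have "(LINT s:{0..t}|lebesgue. N s) = integral {0..t} N"
        by (rule set_lebesgue_integral_eq_integral(2)[OF sub[OF N_integrable]])
      moreover have "integral {0..t} (\<lambda>t. - N t + k t * E t) = integral {0..t} (\<lambda>t. - N t) + integral {0..t} (\<lambda>t. k t * E t)"
        by (intro integral_add integrable_neg set_lebesgue_integral_eq_integral(1) sub N_integrable kE)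
      ultimately show ?thesis using eq by simp
    qed simp
  qed
  then show ?thesis by (simp add: E_def k_def)
qed

lemma mass_evolution: "ac_derivative (exp_moment p0 p 0) (\<lambda>t. - N t) 0 \<tau>"
  using exp_moment_evolution[of 0] by simp

lemma mass_0: "exp_moment p0 p 0 0 = 1"
  using density_on_posD(2)[OF dens] by (simp add: exp_moment_def)

lemma mass_le_1: "0 \<le> t \<Longrightarrow> t \<le> \<tau> \<Longrightarrow> exp_moment p0 p 0 t \<le> 1"
proof -
  assume t: "0 \<le> t" "t \<le> \<tau>"
  have N: "N absolutely_integrable_on {0..t}"
    using absolutely_integrable_on_subinterval[OF N_integrable, of 0 t] t by auto
  have "integral {0..t} (\<lambda>_. 0) \<le> integral {0..t} N"
    by (rule integral_mono_AE_on[OF _ N]) (use N_nonneg t in \<open>auto elim!: eventually_mono\<close>)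
  then show ?thesis using ac_derivative_diff[OF mass_evolution, of 0 t] t mass_0 by simp
qed

lemma blow_up_time_bound:
  assumes "0 < \<alpha>" "0 < \<mu>" "1 \<le> \<mu> * \<alpha> * exp_moment p0 p \<mu> 0"
  shows "exp_moment p0 p \<mu> 0 * exp (\<mu>\<^sup>2 / 2 * \<tau>) \<le> 1"
proof -
  have "exp_moment p0 p \<mu> 0 * exp (\<mu>\<^sup>2 / 2 * \<tau>) \<le> exp_moment p0 p \<mu> \<tau>"
    by (rule growth_bound[where N = N and k = "\<mu> * \<alpha>"])
      (use assms \<tau> exp_moment_evolution[of \<mu>] N_integrable N_nonneg exp_moment_nonneg in auto)
  also have "\<dots> \<le> exp_moment p0 p 0 \<tau>" using \<tau> assms by (intro exp_moment_antimono) auto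
  also have "\<dots> \<le> 1" using \<tau> by (intro mass_le_1) auto
  finally show ?thesis .
qed

text \<open>Constants: the identity 1 - m^2 = 2 * (integral of N m) and the bound E \<ge> m - \<mu>
  X0 give m^2 \<ge> 1 - 2 X0 / \<alpha> - 2 \<mu> X0 \<ge> \<eta> / 2, by the smallness of \<mu>.
  The same smallness leaves E \<ge> \<eta> / 2 - \<eta> / 4.\<close>

lemma first_moment_time_bound:
  assumes \<alpha>: "0 < \<alpha>" and i: "set_integrable lebesgue {0<..} (\<lambda>x. x * p0 x)"
    and X0: "X0 = (LINT x:{0<..}|lebesgue. x * p0 x)" and \<eta>: "\<eta> = 1 - 2 * X0 / \<alpha>"
    and \<mu>: "0 < \<mu>" "4 * X0 * \<mu> \<le> \<eta>"
  shows "\<mu> / 2 * (\<eta> / 4 * \<tau>) \<le> X0"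
proof -
  define m where "m = exp_moment p0 p 0"
  define E where "E = exp_moment p0 p \<mu>"
  \<comment> \<open>A bounded substitute for the first moment, with weight (1 - exp(-\<mu> x)) /
    \<mu> \<le> x. In X' = - \<alpha> N E - (\<mu> / 2) E the terms N from mass and moment cancel,
    so X decreases.\<close>
  define X where "X = (\<lambda>t. (1 / \<mu>) * (m t - E t))"
  have m: "ac_derivative m (\<lambda>t. - N t) 0 \<tau>" using mass_evolution by (simp add: m_def)
  have E: "ac_derivative E (\<lambda>t. - N t + (\<mu> * \<alpha> * N t + \<mu>\<^sup>2 / 2) * E t) 0 \<tau>"
    using exp_moment_evolution[of \<mu>] \<mu> by (simp add: E_def)
  note cont = ac_derivative_continuous[OF m] ac_derivative_continuous[OF E]
  have sub: "f absolutely_integrable_on {0..t}" if "f absolutely_integrable_on {0..\<tau>}" "0 \<le> t" "t \<le> \<tau>" for f :: "real \<Rightarrow> real" and t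
    using absolutely_integrable_on_subinterval[OF that(1), of 0 t] that by auto
  have NE: "(\<lambda>t. N t * E t) absolutely_integrable_on {0..\<tau>}" "(\<lambda>t. N t * m t) absolutely_integrable_on {0..\<tau>}"
    by (intro absolutely_integrable_mult_continuous N_integrable cont)+
  have Ei: "E absolutely_integrable_on {0..\<tau>}" by (intro absolutely_integrable_continuous_real cont)
  have nonneg: "0 \<le> E t" "E t \<le> m t" "m t \<le> 1" if "0 \<le> t" "t \<le> \<tau>" for t
    using that \<mu> exp_moment_nonneg exp_moment_antimono[of t 0 \<mu>] mass_le_1 by (auto simp: E_def m_def)
  have X: "X t = X 0 - \<alpha> * integral {0..t} (\<lambda>t. N t * E t) - \<mu> / 2 * integral {0..t} E"
    if t: "0 \<le> t" "t \<le> \<tau>" for t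
  proof -
    have "integral {0..t} (\<lambda>t. - N t + (\<mu> * \<alpha> * N t + \<mu>\<^sup>2 / 2) * E t) =
      integral {0..t} (\<lambda>t. - N t + ((\<mu> * \<alpha>) * (N t * E t) + (\<mu>\<^sup>2 / 2) * E t))"
      by (intro integral_cong) (simp add: algebra_simps)
    also have "\<dots> = integral {0..t} (\<lambda>t. - N t) + (integral {0..t} (\<lambda>t. (\<mu> * \<alpha>) * (N t * E t)) + integral {0..t} (\<lambda>t. (\<mu>\<^sup>2 / 2) * E t))"
      using sub[OF NE(1) t] sub[OF Ei t] sub[OF N_integrable t]
      by (subst integral_add; (subst integral_add)?)
        (auto intro!: set_lebesgue_integral_eq_integral(1) integrable_neg integrable_add absolutely_integrable_const_mult)
    finally have "E t - E 0 = - integral {0..t} N + (\<mu> * \<alpha> * integral {0..t} (\<lambda>t. N t * E t) + \<mu>\<^sup>2 / 2 * integral {0..t} E)"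
      using ac_derivative_diff[OF E, of 0 t] t by simp
    moreover have "m t - m 0 = - integral {0..t} N" using ac_derivative_diff[OF m, of 0 t] t by simp
    ultimately have "(m t - E t) - (m 0 - E 0) = - (\<mu> * \<alpha> * integral {0..t} (\<lambda>t. N t * E t) + \<mu>\<^sup>2 / 2 * integral {0..t} E)"
      by linarith
    also have "\<dots> = \<mu> * (- (\<alpha> * integral {0..t} (\<lambda>t. N t * E t) + \<mu> / 2 * integral {0..t} E))"
      by (simp add: algebra_simps power2_eq_square)
    finally have "(1 / \<mu>) * ((m t - E t) - (m 0 - E 0)) = - (\<alpha> * integral {0..t} (\<lambda>t. N t * E t) + \<mu> / 2 * integral {0..t} E)"
      using \<mu> by (simp only: mult.assoc[symmetric]) simp
    then show ?thesis by (simp only: X_def) (simp add: algebra_simps)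
  qed
  have int_nonneg: "0 \<le> integral {0..t} (\<lambda>t. N t * E t)" "0 \<le> integral {0..t} E" if t: "0 \<le> t" "t \<le> \<tau>" for t
  proof -
    have AE0: "AE r in lebesgue. r \<in> {0..\<tau>} \<longrightarrow> 0 \<le> N r * E r"
      using N_nonneg by eventually_elim (intro impI mult_nonneg_nonneg; use nonneg(1) in simp)
    have "integral {0..t} (\<lambda>_. 0) \<le> integral {0..t} (\<lambda>t. N t * E t)"
      by (rule integral_mono_AE_on[OF _ sub[OF NE(1) t]])
        (use AE0 t in \<open>auto elim!: eventually_mono\<close>)
    then show "0 \<le> integral {0..t} (\<lambda>t. N t * E t)" by simp
    show "0 \<le> integral {0..t} E"
    proof (rule integral_nonneg)
      show "E integrable_on {0..t}" by (rule set_lebesgue_integral_eq_integral(1)[OF sub[OF Ei t]])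
      show "0 \<le> E r" if "r \<in> {0..t}" for r using nonneg(1)[of r] that t by simp
    qed
  qed
  have X_nonneg: "0 \<le> X t" if "0 \<le> t" "t \<le> \<tau>" for t
    using nonneg[OF that] \<mu> by (simp add: X_def)
  have X_init: "X 0 \<le> X0"
  proof -
    note d = density_on_posD[OF dens]
    note e = integrable_exp_mult[OF d(1), of \<mu>]
    have "X 0 = (LINT x:{0<..}|lebesgue. (1 / \<mu>) * (p0 x - exp (- \<mu> * x) * p0 x))"
      using \<mu> e d(1) by (simp add: X_def m_def E_def exp_moment_def set_integral_diff)
    also have "\<dots> \<le> X0" unfolding X0
    proof (rule set_integral_mono_AE[OF _ i])
      show "set_integrable lebesgue {0<..} (\<lambda>x. (1 / \<mu>) * (p0 x - exp (- \<mu> * x) * p0 x))"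
        using \<mu> e d(1) by (intro absolutely_integrable_const_mult set_integral_diff) auto
      show "AE x in lebesgue. x \<in> {0<..} \<longrightarrow> (1 / \<mu>) * (p0 x - exp (- \<mu> * x) * p0 x) \<le> x * p0 x"
        using d(3)
      proof eventually_elim
        case (elim x)
        show ?case
        proof
          assume "x \<in> {0<..}"
          then have x: "0 < x" by simp
          have "(1 / \<mu>) * (p0 x - exp (- \<mu> * x) * p0 x) = ((1 - exp (- \<mu> * x)) / \<mu>) * p0 x"
            by (simp add: field_simps)
          also have "\<dots> \<le> x * p0 x"
          proof (rule mult_right_mono)
            have "1 - exp (- \<mu> * x) \<le> \<mu> * x" using exp_ge_add_one_self[of "- \<mu> * x"] by simp
            then show "(1 - exp (- \<mu> * x)) / \<mu> \<le> x" using \<mu> by (simp add: field_simps)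
          qed (use elim x in auto)
          finally show "(1 / \<mu>) * (p0 x - exp (- \<mu> * x) * p0 x) \<le> x * p0 x" .
        qed
      qed
    qed
    finally show ?thesis .
  qed
  have X0_nonneg: "0 \<le> X0" using X_init X_nonneg[of 0] \<tau> by simp
  have X_le: "X t \<le> X0" if t: "0 \<le> t" "t \<le> \<tau>" for t
    using X[OF t] int_nonneg[OF t] X_init \<mu> \<alpha> mult_nonneg_nonneg[of \<alpha> "integral {0..t} (\<lambda>t. N t * E t)"]
      mult_nonneg_nonneg[of "\<mu> / 2" "integral {0..t} E"] by linarith
  have E_ge: "m t - \<mu> * X0 \<le> E t" if t: "0 \<le> t" "t \<le> \<tau>" for t
  proof -
    have "m t - E t = \<mu> * X t" using \<mu> by (simp add: X_def)
    also have "\<dots> \<le> \<mu> * X0" using X_le[OF t] \<mu> by simp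
    finally show ?thesis by simp
  qed
  \<comment> \<open>Differentiating m^2 brings in the integral of N m, which differs from that of N
    E by at most \<mu> X0 times the integral of N; the integral of \<alpha> N E is in turn part of
    the decrease of X.\<close>
  have m_ge: "\<eta> / 2 \<le> m t" if t: "0 \<le> t" "t \<le> \<tau>" for t
  proof -
    have mm: "ac_derivative (\<lambda>t. m t * m t) (\<lambda>t. - N t * m t + m t * - N t) 0 \<tau>" by (rule ac_derivative_mult[OF m m])
    have "m t * m t - m 0 * m 0 = integral {0..t} (\<lambda>t. - N t * m t + m t * - N t)"
      using ac_derivative_diff[OF mm, of 0 t] t by simp
    also have "\<dots> = integral {0..t} (\<lambda>t. (-2) * (N t * m t))" by (intro integral_cong) simp
    finally have sq: "1 - m t * m t = 2 * integral {0..t} (\<lambda>t. N t * m t)" using mass_0 by (simp add: m_def)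
    have i1: "(\<lambda>t. N t * E t + (\<mu> * X0) * N t) absolutely_integrable_on {0..t}"
      by (rule sub[OF _ t], intro set_integral_add absolutely_integrable_const_mult NE N_integrable)
    have "integral {0..t} (\<lambda>t. N t * m t) \<le> integral {0..t} (\<lambda>t. N t * E t + (\<mu> * X0) * N t)"
    proof (rule integral_mono_AE_on[OF sub[OF NE(2) t] i1])
      show "AE r in lebesgue. r \<in> {0..t} \<longrightarrow> N r * m r \<le> N r * E r + (\<mu> * X0) * N r"
        using N_nonneg
      proof eventually_elim
        case (elim r)
        show ?case
        proof
          assume r: "r \<in> {0..t}"
          then have "N r * (m r - \<mu> * X0) \<le> N r * E r"
            using elim E_ge[of r] t by (intro mult_left_mono) auto
          then show "N r * m r \<le> N r * E r + (\<mu> * X0) * N r" by (simp add: algebra_simps)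
        qed
      qed
    qed
    also have "\<dots> = integral {0..t} (\<lambda>t. N t * E t) + (\<mu> * X0) * integral {0..t} N"
      using sub[OF NE(1) t] sub[OF N_integrable t]
      by (subst integral_add) (auto intro!: set_lebesgue_integral_eq_integral(1) absolutely_integrable_const_mult)
    also have "integral {0..t} N = 1 - m t" using ac_derivative_diff[OF m, of 0 t] t mass_0 by (simp add: m_def)
    finally have "\<alpha> * integral {0..t} (\<lambda>t. N t * m t) \<le> \<alpha> * (integral {0..t} (\<lambda>t. N t * E t) + (\<mu> * X0) * (1 - m t))"
      using \<alpha> by (intro mult_left_mono) auto
    moreover have "\<alpha> * integral {0..t} (\<lambda>t. N t * E t) \<le> X0"
      using X[OF t] X_nonneg[OF t] X_init int_nonneg(2)[OF t] mult_nonneg_nonneg[of "\<mu> / 2" "integral {0..t} E"] \<mu> by linarith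
    moreover have "\<alpha> * ((\<mu> * X0) * (1 - m t)) \<le> \<alpha> * (\<mu> * X0)"
      using nonneg[OF t] \<alpha> \<mu> X0_nonneg by (intro mult_left_mono) (auto intro!: mult_left_le)
    ultimately have "\<alpha> * integral {0..t} (\<lambda>t. N t * m t) \<le> X0 + \<alpha> * (\<mu> * X0)" by (simp add: algebra_simps)
    then have "integral {0..t} (\<lambda>t. N t * m t) \<le> X0 / \<alpha> + \<mu> * X0" using \<alpha> by (simp add: field_simps)
    then have "1 - m t * m t \<le> 2 * (X0 / \<alpha> + \<mu> * X0)"
      unfolding sq by (intro mult_left_mono) auto
    moreover have "4 * (\<mu> * X0) \<le> \<eta>" using \<mu>(2) by (simp add: ac_simps)
    moreover have "\<eta> = 1 - 2 * (X0 / \<alpha>)" by (simp add: \<eta>)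
    moreover have "h / 2 \<le> s" if "1 - s \<le> 2 * (a + b)" "4 * b \<le> h" "h = 1 - 2 * a" for a b h s :: real
      using that by argo
    ultimately have "\<eta> / 2 \<le> m t * m t" by blast
    also have "\<dots> \<le> m t" using nonneg[OF t] by (intro mult_left_le) auto
    finally show ?thesis .
  qed
  have "integral {0..\<tau>} (\<lambda>t. \<eta> / 4) \<le> integral {0..\<tau>} E"
  proof (intro integral_le)
    show "E integrable_on {0..\<tau>}" using Ei by (rule set_lebesgue_integral_eq_integral(1))
    fix t assume "t \<in> {0..\<tau>}"
    then show "\<eta> / 4 \<le> E t" using m_ge[of t] E_ge[of t] \<mu>(2) by (simp add: algebra_simps)
  qed auto
  then have "\<eta> / 4 * \<tau> \<le> integral {0..\<tau>} E" using \<tau> by (simp add: mult.commute)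
  then have "\<mu> / 2 * (\<eta> / 4 * \<tau>) \<le> \<mu> / 2 * integral {0..\<tau>} E" using \<mu> by (intro mult_left_mono) auto
  also have "\<dots> \<le> X0"
    using X[of \<tau>] X_nonneg[of \<tau>] X_init int_nonneg(1)[of \<tau>] \<alpha> \<tau>
      mult_nonneg_nonneg[of \<alpha> "integral {0..\<tau>} (\<lambda>t. N t * E t)"] by linarith
  finally show ?thesis .
qed

end

lemma weak_solution_A_time_bound:
  assumes \<alpha>: "0 < \<alpha>" and dens: "density_on_pos p0" and \<mu>: "0 < \<mu>"
    and crit: "1 \<le> \<mu> * \<alpha> * (LINT x:{0<..}|lebesgue. exp (- \<mu> * x) * p0 x)"
    and sol: "weak_solution_A \<alpha> p0 T p N"
  shows "T \<le> ereal (2 / \<mu>\<^sup>2 * ln ((LINT x:{0<..}|lebesgue. p0 x) / (LINT x:{0<..}|lebesgue. exp (- \<mu> * x) * p0 x)))"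
proof (rule ccontr)
  define M where "M = (LINT x:{0<..}|lebesgue. exp (- \<mu> * x) * p0 x)"
  have M: "0 < M" unfolding M_def using density_exp_moment_pos[OF dens] \<mu> by simp
  define L where "L = 2 / \<mu>\<^sup>2 * ln (1 / M)"
  assume "\<not> ?thesis"
  then have "ereal L < T" by (simp add: L_def M_def density_on_posD(2)[OF dens])
  moreover have "0 < T" using sol by (simp add: weak_solution_A_def)
  \<comment> \<open>The maximum with 0 ensures that the chosen time is positive, as a test interval
    requires.\<close>
  ultimately have "ereal (max L 0) < T" by (simp add: max_def zero_ereal_def)
  then obtain \<tau> where \<tau>: "ereal (max L 0) < ereal \<tau>" "ereal \<tau> < T" using ereal_dense2 by blast
  then have \<tau>0: "0 < \<tau>" "L < \<tau>" by auto
  have "M * exp (\<mu>\<^sup>2 / 2 * \<tau>) \<le> 1"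
    using blow_up_time_bound[OF sol dens \<tau>0(1) \<tau>(2) \<alpha> \<mu>] crit by (simp add: exp_moment_def M_def)
  then have "exp (\<mu>\<^sup>2 / 2 * \<tau>) \<le> 1 / M" using M by (simp add: field_simps)
  then have "\<mu>\<^sup>2 / 2 * \<tau> \<le> ln (1 / M)" using M by (subst ln_ge_iff) auto
  then have "\<tau> \<le> L" using \<mu> by (simp add: L_def field_simps)
  then show False using \<tau>0 by simp
qed

lemma no_global_weak_solution_first_moment:
  assumes \<alpha>: "0 < \<alpha>" and dens: "density_on_pos p0" and i: "set_integrable lebesgue {0<..} (\<lambda>x. x * p0 x)"
    and gt: "2 * (LINT x:{0<..}|lebesgue. x * p0 x) < \<alpha>"
  shows "\<not> weak_solution_A \<alpha> p0 \<infinity> p N"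
proof
  assume sol: "weak_solution_A \<alpha> p0 \<infinity> p N"
  define X0 where "X0 = (LINT x:{0<..}|lebesgue. x * p0 x)"
  define \<eta> where "\<eta> = 1 - 2 * X0 / \<alpha>"
  have \<eta>: "0 < \<eta>" using gt \<alpha> by (simp add: \<eta>_def X0_def field_simps)
  \<comment> \<open>Small enough for 4 X0 \<mu> \<le> \<eta>; the modulus and the summand 1 keep the
    denominator positive.\<close>
  define \<mu> where "\<mu> = \<eta> / (4 * (\<bar>X0\<bar> + 1))"
  have \<mu>: "0 < \<mu>" using \<eta> by (simp add: \<mu>_def)
  have "X0 * \<eta> \<le> (\<bar>X0\<bar> + 1) * \<eta>" using \<eta> by (intro mult_right_mono) auto
  then have \<mu>2: "4 * X0 * \<mu> \<le> \<eta>" by (simp add: \<mu>_def field_simps)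
  \<comment> \<open>The time at which the lower bound on the dissipated quantity reaches |X0| + 1,
    more than is available.\<close>
  define \<tau> where "\<tau> = (\<bar>X0\<bar> + 1) / (\<mu> / 2 * (\<eta> / 4))"
  have \<tau>: "0 < \<tau>" using \<mu> \<eta> by (simp add: \<tau>_def)
  have "\<mu> / 2 * (\<eta> / 4 * \<tau>) \<le> X0"
    using first_moment_time_bound[OF sol dens \<tau> _ \<alpha> i X0_def \<eta>_def \<mu> \<mu>2] by simp
  moreover have "\<mu> / 2 * (\<eta> / 4 * \<tau>) = \<bar>X0\<bar> + 1" using \<mu> \<eta> by (simp add: \<tau>_def)
  ultimately show False by linarith
qed

section \<open>Weak derivatives on almost every line\<close>

lemma smooth_sum: "finite F \<Longrightarrow> (\<And>i. i \<in> F \<Longrightarrow> smooth (f i)) \<Longrightarrow> smooth (\<lambda>x. \<Sum>i\<in>F. f i x)"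
  by (induction F rule: finite_induct) (auto intro!: smooth_const smooth_add)

text \<open>Since the step lies in [0,1], the gap y - smooth_ramp y is nondecreasing, and from y = 1
  on it equals the constant 1 - smooth_ramp 1. Rescaling by K shrinks the gap to at most
  1/K.\<close>

lemma ramp_bounds: "0 \<le> max y 0 - smooth_ramp y" "max y 0 - smooth_ramp y \<le> 1"
proof -
  have mono: "smooth_ramp x \<le> smooth_ramp y" if "x \<le> y" for x y
    by (rule DERIV_nonneg_imp_nondecreasing[OF that]) (use smooth_ramp_deriv smooth_step_bounds in blast)
  have "((\<lambda>y. y - smooth_ramp y) has_real_derivative 1 - smooth_step x) (at x)" for x
    by (auto intro!: derivative_eq_intros smooth_ramp_deriv)
  then have mono2: "x - smooth_ramp x \<le> y - smooth_ramp y" if "x \<le> y" for x y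
    by (intro DERIV_nonneg_imp_nondecreasing[OF that]) (use smooth_step_bounds in force)
  have k: "0 \<le> smooth_ramp 1" using mono[of 0 1] smooth_ramp_0[of 0] by simp
  consider "y \<le> 0" | "0 \<le> y" "y \<le> 1" | "1 \<le> y" by linarith
  then have "0 \<le> max y 0 - smooth_ramp y \<and> max y 0 - smooth_ramp y \<le> 1"
  proof cases
    case 1 then show ?thesis by (simp add: smooth_ramp_0)
  next
    case 2 then show ?thesis using mono[of 0 y] mono2[of 0 y] smooth_ramp_0[of 0] by simp
  next
    case 3 then show ?thesis using mono2[of 0 y] smooth_ramp_1[of y] smooth_ramp_0[of 0] k by simp
  qed
  then show "0 \<le> max y 0 - smooth_ramp y" "max y 0 - smooth_ramp y \<le> 1" by auto
qed

lemma scaled_bump_deriv: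
  "((\<lambda>x. smooth_step (K * x + d)) has_real_derivative K * smooth_bump (K * x + d)) (at x within S)"
  "((\<lambda>x. smooth_ramp (K * x + d)) has_real_derivative K * smooth_step (K * x + d)) (at x within S)"
proof -
  have 1: "((\<lambda>x. K * x + d) has_real_derivative K) (at x within S)" by (auto intro!: derivative_eq_intros)
  show "((\<lambda>x. smooth_step (K * x + d)) has_real_derivative K * smooth_bump (K * x + d)) (at x within S)"
    using DERIV_chain2[OF smooth_step_deriv 1] by (simp only: mult.commute)
  show "((\<lambda>x. smooth_ramp (K * x + d)) has_real_derivative K * smooth_step (K * x + d)) (at x within S)"
    using DERIV_chain2[OF smooth_ramp_deriv 1] by (simp only: mult.commute)
qed

lemma scaled_continuous [continuous_intros]:
  "continuous_on S (\<lambda>x. smooth_step (K * x + d))" "continuous_on S (\<lambda>x. smooth_ramp (K * x + d))"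
  "continuous_on S (\<lambda>x. smooth_bump (K * x + d))"
  by (intro smooth_continuous_on smooth_affine smooth_step smooth_ramp smooth_bump)+

text \<open>The kernels \<open>K * smooth_bump (K * (x - p))\<close> have mass \<open>1\<close> and are supported in \<open>{p..p + 1/K}\<close>.\<close>

lemma mollifier_tendsto:
  fixes f :: "real \<Rightarrow> real" and K :: "nat \<Rightarrow> real"
  assumes cont: "continuous_on {c..d} f" and p: "c \<le> p" "p < d" and K: "filterlim K at_top sequentially"
  shows "(\<lambda>k. integral {c..d} (\<lambda>x. f x * (K k * smooth_bump (K k * x + - (K k * p))))) \<longlonglongrightarrow> f p"
proof (rule LIMSEQ_I)
  fix e :: real assume e: "0 < e"
  have "\<exists>\<delta>>0. \<forall>x\<in>{c..d}. dist x p < \<delta> \<longrightarrow> dist (f x) (f p) < e / 2"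
    using cont p e unfolding continuous_on_iff by (metis atLeastAtMost_iff half_gt_zero less_eq_real_def)
  then obtain \<delta> where \<delta>: "\<delta> > 0" "\<And>x. x \<in> {c..d} \<Longrightarrow> dist x p < \<delta> \<Longrightarrow> dist (f x) (f p) < e / 2" by blast
  have "eventually (\<lambda>k. K k > max 0 (max (1 / \<delta>) (1 / (d - p)))) sequentially"
    using K unfolding filterlim_at_top_dense by blast
  then obtain k0 where k0: "\<And>k. k \<ge> k0 \<Longrightarrow> K k > max 0 (max (1 / \<delta>) (1 / (d - p)))"
    unfolding eventually_sequentially by blast
  show "\<exists>k0. \<forall>k\<ge>k0. norm (integral {c..d} (\<lambda>x. f x * (K k * smooth_bump (K k * x + - (K k * p)))) - f p) < e"
  proof (intro exI allI impI)
    fix k assume "k0 \<le> k"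
    from k0[OF this] have Kk: "K k > 0" "K k > 1 / \<delta>" "K k > 1 / (d - p)" by auto
    then have K2: "1 < K k * \<delta>" "1 < K k * (d - p)" using \<delta> p by (simp_all add: field_simps)
    define r where "r = (\<lambda>x. K k * smooth_bump (K k * x + - (K k * p)))"
    have rpos: "0 \<le> r x" for x using Kk smooth_bump_nonneg by (simp add: r_def)
    have rc: "continuous_on {c..d} r" unfolding r_def by (intro continuous_intros)
    have "(r has_integral smooth_step (K k * d + - (K k * p)) - smooth_step (K k * c + - (K k * p))) {c..d}"
      unfolding r_def
      by (intro fundamental_theorem_of_calculus scaled_bump_deriv(1)[unfolded has_real_derivative_iff_has_vector_derivative])
        (use p in simp)
    moreover have "smooth_step (K k * d + - (K k * p)) = 1" using K2 by (intro smooth_step_1) (simp add: algebra_simps)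
    moreover have "smooth_step (K k * c + - (K k * p)) = 0" using p Kk by (intro smooth_step_0) simp
    ultimately have r1: "(r has_integral 1) {c..d}" by simp
    have fr: "(\<lambda>x. f x * r x) integrable_on {c..d}" by (intro integrable_continuous_real continuous_intros cont rc)
    have "integral {c..d} (\<lambda>x. f x * r x) - f p = integral {c..d} (\<lambda>x. f x * r x) - integral {c..d} (\<lambda>x. f p * r x)"
      using r1 by (simp add: integral_unique)
    also have "\<dots> = integral {c..d} (\<lambda>x. f x * r x - f p * r x)"
      using fr r1 by (intro integral_diff[symmetric] integrable_on_mult_right) auto
    finally have eq: "integral {c..d} (\<lambda>x. f x * r x) - f p = integral {c..d} (\<lambda>x. f x * r x - f p * r x)" .
    have "norm (integral {c..d} (\<lambda>x. f x * r x - f p * r x)) \<le> integral {c..d} (\<lambda>x. e / 2 * r x)"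
    proof (rule integral_norm_bound_integral)
      show "(\<lambda>x. f x * r x - f p * r x) integrable_on {c..d}"
        by (intro integrable_continuous_real continuous_intros cont rc)
      show "(\<lambda>x. e / 2 * r x) integrable_on {c..d}" by (intro integrable_continuous_real continuous_intros rc)
      fix x assume x: "x \<in> {c..d}"
      show "norm (f x * r x - f p * r x) \<le> e / 2 * r x"
      proof (cases "r x = 0")
        \<comment> \<open>Where the kernel is non-zero, x lies in (p, p + 1/K) and therefore within
          \<delta> of p.\<close>
        case False
        then have "smooth_bump (K k * x + - (K k * p)) \<noteq> 0" by (auto simp: r_def)
        then have "0 < K k * x + - (K k * p)" "K k * x + - (K k * p) < 1" using smooth_bump_0 by (meson not_le)+
        then have "0 < K k * (x - p)" "K k * (x - p) < 1" by (simp_all add: algebra_simps)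
        then have "0 < x - p" "K k * (x - p) < K k * \<delta>" using Kk(1) K2(1) by (simp add: zero_less_mult_iff, linarith)
        then have "0 < x - p" "x - p < \<delta>" using mult_less_cancel_left_pos[OF Kk(1)] by blast+
        then have "\<bar>f x - f p\<bar> \<le> e / 2" using \<delta>(2)[OF x] by (simp add: dist_real_def)
        then have "\<bar>f x - f p\<bar> * r x \<le> e / 2 * r x" using rpos by (rule mult_right_mono)
        moreover have "f x * r x - f p * r x = (f x - f p) * r x" by (simp add: algebra_simps)
        ultimately show ?thesis using rpos[of x] by (simp add: abs_mult)
      qed simp
    qed
    also have "\<dots> = e / 2" using r1 by (simp add: integral_unique)
    finally show "norm (integral {c..d} (\<lambda>x. f x * (K k * smooth_bump (K k * x + - (K k * p)))) - f p) < e"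
      using e eq unfolding r_def by simp
  qed
qed

lemma mollifier_sum_tendsto:
  fixes f :: "real \<Rightarrow> real" and K :: "nat \<Rightarrow> real"
  assumes cont: "continuous_on {c..d} f" and p: "\<And>i. i \<in> F \<Longrightarrow> c \<le> p i \<and> p i < d"
    and K: "filterlim K at_top sequentially" and fin: "finite F"
  shows "(\<lambda>k. integral {c..d} (\<lambda>x. f x * (\<Sum>i\<in>F. w i * (K k * smooth_bump (K k * x + - (K k * p i))))))
    \<longlonglongrightarrow> (\<Sum>i\<in>F. w i * f (p i))"
proof -
  have "integral {c..d} (\<lambda>x. f x * (\<Sum>i\<in>F. w i * (K k * smooth_bump (K k * x + - (K k * p i))))) =
     (\<Sum>i\<in>F. w i * integral {c..d} (\<lambda>x. f x * (K k * smooth_bump (K k * x + - (K k * p i)))))" for k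
  proof -
    have "integral {c..d} (\<lambda>x. f x * (\<Sum>i\<in>F. w i * (K k * smooth_bump (K k * x + - (K k * p i))))) =
      integral {c..d} (\<lambda>x. \<Sum>i\<in>F. w i * (f x * (K k * smooth_bump (K k * x + - (K k * p i)))))"
      by (simp add: sum_distrib_left mult.left_commute)
    also have "\<dots> = (\<Sum>i\<in>F. integral {c..d} (\<lambda>x. w i * (f x * (K k * smooth_bump (K k * x + - (K k * p i))))))"
      by (intro integral_sum fin integrable_continuous_real continuous_intros cont)
    finally show ?thesis by simp
  qed
  then show ?thesis
    by (simp only:) (intro tendsto_sum tendsto_mult tendsto_const mollifier_tendsto[OF cont _ _ K]; use p in blast)
qed

lemma filterlim_Suc_div_at_top: "0 < \<delta> \<Longrightarrow> filterlim (\<lambda>k. real (Suc k) / \<delta>) at_top sequentially"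
proof -
  assume "0 < \<delta>"
  have "filterlim (\<lambda>k. real (Suc k)) at_top sequentially"
    using filterlim_compose[OF filterlim_real_sequentially filterlim_Suc] .
  then have "filterlim (\<lambda>k. (1 / \<delta>) * real (Suc k)) at_top sequentially"
    using \<open>0 < \<delta>\<close> by (intro filterlim_tendsto_pos_mult_at_top[OF tendsto_const]) auto
  then show ?thesis by simp
qed

section \<open>Point values from weak identities on an interval\<close>

context
  fixes f g :: "real \<Rightarrow> real" and c d :: real and F :: "nat set" and w p :: "nat \<Rightarrow> real"
  assumes cont: "continuous_on {c..d} f" and g: "g absolutely_integrable_on {c..d}"
    and fin: "finite F" and p: "\<And>i. i \<in> F \<Longrightarrow> c \<le> p i \<and> p i < d" and cd: "c < d" and w0: "(\<Sum>i\<in>F. w i) = 0"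
begin

text \<open>A kernel attached to p reaches to p + 1/K, so K must be at least 1 / (d - p i) for every
  point. The length d - c is put into the minimum to cover empty \<open>F\<close>.\<close>

lemma bump_scale_exists: "\<exists>K :: nat \<Rightarrow> real. filterlim K at_top sequentially \<and> (\<forall>k. 0 < K k) \<and> (\<forall>k. \<forall>i\<in>F. 1 \<le> K k * (d - p i))"
proof -
  define D where "D = insert (d - c) ((\<lambda>i. d - p i) ` F)"
  have D: "finite D" "D \<noteq> {}" "\<And>x. x \<in> D \<Longrightarrow> 0 < x" using fin p cd by (auto simp: D_def)
  define \<delta> where "\<delta> = Min D"
  have \<delta>: "0 < \<delta>" "\<And>i. i \<in> F \<Longrightarrow> \<delta> \<le> d - p i" using D by (auto simp: \<delta>_def D_def)
  have "1 \<le> real (Suc k) / \<delta> * (d - p i)" if "i \<in> F" for k i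
  proof -
    have "1 \<le> real (Suc k) / \<delta> * \<delta>" using \<delta> by simp
    also have "\<dots> \<le> real (Suc k) / \<delta> * (d - p i)" using \<delta>(1) \<delta>(2)[OF that] by (intro mult_left_mono) auto
    finally show ?thesis .
  qed
  then show ?thesis
    using filterlim_Suc_div_at_top[OF \<delta>(1)] \<delta>(1) by (intro exI[where x = "\<lambda>k. real (Suc k) / \<delta>"]) auto
qed

text \<open>The test functions are weighted sums of steps: their derivatives approximate point
  masses at the p i, and total weight zero makes them vanish to the right of d. Weights -1 and 1
  give the fundamental theorem of calculus for weak derivatives.\<close>

lemma first_order_weak_identity:
  assumes hyp: "\<And>a. smooth a \<Longrightarrow> (\<And>x. x \<notin> {c..d} \<Longrightarrow> a x = 0) \<Longrightarrow>
      integral {c..d} (\<lambda>x. f x * deriv a x) = - integral {c..d} (\<lambda>x. g x * a x)"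
  shows "(\<Sum>i\<in>F. w i * f (p i)) = - integral {c..d} (\<lambda>x. g x * (\<Sum>i\<in>F. w i * (if p i < x then 1 else 0)))"
proof -
  obtain K :: "nat \<Rightarrow> real" where K: "filterlim K at_top sequentially" "\<And>k. 0 < K k" "\<And>k i. i \<in> F \<Longrightarrow> 1 \<le> K k * (d - p i)"
    using bump_scale_exists by blast
  define a where "a = (\<lambda>k x. \<Sum>i\<in>F. w i * smooth_step (K k * x + - (K k * p i)))"
  have sa: "smooth (a k)" for k unfolding a_def
    by (intro smooth_sum fin smooth_mult smooth_const smooth_affine smooth_step)
  have da: "deriv (a k) x = (\<Sum>i\<in>F. w i * (K k * smooth_bump (K k * x + - (K k * p i))))" for k x
    unfolding a_def by (intro DERIV_imp_deriv DERIV_sum DERIV_cmult scaled_bump_deriv)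
  have za: "a k x = 0" if x: "x \<notin> {c..d}" for k x
  proof -
    consider "x < c" | "d < x" using x by fastforce
    then show ?thesis
    proof cases
      case 1
      have "smooth_step (K k * x + - (K k * p i)) = 0" if "i \<in> F" for i
        using mult_left_mono[of x "p i" "K k"] 1 p[OF that] K(2)[of k] by (intro smooth_step_0) auto
      then show ?thesis by (simp add: a_def)
    next
      case 2
      have "smooth_step (K k * x + - (K k * p i)) = 1" if "i \<in> F" for i
      proof (rule smooth_step_1)
        have "K k * d \<le> K k * x" using 2 K(2)[of k] by (intro mult_left_mono) auto
        then show "1 \<le> K k * x + - (K k * p i)" using K(3)[OF that, of k] unfolding right_diff_distrib by linarith
      qed
      then show ?thesis using w0 by (simp add: a_def)
    qed
  qed
  have l1: "(\<lambda>k. integral {c..d} (\<lambda>x. f x * deriv (a k) x)) \<longlonglongrightarrow> (\<Sum>i\<in>F. w i * f (p i))"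
    unfolding da by (rule mollifier_sum_tendsto[OF cont p K(1) fin])
  have "(\<lambda>k. integral {c..d} (\<lambda>x. g x * a k x)) \<longlonglongrightarrow> integral {c..d} (\<lambda>x. g x * (\<Sum>i\<in>F. w i * (if p i < x then 1 else 0)))"
  proof (rule dominated_convergence(2))
    show "(\<lambda>x. g x * a k x) integrable_on {c..d}" for k
      by (intro set_lebesgue_integral_eq_integral(1) absolutely_integrable_mult_continuous g smooth_continuous_on sa)
    show "(\<lambda>x. (\<Sum>i\<in>F. \<bar>w i\<bar>) * \<bar>g x\<bar>) integrable_on {c..d}"
      by (intro integrable_on_mult_right absolutely_integrable_real_abs g)
    show "norm (g x * a k x) \<le> (\<Sum>i\<in>F. \<bar>w i\<bar>) * \<bar>g x\<bar>" if "x \<in> {c..d}" for k x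
    proof -
      have "\<bar>a k x\<bar> \<le> (\<Sum>i\<in>F. \<bar>w i * smooth_step (K k * x + - (K k * p i))\<bar>)" unfolding a_def by (rule sum_abs)
      also have "\<dots> \<le> (\<Sum>i\<in>F. \<bar>w i\<bar>)"
        using smooth_step_bounds by (intro sum_mono) (auto simp: abs_mult intro!: mult_left_le)
      finally have "\<bar>g x\<bar> * \<bar>a k x\<bar> \<le> \<bar>g x\<bar> * \<dots>" by (rule mult_left_mono) simp
      then show ?thesis by (simp only: real_norm_def abs_mult mult.commute)
    qed
    show "(\<lambda>k. g x * a k x) \<longlonglongrightarrow> g x * (\<Sum>i\<in>F. w i * (if p i < x then 1 else 0))" if "x \<in> {c..d}" for x
      unfolding a_def
    proof (intro tendsto_mult tendsto_const tendsto_sum)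
      fix i assume "i \<in> F"
      show "(\<lambda>k. smooth_step (K k * x + - (K k * p i))) \<longlonglongrightarrow> (if p i < x then 1 else 0)"
      proof (cases "p i < x")
        case True
        have "eventually (\<lambda>k. K k \<ge> 1 / (x - p i)) sequentially" using K(1) by (simp add: filterlim_at_top)
        then have "eventually (\<lambda>k. smooth_step (K k * x + - (K k * p i)) = 1) sequentially"
          by eventually_elim (use True in \<open>auto intro!: smooth_step_1 simp: field_simps\<close>)
        then show ?thesis using True by (simp add: tendsto_eventually)
      next
        case False
        have "smooth_step (K k * x + - (K k * p i)) = 0" for k
          using mult_left_mono[of x "p i" "K k"] False K(2)[of k] by (intro smooth_step_0) auto
        then show ?thesis using False by simp
      qed
    qed
  qed
  note l2 = tendsto_minus[OF this]
  have "integral {c..d} (\<lambda>x. f x * deriv (a k) x) = - integral {c..d} (\<lambda>x. g x * a k x)" for k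
    using hyp[OF sa za] .
  with l1 have "(\<lambda>k. - integral {c..d} (\<lambda>x. g x * a k x)) \<longlonglongrightarrow> (\<Sum>i\<in>F. w i * f (p i))" by simp
  from LIMSEQ_unique[OF this l2] show ?thesis .
qed

text \<open>Ramps replace steps, so that the second derivatives approximate point masses. Beyond d
  the weighted sum of ramps is affine, including the constant offset of the ramp, and it vanishes
  because the weights annihilate 1 and p.\<close>

lemma second_order_weak_identity:
  assumes wp0: "(\<Sum>i\<in>F. w i * p i) = 0"
    and hyp: "\<And>a. smooth a \<Longrightarrow> (\<And>x. x \<notin> {c..d} \<Longrightarrow> a x = 0) \<Longrightarrow>
      integral {c..d} (\<lambda>x. f x * deriv (deriv a) x) = integral {c..d} (\<lambda>x. g x * a x)"
  shows "(\<Sum>i\<in>F. w i * f (p i)) = integral {c..d} (\<lambda>x. g x * (\<Sum>i\<in>F. w i * max (p i - x) 0))"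
proof -
  obtain K :: "nat \<Rightarrow> real" where K: "filterlim K at_top sequentially" "\<And>k. 0 < K k" "\<And>k i. i \<in> F \<Longrightarrow> 1 \<le> K k * (d - p i)"
    using bump_scale_exists by blast
  define a where "a = (\<lambda>k x. \<Sum>i\<in>F. w i * (1 / K k) * smooth_ramp (K k * x + - (K k * p i)))"
  define a' where "a' = (\<lambda>k x. \<Sum>i\<in>F. w i * smooth_step (K k * x + - (K k * p i)))"
  have sa: "smooth (a k)" for k unfolding a_def
    by (intro smooth_sum fin smooth_mult smooth_const smooth_affine smooth_ramp)
  have "(a k has_real_derivative a' k x) (at x)" for k x
    unfolding a_def a'_def
  proof (rule DERIV_sum)
    fix i
    have "((\<lambda>x. w i * (1 / K k) * smooth_ramp (K k * x + - (K k * p i))) has_real_derivative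
      w i * (1 / K k) * (K k * smooth_step (K k * x + - (K k * p i)))) (at x)"
      by (intro DERIV_cmult scaled_bump_deriv)
    then show "((\<lambda>x. w i * (1 / K k) * smooth_ramp (K k * x + - (K k * p i))) has_real_derivative
      w i * smooth_step (K k * x + - (K k * p i))) (at x)" using K(2)[of k] by simp
  qed
  then have da: "deriv (a k) = a' k" for k by (auto intro: DERIV_imp_deriv)
  have dda: "deriv (a' k) x = (\<Sum>i\<in>F. w i * (K k * smooth_bump (K k * x + - (K k * p i))))" for k x
    unfolding a'_def by (intro DERIV_imp_deriv DERIV_sum DERIV_cmult scaled_bump_deriv)
  \<comment> \<open>The two kinds of kink differ by the affine function x - p. The form max (p - x)
    0 vanishes beyond p, so on a half-line it leaves an integral over a bounded interval.\<close>
  have flip: "(\<Sum>i\<in>F. w i * max (x - p i) 0) = (\<Sum>i\<in>F. w i * max (p i - x) 0)" for x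
  proof -
    have "(\<Sum>i\<in>F. w i * max (x - p i) 0) - (\<Sum>i\<in>F. w i * max (p i - x) 0) = (\<Sum>i\<in>F. w i * (x - p i))"
      unfolding sum_subtractf[symmetric] by (intro sum.cong refl) (auto simp: max_def algebra_simps)
    also have "\<dots> = x * (\<Sum>i\<in>F. w i) - (\<Sum>i\<in>F. w i * p i)"
      by (simp add: sum_distrib_left sum_subtractf[symmetric] algebra_simps)
    finally show ?thesis using w0 wp0 by simp
  qed
  have za: "a k x = 0" if x: "x \<notin> {c..d}" for k x
  proof -
    consider "x < c" | "d < x" using x by fastforce
    then show ?thesis
    proof cases
      case 1
      have "smooth_ramp (K k * x + - (K k * p i)) = 0" if "i \<in> F" for i
        using mult_left_mono[of x "p i" "K k"] 1 p[OF that] K(2)[of k] by (intro smooth_ramp_0) auto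
      then show ?thesis by (simp add: a_def)
    next
      case 2
      have "(1 / K k) * smooth_ramp (K k * x + - (K k * p i)) = (x - p i) + (smooth_ramp 1 - 1) / K k" if "i \<in> F" for i
      proof -
        have "smooth_ramp (K k * x + - (K k * p i)) = K k * x + - (K k * p i) - 1 + smooth_ramp 1"
        proof (rule smooth_ramp_1)
          have "K k * d \<le> K k * x" using 2 K(2)[of k] by (intro mult_left_mono) auto
          then show "1 \<le> K k * x + - (K k * p i)" using K(3)[OF that, of k] unfolding right_diff_distrib by linarith
        qed
        then show ?thesis using K(2)[of k] by (simp add: field_simps)
      qed
      then have "a k x = (\<Sum>i\<in>F. w i * ((x - p i) + (smooth_ramp 1 - 1) / K k))"
        unfolding a_def mult.assoc by (intro sum.cong) auto
      also have "\<dots> = (x + (smooth_ramp 1 - 1) / K k) * (\<Sum>i\<in>F. w i) - (\<Sum>i\<in>F. w i * p i)"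
      proof -
        have "(\<Sum>i\<in>F. w i * ((x - p i) + (smooth_ramp 1 - 1) / K k))
            = (\<Sum>i\<in>F. (x + (smooth_ramp 1 - 1) / K k) * w i - w i * p i)"
          by (intro sum.cong) (auto simp: algebra_simps)
        then show ?thesis by (simp only: sum_subtractf sum_distrib_left)
      qed
      finally show ?thesis using w0 wp0 by simp
    qed
  qed
  have l1: "(\<lambda>k. integral {c..d} (\<lambda>x. f x * deriv (deriv (a k)) x)) \<longlonglongrightarrow> (\<Sum>i\<in>F. w i * f (p i))"
    unfolding da dda by (rule mollifier_sum_tendsto[OF cont p K(1) fin])
  have l2: "(\<lambda>k. integral {c..d} (\<lambda>x. g x * a k x)) \<longlonglongrightarrow> integral {c..d} (\<lambda>x. g x * (\<Sum>i\<in>F. w i * max (x - p i) 0))"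
  proof (rule dominated_convergence(2))
    show "(\<lambda>x. g x * a k x) integrable_on {c..d}" for k
      by (intro set_lebesgue_integral_eq_integral(1) absolutely_integrable_mult_continuous g smooth_continuous_on sa)
    show "(\<lambda>x. (\<Sum>i\<in>F. \<bar>w i\<bar> * (d - c)) * \<bar>g x\<bar>) integrable_on {c..d}"
      by (intro integrable_on_mult_right absolutely_integrable_real_abs g)
    \<comment> \<open>The scaled ramp lies below the positive part by at most 1/K, which yields both
      the dominating function and, by squeezing, the limit.\<close>
    have ramp: "max z 0 - 1 / K k \<le> (1 / K k) * smooth_ramp (K k * z)" "(1 / K k) * smooth_ramp (K k * z) \<le> max z 0"
      "0 \<le> smooth_ramp (K k * z)" for k z
    proof -
      have m: "max (K k * z) 0 = K k * max z 0" using K(2)[of k] by (auto simp: max_def mult_le_0_iff)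
      have "K k * max z 0 - 1 \<le> smooth_ramp (K k * z)" "smooth_ramp (K k * z) \<le> K k * max z 0"
        using ramp_bounds[of "K k * z"] unfolding m by auto
      then show "max z 0 - 1 / K k \<le> (1 / K k) * smooth_ramp (K k * z)" "(1 / K k) * smooth_ramp (K k * z) \<le> max z 0"
        using K(2)[of k] mult_left_mono[of "K k * max z 0 - 1" "smooth_ramp (K k * z)" "1 / K k"]
          mult_left_mono[of "smooth_ramp (K k * z)" "K k * max z 0" "1 / K k"]
        by (simp_all add: right_diff_distrib)
      have "smooth_ramp (min 0 (K k * z)) \<le> smooth_ramp (K k * z)"
        by (rule DERIV_nonneg_imp_nondecreasing[OF min.cobounded2]) (use smooth_ramp_deriv smooth_step_bounds in blast)
      then show "0 \<le> smooth_ramp (K k * z)" using smooth_ramp_0[of "min 0 (K k * z)"] by simp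
    qed
    have arg: "K k * x + - (K k * p i) = K k * (x - p i)" for k x i by (simp add: algebra_simps)
    show "norm (g x * a k x) \<le> (\<Sum>i\<in>F. \<bar>w i\<bar> * (d - c)) * \<bar>g x\<bar>" if x: "x \<in> {c..d}" for k x
    proof -
      have "\<bar>a k x\<bar> \<le> (\<Sum>i\<in>F. \<bar>w i * (1 / K k) * smooth_ramp (K k * x + - (K k * p i))\<bar>)" unfolding a_def by (rule sum_abs)
      also have "\<dots> \<le> (\<Sum>i\<in>F. \<bar>w i\<bar> * (d - c))"
      proof (rule sum_mono)
        fix i assume i: "i \<in> F"
        have "\<bar>(1 / K k) * smooth_ramp (K k * (x - p i))\<bar> \<le> d - c"
          using ramp(2,3)[where k = k and z = "x - p i"] K(2)[of k] p[OF i] x by (simp add: max_def split: if_splits)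
        then show "\<bar>w i * (1 / K k) * smooth_ramp (K k * x + - (K k * p i))\<bar> \<le> \<bar>w i\<bar> * (d - c)"
          unfolding arg mult.assoc abs_mult[of "w i"] by (intro mult_left_mono) auto
      qed
      finally have "\<bar>g x\<bar> * \<bar>a k x\<bar> \<le> \<bar>g x\<bar> * \<dots>" by (rule mult_left_mono) simp
      then show ?thesis by (simp only: real_norm_def abs_mult mult.commute)
    qed
    show "(\<lambda>k. g x * a k x) \<longlonglongrightarrow> g x * (\<Sum>i\<in>F. w i * max (x - p i) 0)" if "x \<in> {c..d}" for x
      unfolding a_def arg mult.assoc
    proof (intro tendsto_mult tendsto_const tendsto_sum)
      fix i
      have "(\<lambda>k. 1 / K k) \<longlonglongrightarrow> 0"
        using tendsto_divide_0[OF tendsto_const filterlim_at_top_imp_at_infinity[OF K(1)]] .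
      then have "(\<lambda>k. max (x - p i) 0 - 1 / K k) \<longlonglongrightarrow> max (x - p i) 0 - 0" by (intro tendsto_diff tendsto_const)
      then have L: "(\<lambda>k. max (x - p i) 0 - 1 / K k) \<longlonglongrightarrow> max (x - p i) 0" by simp
      show "(\<lambda>k. 1 / K k * smooth_ramp (K k * (x - p i))) \<longlonglongrightarrow> max (x - p i) 0"
        by (rule tendsto_sandwich[OF always_eventually always_eventually L tendsto_const])
          (use ramp(1,2) in blast)+
    qed
  qed
  have "integral {c..d} (\<lambda>x. f x * deriv (deriv (a k)) x) = integral {c..d} (\<lambda>x. g x * a k x)" for k
    using hyp[OF sa za] .
  with l1 have "(\<lambda>k. integral {c..d} (\<lambda>x. g x * a k x)) \<longlonglongrightarrow> (\<Sum>i\<in>F. w i * f (p i))" by simp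
  from LIMSEQ_unique[OF this l2] show ?thesis unfolding flip .
qed

end

section \<open>From weak identities in the plane to almost every line\<close>

text \<open>The bridge between integrals over the whole line, where Fubini's theorem is applied, and
  integrals over intervals, where the calculus of \<open>ac_derivative\<close> lives.\<close>

lemma lborel_integral_on:
  fixes f :: "real \<Rightarrow> real"
  assumes f: "integrable lborel f" and z: "\<And>x. x \<notin> S \<Longrightarrow> f x = 0"
  shows "f absolutely_integrable_on S" "integral S f = (LINT x|lborel. f x)"
proof -
  have m: "f \<in> borel_measurable lborel" using f by simp
  have eq: "(\<lambda>x. indicator S x *\<^sub>R f x) = f" using z by (intro ext) (auto simp: indicator_def)
  show *: "f absolutely_integrable_on S"
    unfolding set_integrable_def eq using f integrable_completion[OF m] by simp
  have "integral S f = (LINT x:S|lebesgue. f x)" by (rule set_lebesgue_integral_eq_integral(2)[OF *, symmetric])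
  also have "\<dots> = (LINT x|lborel. f x)"
    unfolding set_lebesgue_integral_def eq by (rule integral_completion[OF m])
  finally show "integral S f = (LINT x|lborel. f x)" .
qed

lemma integrable_mult_bounded:
  fixes v k :: "real \<times> real \<Rightarrow> real"
  assumes v: "integrable lborel v" and k: "k \<in> borel_measurable borel" "\<And>z. \<bar>k z\<bar> \<le> C"
  shows "integrable lborel (\<lambda>z. v z * k z)"
proof (rule Bochner_Integration.integrable_bound[where f = "\<lambda>z. C * v z"])
  show "integrable lborel (\<lambda>z. C * v z)" using v by simp
  show "(\<lambda>z. v z * k z) \<in> borel_measurable lborel" using v k(1) by auto
  show "AE z in lborel. norm (v z * k z) \<le> norm (C * v z)"
  proof (intro AE_I2)
    fix z :: "real \<times> real"
    have "\<bar>k z\<bar> \<le> \<bar>C\<bar>" using k(2)[of z] by linarith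
    then have "\<bar>v z\<bar> * \<bar>k z\<bar> \<le> \<bar>v z\<bar> * \<bar>C\<bar>" by (rule mult_left_mono) simp
    then show "norm (v z * k z) \<le> norm (C * v z)" by (simp only: real_norm_def abs_mult mult.commute)
  qed
qed

lemma borel_measurable_fst_snd:
  fixes k :: "real \<Rightarrow> real"
  assumes "k \<in> borel_measurable borel"
  shows "(\<lambda>z::real \<times> real. k (fst z)) \<in> borel_measurable borel" "(\<lambda>z::real \<times> real. k (snd z)) \<in> borel_measurable borel"
  by (rule measurable_compose[OF _ assms], intro borel_measurable_continuous_onI continuous_intros)+

lemma bounded_of_support:
  fixes b :: "real \<Rightarrow> real"
  assumes "continuous_on {c..d} b" "\<And>x. x \<notin> {c..d} \<Longrightarrow> b x = 0"
  obtains B where "\<And>x. \<bar>b x\<bar> \<le> B"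
proof -
  have "bounded (b ` {c..d})" using assms(1) by (intro compact_imp_bounded compact_continuous_image) auto
  then obtain B where "\<forall>x\<in>{c..d}. norm (b x) \<le> B" unfolding bounded_iff by blast
  then have B: "\<bar>b x\<bar> \<le> B" if "x \<in> {c..d}" for x using that by simp
  have "\<bar>b x\<bar> \<le> max B 0" for x using B[of x] assms(2)[of x] by (cases "x \<in> {c..d}") auto
  then show ?thesis using that by blast
qed

lemma continuous_on_slice:
  fixes u :: "real \<Rightarrow> real \<Rightarrow> real"
  assumes "continuous_on (A \<times> B) (\<lambda>(r, x). u r x)"
  shows "r \<in> A \<Longrightarrow> continuous_on B (u r)" "x \<in> B \<Longrightarrow> continuous_on A (\<lambda>r. u r x)"
proof -
  show "continuous_on B (u r)" if "r \<in> A"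
  proof -
    have "continuous_on B (\<lambda>x. case (r, x) of (r, x) \<Rightarrow> u r x)"
      by (rule continuous_on_compose2[OF assms continuous_on_Pair[OF continuous_on_const continuous_on_id]])
        (use that in auto)
    then show ?thesis by simp
  qed
  show "continuous_on A (\<lambda>r. u r x)" if "x \<in> B"
  proof -
    have "continuous_on A (\<lambda>r. case (r, x) of (r, x) \<Rightarrow> u r x)"
      by (rule continuous_on_compose2[OF assms continuous_on_Pair[OF continuous_on_id continuous_on_const]])
        (use that in auto)
    then show ?thesis by simp
  qed
qed

text \<open>The fundamental lemma of the calculus of variations, as the case f = 0 of
  \<open>first_order_weak_identity\<close> with the two points c and r: the integral of h over [c,r]
  vanishes.\<close>

lemma AE_zero_of_weakly_zero:
  fixes h :: "real \<Rightarrow> real"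
  assumes cd: "c < d" and h: "h absolutely_integrable_on {c..d}"
    and hyp: "\<And>b. smooth b \<Longrightarrow> (\<And>x. x \<notin> {c..d} \<Longrightarrow> b x = 0) \<Longrightarrow> integral {c..d} (\<lambda>x. h x * b x) = 0"
  shows "AE x in lebesgue. x \<in> {c..d} \<longrightarrow> h x = 0"
proof -
  have sub: "h integrable_on {s..t}" if "c \<le> s" "t \<le> d" for s t
    using absolutely_integrable_on_subinterval[OF h, of s t] that by (auto intro: set_lebesgue_integral_eq_integral(1))
  have "integral {c..r} h = 0" if r: "c \<le> r" "r < d" for r
  proof -
    define w p where "w = (\<lambda>i::nat. if i = 0 then 1 else - 1 :: real)" and "p = (\<lambda>i::nat. if i = 0 then c else r)"
    have "(\<Sum>i\<in>{0,1::nat}. w i * (\<lambda>_. 0) (p i)) = - integral {c..d} (\<lambda>x. h x * (\<Sum>i\<in>{0,1::nat}. w i * (if p i < x then 1 else 0)))"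
      by (rule first_order_weak_identity[OF _ h]) (use cd r hyp in \<open>auto simp: w_def p_def\<close>)
    then have z: "integral {c..d} (\<lambda>x. h x * ((if c < x then 1 else 0) - (if r < x then 1 else 0))) = 0"
      by (simp add: w_def p_def)
    have "integral {c..d} (\<lambda>x. h x * ((if c < x then 1 else 0) - (if r < x then 1 else 0))) = integral {c..d} (\<lambda>x. if x \<in> {c..r} then h x else 0)"
      by (rule integral_spike[of "{c}"]) auto
    also have "\<dots> = integral {c..r} h"
      using r by (subst integral_restrict_Int) (auto simp: Int_absorb2 intro!: arg_cong2[where f = integral])
    finally show ?thesis using z by simp
  qed
  note less = this
  \<comment> \<open>The end r = d is not covered above, because kernels sit to the right of their
    points; it follows from continuity of the primitive.\<close>
  have all: "integral {c..r} h = 0" if r: "r \<in> {c..d}" for r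
  proof -
    have "closedin (top_of_set {c..d}) {r \<in> {c..d}. integral {c..r} h = 0}"
      using indefinite_integral_continuous_1[OF sub[of c d]] by (intro continuous_closedin_preimage_constant) auto
    then have "closed {r \<in> {c..d}. integral {c..r} h = 0}" by (rule closedin_closed_trans) simp
    moreover have "{c..<d} \<subseteq> {r \<in> {c..d}. integral {c..r} h = 0}" using less by auto
    ultimately have "closure {c..<d} \<subseteq> {r \<in> {c..d}. integral {c..r} h = 0}" by (intro closure_minimal)
    then show ?thesis using r cd by auto
  qed
  show ?thesis
  proof (rule AE_zero_of_integrals_zero[OF h])
    fix s t assume st: "c \<le> s" "s \<le> t" "t \<le> d"
    have "integral {c..s} h + integral {s..t} h = integral {c..t} h"
      using st sub[of c t] by (intro Henstock_Kurzweil_Integration.integral_combine) auto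
    then show "integral {s..t} h = 0" using all[of s] all[of t] st by simp
  qed
qed

text \<open>The hypothesis is the asserted identity integrated against each test function of x. By
  Fubini the difference of the two sides is weakly zero on [c,d], hence zero almost everywhere.
  First and second order differ in the kernel \<open>k\<close> only.\<close>

lemma AE_slice_identity:
  fixes u :: "real \<Rightarrow> real \<Rightarrow> real" and v :: "real \<times> real \<Rightarrow> real" and k w p
  assumes cd: "c < d" and cont: "\<And>i. i \<in> F \<Longrightarrow> continuous_on {c..d} (u (p i))" and fin: "finite F"
    and v: "integrable lborel v" and v0: "\<And>r x. r \<notin> {c'..d'} \<or> x \<notin> {c..d} \<Longrightarrow> v (r, x) = 0"
    and k: "k \<in> borel_measurable borel" "\<And>r. \<bar>k r\<bar> \<le> C"
    and hyp: "\<And>b. smooth b \<Longrightarrow> (\<And>x. x \<notin> {c..d} \<Longrightarrow> b x = 0) \<Longrightarrow>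
      (\<Sum>i\<in>F. w i * integral {c..d} (\<lambda>x. u (p i) x * b x)) = integral {c'..d'} (\<lambda>r. (LINT x|lborel. v (r, x) * b x) * k r)"
  shows "AE x in lborel. x \<in> {c..d} \<longrightarrow> (\<Sum>i\<in>F. w i * u (p i) x) = (LINT r|lborel. v (r, x) * k r)"
proof -
  have vk: "integrable lborel (\<lambda>z. v z * k (fst z))"
    by (rule integrable_mult_bounded[OF v borel_measurable_fst_snd(1)[OF k(1)] k(2)])
  define H where "H = (\<lambda>x. LINT r|lborel. v (r, x) * k r)"
  have Hi: "integrable lborel H"
    using lborel_pair.integrable_snd[of "\<lambda>r x. v (r, x) * k r"] vk unfolding H_def
    by (simp add: lborel_prod case_prod_unfold)
  have H0: "H x = 0" if "x \<notin> {c..d}" for x using v0 that by (simp add: H_def)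
  define h where "h = (\<lambda>x. (\<Sum>i\<in>F. w i * u (p i) x) - H x)"
  have Ha: "H absolutely_integrable_on {c..d}" by (rule lborel_integral_on[OF Hi H0])
  have ua: "(\<lambda>x. \<Sum>i\<in>F. w i * u (p i) x) absolutely_integrable_on {c..d}"
    by (intro absolutely_integrable_continuous_real continuous_intros cont)
  have h: "h absolutely_integrable_on {c..d}" unfolding h_def by (intro set_integral_diff Ha ua)
  have "AE x in lebesgue. x \<in> {c..d} \<longrightarrow> h x = 0"
  proof (rule AE_zero_of_weakly_zero[OF cd h])
    fix b :: "real \<Rightarrow> real" assume b: "smooth b" "\<And>x. x \<notin> {c..d} \<Longrightarrow> b x = 0"
    note cb = smooth_continuous_on[OF b(1)]
    have mb: "b \<in> borel_measurable borel" using cb[of UNIV] by (rule borel_measurable_continuous_onI)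
    obtain Cb where Cb: "\<And>x. \<bar>b x\<bar> \<le> Cb" using bounded_of_support[OF cb b(2)] by blast
    have vkb: "integrable lborel (\<lambda>z. v z * k (fst z) * b (snd z))"
      by (rule integrable_mult_bounded[OF vk borel_measurable_fst_snd(2)[OF mb] Cb])
    then have vkb': "integrable (lborel \<Otimes>\<^sub>M lborel) (\<lambda>(r, x). v (r, x) * k r * b x)"
      by (simp add: lborel_prod case_prod_unfold)
    have Hb: "integrable lborel (\<lambda>x. H x * b x)"
      using lborel_pair.integrable_snd[OF vkb'] by (simp add: H_def)
    have pull: "(LINT x|lborel. v (r, x) * k r * b x) = (LINT x|lborel. v (r, x) * b x) * k r" for r
    proof -
      have "(\<lambda>x. v (r, x) * k r * b x) = (\<lambda>x. v (r, x) * b x * k r)" by (simp add: ac_simps)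
      then show ?thesis by simp
    qed
    have gk: "integrable lborel (\<lambda>r. (LINT x|lborel. v (r, x) * b x) * k r)"
      using lborel_pair.integrable_fst'[OF vkb'] unfolding prod.case pull .
    have "integral {c..d} (\<lambda>x. H x * b x) = (LINT x|lborel. H x * b x)"
      by (rule lborel_integral_on[OF Hb]) (simp add: H0)
    also have "\<dots> = (LINT x|lborel. LINT r|lborel. v (r, x) * k r * b x)" by (simp add: H_def)
    also have "\<dots> = (LINT r|lborel. LINT x|lborel. v (r, x) * k r * b x)"
      by (rule lborel_pair.Fubini_integral[OF vkb'])
    also have "\<dots> = (LINT r|lborel. (LINT x|lborel. v (r, x) * b x) * k r)"
      unfolding pull ..
    also have "\<dots> = integral {c'..d'} (\<lambda>r. (LINT x|lborel. v (r, x) * b x) * k r)"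
      by (rule lborel_integral_on(2)[OF gk, symmetric]) (simp add: v0)
    also have "\<dots> = (\<Sum>i\<in>F. w i * integral {c..d} (\<lambda>x. u (p i) x * b x))" using hyp[OF b] by simp
    also have "\<dots> = (\<Sum>i\<in>F. integral {c..d} (\<lambda>x. w i * (u (p i) x * b x)))" by simp
    also have "\<dots> = integral {c..d} (\<lambda>x. \<Sum>i\<in>F. w i * (u (p i) x * b x))"
      by (intro integral_sum[symmetric] fin integrable_continuous_real continuous_intros cont cb)
    also have "\<dots> = integral {c..d} (\<lambda>x. (\<Sum>i\<in>F. w i * u (p i) x) * b x)"
      by (simp add: sum_distrib_right mult.assoc)
    finally have eq: "integral {c..d} (\<lambda>x. H x * b x) = integral {c..d} (\<lambda>x. (\<Sum>i\<in>F. w i * u (p i) x) * b x)" .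
    have "integral {c..d} (\<lambda>x. h x * b x) = integral {c..d} (\<lambda>x. (\<Sum>i\<in>F. w i * u (p i) x) * b x - H x * b x)"
      by (simp add: h_def algebra_simps)
    also have "\<dots> = integral {c..d} (\<lambda>x. (\<Sum>i\<in>F. w i * u (p i) x) * b x) - integral {c..d} (\<lambda>x. H x * b x)"
      by (intro integral_diff set_lebesgue_integral_eq_integral(1) absolutely_integrable_mult_continuous ua Ha cb)
    finally show "integral {c..d} (\<lambda>x. h x * b x) = 0" using eq by simp
  qed
  then have "AE x in lborel. x \<in> {c..d} \<longrightarrow> h x = 0" by (simp add: AE_completion_iff)
  then show ?thesis by eventually_elim (auto simp: h_def H_def)
qed

context
  fixes u :: "real \<Rightarrow> real \<Rightarrow> real" and v :: "real \<times> real \<Rightarrow> real" and c d c' d' :: real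
  assumes cd: "c < d" "c' < d'" and cont: "continuous_on ({c'..d'} \<times> {c..d}) (\<lambda>(r, x). u r x)"
    and v: "integrable lborel v" and v0: "\<And>r x. r \<notin> {c'..d'} \<or> x \<notin> {c..d} \<Longrightarrow> v (r, x) = 0"
begin

text \<open>For tests of the form a(r) b(x), Fubini reduces weak identities in the plane to one
  variable: the function to be tested against \<open>a\<close> is the integral of u r x * b x over
  x, and its weak derivative comes from v in the same way.\<close>

lemma product_test_integrals:
  assumes a: "continuous_on UNIV a" and b: "smooth b" "\<And>x. x \<notin> {c..d} \<Longrightarrow> b x = 0"
  shows "(LINT z|lborel. indicator ({c'..d'} \<times> {c..d}) z * u (fst z) (snd z) * (a (fst z) * b (snd z))) =
      integral {c'..d'} (\<lambda>r. integral {c..d} (\<lambda>x. u r x * b x) * a r)"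
    "(LINT z|lborel. v z * (a (fst z) * b (snd z))) = integral {c'..d'} (\<lambda>r. (LINT x|lborel. v (r, x) * b x) * a r)"
    "continuous_on {c'..d'} (\<lambda>r. integral {c..d} (\<lambda>x. u r x * b x))"
    "(\<lambda>r. LINT x|lborel. v (r, x) * b x) absolutely_integrable_on {c'..d'}"
proof -
  note cb = smooth_continuous_on[OF b(1)]
  have mb: "b \<in> borel_measurable borel" using cb[of UNIV] by (rule borel_measurable_continuous_onI)
  obtain Cb where Cb: "\<And>x. \<bar>b x\<bar> \<le> Cb" using bounded_of_support[OF cb b(2)] by blast
  let ?R = "{c'..d'} \<times> {c..d}"
  have R: "compact ?R" by (intro compact_Times) auto
  have cr: "continuous_on {c..d} (u r)" if "r \<in> {c'..d'}" for r
    by (rule continuous_on_slice(1)[OF cont that])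
  have cont': "continuous_on ?R (\<lambda>z. u (fst z) (snd z))" using cont by (simp add: case_prod_beta)
  have ca: "continuous_on S (\<lambda>z. a (f z))" if "continuous_on S f" for S :: "(real \<times> real) set" and f
    by (rule continuous_on_compose2[OF a that]) simp
  have cbb: "continuous_on S (\<lambda>z. b (f z))" if "continuous_on S f" for S :: "(real \<times> real) set" and f
    by (rule continuous_on_compose2[OF cb[of UNIV] that]) simp
  have "integrable lborel (\<lambda>z. indicator ?R z *\<^sub>R (u (fst z) (snd z) * (a (fst z) * b (snd z))))"
    by (intro borel_integrable_compact R continuous_intros cont' ca cbb)
  then have i: "integrable (lborel \<Otimes>\<^sub>M lborel) (\<lambda>z. indicator ?R z * u (fst z) (snd z) * (a (fst z) * b (snd z)))"
    by (simp add: lborel_prod mult.assoc)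
  have inner: "(LINT x|lborel. indicator ?R (r, x) * u r x * (a r * b x)) =
      (if r \<in> {c'..d'} then integral {c..d} (\<lambda>x. u r x * b x) * a r else 0)" for r
  proof (cases "r \<in> {c'..d'}")
    case True
    have ii: "integrable lborel (\<lambda>x. indicator {c..d} x *\<^sub>R (u r x * (a r * b x)))"
      by (intro borel_integrable_compact continuous_intros cr[OF True] cb) auto
    have "(LINT x|lborel. indicator ?R (r, x) * u r x * (a r * b x)) = (LINT x|lborel. indicator {c..d} x *\<^sub>R (u r x * (a r * b x)))"
      using True by (intro Bochner_Integration.integral_cong) (auto simp: indicator_def)
    also have "\<dots> = integral {c..d} (\<lambda>x. indicator {c..d} x *\<^sub>R (u r x * (a r * b x)))"
      by (rule lborel_integral_on(2)[OF ii, symmetric]) simp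
    also have "\<dots> = integral {c..d} (\<lambda>x. u r x * b x * a r)" by (intro integral_cong) simp
    finally show ?thesis using True by simp
  next
    case False
    then show ?thesis by (auto simp: indicator_times)
  qed
  have oi: "integrable lborel (\<lambda>r. if r \<in> {c'..d'} then integral {c..d} (\<lambda>x. u r x * b x) * a r else 0)"
    using lborel_pair.integrable_fst'[OF i] by (simp add: inner)
  have "(LINT z|lborel. indicator ?R z * u (fst z) (snd z) * (a (fst z) * b (snd z))) =
      (LINT r|lborel. (if r \<in> {c'..d'} then integral {c..d} (\<lambda>x. u r x * b x) * a r else 0))"
    using lborel_pair.integral_fst'[OF i] by (simp add: inner lborel_prod)
  also have "\<dots> = integral {c'..d'} (\<lambda>r. if r \<in> {c'..d'} then integral {c..d} (\<lambda>x. u r x * b x) * a r else 0)"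
    by (rule lborel_integral_on(2)[OF oi, symmetric]) auto
  also have "\<dots> = integral {c'..d'} (\<lambda>r. integral {c..d} (\<lambda>x. u r x * b x) * a r)"
    by (intro integral_cong) simp
  finally show "(LINT z|lborel. indicator ?R z * u (fst z) (snd z) * (a (fst z) * b (snd z))) =
      integral {c'..d'} (\<lambda>r. integral {c..d} (\<lambda>x. u r x * b x) * a r)" .
  have "continuous_on ({c'..d'} \<times> cbox c d) (\<lambda>(r, x). u r x * b x)"
    unfolding case_prod_beta using cont' by (intro continuous_intros cbb) auto
  from integral_continuous_on_param[OF this]
  show "continuous_on {c'..d'} (\<lambda>r. integral {c..d} (\<lambda>x. u r x * b x))" by simp
  have vb: "integrable lborel (\<lambda>z. v z * b (snd z))"
    by (rule integrable_mult_bounded[OF v borel_measurable_fst_snd(2)[OF mb] Cb])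
  have "integrable lborel (\<lambda>r. LINT x|lborel. v (r, x) * b x)"
    using lborel_pair.integrable_fst'[of "\<lambda>z. v z * b (snd z)"] vb by (simp add: lborel_prod)
  then show "(\<lambda>r. LINT x|lborel. v (r, x) * b x) absolutely_integrable_on {c'..d'}"
    by (rule lborel_integral_on(1)) (simp add: v0)
  \<comment> \<open>\<open>v\<close> vanishes off the rectangle, so truncating \<open>a\<close>
    changes nothing and makes it bounded.\<close>
  define k where "k = (\<lambda>r. indicator {c'..d'} r * a r)"
  have mk: "k \<in> borel_measurable borel"
    unfolding k_def using borel_measurable_continuous_onI[OF a] by measurable
  obtain Ck where Ck: "\<And>r. \<bar>k r\<bar> \<le> Ck"
  proof (rule bounded_of_support[of c' d' k])
    show "continuous_on {c'..d'} k"
      using continuous_on_subset[OF a subset_UNIV[of "{c'..d'}"]] by (rule continuous_on_eq) (simp add: k_def)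
  qed (auto simp: k_def)
  have vbk: "integrable (lborel \<Otimes>\<^sub>M lborel) (\<lambda>z. v z * b (snd z) * k (fst z))"
    unfolding lborel_prod by (rule integrable_mult_bounded[OF vb borel_measurable_fst_snd(1)[OF mk] Ck])
  have oi': "integrable lborel (\<lambda>r. (LINT x|lborel. v (r, x) * b x) * k r)"
    using lborel_pair.integrable_fst'[OF vbk] by simp
  have "v z * (a (fst z) * b (snd z)) = v z * b (snd z) * k (fst z)" for z
    using v0[of "fst z" "snd z"] by (cases "fst z \<in> {c'..d'}") (auto simp: k_def)
  then have "(LINT z|lborel. v z * (a (fst z) * b (snd z))) = (LINT z|lborel. v z * b (snd z) * k (fst z))" by (simp only:)
  also have "\<dots> = (LINT r|lborel. (LINT x|lborel. v (r, x) * b x) * k r)"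
    using lborel_pair.integral_fst'[OF vbk] by (simp add: lborel_prod)
  also have "\<dots> = integral {c'..d'} (\<lambda>r. (LINT x|lborel. v (r, x) * b x) * k r)"
    by (rule lborel_integral_on(2)[OF oi', symmetric]) (auto simp: k_def)
  also have "\<dots> = integral {c'..d'} (\<lambda>r. (LINT x|lborel. v (r, x) * b x) * a r)"
    by (intro integral_cong) (simp add: k_def)
  finally show "(LINT z|lborel. v z * (a (fst z) * b (snd z))) = integral {c'..d'} (\<lambda>r. (LINT x|lborel. v (r, x) * b x) * a r)" .
qed

lemma AE_first_order_slice:
  assumes weak: "\<And>a b. smooth a \<Longrightarrow> smooth b \<Longrightarrow> (\<And>x. x \<notin> {c'..d'} \<Longrightarrow> a x = 0) \<Longrightarrow> (\<And>x. x \<notin> {c..d} \<Longrightarrow> b x = 0) \<Longrightarrow>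
      (LINT z|lborel. indicator ({c'..d'} \<times> {c..d}) z * u (fst z) (snd z) * (deriv a (fst z) * b (snd z))) =
      - (LINT z|lborel. v z * (a (fst z) * b (snd z)))"
    and st: "c' \<le> s" "s \<le> t" "t < d'"
  shows "AE x in lborel. x \<in> {c..d} \<longrightarrow> u t x - u s x = (LINT r|lborel. indicator {s<..t} r * v (r, x))"
proof -
  define w p where "w = (\<lambda>i::nat. if i = 0 then - 1 else 1 :: real)" and "p = (\<lambda>i::nat. if i = 0 then s else t)"
  define k where "k = (\<lambda>r. - (\<Sum>i\<in>{0,1::nat}. w i * (if p i < r then 1 else 0)))"
  \<comment> \<open>The two Heaviside functions, jumping at s and t with opposite signs, leave the
    half-open interval from s to t.\<close>
  have kk: "k r = indicator {s<..t} r" for r using st by (auto simp: k_def w_def p_def)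
  have "AE x in lborel. x \<in> {c..d} \<longrightarrow> (\<Sum>i\<in>{0,1::nat}. w i * u (p i) x) = (LINT r|lborel. v (r, x) * k r)"
  proof (rule AE_slice_identity[where c' = c' and d' = d' and C = 1])
    show "continuous_on {c..d} (u (p i))" if "i \<in> {0, 1}" for i
      by (rule continuous_on_slice(1)[OF cont]) (use st in \<open>simp add: p_def\<close>)
    show "k \<in> borel_measurable borel" unfolding kk[abs_def] by simp
    show "\<bar>k r\<bar> \<le> 1" for r by (simp add: kk)
    fix b :: "real \<Rightarrow> real" assume b: "smooth b" "\<And>x. x \<notin> {c..d} \<Longrightarrow> b x = 0"
    have "(\<Sum>i\<in>{0,1::nat}. w i * integral {c..d} (\<lambda>x. u (p i) x * b x)) =
        - integral {c'..d'} (\<lambda>r. (LINT x|lborel. v (r, x) * b x) * (\<Sum>i\<in>{0,1::nat}. w i * (if p i < r then 1 else 0)))"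
    proof (rule first_order_weak_identity[where f = "\<lambda>r. integral {c..d} (\<lambda>x. u r x * b x)"])
      show "continuous_on {c'..d'} (\<lambda>r. integral {c..d} (\<lambda>x. u r x * b x))"
        "(\<lambda>r. LINT x|lborel. v (r, x) * b x) absolutely_integrable_on {c'..d'}"
        using product_test_integrals(3,4)[OF continuous_on_const b] by auto
      fix a assume a: "smooth a" "\<And>x. x \<notin> {c'..d'} \<Longrightarrow> a x = 0"
      have "(LINT z|lborel. indicator ({c'..d'} \<times> {c..d}) z * u (fst z) (snd z) * (deriv a (fst z) * b (snd z))) =
        - (LINT z|lborel. v z * (a (fst z) * b (snd z)))" using weak[OF a(1) b(1) a(2) b(2)] .
      then show "integral {c'..d'} (\<lambda>r. integral {c..d} (\<lambda>x. u r x * b x) * deriv a r) =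
          - integral {c'..d'} (\<lambda>r. (LINT x|lborel. v (r, x) * b x) * a r)"
        using trans[OF product_test_integrals(1)[OF smooth_continuous_on[OF smooth_deriv(2)[OF a(1)]] b, symmetric]]
          product_test_integrals(2)[OF smooth_continuous_on[OF a(1)] b] by auto
    qed (use st cd in \<open>auto simp: w_def p_def\<close>)
    also have "\<dots> = integral {c'..d'} (\<lambda>r. (LINT x|lborel. v (r, x) * b x) * k r)"
      by (simp only: k_def mult_minus_right integral_neg)
    finally show "(\<Sum>i\<in>{0,1::nat}. w i * integral {c..d} (\<lambda>x. u (p i) x * b x)) = integral {c'..d'} (\<lambda>r. (LINT x|lborel. v (r, x) * b x) * k r)" .
  qed (use cd v v0 in auto)
  then show ?thesis by eventually_elim (auto simp: w_def p_def kk mult.commute)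
qed

lemma AE_second_order_slice:
  fixes F :: "nat set" and w p :: "nat \<Rightarrow> real"
  assumes weak: "\<And>a b. smooth a \<Longrightarrow> smooth b \<Longrightarrow> (\<And>x. x \<notin> {c'..d'} \<Longrightarrow> a x = 0) \<Longrightarrow> (\<And>x. x \<notin> {c..d} \<Longrightarrow> b x = 0) \<Longrightarrow>
      (LINT z|lborel. indicator ({c'..d'} \<times> {c..d}) z * u (fst z) (snd z) * (deriv (deriv a) (fst z) * b (snd z))) =
      (LINT z|lborel. v z * (a (fst z) * b (snd z)))"
    and F: "finite F" and p: "\<And>i. i \<in> F \<Longrightarrow> c' \<le> p i \<and> p i < d'" and w: "(\<Sum>i\<in>F. w i) = 0" "(\<Sum>i\<in>F. w i * p i) = 0"
  shows "AE x in lborel. x \<in> {c..d} \<longrightarrow> (\<Sum>i\<in>F. w i * u (p i) x) = (LINT r|lborel. v (r, x) * (\<Sum>i\<in>F. w i * max (p i - r) 0))"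
proof -
  define k where "k = (\<lambda>r. indicator {c'..d'} r * (\<Sum>i\<in>F. w i * max (p i - r) 0))"
  have vk: "v (r, x) * k r = v (r, x) * (\<Sum>i\<in>F. w i * max (p i - r) 0)" for r x
    using v0[of r x] by (cases "r \<in> {c'..d'}") (auto simp: k_def)
  have "AE x in lborel. x \<in> {c..d} \<longrightarrow> (\<Sum>i\<in>F. w i * u (p i) x) = (LINT r|lborel. v (r, x) * k r)"
  proof (rule AE_slice_identity[where c' = c' and d' = d' and C = "\<Sum>i\<in>F. \<bar>w i\<bar> * (d' - c')"])
    show "continuous_on {c..d} (u (p i))" if "i \<in> F" for i
      by (rule continuous_on_slice(1)[OF cont]) (use p[OF that] in simp)
    show "k \<in> borel_measurable borel" unfolding k_def by measurable
    show "\<bar>k r\<bar> \<le> (\<Sum>i\<in>F. \<bar>w i\<bar> * (d' - c'))" for r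
    proof (cases "r \<in> {c'..d'}")
      case True
      have "\<bar>k r\<bar> \<le> (\<Sum>i\<in>F. \<bar>w i * max (p i - r) 0\<bar>)" using True sum_abs[of "\<lambda>i. w i * max (p i - r) 0" F] by (simp add: k_def)
      also have "\<dots> \<le> (\<Sum>i\<in>F. \<bar>w i\<bar> * (d' - c'))"
        unfolding abs_mult using p True cd by (intro sum_mono mult_left_mono) (fastforce simp: max_def)+
      finally show ?thesis .
    next
      case False
      then show ?thesis using cd by (simp add: k_def sum_nonneg)
    qed
    fix b :: "real \<Rightarrow> real" assume b: "smooth b" "\<And>x. x \<notin> {c..d} \<Longrightarrow> b x = 0"
    have "(\<Sum>i\<in>F. w i * integral {c..d} (\<lambda>x. u (p i) x * b x)) =
        integral {c'..d'} (\<lambda>r. (LINT x|lborel. v (r, x) * b x) * (\<Sum>i\<in>F. w i * max (p i - r) 0))"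
    proof (rule second_order_weak_identity[where f = "\<lambda>r. integral {c..d} (\<lambda>x. u r x * b x)"])
      show "continuous_on {c'..d'} (\<lambda>r. integral {c..d} (\<lambda>x. u r x * b x))"
        "(\<lambda>r. LINT x|lborel. v (r, x) * b x) absolutely_integrable_on {c'..d'}"
        using product_test_integrals(3,4)[OF continuous_on_const b] by auto
      fix a assume a: "smooth a" "\<And>x. x \<notin> {c'..d'} \<Longrightarrow> a x = 0"
      have "(LINT z|lborel. indicator ({c'..d'} \<times> {c..d}) z * u (fst z) (snd z) * (deriv (deriv a) (fst z) * b (snd z))) =
        (LINT z|lborel. v z * (a (fst z) * b (snd z)))" using weak[OF a(1) b(1) a(2) b(2)] .
      then show "integral {c'..d'} (\<lambda>r. integral {c..d} (\<lambda>x. u r x * b x) * deriv (deriv a) r) =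
          integral {c'..d'} (\<lambda>r. (LINT x|lborel. v (r, x) * b x) * a r)"
        using trans[OF product_test_integrals(1)[OF smooth_continuous_on[OF smooth_deriv(2)[OF smooth_deriv(2)[OF a(1)]]] b, symmetric]]
          product_test_integrals(2)[OF smooth_continuous_on[OF a(1)] b] by auto
    qed (use F w p cd in auto)
    also have "\<dots> = integral {c'..d'} (\<lambda>r. (LINT x|lborel. v (r, x) * b x) * k r)"
      by (intro integral_cong) (simp add: k_def)
    finally show "(\<Sum>i\<in>F. w i * integral {c..d} (\<lambda>x. u (p i) x * b x)) = integral {c'..d'} (\<lambda>r. (LINT x|lborel. v (r, x) * b x) * k r)" .
  qed (use cd v v0 F in auto)
  then show ?thesis by (simp add: vk)
qed

end

lemma indicator_rect_mult:
  fixes a b :: "real \<Rightarrow> real"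
  assumes "\<And>r. r \<notin> {s..t} \<Longrightarrow> a r = 0" "\<And>r. r \<notin> {x..y} \<Longrightarrow> b r = 0"
  shows "indicator ({s..t} \<times> {x..y}) z * k * (a (fst z) * b (snd z)) = k * (a (fst z) * b (snd z))"
proof (cases "fst z \<in> {s..t} \<and> snd z \<in> {x..y}")
  case False
  then have "a (fst z) = 0 \<or> b (snd z) = 0" using assms by blast
  then show ?thesis by auto
qed (simp add: indicator_def mem_Times_iff)

section \<open>From compact rectangles to open sets\<close>

context
  fixes u :: "real \<Rightarrow> real \<Rightarrow> real" and v :: "real \<times> real \<Rightarrow> real" and I J :: "real set" and c d :: "nat \<Rightarrow> real"
  assumes I: "open I" "convex I" and J: "J = (\<Union>n. {c n..d n})" "\<And>n. c n < d n"
    and cont: "continuous_on (I \<times> J) (\<lambda>(r, x). u r x)" and vm: "v \<in> borel_measurable borel"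
    and vi: "\<And>s t x y. {s..t} \<subseteq> I \<Longrightarrow> {x..y} \<subseteq> J \<Longrightarrow> integrable lborel (\<lambda>z. indicator ({s..t} \<times> {x..y}) z * v z)"
begin

text \<open>The one-dimensional identities need room to the right of the last point, since the
  kernels extend there; openness of I provides it.\<close>

lemma interval_in_open_convex:
  assumes "s \<in> I" "t \<in> I"
  obtains d' where "d' > t" "{s..d'} \<subseteq> I"
proof -
  obtain e where e: "e > 0" "ball t e \<subseteq> I" using I(1) assms(2) open_contains_ball by blast
  have "t + e / 2 \<in> I" using e by (intro subsetD[OF e(2)]) (auto simp: dist_real_def)
  moreover have "is_interval I" using I(2) by (simp add: is_interval_convex_1)
  ultimately have "{s..t + e / 2} \<subseteq> I"
    using mem_is_interval_1_I[OF _ assms(1)] by (meson atLeastAtMost_iff subsetI)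
  then show ?thesis by (rule that[rotated]) (use e in simp)
qed

text \<open>Each choice of s, t and of an interval of x has its own null set. Restricting to
  rational times and to countably many intervals exhausting J leaves a single null set; continuity
  of u reaches the other times afterwards.\<close>

lemma AE_first_order_slices:
  assumes weak: "\<And>a b s t x y. smooth a \<Longrightarrow> smooth b \<Longrightarrow> {s..t} \<subseteq> I \<Longrightarrow> {x..y} \<subseteq> J \<Longrightarrow>
      (\<And>r. r \<notin> {s..t} \<Longrightarrow> a r = 0) \<Longrightarrow> (\<And>r. r \<notin> {x..y} \<Longrightarrow> b r = 0) \<Longrightarrow>
      (LINT z|lborel. indicator ({s..t} \<times> {x..y}) z * u (fst z) (snd z) * (deriv a (fst z) * b (snd z))) =
      - (LINT z|lborel. v z * (a (fst z) * b (snd z)))"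
  shows "AE x in lborel. x \<in> J \<longrightarrow> (\<forall>s\<in>I \<inter> \<rat>. \<forall>t\<in>I \<inter> \<rat>. s \<le> t \<longrightarrow>
      u t x - u s x = (LINT r|lborel. indicator {s<..t} r * v (r, x)))"
proof -
  have "AE x in lborel. s \<le> t \<longrightarrow> x \<in> {c n..d n} \<longrightarrow> u t x - u s x = (LINT r|lborel. indicator {s<..t} r * v (r, x))"
    if st: "s \<in> I \<inter> \<rat>" "t \<in> I \<inter> \<rat>" for s t n
  proof (cases "s \<le> t")
    case True
    obtain d' where d': "d' > t" "{s..d'} \<subseteq> I" using interval_in_open_convex[of s t] st by blast
    let ?R = "{s..d'} \<times> {c n..d n}"
    have Jn: "{c n..d n} \<subseteq> J" using J by auto
    have "AE x in lborel. x \<in> {c n..d n} \<longrightarrow> u t x - u s x = (LINT r|lborel. indicator {s<..t} r * (indicator ?R (r, x) * v (r, x)))"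
    proof (rule AE_first_order_slice[where c' = s and d' = d'])
      show "continuous_on ?R (\<lambda>(r, x). u r x)" by (rule continuous_on_subset[OF cont]) (use d' Jn in auto)
      show "integrable lborel (\<lambda>z. indicator ?R z * v z)" by (rule vi[OF d'(2) Jn])
      fix a b assume ab: "smooth a" "smooth b" "\<And>x. x \<notin> {s..d'} \<Longrightarrow> a x = 0" "\<And>x. x \<notin> {c n..d n} \<Longrightarrow> b x = 0"
      have "(LINT z|lborel. indicator ?R z * u (fst z) (snd z) * (deriv a (fst z) * b (snd z))) =
          - (LINT z|lborel. v z * (a (fst z) * b (snd z)))"
        by (rule weak[OF ab(1,2) d'(2) Jn ab(3,4)])
      also have "(LINT z|lborel. v z * (a (fst z) * b (snd z))) = (LINT z|lborel. indicator ?R z * v z * (a (fst z) * b (snd z)))"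
        by (intro Bochner_Integration.integral_cong refl, rule indicator_rect_mult[symmetric]) (use ab(3,4) in blast)+
      finally show "(LINT z|lborel. indicator ?R z * u (fst z) (snd z) * (deriv a (fst z) * b (snd z))) =
          - (LINT z|lborel. indicator ?R z * v z * (a (fst z) * b (snd z)))" .
    qed (use J d' True in auto)
    then show ?thesis
    proof eventually_elim
      case (elim x)
      have "(LINT r|lborel. indicator {s<..t} r * (indicator ?R (r, x) * v (r, x))) = (LINT r|lborel. indicator {s<..t} r * v (r, x))"
        if "x \<in> {c n..d n}"
        by (intro Bochner_Integration.integral_cong refl) (use that d' in \<open>auto simp: indicator_def\<close>)
      then show ?case using elim by simp
    qed
  qed simp
  then have "AE x in lborel. \<forall>s\<in>I \<inter> \<rat>. \<forall>t\<in>I \<inter> \<rat>. \<forall>n. s \<le> t \<longrightarrow> x \<in> {c n..d n} \<longrightarrow>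
      u t x - u s x = (LINT r|lborel. indicator {s<..t} r * v (r, x))"
    by (intro AE_ball_countable' countable_Int2 countable_rat; subst AE_all_countable; blast)
  then show ?thesis by eventually_elim (unfold J(1), blast)
qed

text \<open>The weights \<open>1\<close>, \<open>1 - p\<close>, \<open>p - 2\<close> at \<open>p\<close>, \<open>2\<close>, \<open>1\<close> annihilate affine functions, so only the second
  derivative of \<open>u\<close> enters.\<close>

lemma AE_second_order_slices:
  assumes weak: "\<And>a b s t x y. smooth a \<Longrightarrow> smooth b \<Longrightarrow> {s..t} \<subseteq> I \<Longrightarrow> {x..y} \<subseteq> J \<Longrightarrow>
      (\<And>r. r \<notin> {s..t} \<Longrightarrow> a r = 0) \<Longrightarrow> (\<And>r. r \<notin> {x..y} \<Longrightarrow> b r = 0) \<Longrightarrow>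
      (LINT z|lborel. indicator ({s..t} \<times> {x..y}) z * u (fst z) (snd z) * (deriv (deriv a) (fst z) * b (snd z))) =
      (LINT z|lborel. v z * (a (fst z) * b (snd z)))"
    and supp: "\<And>r x. r \<notin> I \<Longrightarrow> v (r, x) = 0"
    and pos: "I \<subseteq> {0<..}" and I12: "1 \<in> I" "2 \<in> I"
  shows "AE x in lborel. x \<in> J \<longrightarrow> (\<forall>p\<in>I \<inter> \<rat>.
      u p x + (1 - p) * u 2 x + (p - 2) * u 1 x =
      (LINT r|lborel. v (r, x) * (max (p - r) 0 + (1 - p) * max (2 - r) 0 + (p - 2) * max (1 - r) 0)))"
proof -
  have "AE x in lborel. x \<in> {c n..d n} \<longrightarrow> u p x + (1 - p) * u 2 x + (p - 2) * u 1 x =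
      (LINT r|lborel. v (r, x) * (max (p - r) 0 + (1 - p) * max (2 - r) 0 + (p - 2) * max (1 - r) 0))"
    if p: "p \<in> I \<inter> \<rat>" for p n
  proof -
    define m M where "m = min p 1" and "M = max p 2"
    have mM: "m \<in> I" "M \<in> I" using p I12 by (auto simp: m_def M_def min_def max_def)
    obtain d' where d': "d' > M" "{m..d'} \<subseteq> I" using interval_in_open_convex[OF mM] by blast
    let ?R = "{m..d'} \<times> {c n..d n}"
    have Jn: "{c n..d n} \<subseteq> J" using J by auto
    define w P where "w = (\<lambda>i::nat. if i = 0 then 1 else if i = 1 then 1 - p else p - 2)"
      and "P = (\<lambda>i::nat. if i = 0 then p else if i = 1 then 2 else 1)"
    have "AE x in lborel. x \<in> {c n..d n} \<longrightarrow> (\<Sum>i\<in>{0,1,2::nat}. w i * u (P i) x) =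
        (LINT r|lborel. (indicator ?R (r, x) * v (r, x)) * (\<Sum>i\<in>{0,1,2::nat}. w i * max (P i - r) 0))"
    proof (rule AE_second_order_slice[where c' = m and d' = d'])
      show "continuous_on ?R (\<lambda>(r, x). u r x)" by (rule continuous_on_subset[OF cont]) (use d' Jn in auto)
      show "integrable lborel (\<lambda>z. indicator ?R z * v z)" by (rule vi[OF d'(2) Jn])
      show "m \<le> P i \<and> P i < d'" if "i \<in> {0, 1, 2}" for i using d' by (auto simp: P_def m_def M_def)
      show "(\<Sum>i\<in>{0,1,2::nat}. w i) = 0" "(\<Sum>i\<in>{0,1,2::nat}. w i * P i) = 0" by (auto simp: w_def P_def)
      fix a b assume ab: "smooth a" "smooth b" "\<And>x. x \<notin> {m..d'} \<Longrightarrow> a x = 0" "\<And>x. x \<notin> {c n..d n} \<Longrightarrow> b x = 0"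
      have "(LINT z|lborel. indicator ?R z * u (fst z) (snd z) * (deriv (deriv a) (fst z) * b (snd z))) =
          (LINT z|lborel. v z * (a (fst z) * b (snd z)))"
        by (rule weak[OF ab(1,2) d'(2) Jn ab(3,4)])
      also have "(LINT z|lborel. v z * (a (fst z) * b (snd z))) = (LINT z|lborel. indicator ?R z * v z * (a (fst z) * b (snd z)))"
        by (intro Bochner_Integration.integral_cong refl, rule indicator_rect_mult[symmetric]) (use ab(3,4) in blast)+
      finally show "(LINT z|lborel. indicator ?R z * u (fst z) (snd z) * (deriv (deriv a) (fst z) * b (snd z))) =
          (LINT z|lborel. indicator ?R z * v z * (a (fst z) * b (snd z)))" .
    qed (use J d' in \<open>auto simp: m_def M_def\<close>)
    then show ?thesis
    proof eventually_elim
      case (elim x)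
      have aff: "max (p - r) 0 + (1 - p) * max (2 - r) 0 + (p - 2) * max (1 - r) 0 = 0" if "r \<notin> {m..d'}" for r
        using that d' by (auto simp: m_def M_def max_def min_def algebra_simps split: if_splits)
      have "(LINT r|lborel. (indicator ?R (r, x) * v (r, x)) * (max (p - r) 0 + (1 - p) * max (2 - r) 0 + (p - 2) * max (1 - r) 0))
          = (LINT r|lborel. v (r, x) * (max (p - r) 0 + (1 - p) * max (2 - r) 0 + (p - 2) * max (1 - r) 0))"
        if "x \<in> {c n..d n}"
      proof (intro Bochner_Integration.integral_cong refl)
        fix r show "(indicator ?R (r, x) * v (r, x)) * (max (p - r) 0 + (1 - p) * max (2 - r) 0 + (p - 2) * max (1 - r) 0)
          = v (r, x) * (max (p - r) 0 + (1 - p) * max (2 - r) 0 + (p - 2) * max (1 - r) 0)"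
          using aff[of r] that by (cases "r \<in> {m..d'}") auto
      qed
      then show ?case using elim by (simp add: w_def P_def add.assoc)
    qed
  qed
  then have "AE x in lborel. \<forall>p\<in>I \<inter> \<rat>. \<forall>n. x \<in> {c n..d n} \<longrightarrow> u p x + (1 - p) * u 2 x + (p - 2) * u 1 x =
      (LINT r|lborel. v (r, x) * (max (p - r) 0 + (1 - p) * max (2 - r) 0 + (p - 2) * max (1 - r) 0))"
    by (intro AE_ball_countable' countable_Int2 countable_rat; subst AE_all_countable; blast)
  then show ?thesis by eventually_elim (unfold J(1), blast)
qed

end

text \<open>With the shift 3 the margins are at most \<tau> / 3, so that even the first interval is
  nondegenerate.\<close>

lemma Ioo_as_UN_Icc:
  fixes \<tau> :: real
  assumes "0 < \<tau>"
  shows "{0<..<\<tau>} = (\<Union>n. {\<tau> / real (n + 3)..\<tau> - \<tau> / real (n + 3)})" "\<tau> / real (n + 3) < \<tau> - \<tau> / real (n + 3)"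
proof -
  have pos: "0 < \<tau> / real (n + 3)" for n using assms by simp
  show "{0<..<\<tau>} = (\<Union>n. {\<tau> / real (n + 3)..\<tau> - \<tau> / real (n + 3)})"
  proof (intro antisym subsetI)
    fix x assume x: "x \<in> {0<..<\<tau>}"
    obtain n :: nat where n: "real n > \<tau> / min x (\<tau> - x)" using reals_Archimedean2 by blast
    have m: "0 < min x (\<tau> - x)" using x by auto
    have "\<tau> < real n * min x (\<tau> - x)" using n m by (simp add: pos_divide_less_eq)
    also have "\<dots> \<le> real (n + 3) * min x (\<tau> - x)" using m by (intro mult_right_mono) auto
    finally have "\<tau> \<le> min x (\<tau> - x) * real (n + 3)" by (simp only: mult.commute less_imp_le)
    moreover have "0 < real (n + 3)" by simp
    ultimately have "\<tau> / real (n + 3) \<le> min x (\<tau> - x)" using pos_divide_le_eq by blast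
    then show "x \<in> (\<Union>n. {\<tau> / real (n + 3)..\<tau> - \<tau> / real (n + 3)})" by (intro UN_I[of n]) auto
  next
    fix x assume "x \<in> (\<Union>n. {\<tau> / real (n + 3)..\<tau> - \<tau> / real (n + 3)})"
    then obtain n where "\<tau> / real (n + 3) \<le> x" "x \<le> \<tau> - \<tau> / real (n + 3)" by auto
    then show "x \<in> {0<..<\<tau>}" using pos[of n] by (auto simp del: of_nat_add)
  qed
  have "\<tau> / real (n + 3) \<le> \<tau> / 3" using assms by (intro divide_left_mono) auto
  then show "\<tau> / real (n + 3) < \<tau> - \<tau> / real (n + 3)" using assms by linarith
qed

lemma Ioi_as_UN_Icc: "{0<..} = (\<Union>n. {1 / real (n + 2)..real (n + 2)})" "1 / real (n + 2) < real (n + 2)"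
proof -
  show "{0<..} = (\<Union>n. {1 / real (n + 2)..real (n + 2)})"
  proof (intro antisym subsetI)
    fix x :: real assume x: "x \<in> {0<..}"
    obtain n :: nat where n: "real n > max x (1 / x)" using reals_Archimedean2 by blast
    have "1 / real (n + 2) \<le> x" using n x by (simp add: field_simps)
    then show "x \<in> (\<Union>n. {1 / real (n + 2)..real (n + 2)})" using n by (intro UN_I[of n]) auto
  next
    fix x :: real assume "x \<in> (\<Union>n. {1 / real (n + 2)..real (n + 2)})"
    then obtain n where "1 / real (n + 2) \<le> x" by auto
    moreover have "0 < 1 / real (n + 2)" by simp
    ultimately have "0 < x" by (rule less_le_trans[rotated])
    then show "x \<in> {0<..}" by simp
  qed
  have "1 / real (n + 2) < 1" by simp
  also have "1 < real (n + 2)" by simp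
  finally show "1 / real (n + 2) < real (n + 2)" .
qed

lemma continuous_const_of_dense:
  fixes G :: "real \<Rightarrow> real"
  assumes "continuous_on S G" "closed S" "open I" "S = closure I" "\<And>t. t \<in> I \<inter> \<rat> \<Longrightarrow> G t = k" "t \<in> S"
  shows "G t = k"
proof -
  have "closure (I \<inter> \<rat>) = closure I"
    using assms(3) by (intro closure_open_Int_superset) (auto simp: Rats_closure_real)
  then have S: "closure (I \<inter> \<rat>) = S" using assms(4) by simp
  show ?thesis
    by (rule continuous_constant_on_closure[of "I \<inter> \<rat>" G k]) (use assms S in auto)
qed

section \<open>The linear problem on the half-line\<close>

text \<open>On a set of finite measure square integrability gives integrability, through |f| \<le> 1
  + f^2.\<close>

lemma integrable_of_square:
  fixes f :: "'a::euclidean_space \<Rightarrow> real"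
  assumes f: "f \<in> borel_measurable borel" and f2: "integrable lborel (\<lambda>x. (f x)\<^sup>2)"
    and A: "A \<in> sets borel" "emeasure lborel A < \<infinity>"
  shows "integrable lborel (\<lambda>x. indicator A x * f x)"
proof (rule Bochner_Integration.integrable_bound[where f = "\<lambda>x. indicator A x + (f x)\<^sup>2"])
  show "integrable lborel (\<lambda>x. indicator A x + (f x)\<^sup>2)"
    using f2 A by (intro Bochner_Integration.integrable_add integrable_real_indicator) auto
  show "(\<lambda>x. indicator A x * f x) \<in> borel_measurable lborel" using f A by auto
  show "AE x in lborel. norm (indicator A x * f x) \<le> norm (indicator A x + (f x)\<^sup>2)"
  proof (intro AE_I2)
    fix x
    have "\<bar>f x\<bar> \<le> 1 + (f x)\<^sup>2"
      using zero_le_power2[of "\<bar>f x\<bar> - 1"] zero_le_power2[of "f x"] by (simp add: power2_diff)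
    then show "norm (indicator A x * f x) \<le> norm (indicator A x + (f x)\<^sup>2)"
      by (simp add: indicator_def)
  qed
qed

lemma lborel_swap:
  fixes f :: "real \<times> real \<Rightarrow> real"
  assumes "f \<in> borel_measurable borel"
  shows "(LINT z|lborel. f (snd z, fst z)) = (LINT z|lborel. f z)"
proof -
  have "f \<in> borel_measurable (lborel \<Otimes>\<^sub>M lborel)" using assms by (simp add: lborel_prod)
  from lborel_pair.integral_product_swap[OF this] show ?thesis by (simp add: lborel_prod case_prod_unfold)
qed

lemma at_within_atLeast:
  assumes "x < X"
  shows "at (x::real) within {0..X} = at x within {0..}"
  by (rule at_within_nhd[of _ "{..<X}"]) (use assms in auto)

lemma continuous_on_atLeast_cover:
  fixes W :: "real \<Rightarrow> real"
  assumes "\<And>X. continuous_on {0..X} W"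
  shows "continuous_on {0..} W"
  unfolding continuous_on_eq_continuous_within
proof
  fix x :: real assume "x \<in> {0..}"
  then have "continuous (at x within {0..x + 1}) W" using assms[of "x + 1"] by (simp add: continuous_on_eq_continuous_within)
  then show "continuous (at x within {0..}) W" using at_within_atLeast[of x "x + 1"] by simp
qed

text \<open>The difference of \<open>F\<close> and the primitive of \<open>f\<close> takes a single
  value on the rational points, which are dense, and is continuous up to the end points.\<close>

lemma ac_derivative_of_rational:
  fixes F f :: "real \<Rightarrow> real"
  assumes ab: "a < b" and cont: "continuous_on {a..b} F" and f: "f absolutely_integrable_on {a..b}"
    and inc: "\<And>s t. s \<in> {a<..<b} \<inter> \<rat> \<Longrightarrow> t \<in> {a<..<b} \<inter> \<rat> \<Longrightarrow> s \<le> t \<Longrightarrow> F t - F s = integral {s..t} f"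
  shows "ac_derivative F f a b"
proof -
  define G where "G = (\<lambda>t. F t - integral {a..t} f)"
  have fi: "f integrable_on {a..t}" if "t \<le> b" for t
    using absolutely_integrable_on_subinterval[OF f, of a t] that by (auto intro: set_lebesgue_integral_eq_integral(1))
  have cG: "continuous_on {a..b} G" unfolding G_def
    by (intro continuous_intros cont indefinite_integral_continuous_1 fi) simp
  have step: "G s = G t" if "s \<in> {a<..<b} \<inter> \<rat>" "t \<in> {a<..<b} \<inter> \<rat>" "s \<le> t" for s t
    using inc[OF that] Henstock_Kurzweil_Integration.integral_combine[of a s t f] fi[of t] that by (simp add: G_def)
  obtain r0 where r0: "r0 \<in> {a<..<b} \<inter> \<rat>" using Rats_dense_in_real[OF ab] by auto
  have eq: "G t = G r0" if "t \<in> {a<..<b} \<inter> \<rat>" for t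
  proof (cases "t \<le> r0")
    case True
    show ?thesis by (rule step[OF that r0 True])
  next
    case False
    then show ?thesis using step[OF r0 that] by simp
  qed
  have const: "G t = G r0" if "t \<in> {a..b}" for t
    by (rule continuous_const_of_dense[where I = "{a<..<b}", OF cG _ _ _ eq that]) (use ab in auto)
  show ?thesis
  proof (rule ac_derivative_intro[OF f, where c = "F a"])
    fix t assume "a \<le> t" "t \<le> b"
    then show "F t = F a + integral {a..t} f" using trans[OF const[of t] const[of a, symmetric]] by (simp add: G_def)
  qed
qed

text \<open>Let P be the primitive of f and W that of P. Integration by parts turns the integral of
  f r * max (p - r) 0 into W p, so F - W satisfies the homogeneous three-point relation and is
  affine; it vanishes at 0. The constant in \<open>g\<close> is its slope F 1 - W 1.\<close>

lemma second_order_primitive: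
  fixes F f :: "real \<Rightarrow> real"
  assumes cont: "continuous_on {0..} F" and F0: "F 0 = 0"
    and f: "\<And>X. integrable lborel (\<lambda>x. indicator {0..X} x * f x)" and f0: "\<And>x. x \<le> 0 \<Longrightarrow> f x = 0"
    and three: "\<And>p. p \<in> {0<..} \<inter> \<rat> \<Longrightarrow> F p + (1 - p) * F 2 + (p - 2) * F 1 =
      (LINT r|lborel. f r * (max (p - r) 0 + (1 - p) * max (2 - r) 0 + (p - 2) * max (1 - r) 0))"
  defines "g \<equiv> \<lambda>x. (F 1 - integral {0..1} (\<lambda>y. integral {0..y} f)) + integral {0..x} f"
  assumes X: "0 \<le> X"
  shows "ac_derivative g f 0 X" "ac_derivative F g 0 X"
proof -
  have fa: "f absolutely_integrable_on {0..X}" for X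
  proof -
    have "(\<lambda>x. indicator {0..X} x * f x) absolutely_integrable_on {0..X}"
      by (rule lborel_integral_on(1)[OF f]) simp
    then show ?thesis by (rule set_integrable_cong[THEN iffD1, rotated -1]) auto
  qed
  define P where "P = (\<lambda>x. integral {0..x} f)"
  have acP: "ac_derivative P f 0 X" for X
    unfolding P_def by (rule ac_derivative_intro[OF fa, where c = 0]) simp
  have cP: "continuous_on {0..X} P" for X by (rule ac_derivative_continuous[OF acP])
  define W where "W = (\<lambda>x. integral {0..x} P)"
  have Wi: "integrable lborel (\<lambda>r. f r * max (p - r) 0)" "(LINT r|lborel. f r * max (p - r) 0) = W p" if p: "0 \<le> p" for p
  proof -
    have eq: "(\<lambda>r. f r * max (p - r) 0) = (\<lambda>r. indicator {0..p} r * f r * (indicator {0..p} r * (p - r)))"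
      using f0 by (auto simp: fun_eq_iff indicator_def max_def)
    show i: "integrable lborel (\<lambda>r. f r * max (p - r) 0)" unfolding eq
    proof (rule Bochner_Integration.integrable_bound[where f = "\<lambda>r. p * (indicator {0..p} r * f r)"])
      show "integrable lborel (\<lambda>r. p * (indicator {0..p} r * f r))" using f[of p] by simp
      have "(\<lambda>r. indicator {0..p} r * f r) \<in> borel_measurable lborel" using f[of p] by simp
      then show "(\<lambda>r. indicator {0..p} r * f r * (indicator {0..p} r * (p - r))) \<in> borel_measurable lborel"
        by (rule borel_measurable_times) simp
      show "AE r in lborel. norm (indicator {0..p} r * f r * (indicator {0..p} r * (p - r))) \<le> norm (p * (indicator {0..p} r * f r))"
      proof (intro AE_I2)
        fix r
        have "\<bar>f r\<bar> * (p - r) \<le> \<bar>f r\<bar> * p" if "0 \<le> r" using that by (intro mult_left_mono) auto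
        then show "norm (indicator {0..p} r * f r * (indicator {0..p} r * (p - r))) \<le> norm (p * (indicator {0..p} r * f r))"
          using p by (auto simp: indicator_def abs_mult mult.commute)
      qed
    qed
    have prod: "ac_derivative (\<lambda>r. P r * (p - r)) (\<lambda>r. f r * (p - r) + P r * (-1)) 0 p"
      by (intro ac_derivative_mult acP ac_derivative_C1) (auto intro!: derivative_eq_intros)
    have i1: "(\<lambda>r. f r * (p - r)) integrable_on {0..p}"
      by (intro set_lebesgue_integral_eq_integral(1) absolutely_integrable_mult_continuous fa continuous_intros)
    have i2: "(\<lambda>r. P r * (-1)) integrable_on {0..p}" by (intro integrable_continuous_real continuous_intros cP)
    have "0 = integral {0..p} (\<lambda>r. f r * (p - r) + P r * (-1))"
      using ac_derivative_diff[OF prod, of 0 p] p by (simp add: P_def)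
    also have "\<dots> = integral {0..p} (\<lambda>r. f r * (p - r)) + integral {0..p} (\<lambda>r. P r * (-1))"
      by (rule integral_add[OF i1 i2])
    finally have "integral {0..p} (\<lambda>r. f r * (p - r)) = W p" by (simp add: W_def)
    moreover have "integral {0..p} (\<lambda>r. f r * (p - r)) = integral {0..p} (\<lambda>r. f r * max (p - r) 0)"
      by (intro integral_cong) auto
    moreover have "integral {0..p} (\<lambda>r. f r * max (p - r) 0) = (LINT r|lborel. f r * max (p - r) 0)"
      by (rule lborel_integral_on(2)[OF i]) (use f0 in \<open>auto simp: max_def\<close>)
    ultimately show "(LINT r|lborel. f r * max (p - r) 0) = W p" by simp
  qed
  define k where "k = (\<lambda>x. F x - W x)"
  have cW: "continuous_on {0..} W"
  proof (rule continuous_on_atLeast_cover)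
    show "continuous_on {0..X} W" for X
      unfolding W_def by (intro indefinite_integral_continuous_1 integrable_continuous_real cP)
  qed
  have ck: "continuous_on {0..} (\<lambda>p. k p + (1 - p) * k 2 + (p - 2) * k 1)"
    unfolding k_def by (intro continuous_intros cont cW)
  have zero: "k p + (1 - p) * k 2 + (p - 2) * k 1 = 0" if p: "p \<in> {0<..} \<inter> \<rat>" for p
  proof -
    have "(LINT r|lborel. f r * (max (p - r) 0 + (1 - p) * max (2 - r) 0 + (p - 2) * max (1 - r) 0)) =
       (LINT r|lborel. f r * max (p - r) 0 + ((1 - p) * (f r * max (2 - r) 0) + (p - 2) * (f r * max (1 - r) 0)))"
      by (simp add: algebra_simps)
    also have "\<dots> = W p + ((1 - p) * W 2 + (p - 2) * W 1)"
      using Wi[of p] Wi[of 2] Wi[of 1] p by simp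
    finally show ?thesis using three[OF p] by (simp add: k_def algebra_simps)
  qed
  have all: "k p + (1 - p) * k 2 + (p - 2) * k 1 = 0" if "p \<in> {0..}" for p
    by (rule continuous_const_of_dense[where I = "{0<..}", OF ck _ _ _ zero that]) auto
  have k0: "k 0 = 0" by (simp add: k_def W_def F0)
  have lin: "F p = p * k 1 + W p" if "0 \<le> p" for p
  proof -
    \<comment> \<open>The relation at p = 0, where k vanishes, fixes k 2; inserted back, it makes k
      linear.\<close>
    have k2: "k 2 = 2 * k 1" using all[of 0] k0 by simp
    have "k p = p * k 1" using all[of p] that unfolding k2 by (simp add: algebra_simps)
    then show ?thesis by (simp add: k_def)
  qed
  have gP: "g = (\<lambda>x. k 1 + P x)" by (simp add: g_def k_def W_def P_def)
  show "ac_derivative g f 0 X" unfolding gP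
    by (rule ac_derivative_intro[OF fa, where c = "k 1"]) (simp add: P_def)
  show "ac_derivative F g 0 X"
  proof (rule ac_derivative_intro[where c = 0])
    show "g absolutely_integrable_on {0..X}"
      unfolding gP by (intro absolutely_integrable_continuous_real continuous_intros cP)
    fix t assume t: "0 \<le> t" "t \<le> X"
    have "integral {0..t} g = integral {0..t} (\<lambda>x. k 1) + integral {0..t} P"
      unfolding gP by (intro integral_add integrable_continuous_real continuous_intros cP)
    then show "F t = 0 + integral {0..t} g" using lin[OF t(1)] t by (simp add: W_def)
  qed
qed

text \<open>\<open>v1\<close>, \<open>v2\<close>, \<open>v3\<close> are Borel representatives of \<open>q\<^sub>t\<close>, \<open>q\<^sub>x\<close>, \<open>q\<^sub>x\<^sub>x\<close>, extended by \<open>0\<close>.\<close>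

locale parabolic =
  fixes \<tau> :: real and q :: "real \<Rightarrow> real \<Rightarrow> real" and v1 v2 v3 :: "real \<times> real \<Rightarrow> real" and B :: "real \<Rightarrow> real"
  assumes tau: "0 < \<tau>"
    and cont: "continuous_on ({0..\<tau>} \<times> {0..}) (\<lambda>(t, x). q t x)"
    and bdry: "\<And>t. t \<in> {0..\<tau>} \<Longrightarrow> q t 0 = 0"
    and meas: "v1 \<in> borel_measurable borel" "v2 \<in> borel_measurable borel" "v3 \<in> borel_measurable borel"
    and supp: "\<And>z. z \<notin> {0<..<\<tau>} \<times> {0<..} \<Longrightarrow> v1 z = 0" "\<And>z. z \<notin> {0<..<\<tau>} \<times> {0<..} \<Longrightarrow> v2 z = 0"
      "\<And>z. z \<notin> {0<..<\<tau>} \<times> {0<..} \<Longrightarrow> v3 z = 0"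
    and sq: "integrable lborel (\<lambda>z. (v1 z)\<^sup>2)" "integrable lborel (\<lambda>z. (v2 z)\<^sup>2)" "integrable lborel (\<lambda>z. (v3 z)\<^sup>2)"
    and qsq: "integrable lborel (\<lambda>z. indicator ({0<..<\<tau>} \<times> {0<..}) z * (q (fst z) (snd z))\<^sup>2)"
    and weak1: "\<And>a b s t x y. smooth a \<Longrightarrow> smooth b \<Longrightarrow> {s..t} \<subseteq> {0<..<\<tau>} \<Longrightarrow> {x..y} \<subseteq> {0<..} \<Longrightarrow>
      (\<And>r. r \<notin> {s..t} \<Longrightarrow> a r = 0) \<Longrightarrow> (\<And>r. r \<notin> {x..y} \<Longrightarrow> b r = 0) \<Longrightarrow>
      (LINT z|lborel. indicator ({s..t} \<times> {x..y}) z * q (fst z) (snd z) * (deriv a (fst z) * b (snd z))) =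
      - (LINT z|lborel. v1 z * (a (fst z) * b (snd z)))"
    and weak2: "\<And>a b s t x y. smooth a \<Longrightarrow> smooth b \<Longrightarrow> {s..t} \<subseteq> {0<..<\<tau>} \<Longrightarrow> {x..y} \<subseteq> {0<..} \<Longrightarrow>
      (\<And>r. r \<notin> {s..t} \<Longrightarrow> a r = 0) \<Longrightarrow> (\<And>r. r \<notin> {x..y} \<Longrightarrow> b r = 0) \<Longrightarrow>
      (LINT z|lborel. indicator ({s..t} \<times> {x..y}) z * q (fst z) (snd z) * (a (fst z) * deriv b (snd z))) =
      - (LINT z|lborel. v2 z * (a (fst z) * b (snd z)))"
    and weak3: "\<And>a b s t x y. smooth a \<Longrightarrow> smooth b \<Longrightarrow> {s..t} \<subseteq> {0<..<\<tau>} \<Longrightarrow> {x..y} \<subseteq> {0<..} \<Longrightarrow>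
      (\<And>r. r \<notin> {s..t} \<Longrightarrow> a r = 0) \<Longrightarrow> (\<And>r. r \<notin> {x..y} \<Longrightarrow> b r = 0) \<Longrightarrow>
      (LINT z|lborel. indicator ({s..t} \<times> {x..y}) z * q (fst z) (snd z) * (a (fst z) * deriv (deriv b) (snd z))) =
      (LINT z|lborel. v3 z * (a (fst z) * b (snd z)))"
    and pde: "AE z in lborel. z \<in> {0<..<\<tau>} \<times> {0<..} \<longrightarrow> v1 z = 1 / 2 * v3 z - B (fst z) * v2 z"
    and Bint: "B absolutely_integrable_on {0..\<tau>}"
begin

section \<open>Slices of a solution in time and in space\<close>

lemma rect_integrable:
  "integrable lborel (\<lambda>z. indicator ({s..t} \<times> {x..y}) z * v1 z)"
  "integrable lborel (\<lambda>z. indicator ({s..t} \<times> {x..y}) z * v2 z)"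
  "integrable lborel (\<lambda>z. indicator ({s..t} \<times> {x..y}) z * v3 z)"
proof -
  have R: "compact ({s..t} \<times> {x..y})" by (intro compact_Times) auto
  then have "{s..t} \<times> {x..y} \<in> sets borel" by (intro borel_compact)
  moreover have "emeasure lborel ({s..t} \<times> {x..y}) < \<infinity>" using emeasure_compact_finite[OF R] .
  ultimately show "integrable lborel (\<lambda>z. indicator ({s..t} \<times> {x..y}) z * v1 z)"
    "integrable lborel (\<lambda>z. indicator ({s..t} \<times> {x..y}) z * v2 z)"
    "integrable lborel (\<lambda>z. indicator ({s..t} \<times> {x..y}) z * v3 z)"
    using integrable_of_square meas sq by blast+
qed

text \<open>Along almost every vertical line the square-integrable \<open>v1\<close> is integrable
  on [0,\<tau>] and its integrals are the increments of q at rational times; continuity of q extends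
  this to the closed interval, including the initial time.\<close>

lemma time_slices: "AE x in lborel. 0 < x \<longrightarrow> ac_derivative (\<lambda>t. q t x) (\<lambda>t. v1 (t, x)) 0 \<tau>"
proof -
  have "AE x in lborel. x \<in> {0<..} \<longrightarrow> (\<forall>s\<in>{0<..<\<tau>} \<inter> \<rat>. \<forall>t\<in>{0<..<\<tau>} \<inter> \<rat>. s \<le> t \<longrightarrow>
      q t x - q s x = (LINT r|lborel. indicator {s<..t} r * v1 (r, x)))"
  proof (rule AE_first_order_slices[OF _ _ Ioi_as_UN_Icc])
    show "continuous_on ({0<..<\<tau>} \<times> {0<..}) (\<lambda>(t, x). q t x)" by (rule continuous_on_subset[OF cont]) auto
  qed (use meas rect_integrable weak1 in auto)
  moreover have "AE x in lborel. integrable lborel (\<lambda>t. (v1 (t, x))\<^sup>2)"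
    using lborel_pair.AE_integrable_snd[of "\<lambda>t x. (v1 (t, x))\<^sup>2"] sq(1) by (simp add: lborel_prod case_prod_unfold)
  ultimately show ?thesis
  proof eventually_elim
    case (elim x)
    show ?case
    proof
      assume x: "0 < x"
      have vm: "(\<lambda>t. v1 (t, x)) \<in> borel_measurable borel"
        by (rule measurable_compose[OF _ meas(1)]) (intro borel_measurable_continuous_onI continuous_intros)
      have i: "integrable lborel (\<lambda>t. indicator {0..\<tau>} t * v1 (t, x))"
        using emeasure_compact_finite[of "{0..\<tau>}"] by (intro integrable_of_square[OF vm elim(2)]) auto
      moreover have "(\<lambda>t. indicator {0..\<tau>} t * v1 (t, x)) = (\<lambda>t. v1 (t, x))"
      proof
        fix t show "indicator {0..\<tau>} t * v1 (t, x) = v1 (t, x)"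
          using supp(1)[of "(t, x)"] by (cases "t \<in> {0..\<tau>}") auto
      qed
      ultimately have vi: "integrable lborel (\<lambda>t. v1 (t, x))" by simp
      show "ac_derivative (\<lambda>t. q t x) (\<lambda>t. v1 (t, x)) 0 \<tau>"
      proof (rule ac_derivative_of_rational[OF tau])
        show "continuous_on {0..\<tau>} (\<lambda>t. q t x)" using continuous_on_slice(2)[OF cont, of x] x by simp
        show "(\<lambda>t. v1 (t, x)) absolutely_integrable_on {0..\<tau>}"
          by (rule lborel_integral_on(1)[OF vi]) (use supp(1) in auto)
        fix s t assume st: "s \<in> {0<..<\<tau>} \<inter> \<rat>" "t \<in> {0<..<\<tau>} \<inter> \<rat>" "s \<le> t"
        have "q t x - q s x = (LINT r|lborel. indicator {s<..t} r * v1 (r, x))" using elim(1) x st by auto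
        also have "\<dots> = integral {s..t} (\<lambda>r. indicator {s<..t} r * v1 (r, x))"
          using integrable_mult_indicator[OF _ vi, of "{s<..t}"]
          by (intro lborel_integral_on(2)[symmetric]) auto
        also have "\<dots> = integral {s..t} (\<lambda>r. v1 (r, x))"
          by (rule integral_spike[of "{s}"]) auto
        finally show "q t x - q s x = integral {s..t} (\<lambda>r. v1 (r, x))" .
      qed
    qed
  qed
qed

lemma q_rect_measurable:
  assumes "smooth a" "smooth b" "{s..t} \<subseteq> {0<..<\<tau>}" "{x..y} \<subseteq> {0<..}"
  shows "(\<lambda>z. indicator ({s..t} \<times> {x..y}) z * q (fst z) (snd z) * (a (fst z) * b (snd z))) \<in> borel_measurable borel"
proof -
  have R: "{s..t} \<times> {x..y} \<in> sets borel" by (intro borel_closed closed_Times) auto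
  have "continuous_on ({s..t} \<times> {x..y}) (\<lambda>(t, x). q t x)"
    by (rule continuous_on_subset[OF cont]) (use assms in \<open>auto simp: subset_iff less_imp_le\<close>)
  then have "continuous_on ({s..t} \<times> {x..y}) (\<lambda>z. q (fst z) (snd z))" by (simp add: case_prod_beta)
  from borel_measurable_continuous_on_indicator[OF R this]
  have "(\<lambda>z. indicator ({s..t} \<times> {x..y}) z * q (fst z) (snd z)) \<in> borel_measurable borel" by simp
  moreover have "(\<lambda>z::real \<times> real. a (fst z)) \<in> borel_measurable borel" "(\<lambda>z::real \<times> real. b (snd z)) \<in> borel_measurable borel"
    by (intro borel_measurable_fst_snd borel_measurable_continuous_onI smooth_continuous_on assms)+
  ultimately show ?thesis by (rule borel_measurable_times[OF _ borel_measurable_times])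
qed

lemma q_slice_continuous: "t \<in> {0..\<tau>} \<Longrightarrow> continuous_on {0..} (q t)"
  by (rule continuous_on_slice(1)[OF cont])

lemma slice_sections:
  "(\<lambda>x. v1 (t, x)) \<in> borel_measurable borel" "(\<lambda>x. v2 (t, x)) \<in> borel_measurable borel"
  "(\<lambda>x. v3 (t, x)) \<in> borel_measurable borel"
  by (rule measurable_compose[OF _ meas(1)] measurable_compose[OF _ meas(2)] measurable_compose[OF _ meas(3)],
      intro borel_measurable_continuous_onI continuous_intros)+

lemma slice_integrable:
  assumes "integrable lborel (\<lambda>x. (v2 (t, x))\<^sup>2)" "integrable lborel (\<lambda>x. (v3 (t, x))\<^sup>2)"
  shows "integrable lborel (\<lambda>x. indicator {0..X} x * v2 (t, x))" "integrable lborel (\<lambda>x. indicator {0..X} x * v3 (t, x))"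
  using emeasure_compact_finite[of "{0..X}"] by (intro integrable_of_square slice_sections assms; simp)+

lemma AE_slice_squares:
  "AE t in lborel. integrable lborel (\<lambda>x. (v2 (t, x))\<^sup>2) \<and> integrable lborel (\<lambda>x. (v3 (t, x))\<^sup>2)"
proof -
  have "AE t in lborel. integrable lborel (\<lambda>x. (v2 (t, x))\<^sup>2)" "AE t in lborel. integrable lborel (\<lambda>x. (v3 (t, x))\<^sup>2)"
    using lborel_pair.AE_integrable_fst'[of "\<lambda>z. (v2 z)\<^sup>2"] lborel_pair.AE_integrable_fst'[of "\<lambda>z. (v3 z)\<^sup>2"] sq(2,3)
    by (simp_all add: lborel_prod)
  then show ?thesis by eventually_elim simp
qed

text \<open>The function \<open>g\<close> of \<open>second_order_primitive\<close> for F = q t and f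
  = v3(t, .). It is the representative of q_x that is continuous in x up to 0, which gives the
  boundary slope \<open>slope t 0\<close> a meaning.\<close>

definition slope :: "real \<Rightarrow> real \<Rightarrow> real" where
  "slope t x = (q t 1 - integral {0..1} (\<lambda>y. integral {0..y} (\<lambda>r. v3 (t, r)))) + integral {0..x} (\<lambda>r. v3 (t, r))"

text \<open>The lemmas on lines integrate in the first coordinate, so time and space are
  interchanged throughout. Only the second derivative is used: three-point weights remove the need
  for any information on q_x.\<close>

lemma space_slices_second:
  "AE t in lborel. t \<in> {0<..<\<tau>} \<longrightarrow>
     (\<forall>X\<ge>0. ac_derivative (slope t) (\<lambda>x. v3 (t, x)) 0 X \<and> ac_derivative (q t) (slope t) 0 X)"
proof -
  let ?v = "\<lambda>z. v3 (snd z, fst z)"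
  have vm: "?v \<in> borel_measurable borel"
    by (rule measurable_compose[OF _ meas(3)]) (intro borel_measurable_continuous_onI continuous_intros)
  have "AE t in lborel. t \<in> {0<..<\<tau>} \<longrightarrow> (\<forall>p\<in>{0<..} \<inter> \<rat>. q t p + (1 - p) * q t 2 + (p - 2) * q t 1 =
      (LINT r|lborel. ?v (r, t) * (max (p - r) 0 + (1 - p) * max (2 - r) 0 + (p - 2) * max (1 - r) 0)))"
  proof (rule AE_second_order_slices[OF _ _ Ioo_as_UN_Icc[OF tau]])
    have "continuous_on ({0<..} \<times> {0<..<\<tau>}) (\<lambda>z. case (snd z, fst z) of (t, x) \<Rightarrow> q t x)"
      by (rule continuous_on_compose2[OF cont]) (auto intro!: continuous_intros)
    then show "continuous_on ({0<..} \<times> {0<..<\<tau>}) (\<lambda>(x, t). q t x)" by (simp add: case_prod_unfold)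
    show "?v \<in> borel_measurable borel" by (rule vm)
    fix s t x y :: real
    have "integrable lborel (\<lambda>z. (case (snd z, fst z) of z \<Rightarrow> indicator ({x..y} \<times> {s..t}) z * v3 z))"
      using lborel_pair.integrable_product_swap[of "\<lambda>z. indicator ({x..y} \<times> {s..t}) z * v3 z"] rect_integrable(3)[of x y s t]
      by (simp add: lborel_prod case_prod_unfold)
    then show "integrable lborel (\<lambda>z. indicator ({s..t} \<times> {x..y}) z * ?v z)"
      by (rule Bochner_Integration.integrable_cong[THEN iffD1, rotated -1]) (auto simp: indicator_def)
    fix a b :: "real \<Rightarrow> real"
    assume ab: "smooth a" "smooth b" "{s..t} \<subseteq> {0<..}" "{x..y} \<subseteq> {0<..<\<tau>}"
      "\<And>r. r \<notin> {s..t} \<Longrightarrow> a r = 0" "\<And>r. r \<notin> {x..y} \<Longrightarrow> b r = 0"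
    note w = weak3[OF ab(2,1,4,3,6,5)]
    define h where "h = (\<lambda>z. indicator ({x..y} \<times> {s..t}) z * q (fst z) (snd z) * (b (fst z) * deriv (deriv a) (snd z)))"
    define k where "k = (\<lambda>z. v3 z * (b (fst z) * a (snd z)))"
    have "(LINT z|lborel. indicator ({s..t} \<times> {x..y}) z * q (snd z) (fst z) * (deriv (deriv a) (fst z) * b (snd z))) =
        (LINT z|lborel. h (snd z, fst z))"
      by (intro Bochner_Integration.integral_cong) (auto simp: h_def indicator_def)
    also have "\<dots> = (LINT z|lborel. h z)"
      unfolding h_def by (rule lborel_swap[OF q_rect_measurable[OF ab(2) smooth_deriv(2)[OF smooth_deriv(2)[OF ab(1)]] ab(4,3)]])
    also have "\<dots> = (LINT z|lborel. k z)" using w by (simp add: h_def k_def)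
    also have "\<dots> = (LINT z|lborel. k (snd z, fst z))"
    proof (rule lborel_swap[symmetric])
      show "k \<in> borel_measurable borel" unfolding k_def
        by (intro borel_measurable_times meas borel_measurable_fst_snd borel_measurable_continuous_onI smooth_continuous_on ab)
    qed
    also have "\<dots> = (LINT z|lborel. ?v z * (a (fst z) * b (snd z)))"
      by (intro Bochner_Integration.integral_cong) (auto simp: k_def)
    finally show "(LINT z|lborel. indicator ({s..t} \<times> {x..y}) z * q (snd z) (fst z) * (deriv (deriv a) (fst z) * b (snd z))) =
       (LINT z|lborel. ?v z * (a (fst z) * b (snd z)))" .
  qed (use supp(3) in auto)
  then show ?thesis using AE_slice_squares
  proof eventually_elim
    case (elim t)
    show ?case
    proof (intro impI allI)
      fix X :: real assume t: "t \<in> {0<..<\<tau>}" and X: "0 \<le> X"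
      have *: "q t p + (1 - p) * q t 2 + (p - 2) * q t 1 =
         (LINT r|lborel. v3 (t, r) * (max (p - r) 0 + (1 - p) * max (2 - r) 0 + (p - 2) * max (1 - r) 0))"
        if "p \<in> {0<..} \<inter> \<rat>" for p using elim(1) t that by simp
      show "ac_derivative (slope t) (\<lambda>x. v3 (t, x)) 0 X \<and> ac_derivative (q t) (slope t) 0 X"
        unfolding slope_def
        by (intro conjI second_order_primitive[where F = "q t" and f = "\<lambda>x. v3 (t, x)"] X q_slice_continuous bdry slice_integrable *)
          (use t elim(2) supp(3) in auto)
    qed
  qed
qed

text \<open>This makes \<open>v2\<close> a second derivative of q t in the integral sense, next to
  \<open>slope t\<close>. The two then coincide almost everywhere, and the differential equation can
  be stated with the continuous representative.\<close>

lemma space_slices_first: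
  "AE t in lborel. t \<in> {0<..<\<tau>} \<longrightarrow> (\<forall>X>0. ac_derivative (q t) (\<lambda>x. v2 (t, x)) 0 X)"
proof -
  let ?v = "\<lambda>z. v2 (snd z, fst z)"
  have vm: "?v \<in> borel_measurable borel"
    by (rule measurable_compose[OF _ meas(2)]) (intro borel_measurable_continuous_onI continuous_intros)
  have "AE t in lborel. t \<in> {0<..<\<tau>} \<longrightarrow> (\<forall>x\<in>{0<..} \<inter> \<rat>. \<forall>y\<in>{0<..} \<inter> \<rat>. x \<le> y \<longrightarrow>
      q t y - q t x = (LINT r|lborel. indicator {x<..y} r * ?v (r, t)))"
  proof (rule AE_first_order_slices[OF _ _ Ioo_as_UN_Icc[OF tau]])
    have "continuous_on ({0<..} \<times> {0<..<\<tau>}) (\<lambda>z. case (snd z, fst z) of (t, x) \<Rightarrow> q t x)"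
      by (rule continuous_on_compose2[OF cont]) (auto intro!: continuous_intros)
    then show "continuous_on ({0<..} \<times> {0<..<\<tau>}) (\<lambda>(x, t). q t x)" by (simp add: case_prod_unfold)
    show "?v \<in> borel_measurable borel" by (rule vm)
    fix s t x y :: real
    have "integrable lborel (\<lambda>z. (case (snd z, fst z) of z \<Rightarrow> indicator ({x..y} \<times> {s..t}) z * v2 z))"
      using lborel_pair.integrable_product_swap[of "\<lambda>z. indicator ({x..y} \<times> {s..t}) z * v2 z"] rect_integrable(2)[of x y s t]
      by (simp add: lborel_prod case_prod_unfold)
    then show "integrable lborel (\<lambda>z. indicator ({s..t} \<times> {x..y}) z * ?v z)"
      by (rule Bochner_Integration.integrable_cong[THEN iffD1, rotated -1]) (auto simp: indicator_def)
    fix a b :: "real \<Rightarrow> real"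
    assume ab: "smooth a" "smooth b" "{s..t} \<subseteq> {0<..}" "{x..y} \<subseteq> {0<..<\<tau>}"
      "\<And>r. r \<notin> {s..t} \<Longrightarrow> a r = 0" "\<And>r. r \<notin> {x..y} \<Longrightarrow> b r = 0"
    note w = weak2[OF ab(2,1,4,3,6,5)]
    define h where "h = (\<lambda>z. indicator ({x..y} \<times> {s..t}) z * q (fst z) (snd z) * (b (fst z) * deriv a (snd z)))"
    define k where "k = (\<lambda>z. v2 z * (b (fst z) * a (snd z)))"
    have "(LINT z|lborel. indicator ({s..t} \<times> {x..y}) z * q (snd z) (fst z) * (deriv a (fst z) * b (snd z))) =
        (LINT z|lborel. h (snd z, fst z))"
      by (intro Bochner_Integration.integral_cong) (auto simp: h_def indicator_def)
    also have "\<dots> = (LINT z|lborel. h z)"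
      unfolding h_def by (rule lborel_swap[OF q_rect_measurable[OF ab(2) smooth_deriv(2)[OF ab(1)] ab(4,3)]])
    also have "\<dots> = - (LINT z|lborel. k z)" using w by (simp add: h_def k_def)
    also have "(LINT z|lborel. k z) = (LINT z|lborel. k (snd z, fst z))"
    proof (rule lborel_swap[symmetric])
      show "k \<in> borel_measurable borel" unfolding k_def
        by (intro borel_measurable_times meas borel_measurable_fst_snd borel_measurable_continuous_onI smooth_continuous_on ab)
    qed
    also have "\<dots> = (LINT z|lborel. ?v z * (a (fst z) * b (snd z)))"
      by (intro Bochner_Integration.integral_cong) (auto simp: k_def)
    finally show "(LINT z|lborel. indicator ({s..t} \<times> {x..y}) z * q (snd z) (fst z) * (deriv a (fst z) * b (snd z))) =
       - (LINT z|lborel. ?v z * (a (fst z) * b (snd z)))" .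
  qed auto
  then show ?thesis using AE_slice_squares
  proof eventually_elim
    case (elim t)
    show ?case
    proof (intro impI allI)
      fix X :: real assume t: "t \<in> {0<..<\<tau>}" and X: "0 < X"
      note vi = slice_integrable(1)[OF conjunct1[OF elim(2)] conjunct2[OF elim(2)], of X]
      have "(\<lambda>x. indicator {0..X} x * v2 (t, x)) absolutely_integrable_on {0..X}"
        by (rule lborel_integral_on(1)[OF vi]) simp
      then have va: "(\<lambda>x. v2 (t, x)) absolutely_integrable_on {0..X}"
        by (rule set_integrable_cong[THEN iffD1, rotated -1]) auto
      show "ac_derivative (q t) (\<lambda>x. v2 (t, x)) 0 X"
      proof (rule ac_derivative_of_rational[OF X _ va])
        show "continuous_on {0..X} (q t)"
          by (rule continuous_on_subset[OF q_slice_continuous]) (use t in auto)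
        fix x y assume xy: "x \<in> {0<..<X} \<inter> \<rat>" "y \<in> {0<..<X} \<inter> \<rat>" "x \<le> y"
        have i: "integrable lborel (\<lambda>r. indicator {x<..y} r *\<^sub>R (indicator {0..X} r * v2 (t, r)))"
          by (rule integrable_mult_indicator[OF _ vi]) simp
        have "q t y - q t x = (LINT r|lborel. indicator {x<..y} r * v2 (t, r))" using elim(1) t xy by simp
        also have "\<dots> = (LINT r|lborel. indicator {x<..y} r *\<^sub>R (indicator {0..X} r * v2 (t, r)))"
          by (intro Bochner_Integration.integral_cong) (use xy in \<open>auto simp: indicator_def\<close>)
        also have "\<dots> = integral {x..y} (\<lambda>r. indicator {x<..y} r *\<^sub>R (indicator {0..X} r * v2 (t, r)))"
          by (rule lborel_integral_on(2)[OF i, symmetric]) auto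
        also have "\<dots> = integral {x..y} (\<lambda>r. v2 (t, r))"
          by (rule integral_spike[of "{x}"]) (use xy in auto)
        finally show "q t y - q t x = integral {x..y} (\<lambda>r. v2 (t, r))" .
      qed
    qed
  qed
qed

lemma AE_v2_eq_slope: "AE t in lborel. t \<in> {0<..<\<tau>} \<longrightarrow> (AE x in lborel. 0 < x \<longrightarrow> v2 (t, x) = slope t x)"
  using space_slices_first space_slices_second
proof eventually_elim
  case (elim t)
  show ?case
  proof
    assume t: "t \<in> {0<..<\<tau>}"
    have "AE x in lborel. x \<in> {0..real (Suc n)} \<longrightarrow> v2 (t, x) - slope t x = 0" for n
    proof -
      have 1: "ac_derivative (q t) (\<lambda>x. v2 (t, x)) 0 (real (Suc n))" and 2: "ac_derivative (q t) (slope t) 0 (real (Suc n))"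
        using elim t by auto
      have "AE x in lebesgue. x \<in> {0..real (Suc n)} \<longrightarrow> v2 (t, x) - slope t x = 0"
      proof (rule AE_zero_of_integrals_zero)
        show "(\<lambda>x. v2 (t, x) - slope t x) absolutely_integrable_on {0..real (Suc n)}"
          by (intro set_integral_diff ac_derivative_abs_integrable[OF 1] ac_derivative_abs_integrable[OF 2])
        fix x y assume xy: "0 \<le> x" "x \<le> y" "y \<le> real (Suc n)"
        have "integral {x..y} (\<lambda>x. v2 (t, x) - slope t x) = integral {x..y} (\<lambda>x. v2 (t, x)) - integral {x..y} (slope t)"
          using ac_derivative_integrable_sub(2)[OF 1 xy(1,3)] ac_derivative_integrable_sub(2)[OF 2 xy(1,3)]
          by (rule integral_diff)
        then show "integral {x..y} (\<lambda>x. v2 (t, x) - slope t x) = 0"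
          using ac_derivative_diff[OF 1 xy] ac_derivative_diff[OF 2 xy] by simp
      qed
      then show ?thesis by (simp add: AE_completion_iff)
    qed
    then have "AE x in lborel. \<forall>n. x \<in> {0..real (Suc n)} \<longrightarrow> v2 (t, x) - slope t x = 0"
      by (subst AE_all_countable) blast
    then show "AE x in lborel. 0 < x \<longrightarrow> v2 (t, x) = slope t x"
    proof eventually_elim
      case (elim x)
      obtain n where "x \<le> real n" using real_arch_simple by blast
      then show ?case using elim[rule_format, of n] by auto
    qed
  qed
qed

end

section \<open>Energy of the negative part and integrals over space\<close>

text \<open>The pair (min y 0)^2 and 2 * min y 0 meets the hypotheses of
  \<open>ac_derivative_chain\<close> and \<open>ac_monotone_product\<close> with the common constant
  L = 2. Across 0 the second derivative jumps, so Lipschitz bounds are the best available.\<close>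

lemma min_square_chain:
  fixes x y :: real
  shows "\<bar>(min y 0)\<^sup>2 - (min x 0)\<^sup>2 - 2 * min x 0 * (y - x)\<bar> \<le> 2 * (y - x)\<^sup>2"
    "\<bar>2 * min y 0 - 2 * min x 0\<bar> \<le> 2 * \<bar>y - x\<bar>" "mono (\<lambda>y::real. 2 * min y 0)" "(min y 0)\<^sup>2 \<le> y\<^sup>2"
proof -
  consider "x \<le> 0" "y \<le> 0" | "x \<le> 0" "0 < y" | "0 < x" "y \<le> 0" | "0 < x" "0 < y" by linarith
  then show "\<bar>(min y 0)\<^sup>2 - (min x 0)\<^sup>2 - 2 * min x 0 * (y - x)\<bar> \<le> 2 * (y - x)\<^sup>2"
  proof cases
    case 1
    have "y\<^sup>2 - x\<^sup>2 - 2 * x * (y - x) = (y - x)\<^sup>2" by (simp add: power2_eq_square algebra_simps)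
    then show ?thesis using 1 by simp
  next
    case 2
    have e: "2 * (y - x)\<^sup>2 - (x\<^sup>2 - 2 * x * y) = 2 * y\<^sup>2 + x\<^sup>2 + 2 * (- x * y)"
      and s: "- x\<^sup>2 - 2 * x * (y - x) = x\<^sup>2 - 2 * x * y" by (simp_all add: power2_eq_square algebra_simps)
    have "0 \<le> - x * y" using 2 by (intro mult_nonneg_nonneg) auto
    moreover have "x\<^sup>2 - 2 * x * y = x\<^sup>2 + 2 * (- x * y)" by simp
    ultimately have "0 \<le> x\<^sup>2 - 2 * x * y" "x\<^sup>2 - 2 * x * y \<le> 2 * (y - x)\<^sup>2"
      using e zero_le_power2[of x] zero_le_power2[of y] by linarith+
    then show ?thesis using 2 s by simp
  next
    case 3
    have "0 \<le> x * (x - y)" "0 \<le> x * - y" using 3 by (intro mult_nonneg_nonneg; simp)+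
    moreover have "2 * (y - x)\<^sup>2 - y\<^sup>2 = y\<^sup>2 + 2 * (x * (x - y)) + 2 * (x * - y)" by (simp add: power2_eq_square algebra_simps)
    ultimately have "y\<^sup>2 \<le> 2 * (y - x)\<^sup>2" using zero_le_power2[of y] by linarith
    then show ?thesis using 3 by simp
  next
    case 4 then show ?thesis by simp
  qed
  show "\<bar>2 * min y 0 - 2 * min x 0\<bar> \<le> 2 * \<bar>y - x\<bar>" by (auto simp: min_def abs_if)
  show "mono (\<lambda>y::real. 2 * min y 0)" by (intro monoI) auto
  show "(min y 0)\<^sup>2 \<le> y\<^sup>2" by (auto simp: min_def)
qed

text \<open>\<phi> and its derivative vanish at X and are free at 0. Since q vanishes at 0, two
  integrations by parts against q leave the slope at 0 as the only boundary term.\<close>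

definition cutoff :: "(real \<Rightarrow> real) \<Rightarrow> (real \<Rightarrow> real) \<Rightarrow> (real \<Rightarrow> real) \<Rightarrow> real \<Rightarrow> bool" where
  "cutoff \<phi> \<phi>1 \<phi>2 X \<longleftrightarrow> 0 < X \<and> ac_derivative \<phi> \<phi>1 0 X \<and> ac_derivative \<phi>1 \<phi>2 0 X \<and>
     continuous_on {0..X} \<phi>2 \<and> \<phi> X = 0 \<and> \<phi>1 X = 0"

context parabolic
begin

text \<open>A bound in L^2 of space-time becomes one that is uniform in time: along a line, q(t)^2
  exceeds q(s)^2 by at most the integral of 2 |q q_t| \<le> q^2 + q_t^2, and averaging over s
  removes q(s).\<close>

lemma square_dominated:
  obtains D where "integrable lborel D" "\<And>x. 0 \<le> D x"
    "AE x in lborel. 0 < x \<longrightarrow> (\<forall>t\<in>{0..\<tau>}. (q t x)\<^sup>2 \<le> D x)"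
proof -
  define Z where "Z = (\<lambda>z. indicator ({0<..<\<tau>} \<times> {0<..}) z * (q (fst z) (snd z))\<^sup>2 + (v1 z)\<^sup>2)"
  have Z: "integrable (lborel \<Otimes>\<^sub>M lborel) (\<lambda>(r, x). Z (r, x))"
    using qsq sq(1) unfolding Z_def by (simp add: lborel_prod case_prod_unfold)
  \<comment> \<open>With m the integral of q^2 + q_t^2 along the line, averaging gives \<tau> *
    q(t)^2 \<le> m + \<tau> * m, hence the factor.\<close>
  define D where "D = (\<lambda>x. ((1 + \<tau>) / \<tau>) * (LINT r|lborel. Z (r, x)))"
  have "integrable lborel D" unfolding D_def using lborel_pair.integrable_snd[OF Z] by simp
  moreover have "0 \<le> D x" for x unfolding D_def using tau by (intro mult_nonneg_nonneg integral_nonneg_AE) (auto simp: Z_def)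
  moreover have "AE x in lborel. integrable lborel (\<lambda>r. Z (r, x))"
    using lborel_pair.AE_integrable_snd[OF Z] .
  then have "AE x in lborel. 0 < x \<longrightarrow> (\<forall>t\<in>{0..\<tau>}. (q t x)\<^sup>2 \<le> D x)"
    using time_slices
  proof eventually_elim
    case (elim x)
    show ?case
    proof (intro impI ballI)
      fix t assume x: "0 < x" and t: "t \<in> {0..\<tau>}"
      have ac: "ac_derivative (\<lambda>t. q t x) (\<lambda>t. v1 (t, x)) 0 \<tau>" using elim x by simp
      have ac2: "ac_derivative (\<lambda>t. q t x * q t x) (\<lambda>t. v1 (t, x) * q t x + q t x * v1 (t, x)) 0 \<tau>"
        by (rule ac_derivative_mult[OF ac ac])
      define m where "m = (LINT r|lborel. Z (r, x))"
      have Zi: "(\<lambda>r. Z (r, x)) absolutely_integrable_on {0..\<tau>}" "integral {0..\<tau>} (\<lambda>r. Z (r, x)) = m"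
      proof -
        have z: "Z (r, x) = 0" if "r \<notin> {0..\<tau>}" for r
          using supp(1)[of "(r, x)"] that by (auto simp: Z_def)
        show "(\<lambda>r. Z (r, x)) absolutely_integrable_on {0..\<tau>}" "integral {0..\<tau>} (\<lambda>r. Z (r, x)) = m"
          unfolding m_def by (rule lborel_integral_on[OF elim(1) z], simp)+
      qed
      have Z0: "0 \<le> Z (r, x)" for r by (simp add: Z_def)
      have diff: "(q t x)\<^sup>2 \<le> (q s x)\<^sup>2 + m" if s: "s \<in> {0..\<tau>}" for s
      proof -
        define a b where "a = min s t" and "b = max s t"
        have ab: "0 \<le> a" "a \<le> b" "b \<le> \<tau>" using s t by (auto simp: a_def b_def)
        have "\<bar>q b x * q b x - q a x * q a x\<bar> \<le> integral {a..b} (\<lambda>r. \<bar>v1 (r, x) * q r x + q r x * v1 (r, x)\<bar>)"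
          by (rule ac_derivative_abs_diff_le[OF ac2 ab])
        also have "\<dots> \<le> integral {a..b} (\<lambda>r. Z (r, x))"
        proof (rule integral_mono_AE_on)
          show "(\<lambda>r. \<bar>v1 (r, x) * q r x + q r x * v1 (r, x)\<bar>) absolutely_integrable_on {a..b}"
            using ac_derivative_integrable_sub(1)[OF ac2 ab(1,3)] by (rule absolutely_integrable_real_abs)
          show "(\<lambda>r. Z (r, x)) absolutely_integrable_on {a..b}"
            using absolutely_integrable_on_subinterval[OF Zi(1), of a b] ab by auto
          have "AE r in lebesgue. r \<noteq> 0 \<and> r \<noteq> \<tau>"
            using AE_completion[OF AE_lborel_singleton[of "0::real"]] AE_completion[OF AE_lborel_singleton[of \<tau>]]
            by eventually_elim simp
          then show "AE r in lebesgue. r \<in> {a..b} \<longrightarrow> \<bar>v1 (r, x) * q r x + q r x * v1 (r, x)\<bar> \<le> Z (r, x)"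
          proof eventually_elim
            case (elim r)
            have "0 \<le> (\<bar>v1 (r, x)\<bar> - \<bar>q r x\<bar>)\<^sup>2" by simp
            then have "\<bar>v1 (r, x) * q r x + q r x * v1 (r, x)\<bar> \<le> (q r x)\<^sup>2 + (v1 (r, x))\<^sup>2"
              by (simp add: power2_diff abs_mult mult.commute)
            then show ?case using elim ab x by (auto simp: Z_def indicator_def)
          qed
        qed
        also have "\<dots> \<le> integral {0..\<tau>} (\<lambda>r. Z (r, x))"
          using ab Z0 absolutely_integrable_on_subinterval[OF Zi(1), of a b] Zi(1)
          by (intro integral_subset_le) (auto simp: set_lebesgue_integral_eq_integral(1))
        finally have "\<bar>q b x * q b x - q a x * q a x\<bar> \<le> m" using Zi(2) by simp
        then show ?thesis by (auto simp: a_def b_def power2_eq_square min_def max_def abs_le_iff split: if_splits)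
      qed
      have qc: "continuous_on {0..\<tau>} (\<lambda>s. (q s x)\<^sup>2)" using ac_derivative_continuous[OF ac] by (intro continuous_intros)
      have "integral {0..\<tau>} (\<lambda>s. (q t x)\<^sup>2) \<le> integral {0..\<tau>} (\<lambda>s. (q s x)\<^sup>2 + m)"
        using diff by (intro integral_le integrable_continuous_real continuous_intros qc) auto
      also have "\<dots> = integral {0..\<tau>} (\<lambda>s. (q s x)\<^sup>2) + integral {0..\<tau>} (\<lambda>s. m)"
        by (intro integral_add integrable_continuous_real continuous_intros qc)
      also have "integral {0..\<tau>} (\<lambda>s. (q s x)\<^sup>2) \<le> integral {0..\<tau>} (\<lambda>r. Z (r, x))"
      proof (rule integral_mono_AE_on[OF _ Zi(1)])
        show "(\<lambda>s. (q s x)\<^sup>2) absolutely_integrable_on {0..\<tau>}" by (rule absolutely_integrable_continuous_real[OF qc])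
        have "AE r in lebesgue. r \<noteq> 0 \<and> r \<noteq> \<tau>"
          using AE_completion[OF AE_lborel_singleton[of "0::real"]] AE_completion[OF AE_lborel_singleton[of \<tau>]]
          by eventually_elim simp
        then show "AE r in lebesgue. r \<in> {0..\<tau>} \<longrightarrow> (q r x)\<^sup>2 \<le> Z (r, x)"
          by eventually_elim (use x in \<open>auto simp: Z_def indicator_def\<close>)
      qed
      finally have "\<tau> * (q t x)\<^sup>2 \<le> m + \<tau> * m" using Zi(2) tau by simp
      then show "(q t x)\<^sup>2 \<le> D x" using tau unfolding D_def m_def[symmetric] by (simp add: field_simps)
    qed
  qed
  ultimately show ?thesis using that by blast
qed

text \<open>The chain rule is applied along almost every line in the time direction, and Fubini
  exchanges the two integrals. The exceptional lines do not depend on t, so the identity holds at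
  every time and not just at almost every one.\<close>

lemma time_evolution:
  assumes J: "\<And>x y. \<bar>J y - J x - k x * (y - x)\<bar> \<le> L * (y - x)\<^sup>2"
    and k: "\<And>x y. \<bar>k y - k x\<bar> \<le> L * \<bar>y - x\<bar>" and \<phi>: "continuous_on {0..X} \<phi>"
  shows "ac_derivative (\<lambda>t. integral {0..X} (\<lambda>x. \<phi> x * J (q t x)))
    (\<lambda>r. integral {0..X} (\<lambda>x. \<phi> x * (v1 (r, x) * k (q r x)))) 0 \<tau>"
proof -
  let ?R = "{0..\<tau>} \<times> {0..X}"
  have kc: "continuous_on UNIV k" by (rule lipschitz_continuous(2)[OF k])
  have ac_id: "ac_derivative (\<lambda>x. x) (\<lambda>x. 1) a b" for a b :: real
    by (intro ac_derivative_C1 continuous_intros) (auto intro!: derivative_eq_intros)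
  have Jc: "continuous_on {a..b} J" for a b :: real
    using ac_derivative_continuous[OF ac_derivative_chain[OF ac_id J k]] .
  have R: "?R \<in> sets borel" by (intro borel_closed closed_Times) auto
  have cR: "continuous_on ?R (\<lambda>z. q (fst z) (snd z))"
  proof -
    have "continuous_on ?R (\<lambda>(t, x). q t x)" by (rule continuous_on_subset[OF cont]) auto
    then show ?thesis by (simp add: case_prod_beta)
  qed
  have cW: "continuous_on ?R (\<lambda>z. \<phi> (snd z) * k (q (fst z) (snd z)))"
    by (intro continuous_on_mult continuous_on_compose2[OF \<phi>] continuous_on_compose2[OF kc cR] continuous_intros) auto
  define W where "W = (\<lambda>z. indicator ?R z * (\<phi> (snd z) * k (q (fst z) (snd z))))"
  have Wm: "W \<in> borel_measurable borel"
    using borel_measurable_continuous_on_indicator[OF R cW] by (simp add: W_def)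
  have "bounded ((\<lambda>z. \<phi> (snd z) * k (q (fst z) (snd z))) ` ?R)"
    by (intro compact_imp_bounded compact_continuous_image cW compact_Times) auto
  then obtain C where C: "\<forall>z\<in>?R. norm (\<phi> (snd z) * k (q (fst z) (snd z))) \<le> C" unfolding bounded_iff by blast
  have Wb: "\<bar>W z\<bar> \<le> max C 0" for z
  proof (cases "z \<in> ?R")
    case True
    then have "\<bar>\<phi> (snd z) * k (q (fst z) (snd z))\<bar> \<le> C" using C unfolding real_norm_def by blast
    then show ?thesis using True by (simp add: W_def)
  qed (simp add: W_def)
  define Y where "Y = (\<lambda>z. indicator ?R z * v1 z * W z)"
  have Yi: "integrable lborel Y" unfolding Y_def by (rule integrable_mult_bounded[OF rect_integrable(1) Wm Wb])
  then have Yi': "integrable (lborel \<Otimes>\<^sub>M lborel) Y" by (simp add: lborel_prod)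
  have Yval: "Y (r, x) = \<phi> x * (v1 (r, x) * k (q r x))" if "r \<in> {0..\<tau>}" "x \<in> {0..X}" for r x
    using that by (simp add: Y_def W_def)
  have Y0: "Y (r, x) = 0" if "r \<notin> {0..\<tau>} \<or> x \<notin> {0..X}" for r x
    using that by (auto simp: Y_def W_def)
  \<comment> \<open>\<open>G\<close> comes with measurability and integrability from Fubini;
    \<open>A\<close> is the same quantity as an integral over [0,X], equal to it at almost every
    time.\<close>
  define G where "G = (\<lambda>r. LINT x|lborel. Y (r, x))"
  define A where "A = (\<lambda>r. integral {0..X} (\<lambda>x. \<phi> x * (v1 (r, x) * k (q r x))))"
  have Gi: "integrable lborel G" unfolding G_def by (rule lborel_pair.integrable_fst'[OF Yi'])
  have Ga: "G absolutely_integrable_on {0..\<tau>}" by (rule lborel_integral_on(1)[OF Gi]) (simp add: G_def Y0)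
  have GA: "AE r in lebesgue. r \<in> {0..\<tau>} \<longrightarrow> G r = A r"
  proof (rule AE_completion)
    show "AE r in lborel. r \<in> {0..\<tau>} \<longrightarrow> G r = A r"
      using lborel_pair.AE_integrable_fst'[OF Yi']
    proof eventually_elim
      case (elim r)
      show ?case
      proof
        assume r: "r \<in> {0..\<tau>}"
        have "G r = integral {0..X} (\<lambda>x. Y (r, x))"
          unfolding G_def by (rule lborel_integral_on(2)[OF elim, symmetric]) (simp add: Y0)
        also have "\<dots> = A r" unfolding A_def by (rule integral_cong) (simp add: Yval[OF r])
        finally show "G r = A r" .
      qed
    qed
  qed
  note Aa = absolutely_integrable_AE(1)[OF Ga GA]
  have "ac_derivative (\<lambda>t. integral {0..X} (\<lambda>x. \<phi> x * J (q t x))) A 0 \<tau>"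
  proof (rule ac_derivative_intro[OF Aa, where c = "integral {0..X} (\<lambda>x. \<phi> x * J (q 0 x))"])
    fix t assume t: "0 \<le> t" "t \<le> \<tau>"
    have Jq: "continuous_on {0..X} (\<lambda>x. J (q s x))" if "s \<in> {0..\<tau>}" for s
    proof -
      have qc: "continuous_on {0..X} (q s)" by (rule continuous_on_subset[OF q_slice_continuous[OF that]]) auto
      then have "bounded (q s ` {0..X})" by (intro compact_imp_bounded compact_continuous_image) auto
      then obtain b where b: "\<forall>x\<in>{0..X}. norm (q s x) \<le> b" unfolding bounded_iff by blast
      show ?thesis by (rule continuous_on_compose2[OF Jc[of "- b" b] qc]) (use b in \<open>auto simp: abs_le_iff\<close>)
    qed
    define D where "D = (\<lambda>x. \<phi> x * J (q t x) - \<phi> x * J (q 0 x))"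
    define H where "H = (\<lambda>x. LINT r|lborel. indicator {0..t} r * Y (r, x))"
    have m: "(\<lambda>z::real \<times> real. indicator {0..t} (fst z) :: real) \<in> borel_measurable borel"
      by (rule borel_measurable_fst_snd) simp
    have tY: "integrable lborel (\<lambda>z. Y z * indicator {0..t} (fst z))"
      by (rule integrable_mult_bounded[OF Yi m, of 1]) (simp add: indicator_def)
    then have tY': "integrable (lborel \<Otimes>\<^sub>M lborel) (\<lambda>(r, x). indicator {0..t} r * Y (r, x))"
      by (simp add: lborel_prod case_prod_unfold mult.commute)
    have Hi: "integrable lborel H" unfolding H_def using lborel_pair.integrable_snd[OF tY'] .
    have H0: "H x = 0" if "x \<notin> {0..X}" for x using that by (simp add: H_def Y0)
    have Da: "D absolutely_integrable_on {0..X}"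
      unfolding D_def using t tau by (intro absolutely_integrable_continuous_real continuous_intros \<phi> Jq) auto
    have DH: "AE x in lebesgue. x \<in> {0..X} \<longrightarrow> D x = H x"
    proof (rule AE_completion)
      have "AE x in lborel. integrable lborel (\<lambda>r. indicator {0..t} r * Y (r, x))"
        using lborel_pair.AE_integrable_snd[OF tY'] .
      with time_slices AE_lborel_singleton[of "0::real"]
      show "AE x in lborel. x \<in> {0..X} \<longrightarrow> D x = H x"
      proof eventually_elim
        case (elim x)
        show ?case
        proof
          assume x: "x \<in> {0..X}"
          then have ac: "ac_derivative (\<lambda>t. q t x) (\<lambda>t. v1 (t, x)) 0 \<tau>" using elim by auto
          have "J (q t x) - J (q 0 x) = integral {0..t} (\<lambda>r. v1 (r, x) * k (q r x))"
            using ac_derivative_diff[OF ac_derivative_chain[OF ac J k], of 0 t] t by simp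
          then have "D x = \<phi> x * integral {0..t} (\<lambda>r. v1 (r, x) * k (q r x))"
            by (simp add: D_def right_diff_distrib[symmetric])
          also have "\<dots> = integral {0..t} (\<lambda>r. \<phi> x * (v1 (r, x) * k (q r x)))" by simp
          also have "\<dots> = integral {0..t} (\<lambda>r. indicator {0..t} r * Y (r, x))"
            by (rule integral_cong) (use t x in \<open>simp add: Yval\<close>)
          also have "\<dots> = H x" unfolding H_def by (rule lborel_integral_on(2)[OF elim(3)]) simp
          finally show "D x = H x" .
        qed
      qed
    qed
    have tG: "integrable lborel (\<lambda>r. indicator {0..t} r * G r)"
      using integrable_mult_indicator[OF _ Gi, of "{0..t}"] by simp
    have "integral {0..X} (\<lambda>x. \<phi> x * J (q t x)) - integral {0..X} (\<lambda>x. \<phi> x * J (q 0 x)) = integral {0..X} D"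
      unfolding D_def using t tau
      by (intro integral_diff[symmetric] integrable_continuous_real continuous_intros \<phi> Jq) auto
    also have "\<dots> = integral {0..X} H" by (rule integral_eq_AE_on[OF Da lborel_integral_on(1)[OF Hi H0] DH])
    also have "\<dots> = (LINT x|lborel. H x)" by (rule lborel_integral_on(2)[OF Hi H0])
    also have "\<dots> = (LINT r|lborel. LINT x|lborel. indicator {0..t} r * Y (r, x))"
      unfolding H_def by (rule lborel_pair.Fubini_integral[OF tY'])
    also have "\<dots> = (LINT r|lborel. indicator {0..t} r * G r)" by (simp add: G_def)
    also have "\<dots> = integral {0..t} (\<lambda>r. indicator {0..t} r * G r)"
      by (rule lborel_integral_on(2)[OF tG, symmetric]) simp
    also have "\<dots> = integral {0..t} G" by (rule integral_cong) simp
    also have "\<dots> = integral {0..t} A"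
    proof (rule integral_eq_AE_on)
      show "G absolutely_integrable_on {0..t}" "A absolutely_integrable_on {0..t}"
        using absolutely_integrable_on_subinterval[OF Ga, of 0 t] absolutely_integrable_on_subinterval[OF Aa, of 0 t] t by auto
      show "AE x in lebesgue. x \<in> {0..t} \<longrightarrow> G x = A x" using GA by eventually_elim (use t in auto)
    qed
    finally show "integral {0..X} (\<lambda>x. \<phi> x * J (q t x)) = integral {0..X} (\<lambda>x. \<phi> x * J (q 0 x)) + integral {0..t} A" by simp
  qed
  then show ?thesis by (simp add: A_def)
qed

text \<open>Times at which the equation can be used along the whole space slice, with
  \<open>slope\<close> in place of the weak derivative \<open>v2\<close>, so that one-dimensional
  integration by parts applies.\<close>

definition regular_time :: "real \<Rightarrow> bool" where
  "regular_time r \<longleftrightarrow> r \<in> {0<..<\<tau>} \<and>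
     (\<forall>X\<ge>0. ac_derivative (slope r) (\<lambda>x. v3 (r, x)) 0 X \<and> ac_derivative (q r) (slope r) 0 X) \<and>
     (AE x in lborel. 0 < x \<longrightarrow> v1 (r, x) = 1 / 2 * v3 (r, x) - B r * slope r x)"

lemma AE_regular_time: "AE r in lebesgue. r \<in> {0..\<tau>} \<longrightarrow> regular_time r"
proof (rule AE_completion)
  show "AE r in lborel. r \<in> {0..\<tau>} \<longrightarrow> regular_time r"
    using space_slices_second AE_v2_eq_slope AE_lborel_pair[OF pde] AE_lborel_singleton[of 0] AE_lborel_singleton[of \<tau>]
  proof eventually_elim
    case (elim r)
    show ?case
    proof
      assume "r \<in> {0..\<tau>}"
      then have r: "r \<in> {0<..<\<tau>}" using elim by auto
      have "AE x in lborel. 0 < x \<longrightarrow> v1 (r, x) = 1 / 2 * v3 (r, x) - B r * slope r x"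
        using elim(2)[rule_format, OF r] elim(3) by eventually_elim (use r in auto)
      then show "regular_time r" using elim(1) r by (simp add: regular_time_def)
    qed
  qed
qed

lemma regular_time_split:
  assumes r: "regular_time r" and X: "0 \<le> X" and m: "continuous_on {0..X} m"
  shows "integral {0..X} (\<lambda>x. m x * v1 (r, x)) =
     1 / 2 * integral {0..X} (\<lambda>x. m x * v3 (r, x)) - B r * integral {0..X} (\<lambda>x. m x * slope r x)"
    "(\<lambda>x. m x * v3 (r, x)) absolutely_integrable_on {0..X}"
proof -
  have 1: "ac_derivative (slope r) (\<lambda>x. v3 (r, x)) 0 X" and 2: "ac_derivative (q r) (slope r) 0 X"
    using r X by (auto simp: regular_time_def)
  show a3: "(\<lambda>x. m x * v3 (r, x)) absolutely_integrable_on {0..X}"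
    using absolutely_integrable_mult_continuous[OF ac_derivative_abs_integrable[OF 1] m] by (simp add: mult.commute)
  have a2: "(\<lambda>x. m x * slope r x) absolutely_integrable_on {0..X}"
    using absolutely_integrable_mult_continuous[OF ac_derivative_abs_integrable[OF 2] m] by (simp add: mult.commute)
  have a: "(\<lambda>x. 1 / 2 * (m x * v3 (r, x)) - B r * (m x * slope r x)) absolutely_integrable_on {0..X}"
    by (intro set_integral_diff absolutely_integrable_const_mult a2 a3)
  have "AE x in lborel. x \<noteq> 0 \<and> (0 < x \<longrightarrow> v1 (r, x) = 1 / 2 * v3 (r, x) - B r * slope r x)"
    using r AE_lborel_singleton[of 0] by (auto simp: regular_time_def)
  then have "AE x in lborel. x \<in> {0..X} \<longrightarrow> 1 / 2 * (m x * v3 (r, x)) - B r * (m x * slope r x) = m x * v1 (r, x)"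
  proof eventually_elim
    case (elim x)
    show ?case
    proof
      assume "x \<in> {0..X}"
      then have v: "v1 (r, x) = 1 / 2 * v3 (r, x) - B r * slope r x" using elim by auto
      show "1 / 2 * (m x * v3 (r, x)) - B r * (m x * slope r x) = m x * v1 (r, x)"
        unfolding v by (simp add: right_diff_distrib)
    qed
  qed
  then have "integral {0..X} (\<lambda>x. m x * v1 (r, x)) = integral {0..X} (\<lambda>x. 1 / 2 * (m x * v3 (r, x)) - B r * (m x * slope r x))"
    by (intro absolutely_integrable_AE(2)[OF a] AE_completion)
  also have "\<dots> = integral {0..X} (\<lambda>x. 1 / 2 * (m x * v3 (r, x))) - integral {0..X} (\<lambda>x. B r * (m x * slope r x))"
    by (intro integral_diff set_lebesgue_integral_eq_integral(1) absolutely_integrable_const_mult a2 a3)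
  finally show "integral {0..X} (\<lambda>x. m x * v1 (r, x)) =
     1 / 2 * integral {0..X} (\<lambda>x. m x * v3 (r, x)) - B r * integral {0..X} (\<lambda>x. m x * slope r x)" by simp
qed

end

section \<open>Spatial cutoffs\<close>

text \<open>Equal to 1 up to R and to 0 from 2 * R on; the argument is written as K * x + d to match
  \<open>scaled_bump_deriv\<close>. \<open>cut1\<close> and \<open>cut2\<close> are the first two
  derivatives.\<close>

definition cut0 :: "real \<Rightarrow> real \<Rightarrow> real" where "cut0 R x = 1 - smooth_step (1 / R * x + - 1)"
definition cut1 :: "real \<Rightarrow> real \<Rightarrow> real" where "cut1 R x = - (1 / R * smooth_bump (1 / R * x + - 1))"
definition cut2 :: "real \<Rightarrow> real \<Rightarrow> real" where "cut2 R x = - (1 / R * (1 / R * deriv smooth_bump (1 / R * x + - 1)))"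

lemma cut_derivatives:
  "(cut0 R has_real_derivative cut1 R x) (at x within S)" "(cut1 R has_real_derivative cut2 R x) (at x within S)"
proof -
  have "(cut0 R has_real_derivative 0 - 1 / R * smooth_bump (1 / R * x + - 1)) (at x within S)"
    unfolding cut0_def[abs_def] by (intro DERIV_diff DERIV_const scaled_bump_deriv)
  then show "(cut0 R has_real_derivative cut1 R x) (at x within S)" by (simp add: cut1_def)
  have 1: "((\<lambda>x. 1 / R * x + - 1) has_real_derivative 1 / R) (at x within S)"
    using DERIV_add[OF DERIV_cmult[OF DERIV_ident, of "1 / R"] DERIV_const[of "- 1"]] by simp
  have "((\<lambda>x. smooth_bump (1 / R * x + - 1)) has_real_derivative 1 / R * deriv smooth_bump (1 / R * x + - 1)) (at x within S)"
    using DERIV_chain2[OF smooth_deriv(1)[OF smooth_bump] 1] by (simp only: mult.commute)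
  then show "(cut1 R has_real_derivative cut2 R x) (at x within S)"
    unfolding cut1_def[abs_def] cut2_def by (intro DERIV_minus DERIV_cmult)
qed

lemma cut_continuous: "continuous_on S (cut0 R)" "continuous_on S (cut1 R)" "continuous_on S (cut2 R)"
proof -
  show "continuous_on S (cut0 R)" "continuous_on S (cut1 R)"
    unfolding cut0_def[abs_def] cut1_def[abs_def] by (intro continuous_intros)+
  show "continuous_on S (cut2 R)"
    unfolding cut2_def[abs_def]
    by (intro continuous_intros smooth_continuous_on smooth_affine smooth_deriv(2)[OF smooth_bump])
qed

lemma cut_values:
  assumes "0 < R"
  shows "0 \<le> cut0 R x" "cut0 R x \<le> 1" "x \<le> R \<Longrightarrow> cut0 R x = 1" "2 * R \<le> x \<Longrightarrow> cut0 R x = 0"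
    "2 * R \<le> x \<Longrightarrow> cut1 R x = 0" "x \<le> R \<Longrightarrow> cut1 R x = 0"
proof -
  show "0 \<le> cut0 R x" "cut0 R x \<le> 1" using smooth_step_bounds by (auto simp: cut0_def)
  have le: "1 / R * x + - 1 \<le> 0" if "x \<le> R" using that assms by (simp add: field_simps)
  have ge: "1 / R * x + - 1 \<ge> 1" if "2 * R \<le> x" using that assms by (simp add: field_simps)
  show "x \<le> R \<Longrightarrow> cut0 R x = 1" using smooth_step_0[OF le] by (simp add: cut0_def)
  show "2 * R \<le> x \<Longrightarrow> cut0 R x = 0" using smooth_step_1[OF ge] by (simp add: cut0_def)
  show "2 * R \<le> x \<Longrightarrow> cut1 R x = 0" using smooth_bump_0[OF disjI2[OF ge]] by (simp add: cut1_def)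
  show "x \<le> R \<Longrightarrow> cut1 R x = 0" using smooth_bump_0[OF disjI1[OF le]] by (simp add: cut1_def)
qed

lemma cutoff_cut: "0 < R \<Longrightarrow> cutoff (cut0 R) (cut1 R) (cut2 R) (2 * R)"
  unfolding cutoff_def
  by (intro conjI ac_derivative_C1 cut_derivatives cut_continuous cut_values) auto

text \<open>The second derivative is of order 1/R^2; for R \<ge> 1 it obeys the weaker bound 1/R, so
  that both errors can be treated with one constant.\<close>

lemma cut_bounds:
  obtains C where "0 \<le> C" "\<And>R x. 0 < R \<Longrightarrow> \<bar>cut1 R x\<bar> \<le> C / R" "\<And>R x. 1 \<le> R \<Longrightarrow> \<bar>cut2 R x\<bar> \<le> C / R"
proof -
  have d0: "\<forall>y. y \<notin> {0..1} \<longrightarrow> deriv smooth_bump y = 0"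
    by (rule deriv_zero_outside) (auto intro: smooth_bump_0)
  obtain C1 where C1: "\<And>y. \<bar>smooth_bump y\<bar> \<le> C1"
    by (rule bounded_of_support[of 0 1 smooth_bump]) (use smooth_bump_0 smooth_continuous_on[OF smooth_bump] in auto)
  obtain C2 where C2: "\<And>y. \<bar>deriv smooth_bump y\<bar> \<le> C2"
    by (rule bounded_of_support[of 0 1 "deriv smooth_bump"])
      (use d0 smooth_continuous_on[OF smooth_deriv(2)[OF smooth_bump]] in auto)
  define C where "C = max C1 C2"
  have C: "\<bar>smooth_bump y\<bar> \<le> C" "\<bar>deriv smooth_bump y\<bar> \<le> C" for y using C1[of y] C2[of y] by (auto simp: C_def)
  have C0: "0 \<le> C" using C(1)[of 0] by linarith
  have "\<bar>cut1 R x\<bar> \<le> C / R" if "0 < R" for R x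
    using mult_left_mono[OF C(1)[of "1 / R * x + - 1"], of "1 / R"] that by (simp add: cut1_def abs_mult)
  moreover have "\<bar>cut2 R x\<bar> \<le> C / R" if "1 \<le> R" for R x
  proof -
    let ?d = "\<bar>deriv smooth_bump (1 / R * x + - 1)\<bar>"
    have "1 / R * ?d \<le> 1 * ?d" using that by (intro mult_right_mono) auto
    also have "\<dots> \<le> C" using C(2) by simp
    finally have "1 / R * (1 / R * ?d) \<le> 1 / R * C" using that by (intro mult_left_mono) auto
    then show ?thesis using that by (simp add: cut2_def abs_mult)
  qed
  ultimately show ?thesis using that C0 by blast
qed

section \<open>Boundary flux and non-negativity\<close>

context parabolic
begin

text \<open>Integrating by parts the products \<phi> * slope, \<phi>1 * q and \<phi> * q moves all
  derivatives onto \<phi>. The data at 0 and X kill every boundary term except \<phi> 0 * slope r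
  0.\<close>

lemma regular_time_flux:
  assumes r: "regular_time r" and \<phi>: "cutoff \<phi> \<phi>1 \<phi>2 X"
  shows "integral {0..X} (\<lambda>x. \<phi> x * (v1 (r, x) * 1)) =
    - (1 / 2) * \<phi> 0 * slope r 0 + 1 / 2 * integral {0..X} (\<lambda>x. \<phi>2 x * q r x) + B r * integral {0..X} (\<lambda>x. \<phi>1 x * q r x)"
proof -
  have X: "0 < X" and a1: "ac_derivative \<phi> \<phi>1 0 X" and a2: "ac_derivative \<phi>1 \<phi>2 0 X" and z: "\<phi> X = 0" "\<phi>1 X = 0"
    and c2: "continuous_on {0..X} \<phi>2" using \<phi> by (auto simp: cutoff_def)
  note c = ac_derivative_continuous[OF a1] ac_derivative_continuous[OF a2] c2
  have s: "ac_derivative (slope r) (\<lambda>x. v3 (r, x)) 0 X" and qs: "ac_derivative (q r) (slope r) 0 X"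
    and r0: "r \<in> {0..\<tau>}" using r X by (auto simp: regular_time_def)
  note cs = ac_derivative_continuous[OF s] ac_derivative_continuous[OF qs]
  have e1: "- \<phi> 0 * slope r 0 = integral {0..X} (\<lambda>x. \<phi>1 x * slope r x) + integral {0..X} (\<lambda>x. \<phi> x * v3 (r, x))"
  proof -
    have "- \<phi> 0 * slope r 0 = integral {0..X} (\<lambda>x. \<phi>1 x * slope r x + \<phi> x * v3 (r, x))"
      using ac_derivative_diff[OF ac_derivative_mult[OF a1 s], of 0 X] X z by simp
    also have "\<dots> = integral {0..X} (\<lambda>x. \<phi>1 x * slope r x) + integral {0..X} (\<lambda>x. \<phi> x * v3 (r, x))"
      using X by (intro integral_add integrable_continuous_real continuous_intros c cs
          set_lebesgue_integral_eq_integral(1)[OF regular_time_split(2)[OF r]]) auto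
    finally show ?thesis .
  qed
  have e2: "0 = integral {0..X} (\<lambda>x. \<phi>2 x * q r x) + integral {0..X} (\<lambda>x. \<phi>1 x * slope r x)"
  proof -
    have "0 = integral {0..X} (\<lambda>x. \<phi>2 x * q r x + \<phi>1 x * slope r x)"
      using ac_derivative_diff[OF ac_derivative_mult[OF a2 qs], of 0 X] X z bdry[OF r0] by simp
    also have "\<dots> = integral {0..X} (\<lambda>x. \<phi>2 x * q r x) + integral {0..X} (\<lambda>x. \<phi>1 x * slope r x)"
      by (intro integral_add integrable_continuous_real continuous_intros c cs)
    finally show ?thesis .
  qed
  have e3: "0 = integral {0..X} (\<lambda>x. \<phi>1 x * q r x) + integral {0..X} (\<lambda>x. \<phi> x * slope r x)"
  proof -
    have "0 = integral {0..X} (\<lambda>x. \<phi>1 x * q r x + \<phi> x * slope r x)"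
      using ac_derivative_diff[OF ac_derivative_mult[OF a1 qs], of 0 X] X z bdry[OF r0] by simp
    also have "\<dots> = integral {0..X} (\<lambda>x. \<phi>1 x * q r x) + integral {0..X} (\<lambda>x. \<phi> x * slope r x)"
      by (intro integral_add integrable_continuous_real continuous_intros c cs)
    finally show ?thesis .
  qed
  have "integral {0..X} (\<lambda>x. \<phi> x * slope r x) = - integral {0..X} (\<lambda>x. \<phi>1 x * q r x)" using e3 by linarith
  moreover have "integral {0..X} (\<lambda>x. \<phi> x * v3 (r, x)) = - \<phi> 0 * slope r 0 + integral {0..X} (\<lambda>x. \<phi>2 x * q r x)"
    using e1 e2 by linarith
  ultimately show ?thesis
    using regular_time_split(1)[OF r less_imp_le[OF X] c(1)] by (simp add: algebra_simps)
qed

text \<open>The equation is multiplied by \<phi> * 2 * min q 0. Diffusion only dissipates, which is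
  \<open>ac_monotone_product\<close> for the product \<phi> * slope. The drift coefficient is
  constant in x, so the drift term is an exact derivative of the squared negative part and lands on
  \<phi>1.\<close>

lemma regular_time_kato:
  assumes r: "regular_time r" and \<phi>: "cutoff \<phi> \<phi>1 \<phi>2 X" and pos: "\<And>x. x \<in> {0..X} \<Longrightarrow> 0 \<le> \<phi> x \<and> \<phi> x \<le> C"
  shows "integral {0..X} (\<lambda>x. \<phi> x * (v1 (r, x) * (2 * min (q r x) 0))) \<le>
    1 / 2 * integral {0..X} (\<lambda>x. \<phi>2 x * (min (q r x) 0)\<^sup>2) + B r * integral {0..X} (\<lambda>x. \<phi>1 x * (min (q r x) 0)\<^sup>2)"
proof -
  let ?J = "\<lambda>x. (min (q r x) 0)\<^sup>2" and ?k = "\<lambda>x. 2 * min (q r x) 0"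
  have X: "0 < X" and a1: "ac_derivative \<phi> \<phi>1 0 X" and a2: "ac_derivative \<phi>1 \<phi>2 0 X" and z: "\<phi> X = 0" "\<phi>1 X = 0"
    and c2: "continuous_on {0..X} \<phi>2" using \<phi> by (auto simp: cutoff_def)
  note c = ac_derivative_continuous[OF a1] ac_derivative_continuous[OF a2] c2
  have s: "ac_derivative (slope r) (\<lambda>x. v3 (r, x)) 0 X" and qs: "ac_derivative (q r) (slope r) 0 X"
    and r0: "r \<in> {0..\<tau>}" using r X by (auto simp: regular_time_def)
  note cs = ac_derivative_continuous[OF s] ac_derivative_continuous[OF qs]
  have ck: "continuous_on {0..X} ?k" and cJ: "continuous_on {0..X} ?J" by (intro continuous_intros cs)+
  have aJ: "ac_derivative ?J (\<lambda>x. slope r x * ?k x) 0 X"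
    by (rule ac_derivative_chain[OF qs min_square_chain(1,2)])
  have q0: "q r 0 = 0" using bdry[OF r0] .
  have e1: "0 = integral {0..X} (\<lambda>x. \<phi>1 x * ?J x) + integral {0..X} (\<lambda>x. \<phi> x * ?k x * slope r x)"
  proof -
    have "0 = integral {0..X} (\<lambda>x. \<phi>1 x * ?J x + \<phi> x * (slope r x * ?k x))"
      using ac_derivative_diff[OF ac_derivative_mult[OF a1 aJ], of 0 X] X z q0 by simp
    also have "\<dots> = integral {0..X} (\<lambda>x. \<phi>1 x * ?J x) + integral {0..X} (\<lambda>x. \<phi> x * (slope r x * ?k x))"
      by (intro integral_add integrable_continuous_real continuous_intros c cs)
    also have "(\<lambda>x. \<phi> x * (slope r x * ?k x)) = (\<lambda>x. \<phi> x * ?k x * slope r x)" by (simp add: ac_simps)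
    finally show ?thesis .
  qed
  have e2: "0 = integral {0..X} (\<lambda>x. \<phi>2 x * ?J x) + integral {0..X} (\<lambda>x. \<phi>1 x * slope r x * ?k x)"
  proof -
    have "0 = integral {0..X} (\<lambda>x. \<phi>2 x * ?J x + \<phi>1 x * (slope r x * ?k x))"
      using ac_derivative_diff[OF ac_derivative_mult[OF a2 aJ], of 0 X] X z q0 by simp
    also have "\<dots> = integral {0..X} (\<lambda>x. \<phi>2 x * ?J x) + integral {0..X} (\<lambda>x. \<phi>1 x * (slope r x * ?k x))"
      by (intro integral_add integrable_continuous_real continuous_intros c cs)
    also have "(\<lambda>x. \<phi>1 x * (slope r x * ?k x)) = (\<lambda>x. \<phi>1 x * slope r x * ?k x)" by (simp add: ac_simps)
    finally show ?thesis .
  qed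
  have v3i: "(\<lambda>x. \<phi> x * ?k x * v3 (r, x)) absolutely_integrable_on {0..X}"
    by (rule regular_time_split(2)[OF r]) (use X in \<open>auto intro!: continuous_intros c cs\<close>)
  have "integral {0..X} (\<lambda>x. (\<phi>1 x * slope r x + \<phi> x * v3 (r, x)) * (2 * min (q r x) 0))
      \<le> 2 * min (q r X) 0 * (\<phi> X * slope r X) - 2 * min (q r 0) 0 * (\<phi> 0 * slope r 0)"
    by (rule ac_monotone_product[OF less_imp_le[OF X] qs s ac_derivative_mult[OF a1 s] pos min_square_chain(2,3)])
  then have "integral {0..X} (\<lambda>x. (\<phi>1 x * slope r x + \<phi> x * v3 (r, x)) * ?k x) \<le> 0" using z q0 by simp
  moreover have "integral {0..X} (\<lambda>x. (\<phi>1 x * slope r x + \<phi> x * v3 (r, x)) * ?k x) =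
      integral {0..X} (\<lambda>x. \<phi>1 x * slope r x * ?k x + \<phi> x * ?k x * v3 (r, x))"
    by (intro integral_cong) (simp add: algebra_simps)
  moreover have "\<dots> = integral {0..X} (\<lambda>x. \<phi>1 x * slope r x * ?k x) + integral {0..X} (\<lambda>x. \<phi> x * ?k x * v3 (r, x))"
    by (intro integral_add integrable_continuous_real continuous_intros c cs set_lebesgue_integral_eq_integral(1)[OF v3i])
  ultimately have e3: "integral {0..X} (\<lambda>x. \<phi> x * ?k x * v3 (r, x)) \<le> integral {0..X} (\<lambda>x. \<phi>2 x * ?J x)"
    using e2 by linarith
  have "integral {0..X} (\<lambda>x. \<phi> x * (v1 (r, x) * ?k x)) = integral {0..X} (\<lambda>x. \<phi> x * ?k x * v1 (r, x))"
    by (simp add: ac_simps)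
  also have "\<dots> = 1 / 2 * integral {0..X} (\<lambda>x. \<phi> x * ?k x * v3 (r, x)) - B r * integral {0..X} (\<lambda>x. \<phi> x * ?k x * slope r x)"
    by (rule regular_time_split(1)[OF r less_imp_le[OF X]]) (intro continuous_intros c cs)
  also have "integral {0..X} (\<lambda>x. \<phi> x * ?k x * slope r x) = - integral {0..X} (\<lambda>x. \<phi>1 x * ?J x)" using e1 by linarith
  finally show ?thesis using e3 by simp
qed

lemma dominated_integral_le:
  fixes D h :: "real \<Rightarrow> real"
  assumes D: "integrable lborel D" "\<And>x. 0 \<le> D x" and h: "continuous_on {0..X} h"
    and le: "AE x in lborel. 0 < x \<longrightarrow> h x \<le> D x"
  shows "integral {0..X} h \<le> (LINT x|lborel. D x)"
proof -
  have Di: "integrable lborel (\<lambda>x. indicator {0..X} x * D x)"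
    using integrable_mult_indicator[OF _ D(1), of "{0..X}"] by simp
  have i: "(\<lambda>x. indicator {0..X} x * D x) absolutely_integrable_on {0..X}"
    "integral {0..X} (\<lambda>x. indicator {0..X} x * D x) = (LINT x|lborel. indicator {0..X} x * D x)"
    by (rule lborel_integral_on[OF Di], simp)+
  have "integral {0..X} h \<le> integral {0..X} (\<lambda>x. indicator {0..X} x * D x)"
  proof (rule integral_mono_AE_on[OF absolutely_integrable_continuous_real[OF h] i(1)])
    show "AE x in lebesgue. x \<in> {0..X} \<longrightarrow> h x \<le> indicator {0..X} x * D x"
      using AE_completion[OF le] AE_completion[OF AE_lborel_singleton[of "0::real"]]
      by eventually_elim auto
  qed
  also have "\<dots> \<le> (LINT x|lborel. D x)"
    unfolding i(2) by (rule integral_mono[OF Di D(1)]) (use D(2) in \<open>auto simp: indicator_def\<close>)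
  finally show ?thesis .
qed

lemma integral_mult_bounded_le:
  fixes w h :: "real \<Rightarrow> real"
  assumes w: "continuous_on {0..X} w" and h: "continuous_on {0..X} h" "\<And>x. x \<in> {0..X} \<Longrightarrow> 0 \<le> h x"
    and wc: "\<And>x. x \<in> {0..X} \<Longrightarrow> \<bar>w x\<bar> \<le> c" and hN: "integral {0..X} h \<le> N" and c: "0 \<le> c"
  shows "\<bar>integral {0..X} (\<lambda>x. w x * h x)\<bar> \<le> c * N"
proof -
  have "\<bar>integral {0..X} (\<lambda>x. h x * w x)\<bar> \<le> c * integral {0..X} (\<lambda>x. \<bar>h x\<bar>)"
    by (rule abs_integral_mult_le[OF absolutely_integrable_continuous_real[OF h(1)] w wc])
  also have "integral {0..X} (\<lambda>x. \<bar>h x\<bar>) = integral {0..X} h" by (rule integral_cong) (use h(2) in auto)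
  also have "c * integral {0..X} h \<le> c * N" using hN c by (rule mult_left_mono)
  finally show ?thesis by (simp add: mult.commute)
qed

lemma B_abs_integrable: "(\<lambda>r. \<bar>B r\<bar>) absolutely_integrable_on {0..\<tau>}"
  by (rule absolutely_integrable_real_abs(1)[OF Bint])

text \<open>The negative part is controlled by an energy estimate with a cutoff whose error tends to zero.\<close>

lemma q_nonneg:
  assumes q0: "\<And>x. 0 \<le> x \<Longrightarrow> 0 \<le> q 0 x" and t: "t \<in> {0..\<tau>}" and x: "0 \<le> x"
  shows "0 \<le> q t x"
proof -
  let ?J = "\<lambda>r x. (min (q r x) 0)\<^sup>2"
  obtain D where D: "integrable lborel D" "\<And>x. 0 \<le> D x"
    "AE x in lborel. 0 < x \<longrightarrow> (\<forall>t\<in>{0..\<tau>}. (q t x)\<^sup>2 \<le> D x)" using square_dominated by blast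
  define N where "N = (LINT x|lborel. D x)"
  have N0: "0 \<le> N" unfolding N_def by (rule integral_nonneg_AE) (use D(2) in auto)
  obtain C where C: "0 \<le> C" "\<And>R x. 0 < R \<Longrightarrow> \<bar>cut1 R x\<bar> \<le> C / R" "\<And>R x. 1 \<le> R \<Longrightarrow> \<bar>cut2 R x\<bar> \<le> C / R"
    using cut_bounds by blast
  have cJ: "continuous_on {0..X} (?J r)" if "r \<in> {0..\<tau>}" for r X
    by (intro continuous_intros continuous_on_subset[OF q_slice_continuous[OF that]]) auto
  have JN: "integral {0..X} (?J r) \<le> N" if "r \<in> {0..\<tau>}" for r X
    unfolding N_def
  proof (rule dominated_integral_le[OF D(1,2) cJ[OF that]])
    show "AE x in lborel. 0 < x \<longrightarrow> ?J r x \<le> D x"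
      using D(3) by eventually_elim (use that min_square_chain(4) in \<open>blast intro: order_trans\<close>)
  qed
  \<comment> \<open>Diffusion and drift errors each carry C/R and an energy of at most N, so their
    sum is bounded in terms of the integral of 1 + |B|.\<close>
  define K where "K = C * N * integral {0..\<tau>} (\<lambda>r. 1 + \<bar>B r\<bar>)"
  have bi: "(\<lambda>r. 1 + \<bar>B r\<bar>) absolutely_integrable_on {0..\<tau>}"
    by (intro set_integral_add B_abs_integrable absolutely_integrable_continuous_real continuous_intros)
  have F: "integral {0..2 * R} (\<lambda>x. cut0 R x * ?J t x) \<le> K / R" if R: "1 \<le> R" for R
  proof -
    have R0: "0 < R" using R by simp
    define A where "A = (\<lambda>r. integral {0..2 * R} (\<lambda>x. cut0 R x * (v1 (r, x) * (2 * min (q r x) 0))))"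
    have ac: "ac_derivative (\<lambda>t. integral {0..2 * R} (\<lambda>x. cut0 R x * ?J t x)) A 0 \<tau>"
      unfolding A_def by (rule time_evolution[OF min_square_chain(1,2) cut_continuous(1)])
    have Ale: "A r \<le> C * N / R * (1 + \<bar>B r\<bar>)" if r: "regular_time r" for r
    proof -
      have r0: "r \<in> {0..\<tau>}" using r by (auto simp: regular_time_def)
      have b2: "\<bar>integral {0..2 * R} (\<lambda>x. cut2 R x * ?J r x)\<bar> \<le> C / R * N"
        using C R by (intro integral_mult_bounded_le cut_continuous cJ JN r0) auto
      have b1: "\<bar>integral {0..2 * R} (\<lambda>x. cut1 R x * ?J r x)\<bar> \<le> C / R * N"
        using C R by (intro integral_mult_bounded_le cut_continuous cJ JN r0) auto
      have CN: "0 \<le> C / R * N" using C N0 R by simp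
      have "B r * integral {0..2 * R} (\<lambda>x. cut1 R x * ?J r x) \<le> \<bar>B r\<bar> * (C / R * N)"
      proof -
        have "B r * integral {0..2 * R} (\<lambda>x. cut1 R x * ?J r x) \<le> \<bar>B r\<bar> * \<bar>integral {0..2 * R} (\<lambda>x. cut1 R x * ?J r x)\<bar>"
          unfolding abs_mult[symmetric] by (rule abs_ge_self)
        also have "\<dots> \<le> \<bar>B r\<bar> * (C / R * N)" using b1 by (rule mult_left_mono) simp
        finally show ?thesis .
      qed
      moreover have "A r \<le> 1 / 2 * integral {0..2 * R} (\<lambda>x. cut2 R x * ?J r x) + B r * integral {0..2 * R} (\<lambda>x. cut1 R x * ?J r x)"
        unfolding A_def by (rule regular_time_kato[OF r cutoff_cut[OF R0], of 1]) (use cut_values[OF R0] in auto)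
      ultimately have "A r \<le> C / R * N + \<bar>B r\<bar> * (C / R * N)" using b2 CN by linarith
      then show ?thesis by (simp add: algebra_simps add_divide_distrib)
    qed
    have "integral {0..2 * R} (\<lambda>x. cut0 R x * ?J 0 x) = integral {0..2 * R} (\<lambda>x. 0)"
    proof (rule integral_cong)
      fix x assume "x \<in> {0..2 * R}"
      then have "min (q 0 x) 0 = 0" using q0[of x] by simp
      then show "cut0 R x * ?J 0 x = 0" by simp
    qed
    then have "integral {0..2 * R} (\<lambda>x. cut0 R x * ?J t x) = integral {0..t} A"
      using ac_derivative_diff[OF ac, of 0 t] t by simp
    also have "\<dots> \<le> integral {0..t} (\<lambda>r. C * N / R * (1 + \<bar>B r\<bar>))"
    proof (rule integral_mono_AE_on)
      show "A absolutely_integrable_on {0..t}" using ac_derivative_integrable_sub(1)[OF ac] t by auto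
      show "(\<lambda>r. C * N / R * (1 + \<bar>B r\<bar>)) absolutely_integrable_on {0..t}"
        using absolutely_integrable_on_subinterval[OF bi, of 0 t] t by (intro absolutely_integrable_const_mult) auto
      show "AE r in lebesgue. r \<in> {0..t} \<longrightarrow> A r \<le> C * N / R * (1 + \<bar>B r\<bar>)"
        using AE_regular_time by eventually_elim (use t Ale in auto)
    qed
    also have "\<dots> \<le> integral {0..\<tau>} (\<lambda>r. C * N / R * (1 + \<bar>B r\<bar>))"
      using absolutely_integrable_on_subinterval[OF bi, of 0 t] bi t C N0 R
      by (intro integral_subset_le set_lebesgue_integral_eq_integral(1) absolutely_integrable_const_mult) auto
    also have "\<dots> = K / R" by (simp add: K_def)
    finally show ?thesis .
  qed
  \<comment> \<open>The summand 1 keeps the interval nondegenerate for x = 0, so that a zero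
    integral of a continuous non-negative function forces the value at x to be zero.\<close>
  define Y where "Y = x + 1"
  have Y: "0 < Y" "x \<in> {0..Y}" using x by (auto simp: Y_def)
  have le: "integral {0..Y} (?J t) \<le> K / R" if R: "max 1 Y \<le> R" for R
  proof -
    have R1: "1 \<le> R" "Y \<le> R" "0 < R" using R by auto
    have "integral {0..Y} (?J t) = integral {0..Y} (\<lambda>x. cut0 R x * ?J t x)"
      by (rule integral_cong) (use cut_values(3)[OF R1(3)] R1 in auto)
    also have "\<dots> \<le> integral {0..2 * R} (\<lambda>x. cut0 R x * ?J t x)"
      using R1 cut_values(1)[OF R1(3)]
      by (intro integral_subset_le integrable_continuous_real continuous_intros cut_continuous cJ t) auto
    also have "\<dots> \<le> K / R" by (rule F[OF R1(1)])
    finally show ?thesis .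
  qed
  have "integral {0..Y} (?J t) \<le> 0"
  proof (rule tendsto_lowerbound)
    show "((\<lambda>R. K / R) \<longlongrightarrow> 0) at_top" by (rule tendsto_divide_0[OF tendsto_const filterlim_at_top_imp_at_infinity[OF filterlim_ident]])
    show "\<forall>\<^sub>F R in at_top. integral {0..Y} (?J t) \<le> K / R"
      using eventually_ge_at_top[of "max 1 Y"] by eventually_elim (rule le)
  qed simp
  moreover have "0 \<le> integral {0..Y} (?J t)" by (intro integral_nonneg integrable_continuous_real cJ t) auto
  ultimately have "integral {0..Y} (?J t) = 0" by simp
  then have "?J t x = 0" using integral_eq_0_iff[OF cJ[OF t], of Y] Y by auto
  then show ?thesis by (simp add: min_def split: if_splits)
qed

end

section \<open>Mass and Laplace transform\<close>

lemma ac_derivative_AE: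
  assumes "ac_derivative F f a b" "AE r in lebesgue. r \<in> {a..b} \<longrightarrow> f r = g r"
  shows "ac_derivative F g a b"
proof -
  note fi = ac_derivative_abs_integrable[OF assms(1)]
  note gi = absolutely_integrable_AE(1)[OF fi assms(2)]
  show ?thesis
  proof (rule ac_derivative_intro[OF gi, where c = "F a"])
    fix t assume t: "a \<le> t" "t \<le> b"
    have "integral {a..t} f = integral {a..t} g"
    proof (rule integral_eq_AE_on)
      show "f absolutely_integrable_on {a..t}" "g absolutely_integrable_on {a..t}"
        using absolutely_integrable_on_subinterval[OF fi, of a t] absolutely_integrable_on_subinterval[OF gi, of a t] t by auto
      show "AE x in lebesgue. x \<in> {a..t} \<longrightarrow> f x = g x" using assms(2) by eventually_elim (use t in auto)
    qed
    then show "F t = F a + integral {a..t} g" using ac_derivative_eq[OF assms(1), of t] t by simp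
  qed
qed

text \<open>Dominated convergence in the integral form; it is the way the cutoff is removed from the
  evolution equations.\<close>

lemma ac_derivative_limit:
  assumes ac: "\<And>n. ac_derivative (F n) (f n) a b" and g: "g absolutely_integrable_on {a..b}"
    and le: "\<And>n r. r \<in> {a..b} \<Longrightarrow> \<bar>f n r\<bar> \<le> g r" and lim: "\<And>r. r \<in> {a..b} \<Longrightarrow> (\<lambda>n. f n r) \<longlonglongrightarrow> h r"
    and Flim: "\<And>t. t \<in> {a..b} \<Longrightarrow> (\<lambda>n. F n t) \<longlonglongrightarrow> H t"
  shows "ac_derivative H h a b"
proof -
  have conv: "h integrable_on {a..t}" "(\<lambda>n. integral {a..t} (f n)) \<longlonglongrightarrow> integral {a..t} h" if t: "t \<le> b" for t
  proof -
    have 1: "f n integrable_on {a..t}" for n using ac_derivative_integrable_sub(2)[OF ac order_refl t] .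
    have 2: "g integrable_on {a..t}"
      using absolutely_integrable_on_subinterval[OF g, of a t] t by (auto intro: set_lebesgue_integral_eq_integral(1))
    have 3: "norm (f n x) \<le> g x" "(\<lambda>n. f n x) \<longlonglongrightarrow> h x" if "x \<in> {a..t}" for n x
      using le[of x n] lim[of x] that t by auto
    show "h integrable_on {a..t}" "(\<lambda>n. integral {a..t} (f n)) \<longlonglongrightarrow> integral {a..t} h"
      using dominated_convergence[OF 1 2 3] by blast+
  qed
  have hb: "\<bar>h r\<bar> \<le> g r" if "r \<in> {a..b}" for r
    by (rule tendsto_upperbound[OF tendsto_rabs[OF lim[OF that]]]) (use le[OF that] in auto)
  have hi: "h absolutely_integrable_on {a..b}"
    by (rule absolutely_integrable_integrable_bound[of "{a..b}" h g])
      (use hb conv(1)[of b] set_lebesgue_integral_eq_integral(1)[OF g] in auto)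
  show ?thesis
  proof (rule ac_derivative_intro[OF hi, where c = "H a"])
    fix t assume t: "a \<le> t" "t \<le> b"
    have "F n t = F n a + integral {a..t} (f n)" for n by (rule ac_derivative_eq[OF ac]) (use t in simp)
    moreover have "(\<lambda>n. F n a + integral {a..t} (f n)) \<longlonglongrightarrow> H a + integral {a..t} h"
      by (intro tendsto_add Flim conv(2) t(2)) (use t in auto)
    ultimately have "(\<lambda>n. F n t) \<longlonglongrightarrow> H a + integral {a..t} h" by simp
    then show "H t = H a + integral {a..t} h" using Flim[of t] t by (auto intro: LIMSEQ_unique)
  qed
qed

lemma nonneg_integrable_atLeast:
  fixes h :: "real \<Rightarrow> real"
  assumes h: "continuous_on {0..} h" "\<And>x. 0 \<le> x \<Longrightarrow> 0 \<le> h x" and le: "\<And>X. 0 \<le> X \<Longrightarrow> integral {0..X} h \<le> K"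
  shows "h absolutely_integrable_on {0..}" "\<And>X. integral {0..X} h \<le> integral {0..} h"
proof -
  define f where "f = (\<lambda>n::nat. \<lambda>x. if x \<in> {0..real n} then h x else 0)"
  have hc: "continuous_on {0..X} h" for X by (rule continuous_on_subset[OF h(1)]) auto
  have fi: "f n integrable_on {0..}" and fint: "integral {0..} (f n) = integral {0..real n} h" for n
  proof -
    have "h integrable_on {0..real n}" by (rule integrable_continuous_real[OF hc])
    then show "f n integrable_on {0..}" unfolding f_def by (subst integrable_restrict_Int) (simp add: Int_absorb2)
    show "integral {0..} (f n) = integral {0..real n} h" unfolding f_def by (subst integral_restrict_Int) (simp add: Int_absorb2)
  qed
  have "h integrable_on {0..}"
  proof (rule conjunct1[OF monotone_convergence_increasing[of f]])
    show "f n integrable_on {0..}" for n by (rule fi)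
    show "f n x \<le> f (Suc n) x" if "x \<in> {0..}" for n x using h(2) that by (auto simp: f_def)
    show "(\<lambda>n. f n x) \<longlonglongrightarrow> h x" if "x \<in> {0..}" for x
    proof (rule tendsto_eventually)
      obtain N :: nat where "x \<le> real N" using real_arch_simple by blast
      then show "\<forall>\<^sub>F n in sequentially. f n x = h x"
        using that by (intro eventually_sequentiallyI[of N]) (auto simp: f_def)
    qed
    have "norm (integral {0..} (f n)) \<le> \<bar>K\<bar>" for n
    proof -
      have "0 \<le> integral {0..real n} h" by (intro integral_nonneg integrable_continuous_real hc) (use h(2) in auto)
      then show ?thesis unfolding fint using le[of "real n"] by simp
    qed
    then show "bounded (range (\<lambda>n. integral {0..} (f n)))" by (intro boundedI[where B = "\<bar>K\<bar>"]) auto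
  qed
  then show *: "h absolutely_integrable_on {0..}" by (intro nonnegative_absolutely_integrable_1) (use h(2) in auto)
  show "integral {0..X} h \<le> integral {0..} h" for X
    by (intro integral_subset_le integrable_continuous_real hc set_lebesgue_integral_eq_integral(1)[OF *]) (use h(2) in auto)
qed

text \<open>The mass of \<open>q\<close> on \<open>{0..2 * R}\<close> is of order \<open>Suc n\<close> for this \<open>R\<close>, so that the error \<open>1 / R\<close> of the
  cutoff wins.\<close>

definition cut_scale :: "nat \<Rightarrow> real" where "cut_scale n = (real (Suc n))\<^sup>2"

lemma cut_scale: "1 \<le> cut_scale n" "0 < cut_scale n" "real n \<le> cut_scale n" "filterlim cut_scale at_top sequentially"
proof -
  have *: "real n + 1 \<le> cut_scale n" for n
  proof -
    have "real (Suc n) * 1 \<le> real (Suc n) * real (Suc n)" by (intro mult_left_mono) auto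
    then show ?thesis by (simp only: cut_scale_def power2_eq_square mult_1_right of_nat_Suc add.commute)
  qed
  show "1 \<le> cut_scale n" "0 < cut_scale n" "real n \<le> cut_scale n" using *[of n] of_nat_0_le_iff[of n, where ?'a = real] by linarith+
  have "real n \<le> cut_scale n" for n using *[of n] by linarith
  then show "filterlim cut_scale at_top sequentially"
    by (intro filterlim_at_top_mono[OF filterlim_real_sequentially] always_eventually) auto
qed

lemma cut_integral_tendsto:
  fixes h :: "real \<Rightarrow> real"
  assumes h: "h absolutely_integrable_on {0..}" "continuous_on {0..} h"
  shows "(\<lambda>n. integral {0..2 * cut_scale n} (\<lambda>x. cut0 (cut_scale n) x * h x)) \<longlonglongrightarrow> integral {0..} h"
proof -
  define f where "f = (\<lambda>n x. if x \<in> {0..2 * cut_scale n} then cut0 (cut_scale n) x * h x else 0)"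
  have "(\<lambda>n. integral {0..} (f n)) \<longlonglongrightarrow> integral {0..} h"
  proof (rule dominated_convergence(2))
    have c: "continuous_on {0..2 * cut_scale n} (\<lambda>x. cut0 (cut_scale n) x * h x)" for n
      by (intro continuous_intros cut_continuous continuous_on_subset[OF h(2)]) auto
    show "f n integrable_on {0..}" for n
      unfolding f_def using integrable_continuous_real[OF c[of n]] by (subst integrable_restrict_Int) (simp add: Int_absorb2)
    show "(\<lambda>x. \<bar>h x\<bar>) integrable_on {0..}" by (rule absolutely_integrable_real_abs(2)[OF h(1)])
    show "norm (f n x) \<le> \<bar>h x\<bar>" for n x
      using cut_values(1,2)[OF cut_scale(2), of n x] by (auto simp: f_def abs_mult intro: mult_left_le_one_le)
    show "(\<lambda>n. f n x) \<longlonglongrightarrow> h x" if "x \<in> {0..}" for x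
    proof (rule tendsto_eventually)
      have "\<forall>\<^sub>F n in sequentially. x \<le> cut_scale n" using cut_scale(4) by (simp add: filterlim_at_top)
      then show "\<forall>\<^sub>F n in sequentially. f n x = h x"
      proof eventually_elim
        case (elim n)
        have "x \<le> 2 * cut_scale n" using elim cut_scale(2)[of n] by linarith
        then show ?case using that cut_values(3)[OF cut_scale(2) elim] by (simp add: f_def)
      qed
    qed
  qed
  moreover have "integral {0..} (f n) = integral {0..2 * cut_scale n} (\<lambda>x. cut0 (cut_scale n) x * h x)" for n
    unfolding f_def by (subst integral_restrict_Int) (simp add: Int_absorb2)
  ultimately show ?thesis by simp
qed

section \<open>Evolution of the mass\<close>

context parabolic
begin

text \<open>Connects the constructed trace with the one-sided derivative in the feedback relation: q
  r is a primitive of a function continuous at 0.\<close>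

lemma slope_derivative:
  assumes r: "regular_time r"
  shows "(q r has_real_derivative slope r 0) (at 0 within {0..})"
proof -
  have s: "ac_derivative (slope r) (\<lambda>x. v3 (r, x)) 0 1" and qs: "ac_derivative (q r) (slope r) 0 1"
    and r0: "r \<in> {0..\<tau>}" using r by (auto simp: regular_time_def)
  have "((\<lambda>x. integral {0..x} (slope r)) has_real_derivative slope r 0) (at 0 within {0..1})"
    by (rule integral_has_real_derivative[OF ac_derivative_continuous[OF s]]) simp
  then have "(q r has_real_derivative slope r 0) (at 0 within {0..1})"
    by (rule has_field_derivative_transform_within[of _ _ _ _ 1])
      (use ac_derivative_eq[OF qs] bdry[OF r0] in \<open>auto simp del: integral_0\<close>)
  then show ?thesis using at_within_atLeast[of 0 1] by simp
qed

text \<open>The rate of change of the mass. By the feedback relation it equals \<Lambda> times the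
  mass, a form free of division.\<close>

definition flux :: "real \<Rightarrow> real" where "flux r = - (1 / 2) * slope r 0"

lemma flux_evolution:
  assumes \<phi>: "cutoff \<phi> \<phi>1 \<phi>2 X"
  shows "ac_derivative (\<lambda>t. integral {0..X} (\<lambda>x. \<phi> x * q t x))
    (\<lambda>r. \<phi> 0 * flux r + 1 / 2 * integral {0..X} (\<lambda>x. \<phi>2 x * q r x) + B r * integral {0..X} (\<lambda>x. \<phi>1 x * q r x)) 0 \<tau>"
proof (rule ac_derivative_AE)
  have "continuous_on {0..X} \<phi>" using \<phi> ac_derivative_continuous by (auto simp: cutoff_def)
  \<comment> \<open>For linear J the derivative is constant, so the Lipschitz constant is 0.\<close>
  then show "ac_derivative (\<lambda>t. integral {0..X} (\<lambda>x. \<phi> x * q t x)) (\<lambda>r. integral {0..X} (\<lambda>x. \<phi> x * (v1 (r, x) * 1))) 0 \<tau>"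
    by (rule time_evolution[where J = "\<lambda>y. y" and k = "\<lambda>_. 1" and L = 0, rotated 2]) auto
  show "AE r in lebesgue. r \<in> {0..\<tau>} \<longrightarrow> integral {0..X} (\<lambda>x. \<phi> x * (v1 (r, x) * 1)) =
      \<phi> 0 * flux r + 1 / 2 * integral {0..X} (\<lambda>x. \<phi>2 x * q r x) + B r * integral {0..X} (\<lambda>x. \<phi>1 x * q r x)"
    using AE_regular_time by eventually_elim (use regular_time_flux[OF _ \<phi>] in \<open>auto simp: flux_def\<close>)
qed

lemma slice_integral_continuous:
  assumes "continuous_on {0..X} w"
  shows "continuous_on {0..\<tau>} (\<lambda>r. integral {0..X} (\<lambda>x. w x * q r x))"
proof -
  have "continuous_on ({0..\<tau>} \<times> cbox 0 X) (\<lambda>(t, x). q t x)" by (rule continuous_on_subset[OF cont]) auto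
  then have "continuous_on ({0..\<tau>} \<times> cbox 0 X) (\<lambda>(r, x). w x * q r x)"
    unfolding case_prod_beta using assms by (intro continuous_intros continuous_on_compose2[OF assms]) auto
  from integral_continuous_on_param[OF this] show ?thesis by simp
qed

text \<open>Read off from the cutoff at R = 1: the localized mass is absolutely continuous, and its
  derivative is the flux plus terms that are visibly integrable in time.\<close>

lemma flux_integrable: "flux absolutely_integrable_on {0..\<tau>}"
proof -
  let ?e = "\<lambda>r. 1 / 2 * integral {0..2 * 1} (\<lambda>x. cut2 1 x * q r x) + B r * integral {0..2 * 1} (\<lambda>x. cut1 1 x * q r x)"
  note f = ac_derivative_abs_integrable[OF flux_evolution[OF cutoff_cut[of 1]], simplified]
  have e: "?e absolutely_integrable_on {0..\<tau>}"
    by (intro set_integral_add absolutely_integrable_const_mult absolutely_integrable_mult_continuous Bint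
        slice_integral_continuous cut_continuous absolutely_integrable_continuous_real)
  have "(\<lambda>r. (cut0 1 0 * flux r + ?e r) - ?e r) absolutely_integrable_on {0..\<tau>}"
    by (intro set_integral_diff e)
      (use ac_derivative_abs_integrable[OF flux_evolution[OF cutoff_cut[of 1]]] in \<open>simp add: add.assoc\<close>)
  then show ?thesis using cut_values(3)[of 1 0] by simp
qed


definition mass :: "real \<Rightarrow> real" where "mass t = integral {0..} (q t)"

lemma slice_continuous_Icc: "r \<in> {0..\<tau>} \<Longrightarrow> continuous_on {0..X} (q r)"
  by (rule continuous_on_subset[OF q_slice_continuous]) auto

text \<open>With m = n + 1 and R = m^2, Young's inequality q \<le> (m/2) q^2 + 1/(2m) is integrated
  over [0, 2 m^2]: the first term gives at most m N / 2 and the second exactly m.\<close>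

lemma cut_mass_bound:
  obtains K where "0 \<le> K" "\<And>n r. r \<in> {0..\<tau>} \<Longrightarrow> integral {0..2 * cut_scale n} (q r) \<le> K * real (Suc n)"
proof -
  obtain D where D: "integrable lborel D" "\<And>x. 0 \<le> D x"
    "AE x in lborel. 0 < x \<longrightarrow> (\<forall>t\<in>{0..\<tau>}. (q t x)\<^sup>2 \<le> D x)" using square_dominated by blast
  define N where "N = (LINT x|lborel. D x)"
  have N0: "0 \<le> N" unfolding N_def by (rule integral_nonneg_AE) (use D(2) in auto)
  have "integral {0..2 * cut_scale n} (q r) \<le> ((N + 2) / 2) * real (Suc n)" if r: "r \<in> {0..\<tau>}" for n r
  proof -
    define m where "m = real (Suc n)"
    have m: "0 < m" and R: "cut_scale n = m * m" by (auto simp: m_def cut_scale_def power2_eq_square)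
    let ?I = "{0..2 * (m * m)}"
    have c2: "continuous_on ?I (\<lambda>x. (q r x)\<^sup>2)" by (intro continuous_intros slice_continuous_Icc r)
    have sq: "integral ?I (\<lambda>x. (q r x)\<^sup>2) \<le> N"
      unfolding N_def
      by (rule dominated_integral_le[OF D(1,2) c2]) (use D(3) r in \<open>auto elim: eventually_mono\<close>)
    have "integral ?I (q r) \<le> integral ?I (\<lambda>x. m / 2 * (q r x)\<^sup>2 + 1 / (2 * m))"
    proof (rule integral_le)
      fix x assume "x \<in> ?I"
      have "0 \<le> (m * q r x - 1)\<^sup>2" by simp
      then have "2 * m * q r x \<le> m * m * (q r x)\<^sup>2 + 1" by (simp add: power2_eq_square algebra_simps)
      then show "q r x \<le> m / 2 * (q r x)\<^sup>2 + 1 / (2 * m)" using m by (simp add: field_simps)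
    qed (intro integrable_continuous_real continuous_intros slice_continuous_Icc r)+
    also have "\<dots> = m / 2 * integral ?I (\<lambda>x. (q r x)\<^sup>2) + integral ?I (\<lambda>x. 1 / (2 * m))"
      by (subst integral_add) (auto intro!: integrable_continuous_real continuous_intros slice_continuous_Icc r)
    also have "integral ?I (\<lambda>x. 1 / (2 * m)) = m" using m by simp
    also have "m / 2 * integral ?I (\<lambda>x. (q r x)\<^sup>2) \<le> m / 2 * N" using sq m by (intro mult_left_mono) auto
    finally show ?thesis unfolding R m_def[symmetric] by (simp add: algebra_simps add_divide_distrib)
  qed
  then show ?thesis using that[of "(N + 2) / 2"] N0 by simp
qed

text \<open>The cutoff derivatives are at most C / m^2 on a region of mass at most K m, so the error
  terms are at most C K / m. Being bounded, they make the mass finite; tending to zero, they leave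
  the flux alone as derivative.\<close>

lemma mass_evolution:
  assumes q0: "\<And>x. 0 \<le> x \<Longrightarrow> 0 \<le> q 0 x" and i0: "q 0 absolutely_integrable_on {0..}"
  shows "\<And>t. t \<in> {0..\<tau>} \<Longrightarrow> q t absolutely_integrable_on {0..}" "ac_derivative mass flux 0 \<tau>"
proof -
  have nn: "0 \<le> q t x" if "t \<in> {0..\<tau>}" "0 \<le> x" for t x by (rule q_nonneg[OF q0 that])
  obtain K where K: "0 \<le> K" "\<And>n r. r \<in> {0..\<tau>} \<Longrightarrow> integral {0..2 * cut_scale n} (q r) \<le> K * real (Suc n)"
    using cut_mass_bound by blast
  obtain C where C: "0 \<le> C" "\<And>R x. 0 < R \<Longrightarrow> \<bar>cut1 R x\<bar> \<le> C / R" "\<And>R x. 1 \<le> R \<Longrightarrow> \<bar>cut2 R x\<bar> \<le> C / R"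
    using cut_bounds by blast
  define I where "I = (\<lambda>w r n. integral {0..2 * cut_scale n} (\<lambda>x. w (cut_scale n) x * q r x))"
  define f where "f = (\<lambda>n r. flux r + 1 / 2 * I cut2 r n + B r * I cut1 r n)"
  define g where "g = (\<lambda>r. \<bar>flux r\<bar> + 1 / 2 * (C * K) + \<bar>B r\<bar> * (C * K))"
  have Ib: "\<bar>I cut1 r n\<bar> \<le> C * K / real (Suc n)" "\<bar>I cut2 r n\<bar> \<le> C * K / real (Suc n)" if r: "r \<in> {0..\<tau>}" for r n
  proof -
    have e: "C / cut_scale n * (K * real (Suc n)) = C * K / real (Suc n)"
      by (simp add: cut_scale_def power2_eq_square)
    have "0 \<le> C / cut_scale n" using C(1) cut_scale(2)[of n] by simp
    then show "\<bar>I cut1 r n\<bar> \<le> C * K / real (Suc n)" "\<bar>I cut2 r n\<bar> \<le> C * K / real (Suc n)"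
      unfolding I_def e[symmetric]
      by (intro integral_mult_bounded_le cut_continuous slice_continuous_Icc r K(2) C(2,3) cut_scale nn; use r in simp)+
  qed
  have le: "C * K / real (Suc n) \<le> C * K" for n
    using C(1) K(1) by (simp add: field_simps mult_left_mono)
  have lim0: "(\<lambda>n. C * K / real (Suc n)) \<longlonglongrightarrow> 0"
    using tendsto_mult_right_zero[OF LIMSEQ_inverse_real_of_nat, of "C * K"] by (simp add: divide_inverse)
  have ac: "ac_derivative (\<lambda>t. I cut0 t n) (f n) 0 \<tau>" for n
    using flux_evolution[OF cutoff_cut[OF cut_scale(2)[of n]]] cut_values(3)[OF cut_scale(2)[of n], of 0] cut_scale(2)[of n]
    by (simp add: I_def f_def)
  have fg: "\<bar>f n r\<bar> \<le> g r" if r: "r \<in> {0..\<tau>}" for n r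
  proof -
    have "\<bar>B r * I cut1 r n\<bar> \<le> \<bar>B r\<bar> * (C * K)"
      unfolding abs_mult using Ib(1)[OF r, of n] le[of n] by (intro mult_left_mono) auto
    moreover have "\<bar>I cut2 r n\<bar> \<le> C * K" using Ib(2)[OF r, of n] le[of n] by linarith
    moreover have "\<bar>a + 1 / 2 * b + c\<bar> \<le> \<bar>a\<bar> + 1 / 2 * k + d" if "\<bar>c\<bar> \<le> d" "\<bar>b\<bar> \<le> k" for a b c d k :: real
      using that by argo
    ultimately show ?thesis unfolding f_def g_def by blast
  qed
  have gi: "g absolutely_integrable_on {0..\<tau>}"
    unfolding g_def
    by (intro set_integral_add absolutely_integrable_real_abs(1) flux_integrable absolutely_integrable_mult_continuous
        B_abs_integrable absolutely_integrable_continuous_real continuous_intros Bint)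
  have flim: "(\<lambda>n. f n r) \<longlonglongrightarrow> flux r" if r: "r \<in> {0..\<tau>}" for r
  proof -
    have "(\<lambda>n. I cut1 r n) \<longlonglongrightarrow> 0" "(\<lambda>n. I cut2 r n) \<longlonglongrightarrow> 0"
      using Ib[OF r] by (intro Lim_null_comparison[OF _ lim0] always_eventually; simp)+
    then have "(\<lambda>n. f n r) \<longlonglongrightarrow> flux r + 1 / 2 * 0 + B r * 0" unfolding f_def by (intro tendsto_intros)
    then show ?thesis by simp
  qed
  show int: "q t absolutely_integrable_on {0..}" if t: "t \<in> {0..\<tau>}" for t
  proof (rule nonneg_integrable_atLeast(1)[OF q_slice_continuous[OF t] nn[OF t], where K = "integral {0..} (q 0) + integral {0..\<tau>} g"])
    fix X :: real assume X: "0 \<le> X"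
    have z: "0 \<in> {0..\<tau>}" using tau by simp
    obtain n :: nat where "X \<le> real n" using real_arch_simple by blast
    then have Xn: "X \<le> cut_scale n" using cut_scale(3)[of n] by linarith
    have "integral {0..X} (q t) = integral {0..X} (\<lambda>x. cut0 (cut_scale n) x * q t x)"
      by (rule integral_cong) (use cut_values(3)[OF cut_scale(2)] Xn in auto)
    also have "\<dots> \<le> I cut0 t n"
      unfolding I_def
      by (intro integral_subset_le integrable_continuous_real continuous_intros cut_continuous slice_continuous_Icc t)
        (use Xn cut_scale(2)[of n] nn[OF t] cut_values(1)[OF cut_scale(2)] X in auto)
    also have "\<dots> = I cut0 0 n + integral {0..t} (f n)" using ac_derivative_diff[OF ac, of 0 t n] t by simp
    also have "I cut0 0 n \<le> integral {0..2 * cut_scale n} (q 0)"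
      unfolding I_def
      by (intro integral_le integrable_continuous_real continuous_intros cut_continuous slice_continuous_Icc z)
        (use q0 cut_values(1,2)[OF cut_scale(2)] in \<open>auto intro!: mult_left_le_one_le\<close>)
    also have "\<dots> \<le> integral {0..} (q 0)"
      by (intro integral_subset_le integrable_continuous_real slice_continuous_Icc z set_lebesgue_integral_eq_integral(1)[OF i0])
        (use q0 in auto)
    also have "integral {0..t} (f n) \<le> integral {0..\<tau>} g"
    proof -
      have g0: "0 \<le> g r" if "r \<in> {0..\<tau>}" for r using fg[OF that, of 0] by linarith
      have gt: "g absolutely_integrable_on {0..t}"
        using absolutely_integrable_on_subinterval[OF gi, of 0 t] t by auto
      have "integral {0..t} (f n) \<le> integral {0..t} g"
        using t by (intro integral_le set_lebesgue_integral_eq_integral(1)[OF gt] ac_derivative_integrable_sub(2)[OF ac])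
          (use fg[THEN abs_le_D1] in auto)
      also have "\<dots> \<le> integral {0..\<tau>} g"
        by (intro integral_subset_le set_lebesgue_integral_eq_integral(1) gi gt) (use t g0 in auto)
      finally show ?thesis .
    qed
    finally show "integral {0..X} (q t) \<le> integral {0..} (q 0) + integral {0..\<tau>} g" by simp
  qed
  show "ac_derivative mass flux 0 \<tau>"
  proof (rule ac_derivative_limit[OF ac gi fg flim])
    show "(\<lambda>n. I cut0 t n) \<longlonglongrightarrow> mass t" if "t \<in> {0..\<tau>}" for t
      unfolding I_def mass_def by (rule cut_integral_tendsto[OF int[OF that] q_slice_continuous[OF that]])
  qed
qed

text \<open>A non-negative function that vanishes at 0 has non-negative difference quotients
  there.\<close>

lemma flux_nonpos:
  assumes q0: "\<And>x. 0 \<le> x \<Longrightarrow> 0 \<le> q 0 x"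
  shows "AE r in lebesgue. r \<in> {0..\<tau>} \<longrightarrow> flux r \<le> 0"
  using AE_regular_time
proof eventually_elim
  case (elim r)
  show ?case
  proof
    assume r: "r \<in> {0..\<tau>}"
    have "0 \<le> slope r 0"
    proof (rule tendsto_lowerbound)
      show "((\<lambda>x. (q r x - q r 0) / (x - 0)) \<longlongrightarrow> slope r 0) (at 0 within {0..})"
        using slope_derivative[of r] elim r by (simp add: has_field_derivative_iff)
      show "\<forall>\<^sub>F x in at 0 within {0..}. 0 \<le> (q r x - q r 0) / (x - 0)"
        using q_nonneg[OF q0 r] bdry[OF r] by (auto simp: eventually_at_filter)
      show "at (0::real) within {0..} \<noteq> bot" by (rule at_within_atLeast_not_bot) simp
    qed
    then show "flux r \<le> 0" by (simp add: flux_def)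
  qed
qed

lemma mass_antimono:
  assumes q0: "\<And>x. 0 \<le> x \<Longrightarrow> 0 \<le> q 0 x" and i0: "q 0 absolutely_integrable_on {0..}"
    and st: "0 \<le> s" "s \<le> t" "t \<le> \<tau>"
  shows "mass t \<le> mass s"
proof -
  note ac = mass_evolution(2)[OF q0 i0]
  have "integral {s..t} flux \<le> integral {s..t} (\<lambda>_. 0)"
    by (rule integral_mono_AE_on[OF ac_derivative_integrable_sub(1)[OF ac st(1,3)]])
      (use flux_nonpos[OF q0] st in \<open>auto elim: eventually_mono intro: absolutely_integrable_continuous_real\<close>)
  then show ?thesis using ac_derivative_diff[OF ac st] by simp
qed

section \<open>Evolution of the Laplace transform\<close>

definition laplace :: "real \<Rightarrow> real \<Rightarrow> real" where
  "laplace \<mu> t = integral {0..} (\<lambda>x. exp (- \<mu> * x) * q t x)"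

lemma cutoff_exp_cut:
  assumes "0 < R"
  shows "cutoff (\<lambda>x. exp (- \<mu> * x) * cut0 R x)
    (\<lambda>x. - \<mu> * exp (- \<mu> * x) * cut0 R x + exp (- \<mu> * x) * cut1 R x)
    (\<lambda>x. \<mu>\<^sup>2 * exp (- \<mu> * x) * cut0 R x - 2 * \<mu> * exp (- \<mu> * x) * cut1 R x + exp (- \<mu> * x) * cut2 R x) (2 * R)"
  unfolding cutoff_def
proof (intro conjI ac_derivative_C1)
  have e: "((\<lambda>x. exp (- \<mu> * x)) has_real_derivative - \<mu> * exp (- \<mu> * x)) (at x within S)" for x S
    by (auto intro!: derivative_eq_intros)
  note d = cut_derivatives[of R]
  show "((\<lambda>x. exp (- \<mu> * x) * cut0 R x) has_real_derivative
      - \<mu> * exp (- \<mu> * x) * cut0 R x + exp (- \<mu> * x) * cut1 R x) (at x within {0..2 * R})" for x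
    using DERIV_mult[OF e d(1), of x "{0..2 * R}"] by (simp add: algebra_simps)
  show "((\<lambda>x. - \<mu> * exp (- \<mu> * x) * cut0 R x + exp (- \<mu> * x) * cut1 R x) has_real_derivative
      \<mu>\<^sup>2 * exp (- \<mu> * x) * cut0 R x - 2 * \<mu> * exp (- \<mu> * x) * cut1 R x + exp (- \<mu> * x) * cut2 R x) (at x within {0..2 * R})" for x
    using DERIV_add[OF DERIV_mult[OF DERIV_cmult[OF e, of "- \<mu>"] d(1)] DERIV_mult[OF e d(2)], of x "{0..2 * R}"]
    by (simp add: algebra_simps power2_eq_square)
qed (use assms in \<open>auto intro!: continuous_intros cut_continuous simp: cut_values\<close>)

text \<open>Now that the mass is finite and nonincreasing, the cutoff errors are at most C / R times
  the initial mass. The surviving terms are those in which all derivatives fall on the exponential: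
  \<mu>^2 / 2 from diffusion and - \<mu> B from drift.\<close>

lemma laplace_evolution:
  assumes q0: "\<And>x. 0 \<le> x \<Longrightarrow> 0 \<le> q 0 x" and i0: "q 0 absolutely_integrable_on {0..}" and \<mu>: "0 \<le> \<mu>"
  shows "\<And>t. t \<in> {0..\<tau>} \<Longrightarrow> 0 \<le> laplace \<mu> t \<and> laplace \<mu> t \<le> mass t"
    "ac_derivative (laplace \<mu>) (\<lambda>r. flux r + (\<mu>\<^sup>2 / 2 - \<mu> * B r) * laplace \<mu> r) 0 \<tau>"
proof -
  have nn: "0 \<le> q t x" if "t \<in> {0..\<tau>}" "0 \<le> x" for t x by (rule q_nonneg[OF q0 that])
  have qi: "q t absolutely_integrable_on {0..}" if "t \<in> {0..\<tau>}" for t by (rule mass_evolution(1)[OF q0 i0 that])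
  define h where "h = (\<lambda>r x. exp (- \<mu> * x) * q r x)"
  have hc: "continuous_on {0..} (h r)" "continuous_on {0..X} (h r)" if "r \<in> {0..\<tau>}" for r X
    unfolding h_def using that by (intro continuous_intros q_slice_continuous slice_continuous_Icc; simp)+
  have hb: "0 \<le> h r x" "h r x \<le> q r x" if "r \<in> {0..\<tau>}" "0 \<le> x" for r x
    using nn[OF that] \<mu> that by (auto simp: h_def intro!: mult_left_le_one_le)
  have hX: "integral {0..X} (h r) \<le> mass r" if r: "r \<in> {0..\<tau>}" for r X
  proof -
    have "integral {0..X} (h r) \<le> integral {0..X} (q r)"
      using hb[OF r] by (intro integral_le integrable_continuous_real hc slice_continuous_Icc r) auto
    also have "\<dots> \<le> mass r"
      unfolding mass_def
      by (intro integral_subset_le integrable_continuous_real slice_continuous_Icc r set_lebesgue_integral_eq_integral(1)[OF qi[OF r]])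
        (use nn[OF r] in auto)
    finally show ?thesis .
  qed
  have hi: "h r absolutely_integrable_on {0..}" if "r \<in> {0..\<tau>}" for r
    by (rule nonneg_integrable_atLeast(1)[OF hc(1)[OF that] hb(1)[OF that] hX[OF that]])
  have E: "laplace \<mu> t = integral {0..} (h t)" for t by (simp add: laplace_def h_def)
  show "0 \<le> laplace \<mu> t \<and> laplace \<mu> t \<le> mass t" if t: "t \<in> {0..\<tau>}" for t
    unfolding E mass_def
    by (intro conjI integral_nonneg integral_le set_lebesgue_integral_eq_integral(1) hi qi t) (use hb[OF t] in auto)
  obtain C where C: "0 \<le> C" "\<And>R x. 0 < R \<Longrightarrow> \<bar>cut1 R x\<bar> \<le> C / R" "\<And>R x. 1 \<le> R \<Longrightarrow> \<bar>cut2 R x\<bar> \<le> C / R"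
    using cut_bounds by blast
  define M where "M = mass 0"
  have hM: "integral {0..X} (h r) \<le> M" if r: "r \<in> {0..\<tau>}" for r X
    using hX[OF r, of X] mass_antimono[OF q0 i0, of 0 r] r by (auto simp: M_def)
  have M0: "0 \<le> M" unfolding M_def mass_def
    by (intro integral_nonneg set_lebesgue_integral_eq_integral(1)[OF i0]) (use q0 in auto)
  define I where "I = (\<lambda>w r n. integral {0..2 * cut_scale n} (\<lambda>x. w (cut_scale n) x * h r x))"
  have Ib: "\<bar>I cut1 r n\<bar> \<le> C / cut_scale n * M" "\<bar>I cut2 r n\<bar> \<le> C / cut_scale n * M" "\<bar>I cut0 r n\<bar> \<le> 1 * M"
    if r: "r \<in> {0..\<tau>}" for r n
  proof -
    have c: "0 \<le> C / cut_scale n" using C(1) cut_scale(2)[of n] by simp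
    show "\<bar>I cut1 r n\<bar> \<le> C / cut_scale n * M" "\<bar>I cut2 r n\<bar> \<le> C / cut_scale n * M"
      unfolding I_def
      by (intro integral_mult_bounded_le cut_continuous hc r hM C(2,3) cut_scale hb c; use r in simp)+
    show "\<bar>I cut0 r n\<bar> \<le> 1 * M"
      unfolding I_def
      by (intro integral_mult_bounded_le cut_continuous hc r hM hb)
        (use r cut_values(1,2)[OF cut_scale(2)] in auto)
  qed
  have le: "C / cut_scale n * M \<le> C * M" for n
    using divide_left_mono[of 1 "cut_scale n" C] C(1) M0 cut_scale(1,2)[of n] by (intro mult_right_mono) auto
  have lim0: "(\<lambda>n. C / cut_scale n * M) \<longlonglongrightarrow> 0"
    by (intro tendsto_mult_left_zero tendsto_divide_0[OF tendsto_const] filterlim_at_top_imp_at_infinity cut_scale)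
  define f where "f = (\<lambda>n r. flux r + 1 / 2 * (\<mu>\<^sup>2 * I cut0 r n - 2 * \<mu> * I cut1 r n + I cut2 r n)
      + B r * (- \<mu> * I cut0 r n + I cut1 r n))"
  define g where "g = (\<lambda>r. \<bar>flux r\<bar> + 1 / 2 * (\<mu>\<^sup>2 * M + 2 * \<mu> * (C * M) + C * M) + \<bar>B r\<bar> * (\<mu> * M + C * M))"
  have ac: "ac_derivative (\<lambda>t. I cut0 t n) (f n) 0 \<tau>" for n
  proof -
    let ?R = "cut_scale n"
    note R = cut_scale(2)[of n]
    have hI: "((\<lambda>x. w ?R x * h r x) has_integral I w r n) {0..2 * ?R}"
      if "r \<in> {0..\<tau>}" "w = cut0 \<or> w = cut1 \<or> w = cut2" for r w
      unfolding I_def using that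
      by (auto intro!: integrable_integral integrable_continuous_real continuous_intros cut_continuous hc)
    have "ac_derivative (\<lambda>t. integral {0..2 * ?R} (\<lambda>x. (exp (- \<mu> * x) * cut0 ?R x) * q t x)) (f n) 0 \<tau>"
    proof (rule ac_derivative_AE[OF flux_evolution[OF cutoff_exp_cut[OF R]]], intro always_eventually allI impI)
      fix r assume r: "r \<in> {0..\<tau>}"
      have "integral {0..2 * ?R} (\<lambda>x. (\<mu>\<^sup>2 * exp (- \<mu> * x) * cut0 ?R x - 2 * \<mu> * exp (- \<mu> * x) * cut1 ?R x + exp (- \<mu> * x) * cut2 ?R x) * q r x)
          = integral {0..2 * ?R} (\<lambda>x. \<mu>\<^sup>2 * (cut0 ?R x * h r x) - 2 * \<mu> * (cut1 ?R x * h r x) + cut2 ?R x * h r x)"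
        by (intro integral_cong) (simp add: h_def algebra_simps)
      also have "\<dots> = \<mu>\<^sup>2 * I cut0 r n - 2 * \<mu> * I cut1 r n + I cut2 r n"
        by (intro integral_unique has_integral_add has_integral_diff has_integral_mult_right hI[OF r]) auto
      finally have 2: "integral {0..2 * ?R} (\<lambda>x. (\<mu>\<^sup>2 * exp (- \<mu> * x) * cut0 ?R x - 2 * \<mu> * exp (- \<mu> * x) * cut1 ?R x + exp (- \<mu> * x) * cut2 ?R x) * q r x)
          = \<mu>\<^sup>2 * I cut0 r n - 2 * \<mu> * I cut1 r n + I cut2 r n" .
      have "integral {0..2 * ?R} (\<lambda>x. (- \<mu> * exp (- \<mu> * x) * cut0 ?R x + exp (- \<mu> * x) * cut1 ?R x) * q r x)
          = integral {0..2 * ?R} (\<lambda>x. - \<mu> * (cut0 ?R x * h r x) + cut1 ?R x * h r x)"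
        by (intro integral_cong) (simp add: h_def algebra_simps)
      also have "\<dots> = - \<mu> * I cut0 r n + I cut1 r n"
        by (intro integral_unique has_integral_add has_integral_mult_right hI[OF r]) auto
      finally have 1: "integral {0..2 * ?R} (\<lambda>x. (- \<mu> * exp (- \<mu> * x) * cut0 ?R x + exp (- \<mu> * x) * cut1 ?R x) * q r x)
          = - \<mu> * I cut0 r n + I cut1 r n" .
      have 0: "cut0 ?R 0 = 1" by (rule cut_values(3)[OF R]) (use R in simp)
      show "exp (- \<mu> * 0) * cut0 ?R 0 * flux r
          + 1 / 2 * integral {0..2 * ?R} (\<lambda>x. (\<mu>\<^sup>2 * exp (- \<mu> * x) * cut0 ?R x - 2 * \<mu> * exp (- \<mu> * x) * cut1 ?R x + exp (- \<mu> * x) * cut2 ?R x) * q r x)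
          + B r * integral {0..2 * ?R} (\<lambda>x. (- \<mu> * exp (- \<mu> * x) * cut0 ?R x + exp (- \<mu> * x) * cut1 ?R x) * q r x) = f n r"
        unfolding 1 2 f_def 0 by simp
    qed
    also have "(\<lambda>t. integral {0..2 * ?R} (\<lambda>x. (exp (- \<mu> * x) * cut0 ?R x) * q t x)) = (\<lambda>t. I cut0 t n)"
      by (simp add: I_def h_def ac_simps)
    finally show ?thesis .
  qed
  show "ac_derivative (laplace \<mu>) (\<lambda>r. flux r + (\<mu>\<^sup>2 / 2 - \<mu> * B r) * laplace \<mu> r) 0 \<tau>"
  proof (rule ac_derivative_limit[OF ac])
    show "g absolutely_integrable_on {0..\<tau>}"
      unfolding g_def
      by (intro set_integral_add absolutely_integrable_real_abs(1) flux_integrable absolutely_integrable_mult_continuous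
          B_abs_integrable absolutely_integrable_continuous_real continuous_intros Bint)
    fix r assume r: "r \<in> {0..\<tau>}"
    have I0: "(\<lambda>n. I cut0 r n) \<longlonglongrightarrow> laplace \<mu> r"
      unfolding I_def E by (rule cut_integral_tendsto[OF hi[OF r] hc(1)[OF r]])
    then show "(\<lambda>n. I cut0 r n) \<longlonglongrightarrow> laplace \<mu> r" .
    have "(\<lambda>n. I cut1 r n) \<longlonglongrightarrow> 0" "(\<lambda>n. I cut2 r n) \<longlonglongrightarrow> 0"
      using Ib[OF r] by (intro Lim_null_comparison[OF _ lim0] always_eventually; simp)+
    then have "(\<lambda>n. f n r) \<longlonglongrightarrow> flux r + 1 / 2 * (\<mu>\<^sup>2 * laplace \<mu> r - 2 * \<mu> * 0 + 0) + B r * (- \<mu> * laplace \<mu> r + 0)"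
      unfolding f_def by (intro tendsto_intros I0)
    then show "(\<lambda>n. f n r) \<longlonglongrightarrow> flux r + (\<mu>\<^sup>2 / 2 - \<mu> * B r) * laplace \<mu> r" by (simp add: algebra_simps)
    fix n
    have i1: "\<bar>I cut1 r n\<bar> \<le> C * M" and i2: "\<bar>I cut2 r n\<bar> \<le> C * M" and i0: "\<bar>I cut0 r n\<bar> \<le> M"
      using Ib[OF r, of n] le[of n] by linarith+
    have a: "\<bar>\<mu>\<^sup>2 * I cut0 r n\<bar> \<le> \<mu>\<^sup>2 * M" "\<bar>2 * \<mu> * I cut1 r n\<bar> \<le> 2 * \<mu> * (C * M)" "\<bar>- \<mu> * I cut0 r n\<bar> \<le> \<mu> * M"
      using i0 i1 \<mu> by (auto simp: abs_mult intro!: mult_left_mono)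
    have "\<bar>- \<mu> * I cut0 r n + I cut1 r n\<bar> \<le> \<mu> * M + C * M" using a(3) i1 by linarith
    then have "\<bar>B r * (- \<mu> * I cut0 r n + I cut1 r n)\<bar> \<le> \<bar>B r\<bar> * (\<mu> * M + C * M)"
      unfolding abs_mult by (intro mult_left_mono) auto
    moreover have "\<bar>\<mu>\<^sup>2 * I cut0 r n - 2 * \<mu> * I cut1 r n + I cut2 r n\<bar> \<le> \<mu>\<^sup>2 * M + 2 * \<mu> * (C * M) + C * M"
      using a(1,2) i2 by linarith
    moreover have "\<bar>a + 1 / 2 * b + c\<bar> \<le> \<bar>a\<bar> + 1 / 2 * k + d" if "\<bar>c\<bar> \<le> d" "\<bar>b\<bar> \<le> k" for a b c d k :: real
      using that by argo
    ultimately show "\<bar>f n r\<bar> \<le> g r" unfolding f_def g_def by blast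
  qed
qed

end

lemma ac_derivative_lincomb:
  assumes F: "ac_derivative F f a b" and G: "ac_derivative G g a b"
  shows "ac_derivative (\<lambda>t. c * F t - G t) (\<lambda>t. c * f t - g t) a b"
proof (rule ac_derivative_intro[where c = "c * F a - G a"])
  note fi = ac_derivative_abs_integrable[OF F] and gi = ac_derivative_abs_integrable[OF G]
  show "(\<lambda>t. c * f t - g t) absolutely_integrable_on {a..b}"
    by (intro set_integral_diff absolutely_integrable_const_mult fi gi)
  fix t assume t: "a \<le> t" "t \<le> b"
  have "integral {a..t} (\<lambda>t. c * f t - g t) = c * integral {a..t} f - integral {a..t} g"
    using ac_derivative_integrable_sub(2)[OF F order_refl t(2)] ac_derivative_integrable_sub(2)[OF G order_refl t(2)]
    by (intro integral_unique has_integral_diff has_integral_mult_right integrable_integral)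
  also have "\<dots> = c * (F t - F a) - (G t - G a)"
    using ac_derivative_diff[OF F order_refl t] ac_derivative_diff[OF G order_refl t] by simp
  finally show "c * F t - G t = c * F a - G a + integral {a..t} (\<lambda>t. c * f t - g t)" by (simp add: algebra_simps)
qed

lemma ac_gronwall_AE:
  assumes H: "ac_derivative H h a b" and k: "k absolutely_integrable_on {a..b}" and a: "0 \<le> H a"
    and le: "AE r in lebesgue. r \<in> {a..b} \<longrightarrow> k r * H r \<le> h r" and t: "a \<le> t" "t \<le> b"
  shows "0 \<le> H t"
proof (rule ac_gronwall[OF k ac_derivative_continuous[OF H] a _ t])
  fix s t assume st: "a \<le> s" "s \<le> t" "t \<le> b"
  have kH: "(\<lambda>r. k r * H r) absolutely_integrable_on {s..t}"
    using absolutely_integrable_on_subinterval[OF absolutely_integrable_mult_continuous[OF k ac_derivative_continuous[OF H]], of s t] st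
    by auto
  have "integral {s..t} (\<lambda>r. k r * H r) \<le> integral {s..t} h"
    by (rule integral_mono_AE_on[OF kH ac_derivative_integrable_sub(1)[OF H st(1,3)]])
      (use le st in \<open>auto elim: eventually_mono\<close>)
  then show "integral {s..t} (\<lambda>r. k r * H r) \<le> H t - H s" using ac_derivative_diff[OF H st] by simp
qed

lemma AE_interval_witness:
  fixes a b :: real
  assumes "AE x in lebesgue. x \<in> {a<..<b} \<longrightarrow> P x" "a < b"
  obtains x where "x \<in> {a<..<b}" "P x"
proof (cases "\<exists>x\<in>{a<..<b}. P x")
  case False
  have "AE x in lebesgue. x \<notin> {a<..<b}" using assms(1) by eventually_elim (use False in auto)
  then have "{a<..<b} \<in> null_sets lebesgue"
    by (subst (asm) AE_iff_null_sets[symmetric]) auto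
  then show ?thesis using assms(2) by auto
qed (use that in auto)

lemma absolutely_integrable_atLeast_iff:
  fixes f :: "real \<Rightarrow> real"
  shows "f absolutely_integrable_on {0..} \<longleftrightarrow> f absolutely_integrable_on {0<..}" "integral {0..} f = integral {0<..} f"
proof -
  have n: "negligible {x \<in> {0..} - {0<..}. f x \<noteq> 0}" "negligible {x \<in> {0<..} - {0..}. f x \<noteq> 0}"
    by (rule negligible_subset[OF negligible_sing[of 0]]; force)+
  show "f absolutely_integrable_on {0..} \<longleftrightarrow> f absolutely_integrable_on {0<..}"
    by (rule absolutely_integrable_spike_set_eq[OF n])
  show "integral {0..} f = integral {0<..} f" by (rule integral_spike_set[OF n])
qed

section \<open>Consequences of the feedback relation\<close>

context parabolic
begin

text \<open>The one-sided derivative at 0 is unique, so \<open>d\<close> is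
  \<open>slope t 0\<close>. As the integral is non-zero, the quotient may be multiplied out.\<close>

lemma flux_feedback:
  assumes "AE t in lebesgue. t \<in> {0..\<tau>} \<longrightarrow>
    (\<exists>d. (q t has_real_derivative d) (at 0 within {0..}) \<and> set_integrable lebesgue {0<..} (q t) \<and>
      (LINT y:{0<..}|lebesgue. q t y) \<noteq> 0 \<and> \<Lambda> t = - (1 / 2) * (d / (LINT y:{0<..}|lebesgue. q t y)))"
  shows "AE t in lebesgue. t \<in> {0..\<tau>} \<longrightarrow> mass t \<noteq> 0 \<and> flux t = \<Lambda> t * mass t"
  using assms AE_regular_time
proof eventually_elim
  case (elim t)
  show ?case
  proof
    assume t: "t \<in> {0..\<tau>}"
    then obtain d where d: "(q t has_real_derivative d) (at 0 within {0..})" and i: "q t absolutely_integrable_on {0<..}"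
      and m: "(LINT y:{0<..}|lebesgue. q t y) \<noteq> 0" and L: "\<Lambda> t = - (1 / 2) * (d / (LINT y:{0<..}|lebesgue. q t y))"
      using elim(1) by blast
    have e: "(LINT y:{0<..}|lebesgue. q t y) = mass t"
      unfolding mass_def absolutely_integrable_atLeast_iff(2) by (rule set_lebesgue_integral_eq_integral(2)[OF i])
    have "(q t has_real_derivative slope t 0) (at 0 within {0..})" using slope_derivative elim(2) t by blast
    then have "slope t 0 = d"
      using d unfolding has_field_derivative_iff by (intro tendsto_unique[OF at_within_atLeast_not_bot]) auto
    then show "mass t \<noteq> 0 \<and> flux t = \<Lambda> t * mass t" using m L unfolding e by (simp add: flux_def)
  qed
qed

text \<open>The exact residuals are G' = - \<alpha> \<mu> \<Lambda> G + (1 + \<alpha> \<mu>) c E and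
  H' = (c + \<Lambda>) H - \<Lambda> G; both are non-negative beyond the Gronwall term, the second
  because \<Lambda> \<le> 0 and G \<ge> 0. The drift \<beta> is absorbed into c = \<mu>^2 / 2 -
  \<mu> \<beta>.\<close>

lemma laplace_lower_bound:
  assumes q0: "\<And>x. 0 \<le> x \<Longrightarrow> 0 \<le> q 0 x" and i0: "q 0 absolutely_integrable_on {0..}" and m0: "mass 0 = 1"
    and feedback: "AE t in lebesgue. t \<in> {0..\<tau>} \<longrightarrow> mass t \<noteq> 0 \<and> flux t = \<Lambda> t * mass t"
    and B: "\<And>t. B t = \<alpha> * \<Lambda> t + \<beta>" and \<Lambda>: "\<Lambda> absolutely_integrable_on {0..\<tau>}"
    and \<alpha>: "0 < \<alpha>" and \<mu>: "0 < \<mu>" "2 * \<beta> < \<mu>" and crit: "1 \<le> (1 + \<alpha> * \<mu>) * laplace \<mu> 0"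
    and t: "t \<in> {0..\<tau>}"
  shows "laplace \<mu> 0 * exp (\<mu> * (\<mu> - 2 * \<beta>) / 2 * t) * mass t \<le> laplace \<mu> t"
proof -
  define c where "c = \<mu> * (\<mu> - 2 * \<beta>) / 2"
  have c: "0 \<le> c" using \<mu> by (simp add: c_def)
  define E where "E = laplace \<mu>"
  define e where "e = (\<lambda>r. flux r + (\<mu>\<^sup>2 / 2 - \<mu> * B r) * E r)"
  have \<mu>0: "0 \<le> \<mu>" using \<mu> by simp
  have Eb: "0 \<le> E r" "E r \<le> mass r" if "r \<in> {0..\<tau>}" for r
    using laplace_evolution(1)[OF q0 i0 \<mu>0 that] by (auto simp: E_def)
  have aE: "ac_derivative E e 0 \<tau>" unfolding E_def e_def by (rule laplace_evolution(2)[OF q0 i0 \<mu>0])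
  have aQ: "ac_derivative mass flux 0 \<tau>" by (rule mass_evolution(2)[OF q0 i0])
  have "AE r in lebesgue. r \<in> {0..\<tau>} \<longrightarrow> flux r \<le> 0" by (rule flux_nonpos[OF q0])
  with feedback have fb: "AE r in lebesgue. r \<in> {0..\<tau>} \<longrightarrow> \<Lambda> r \<le> 0 \<and> flux r = \<Lambda> r * mass r \<and> e r = \<Lambda> r * mass r + (c - \<alpha> * \<mu> * \<Lambda> r) * E r"
  proof eventually_elim
    case (elim r)
    show ?case
    proof
      assume r: "r \<in> {0..\<tau>}"
      \<comment> \<open>The mass dominates the non-negative Laplace transform and is not zero, hence
        positive; dividing the sign of the flux by it gives the sign of \<Lambda>.\<close>
      have "0 < mass r" using Eb[OF r] elim r by force
      then have "\<Lambda> r \<le> 0" using elim r by (auto simp: mult_le_0_iff)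
      moreover have fr: "flux r = \<Lambda> r * mass r" using elim r by blast
      moreover have "e r = \<Lambda> r * mass r + (c - \<alpha> * \<mu> * \<Lambda> r) * E r"
        unfolding e_def c_def B fr by (simp add: power2_eq_square field_simps)
      ultimately show "\<Lambda> r \<le> 0 \<and> flux r = \<Lambda> r * mass r \<and> e r = \<Lambda> r * mass r + (c - \<alpha> * \<mu> * \<Lambda> r) * E r" by blast
    qed
  qed
  have G: "0 \<le> (1 + \<alpha> * \<mu>) * E r - mass r" if r: "r \<in> {0..\<tau>}" for r
  proof (rule ac_gronwall_AE[OF ac_derivative_lincomb[OF aE aQ]])
    show "(\<lambda>r. (- \<alpha> * \<mu>) * \<Lambda> r) absolutely_integrable_on {0..\<tau>}" by (rule absolutely_integrable_const_mult[OF \<Lambda>])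
    show "0 \<le> (1 + \<alpha> * \<mu>) * E 0 - mass 0" using crit m0 by (simp add: E_def)
    show "AE r in lebesgue. r \<in> {0..\<tau>} \<longrightarrow> - \<alpha> * \<mu> * \<Lambda> r * ((1 + \<alpha> * \<mu>) * E r - mass r) \<le> (1 + \<alpha> * \<mu>) * e r - flux r"
      using fb
    proof eventually_elim
      case (elim r)
      show ?case
      proof
        assume r: "r \<in> {0..\<tau>}"
        then have fr: "flux r = \<Lambda> r * mass r" and er: "e r = \<Lambda> r * mass r + (c - \<alpha> * \<mu> * \<Lambda> r) * E r" using elim by blast+
        have "0 \<le> (1 + \<alpha> * \<mu>) * (c * E r)" using c \<alpha> \<mu> Eb[OF r] by simp
        moreover have "(1 + \<alpha> * \<mu>) * e r - flux r = - \<alpha> * \<mu> * \<Lambda> r * ((1 + \<alpha> * \<mu>) * E r - mass r) + (1 + \<alpha> * \<mu>) * (c * E r)"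
          unfolding fr er by (simp add: algebra_simps)
        ultimately show "- \<alpha> * \<mu> * \<Lambda> r * ((1 + \<alpha> * \<mu>) * E r - mass r) \<le> (1 + \<alpha> * \<mu>) * e r - flux r" by linarith
      qed
    qed
  qed (use r in auto)
  define w where "w = (\<lambda>r. E 0 * exp (c * r))"
  have "((\<lambda>r. E 0 * exp (c * r)) has_real_derivative c * (E 0 * exp (c * r))) (at r within S)" for r S
    by (auto intro!: derivative_eq_intros)
  then have aw: "ac_derivative w (\<lambda>r. c * w r) 0 \<tau>"
    unfolding w_def by (intro ac_derivative_C1 continuous_intros)
  \<comment> \<open>The factor 1 is the coefficient of \<open>ac_derivative_lincomb\<close>.\<close>
  have "0 \<le> 1 * E t - w t * mass t"
  proof (rule ac_gronwall_AE[OF ac_derivative_lincomb[OF aE ac_derivative_mult[OF aw aQ]]])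
    show "(\<lambda>r. c + \<Lambda> r) absolutely_integrable_on {0..\<tau>}"
      by (intro set_integral_add \<Lambda> absolutely_integrable_continuous_real continuous_intros)
    show "0 \<le> 1 * E 0 - w 0 * mass 0" by (simp add: w_def m0)
    show "AE r in lebesgue. r \<in> {0..\<tau>} \<longrightarrow>
      (c + \<Lambda> r) * (1 * E r - w r * mass r) \<le> 1 * e r - (c * w r * mass r + w r * flux r)"
      using fb
    proof eventually_elim
      case (elim r)
      show ?case
      proof
        assume r: "r \<in> {0..\<tau>}"
        then have fr: "flux r = \<Lambda> r * mass r" and er: "e r = \<Lambda> r * mass r + (c - \<alpha> * \<mu> * \<Lambda> r) * E r" using elim by blast+
        have "\<Lambda> r * ((1 + \<alpha> * \<mu>) * E r - mass r) \<le> 0" using elim r G[OF r] by (intro mult_nonpos_nonneg) auto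
        moreover have "1 * e r - (c * w r * mass r + w r * flux r) =
            (c + \<Lambda> r) * (1 * E r - w r * mass r) - \<Lambda> r * ((1 + \<alpha> * \<mu>) * E r - mass r)"
          unfolding fr er by (simp add: algebra_simps)
        ultimately show "(c + \<Lambda> r) * (1 * E r - w r * mass r) \<le> 1 * e r - (c * w r * mass r + w r * flux r)" by linarith
      qed
    qed
  qed (use t in auto)
  then show ?thesis by (simp add: w_def E_def c_def)
qed

lemma laplace_time_bound:
  assumes q0: "\<And>x. 0 \<le> x \<Longrightarrow> 0 \<le> q 0 x" and i0: "q 0 absolutely_integrable_on {0..}" and m0: "mass 0 = 1"
    and feedback: "AE t in lebesgue. t \<in> {0..\<tau>} \<longrightarrow> mass t \<noteq> 0 \<and> flux t = \<Lambda> t * mass t"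
    and B: "\<And>t. B t = \<alpha> * \<Lambda> t + \<beta>" and \<Lambda>: "\<Lambda> absolutely_integrable_on {0..\<tau>}"
    and \<alpha>: "0 < \<alpha>" and \<mu>: "0 < \<mu>" "2 * \<beta> < \<mu>" and crit: "1 \<le> (1 + \<alpha> * \<mu>) * laplace \<mu> 0"
    and \<sigma>: "0 \<le> \<sigma>" "\<sigma> < \<tau>"
  shows "laplace \<mu> 0 * exp (\<mu> * (\<mu> - 2 * \<beta>) / 2 * \<sigma>) \<le> 1"
proof -
  have ae: "AE t in lebesgue. t \<in> {\<sigma><..<\<tau>} \<longrightarrow> mass t \<noteq> 0" using feedback by eventually_elim (use \<sigma> in auto)
  \<comment> \<open>The mass is known to be non-zero at almost every time only, so it is cancelled
    at some time shortly after \<sigma>; the exponential is monotone in time.\<close>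
  obtain t where t: "t \<in> {\<sigma><..<\<tau>}" "mass t \<noteq> 0" by (rule AE_interval_witness[OF ae \<sigma>(2)])
  have t': "t \<in> {0..\<tau>}" "0 \<in> {0..\<tau>}" using t \<sigma> by auto
  have \<mu>0: "0 \<le> \<mu>" using \<mu> by simp
  have b: "0 \<le> laplace \<mu> r" "laplace \<mu> r \<le> mass r" if "r \<in> {0..\<tau>}" for r
    using laplace_evolution(1)[OF q0 i0 \<mu>0 that] by auto
  have m: "0 < mass t" using b[OF t'(1)] t(2) by linarith
  have "laplace \<mu> 0 * exp (\<mu> * (\<mu> - 2 * \<beta>) / 2 * t) * mass t \<le> 1 * mass t"
    using laplace_lower_bound[OF q0 i0 m0 feedback B \<Lambda> \<alpha> \<mu> crit t'(1)] b[OF t'(1)] by linarith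
  then have "laplace \<mu> 0 * exp (\<mu> * (\<mu> - 2 * \<beta>) / 2 * t) \<le> 1" using m by (rule mult_right_le_imp_le)
  moreover have "laplace \<mu> 0 * exp (\<mu> * (\<mu> - 2 * \<beta>) / 2 * \<sigma>) \<le> laplace \<mu> 0 * exp (\<mu> * (\<mu> - 2 * \<beta>) / 2 * t)"
    using b[OF t'(2)] t(1) \<mu> by (intro mult_left_mono) (auto intro!: mult_left_mono)
  ultimately show ?thesis by linarith
qed

end

section \<open>Problem (B)\<close>

text \<open>A Borel representative extended by zero moves all integrals to \<open>lborel\<close>,
  where products and Fubini's theorem are available without completion.\<close>

lemma L2_borel_representative:
  fixes v :: "real \<times> real \<Rightarrow> real"
  assumes v: "L2_on \<Omega> v" and \<Omega>: "\<Omega> \<in> sets borel"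
  obtains w where "w \<in> borel_measurable borel" "\<forall>z. z \<notin> \<Omega> \<longrightarrow> w z = 0"
    "AE z in lebesgue. z \<in> \<Omega> \<longrightarrow> v z = w z" "integrable lborel (\<lambda>z. (w z)\<^sup>2)"
proof -
  have "(\<lambda>z. indicator \<Omega> z *\<^sub>R v z) \<in> borel_measurable lebesgue"
    using v by (simp add: L2_on_def set_borel_measurable_def)
  then obtain u where u: "u \<in> borel_measurable lborel" "AE z in lborel. indicator \<Omega> z *\<^sub>R v z = u z"
    using completion_ex_borel_measurable_real by blast
  define w where "w = (\<lambda>z. indicator \<Omega> z * u z)"
  have w: "w \<in> borel_measurable borel" unfolding w_def using u(1) \<Omega> by simp
  have ae: "AE z in lebesgue. indicator \<Omega> z *\<^sub>R v z = w z"
    using AE_completion[OF u(2)] by eventually_elim (auto simp: w_def indicator_def split: if_splits)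
  have w2: "(\<lambda>z. (w z)\<^sup>2) \<in> borel_measurable lborel" using w by simp
  have "integrable lebesgue (\<lambda>z. indicator \<Omega> z *\<^sub>R (v z)\<^sup>2)"
    using v by (simp add: L2_on_def set_integrable_def)
  moreover have "AE z in lebesgue. indicator \<Omega> z *\<^sub>R (v z)\<^sup>2 = (w z)\<^sup>2"
    using ae by eventually_elim (auto simp: indicator_def split: if_splits)
  ultimately have "integrable lebesgue (\<lambda>z. (w z)\<^sup>2)"
    using measurable_completion[OF w2] by (subst integrable_cong_AE[symmetric]) (auto dest: borel_measurable_integrable)
  then have "integrable lborel (\<lambda>z. (w z)\<^sup>2)" unfolding integrable_completion[OF w2] .
  moreover have "AE z in lebesgue. z \<in> \<Omega> \<longrightarrow> v z = w z" using ae by eventually_elim auto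
  moreover have "\<forall>z. z \<notin> \<Omega> \<longrightarrow> w z = 0" by (simp add: w_def)
  ultimately show ?thesis using that w by blast
qed

lemma set_integral_borel_representative:
  fixes u w g :: "real \<times> real \<Rightarrow> real"
  assumes w: "w \<in> borel_measurable borel" "\<forall>z. z \<notin> \<Omega> \<longrightarrow> w z = 0" "AE z in lebesgue. z \<in> \<Omega> \<longrightarrow> u z = w z"
    and g: "g \<in> borel_measurable borel"
  shows "(LINT z:\<Omega>|lebesgue. u z * g z) = (LINT z|lborel. w z * g z)"
proof -
  have m: "(\<lambda>z. w z * g z) \<in> borel_measurable lborel" using w(1) g by simp
  have ae: "AE z in lebesgue. indicator \<Omega> z *\<^sub>R (u z * g z) = w z * g z"
    using w(3) by eventually_elim (auto simp: indicator_def w(2))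
  have "(LINT z|lebesgue. indicator \<Omega> z *\<^sub>R (u z * g z)) = (LINT z|lebesgue. w z * g z)"
    using lebesgue_measurable_AE[OF measurable_completion[OF m] ae] measurable_completion[OF m] ae
    by (intro integral_cong_AE)
  also have "\<dots> = (LINT z|lborel. w z * g z)" by (rule integral_completion[OF m])
  finally show ?thesis by (simp add: set_lebesgue_integral_def)
qed

lemma separable_test_function:
  assumes a: "smooth a" "\<forall>r. r \<notin> {s..t} \<longrightarrow> a r = 0" and b: "smooth b" "\<forall>r. r \<notin> {x..y} \<longrightarrow> b r = 0"
    and sub: "{s..t} \<times> {x..y} \<subseteq> \<Omega>"
  shows "cc_test_function \<Omega> (\<lambda>t x. a t * b x)" "pd_t UNIV (\<lambda>t x. a t * b x) = (\<lambda>t x. deriv a t * b x)"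
    "pd_x UNIV (\<lambda>t x. a t * b x) = (\<lambda>t x. a t * deriv b x)"
proof -
  have "C_k k UNIV UNIV (\<lambda>t x. (deriv ^^ 0) a t * (deriv ^^ 0) b x)" for k
    by (rule C_k_separable) (use smooth_deriv(1)[OF smooth_deriv_funpow[OF a(1)]] smooth_deriv(1)[OF smooth_deriv_funpow[OF b(1)]] in auto)
  then show "cc_test_function \<Omega> (\<lambda>t x. a t * b x)"
    unfolding cc_test_function_def C_infinity_def
    by (intro conjI exI[of _ "{s..t} \<times> {x..y}"] compact_Times sub) (use a(2) b(2) in auto)
  show "pd_t UNIV (\<lambda>t x. a t * b x) = (\<lambda>t x. deriv a t * b x)"
    by (intro ext pd_t_separable smooth_deriv(1) a) simp
  show "pd_x UNIV (\<lambda>t x. a t * b x) = (\<lambda>t x. a t * deriv b x)"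
    by (intro ext pd_x_separable smooth_deriv(1) b) simp
qed

lemma L2_on_Icc_absolutely_integrable:
  fixes f :: "real \<Rightarrow> real"
  assumes "L2_on {a..b} f"
  shows "f absolutely_integrable_on {a..b}"
  unfolding set_integrable_def
proof (rule Bochner_Integration.integrable_bound)
  have "(\<lambda>x. 1 + (f x)\<^sup>2) absolutely_integrable_on {a..b}"
    using assms by (intro set_integral_add(1) absolutely_integrable_continuous_real[OF continuous_on_const]) (simp add: L2_on_def)
  then show "integrable lebesgue (\<lambda>x. indicator {a..b} x *\<^sub>R (1 + (f x)\<^sup>2))" by (simp add: set_integrable_def)
  show "(\<lambda>x. indicator {a..b} x *\<^sub>R f x) \<in> borel_measurable lebesgue"
    using assms by (simp add: L2_on_def set_borel_measurable_def)
  have "\<bar>f x\<bar> \<le> 1 + (f x)\<^sup>2" for x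
  proof -
    have "0 \<le> (\<bar>f x\<bar> - 1 / 2)\<^sup>2" by simp
    then show ?thesis by (simp add: power2_diff power_divide)
  qed
  then show "AE x in lebesgue. norm (indicator {a..b} x *\<^sub>R f x) \<le> norm (indicator {a..b} x *\<^sub>R (1 + (f x)\<^sup>2))"
    by (intro always_eventually allI) (auto simp: indicator_def abs_of_nonneg add_nonneg_nonneg)
qed

lemma W122_solution_parabolic:
  assumes \<tau>: "0 < \<tau>" and sol: "W122_solution_B \<alpha> \<beta> q0 \<Lambda> \<tau> q" and \<Lambda>: "\<Lambda> absolutely_integrable_on {0..\<tau>}"
  obtains v1 v2 v3 where "parabolic \<tau> q v1 v2 v3 (\<lambda>t. \<alpha> * \<Lambda> t + \<beta>)"
proof -
  define \<Omega> where "\<Omega> = {0<..<\<tau>} \<times> {0::real<..}"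
  have \<Omega>b: "\<Omega> \<in> sets borel" unfolding \<Omega>_def by (intro borel_open open_Times) auto
  have st: "space_time \<tau> = \<Omega>" by (simp add: space_time_def \<Omega>_def)
  obtain qt qx qxx where cont: "continuous_on ({0..\<tau>} \<times> {0..}) (\<lambda>(t, x). q t x)"
    and W: "W122_with \<tau> q qt qx qxx"
    and pde: "AE (t, x) in lebesgue. (t, x) \<in> \<Omega> \<longrightarrow> qt t x = 1 / 2 * qxx t x - (\<alpha> * \<Lambda> t + \<beta>) * qx t x"
    and bdry: "\<And>t. t \<in> {0..\<tau>} \<Longrightarrow> q t 0 = 0"
    using sol unfolding W122_solution_B_def st by blast
  have L2: "L2_on \<Omega> (\<lambda>(t, x). q t x)" "L2_on \<Omega> (\<lambda>(t, x). qt t x)" "L2_on \<Omega> (\<lambda>(t, x). qx t x)" "L2_on \<Omega> (\<lambda>(t, x). qxx t x)"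
    and wt: "weak_pd_t \<Omega> q qt" and wx: "weak_pd_x \<Omega> q qx" and wxx: "weak_pd_x \<Omega> qx qxx"
    using W unfolding W122_with_def st by auto
  obtain v1 where v1: "v1 \<in> borel_measurable borel" "\<forall>z. z \<notin> \<Omega> \<longrightarrow> v1 z = 0"
    "AE z in lebesgue. z \<in> \<Omega> \<longrightarrow> (\<lambda>(t, x). qt t x) z = v1 z" and sq1: "integrable lborel (\<lambda>z. (v1 z)\<^sup>2)"
    by (rule L2_borel_representative[OF L2(2) \<Omega>b], rule that)
  obtain v2 where v2: "v2 \<in> borel_measurable borel" "\<forall>z. z \<notin> \<Omega> \<longrightarrow> v2 z = 0"
    "AE z in lebesgue. z \<in> \<Omega> \<longrightarrow> (\<lambda>(t, x). qx t x) z = v2 z" and sq2: "integrable lborel (\<lambda>z. (v2 z)\<^sup>2)"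
    by (rule L2_borel_representative[OF L2(3) \<Omega>b], rule that)
  obtain v3 where v3: "v3 \<in> borel_measurable borel" "\<forall>z. z \<notin> \<Omega> \<longrightarrow> v3 z = 0"
    "AE z in lebesgue. z \<in> \<Omega> \<longrightarrow> (\<lambda>(t, x). qxx t x) z = v3 z" and sq3: "integrable lborel (\<lambda>z. (v3 z)\<^sup>2)"
    by (rule L2_borel_representative[OF L2(4) \<Omega>b], rule that)
  define u where "u = (\<lambda>z. indicator \<Omega> z * q (fst z) (snd z))"
  have "continuous_on \<Omega> (\<lambda>(t, x). q t x)" by (rule continuous_on_subset[OF cont]) (auto simp: \<Omega>_def)
  from borel_measurable_continuous_on_indicator[OF \<Omega>b this]
  have u: "u \<in> borel_measurable borel" "\<forall>z. z \<notin> \<Omega> \<longrightarrow> u z = 0"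
    "AE z in lebesgue. z \<in> \<Omega> \<longrightarrow> (\<lambda>(t, x). q t x) z = u z"
    by (auto simp: u_def case_prod_beta)
  have rep: "(LINT (t, x):\<Omega>|lebesgue. f t x * (a t * b x)) = (LINT z|lborel. w z * (a (fst z) * b (snd z)))"
    if w: "w \<in> borel_measurable borel" "\<forall>z. z \<notin> \<Omega> \<longrightarrow> w z = 0" "AE z in lebesgue. z \<in> \<Omega> \<longrightarrow> (\<lambda>(t, x). f t x) z = w z"
      and ab: "smooth a" "smooth b" for f w a b
  proof -
    have "(\<lambda>z. a (fst z) * b (snd z)) \<in> borel_measurable borel"
      by (intro borel_measurable_times borel_measurable_fst_snd borel_measurable_continuous_onI smooth_continuous_on ab)
    from set_integral_borel_representative[OF w this] show ?thesis by (simp add: case_prod_unfold)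
  qed
  have rect: "(LINT z|lborel. indicator ({s..t} \<times> {x..y}) z * q (fst z) (snd z) * (a (fst z) * b (snd z))) =
      (LINT z|lborel. u z * (a (fst z) * b (snd z)))"
    if "{s..t} \<subseteq> {0<..<\<tau>}" "{x..y} \<subseteq> {0<..}" "\<forall>r. r \<notin> {s..t} \<longrightarrow> a r = 0" "\<forall>r. r \<notin> {x..y} \<longrightarrow> b r = 0"
    for a b :: "real \<Rightarrow> real" and s t x y
  proof (rule Bochner_Integration.integral_cong[OF refl])
    fix z
    show "indicator ({s..t} \<times> {x..y}) z * q (fst z) (snd z) * (a (fst z) * b (snd z)) = u z * (a (fst z) * b (snd z))"
    proof (cases "z \<in> {s..t} \<times> {x..y}")
      case True
      then have "z \<in> \<Omega>" using that(1,2) by (auto simp: \<Omega>_def)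
      then show ?thesis using True by (simp add: u_def)
    next
      case False
      then have "fst z \<notin> {s..t} \<or> snd z \<notin> {x..y}" by (auto simp: mem_Times_iff)
      then have "a (fst z) * b (snd z) = 0" using that(3,4) by auto
      then show ?thesis by simp
    qed
  qed
  have "parabolic \<tau> q v1 v2 v3 (\<lambda>t. \<alpha> * \<Lambda> t + \<beta>)"
  proof
    show "0 < \<tau>" "continuous_on ({0..\<tau>} \<times> {0..}) (\<lambda>(t, x). q t x)" "\<And>t. t \<in> {0..\<tau>} \<Longrightarrow> q t 0 = 0"
      using \<tau> cont bdry by auto
    show "v1 \<in> borel_measurable borel" "v2 \<in> borel_measurable borel" "v3 \<in> borel_measurable borel"
      "integrable lborel (\<lambda>z. (v1 z)\<^sup>2)" "integrable lborel (\<lambda>z. (v2 z)\<^sup>2)" "integrable lborel (\<lambda>z. (v3 z)\<^sup>2)"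
      by fact+
    show "v1 z = 0" "v2 z = 0" "v3 z = 0" if "z \<notin> {0<..<\<tau>} \<times> {0<..}" for z
      using that v1(2) v2(2) v3(2) unfolding \<Omega>_def by blast+
    have i: "integrable lebesgue (\<lambda>z. indicator \<Omega> z * (q (fst z) (snd z))\<^sup>2)"
      using L2(1) by (simp add: L2_on_def set_integrable_def case_prod_beta)
    have eq: "(\<lambda>z. indicator \<Omega> z * (q (fst z) (snd z))\<^sup>2) = (\<lambda>z. (u z)\<^sup>2)" by (auto simp: u_def indicator_def)
    have "(\<lambda>z. (u z)\<^sup>2) \<in> borel_measurable lborel" using u(1) by simp
    from integrable_completion[OF this] i show "integrable lborel (\<lambda>z. indicator ({0<..<\<tau>} \<times> {0<..}) z * (q (fst z) (snd z))\<^sup>2)"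
      unfolding \<Omega>_def[symmetric] eq by simp
    show "(\<lambda>t. \<alpha> * \<Lambda> t + \<beta>) absolutely_integrable_on {0..\<tau>}"
      by (intro set_integral_add absolutely_integrable_const_mult \<Lambda> absolutely_integrable_continuous_real continuous_intros)
    have "AE z in lebesgue. z \<in> \<Omega> \<longrightarrow> v1 z = 1 / 2 * v3 z - (\<alpha> * \<Lambda> (fst z) + \<beta>) * v2 z"
      using pde v1(3) v2(3) v3(3) by eventually_elim auto
    then show "AE z in lborel. z \<in> {0<..<\<tau>} \<times> {0<..} \<longrightarrow> v1 z = 1 / 2 * v3 z - (\<alpha> * \<Lambda> (fst z) + \<beta>) * v2 z"
      unfolding \<Omega>_def by (simp only: AE_completion_iff)
    fix a b :: "real \<Rightarrow> real" and s t x y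
    assume a: "smooth a" and b: "smooth b" and sub: "{s..t} \<subseteq> {0<..<\<tau>}" "{x..y} \<subseteq> {0<..}"
      and "\<And>r. r \<notin> {s..t} \<Longrightarrow> a r = 0" and "\<And>r. r \<notin> {x..y} \<Longrightarrow> b r = 0"
    then have az: "\<forall>r. r \<notin> {s..t} \<longrightarrow> a r = 0" and bz: "\<forall>r. r \<notin> {x..y} \<longrightarrow> b r = 0" by blast+
    have sub': "{s..t} \<times> {x..y} \<subseteq> \<Omega>" using sub by (auto simp: \<Omega>_def)
    note az' = deriv_zero_outside[OF az] and bz' = deriv_zero_outside[OF bz]
    note a' = smooth_deriv(2)[OF a] and b' = smooth_deriv(2)[OF b]
    note T = separable_test_function[OF a az b bz sub']
    have "(LINT z|lborel. u z * (deriv a (fst z) * b (snd z))) = (LINT (t, x):\<Omega>|lebesgue. q t x * pd_t UNIV (\<lambda>t x. a t * b x) t x)"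
      unfolding T(2) by (rule rep[OF u a' b, symmetric])
    also have "\<dots> = - (LINT (t, x):\<Omega>|lebesgue. qt t x * (a t * b x))"
      using wt T(1) unfolding weak_pd_t_def by blast
    also have "\<dots> = - (LINT z|lborel. v1 z * (a (fst z) * b (snd z)))" unfolding rep[OF v1 a b] ..
    finally show "(LINT z|lborel. indicator ({s..t} \<times> {x..y}) z * q (fst z) (snd z) * (deriv a (fst z) * b (snd z))) =
        - (LINT z|lborel. v1 z * (a (fst z) * b (snd z)))"
      unfolding rect[OF sub az' bz] .
    have x: "(LINT (t, x):\<Omega>|lebesgue. q t x * (a t * deriv \<psi> x)) = - (LINT (t, x):\<Omega>|lebesgue. qx t x * (a t * \<psi> x))"
      if "smooth \<psi>" "\<forall>r. r \<notin> {x..y} \<longrightarrow> \<psi> r = 0" for \<psi>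
    proof -
      note S = separable_test_function[OF a az that sub']
      show ?thesis using wx[unfolded weak_pd_x_def, rule_format, OF S(1)] unfolding S(3) .
    qed
    have "(LINT z|lborel. u z * (a (fst z) * deriv b (snd z))) = - (LINT z|lborel. v2 z * (a (fst z) * b (snd z)))"
      using x[OF b bz] unfolding rep[OF u a b'] rep[OF v2 a b] .
    then show "(LINT z|lborel. indicator ({s..t} \<times> {x..y}) z * q (fst z) (snd z) * (a (fst z) * deriv b (snd z))) =
        - (LINT z|lborel. v2 z * (a (fst z) * b (snd z)))"
      unfolding rect[OF sub az bz'] .
    have "(LINT (t, x):\<Omega>|lebesgue. qx t x * (a t * deriv b x)) = - (LINT (t, x):\<Omega>|lebesgue. qxx t x * (a t * b x))"
      using wxx[unfolded weak_pd_x_def, rule_format, OF T(1)] unfolding T(3) .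
    \<comment> \<open>Two first-order weak derivatives compose: the first is tested with the
      derivative of b, the second with b itself, and the signs cancel.\<close>
    with x[OF b' bz'] have "(LINT (t, x):\<Omega>|lebesgue. q t x * (a t * deriv (deriv b) x)) = (LINT (t, x):\<Omega>|lebesgue. qxx t x * (a t * b x))"
      by linarith
    then have "(LINT z|lborel. u z * (a (fst z) * deriv (deriv b) (snd z))) = (LINT z|lborel. v3 z * (a (fst z) * b (snd z)))"
      unfolding rep[OF u a smooth_deriv(2)[OF b']] rep[OF v3 a b] .
    then show "(LINT z|lborel. indicator ({s..t} \<times> {x..y}) z * q (fst z) (snd z) * (a (fst z) * deriv (deriv b) (snd z))) =
        (LINT z|lborel. v3 z * (a (fst z) * b (snd z)))"
      unfolding rect[OF sub az deriv_zero_outside[OF bz']] .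
  qed
  then show ?thesis by (rule that)
qed

lemma continuous_nonneg_of_AE:
  fixes f :: "real \<Rightarrow> real"
  assumes f: "continuous_on {0..} f" and ae: "AE x in lebesgue. 0 < x \<longrightarrow> 0 \<le> f x" and x: "0 \<le> x"
  shows "0 \<le> f x"
proof (rule ccontr)
  assume n: "\<not> 0 \<le> f x"
  obtain d where d: "0 < d" "\<And>y. y \<in> {0..} \<Longrightarrow> dist y x < d \<Longrightarrow> dist (f y) (f x) < - f x"
    using f x n unfolding continuous_on_iff by (metis atLeast_iff neg_0_less_iff_less not_le)
  have "AE y in lebesgue. y \<in> {x<..<x + d} \<longrightarrow> 0 \<le> f y" using ae by eventually_elim (use x in auto)
  then obtain y where y: "y \<in> {x<..<x + d}" "0 \<le> f y" by (rule AE_interval_witness) (use d in auto)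
  then show False using d(2)[of y] x by (auto simp: dist_real_def)
qed

section \<open>Time bound for (B) and conclusion\<close>

lemma generalized_solution_B_time_bound:
  assumes \<alpha>: "0 < \<alpha>" and dens: "density_on_pos q0" and \<mu>: "0 < \<mu>" "2 * \<beta> < \<mu>"
    and crit: "1 \<le> (1 + \<alpha> * \<mu>) * (LINT x:{0<..}|lebesgue. exp (- \<mu> * x) * q0 x)"
    and sol: "generalized_solution_B \<alpha> \<beta> q0 T q \<Lambda>"
  shows "T \<le> ereal (2 / (\<mu> * (\<mu> - 2 * \<beta>)) *
    ln ((LINT x:{0<..}|lebesgue. q0 x) / (LINT x:{0<..}|lebesgue. exp (- \<mu> * x) * q0 x)))"
proof (rule ccontr)
  define M where "M = (LINT x:{0<..}|lebesgue. exp (- \<mu> * x) * q0 x)"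
  have M: "0 < M" unfolding M_def using density_exp_moment_pos[OF dens] \<mu> by simp
  define L where "L = 2 / (\<mu> * (\<mu> - 2 * \<beta>)) * ln (1 / M)"
  assume "\<not> ?thesis"
  then have "ereal L < T" by (simp add: L_def M_def density_on_posD(2)[OF dens])
  moreover have "0 < T" using sol by (simp add: generalized_solution_B_def)
  ultimately have "ereal (max L 0) < T" by (simp add: max_def zero_ereal_def)
  then obtain \<tau> where \<tau>: "ereal (max L 0) < ereal \<tau>" "ereal \<tau> < T" using ereal_dense2 by blast
  then have \<tau>0: "0 < \<tau>" "L < \<tau>" by auto
  have \<Lambda>: "\<Lambda> absolutely_integrable_on {0..\<tau>}" and W: "W122_solution_B \<alpha> \<beta> q0 \<Lambda> \<tau> q"
    and fb: "AE t in lebesgue. t \<in> {0..\<tau>} \<longrightarrow>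
      (\<exists>d. (q t has_real_derivative d) (at 0 within {0..}) \<and> set_integrable lebesgue {0<..} (q t) \<and>
        (LINT y:{0<..}|lebesgue. q t y) \<noteq> 0 \<and> \<Lambda> t = - (1 / 2) * (d / (LINT y:{0<..}|lebesgue. q t y)))"
    using sol \<tau>0(1) \<tau>(2) unfolding generalized_solution_B_def by (blast intro: L2_on_Icc_absolutely_integrable)+
  obtain v1 v2 v3 where "parabolic \<tau> q v1 v2 v3 (\<lambda>t. \<alpha> * \<Lambda> t + \<beta>)"
    by (rule W122_solution_parabolic[OF \<tau>0(1) W \<Lambda>])
  then interpret parabolic \<tau> q v1 v2 v3 "\<lambda>t. \<alpha> * \<Lambda> t + \<beta>" .
  note d = density_on_posD[OF dens]
  have init: "AE x in lebesgue. 0 < x \<longrightarrow> q 0 x = q0 x" using W by (simp add: W122_solution_B_def)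
  \<comment> \<open>One formula for both initial values: \<nu> = 0 gives the mass.\<close>
  have l: "laplace \<nu> 0 = (LINT x:{0<..}|lebesgue. exp (- \<nu> * x) * q0 x)" if "0 \<le> \<nu>" for \<nu>
  proof -
    note e = integrable_exp_mult[OF d(1) that]
    have "integral {0<..} (\<lambda>x. exp (- \<nu> * x) * q 0 x) = integral {0<..} (\<lambda>x. exp (- \<nu> * x) * q0 x)"
      by (rule absolutely_integrable_AE(2)[OF e]) (use init in \<open>auto elim: eventually_mono\<close>)
    then show ?thesis
      unfolding laplace_def absolutely_integrable_atLeast_iff(2) set_lebesgue_integral_eq_integral(2)[OF e] .
  qed
  have i0: "q 0 absolutely_integrable_on {0..}"
    unfolding absolutely_integrable_atLeast_iff(1)
    by (rule absolutely_integrable_AE(1)[OF d(1)]) (use init in \<open>auto elim: eventually_mono\<close>)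
  have q0: "0 \<le> q 0 x" if "0 \<le> x" for x
  proof (rule continuous_nonneg_of_AE[OF q_slice_continuous _ that])
    show "0 \<in> {0..\<tau>}" using \<tau>0 by simp
    show "AE x in lebesgue. 0 < x \<longrightarrow> 0 \<le> q 0 x" using init d(3) by eventually_elim auto
  qed
  have m0: "mass 0 = 1" using l[of 0] d(2) by (simp add: mass_def laplace_def)
  have le: "laplace \<mu> 0 * exp (\<mu> * (\<mu> - 2 * \<beta>) / 2 * \<sigma>) \<le> 1" if "0 \<le> \<sigma>" "\<sigma> < \<tau>" for \<sigma>
    by (rule laplace_time_bound[OF q0 i0 m0 flux_feedback[OF fb] refl \<Lambda> \<alpha> \<mu> _ that])
      (use crit l[of \<mu>] \<mu> in auto)
  \<comment> \<open>Strictly between the claimed bound and \<tau>, because the estimate at \<sigma>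
    uses a slightly later time.\<close>
  define \<sigma> where "\<sigma> = (max L 0 + \<tau>) / 2"
  have \<sigma>: "0 \<le> \<sigma>" "\<sigma> < \<tau>" "L < \<sigma>" using \<tau>0 by (auto simp: \<sigma>_def)
  have c: "0 < \<mu> * (\<mu> - 2 * \<beta>)" using \<mu> by simp
  have "M * exp (\<mu> * (\<mu> - 2 * \<beta>) / 2 * \<sigma>) \<le> 1" using le[OF \<sigma>(1,2)] l[of \<mu>] \<mu> by (simp add: M_def)
  then have "exp (\<mu> * (\<mu> - 2 * \<beta>) / 2 * \<sigma>) \<le> 1 / M" using M by (simp add: field_simps)
  then have "\<mu> * (\<mu> - 2 * \<beta>) / 2 * \<sigma> \<le> ln (1 / M)" using M by (subst ln_ge_iff) auto
  then have "2 / (\<mu> * (\<mu> - 2 * \<beta>)) * (\<mu> * (\<mu> - 2 * \<beta>) / 2 * \<sigma>) \<le> L"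
    unfolding L_def using c by (intro mult_left_mono) auto
  then have "\<sigma> \<le> L" using \<mu> by simp
  then show False using \<sigma> by simp
qed

theorem proposition1p1:
  shows
    "(\<forall>(\<alpha>::real) (p0::real \<Rightarrow> real). \<alpha> > 0 \<longrightarrow> density_on_pos p0 \<longrightarrow>
        (\<forall>\<mu>>0. \<mu> * \<alpha> * (LINT x:{0<..}|lebesgue. exp (- \<mu> * x) * p0 x) \<ge> 1 \<longrightarrow>
           \<not> (\<exists>p N. weak_solution_A \<alpha> p0 \<infinity> p N) \<and>
           (\<forall>T' p N. weak_solution_A \<alpha> p0 T' p N \<longrightarrow>
              T' \<le> ereal (2 / \<mu>\<^sup>2 * ln ((LINT x:{0<..}|lebesgue. p0 x) /
                        (LINT x:{0<..}|lebesgue. exp (- \<mu> * x) * p0 x))))) \<and>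
        (set_integrable lebesgue {0<..} (\<lambda>x. x * p0 x) \<and>
           \<alpha> > 2 * (LINT x:{0<..}|lebesgue. x * p0 x) \<longrightarrow>
           \<not> (\<exists>p N. weak_solution_A \<alpha> p0 \<infinity> p N)) \<and>
        ((\<exists>\<mu>>0. \<alpha> > inverse (\<mu> * (LINT x:{0<..}|lebesgue. exp (- \<mu> * x) * p0 x))) \<longrightarrow>
           \<not> (\<exists>p N. weak_solution_A \<alpha> p0 \<infinity> p N)))
   \<and> (\<forall>(\<alpha>::real) (\<beta>::real) (q0::real \<Rightarrow> real). \<alpha> > 0 \<longrightarrow> density_on_pos q0 \<longrightarrow>
        (\<forall>\<mu>. \<mu> > 0 \<and> \<mu> > 2 * \<beta> \<and>
           (1 + \<alpha> * \<mu>) * (LINT x:{0<..}|lebesgue. exp (- \<mu> * x) * q0 x)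
             \<ge> (LINT x:{0<..}|lebesgue. q0 x) \<longrightarrow>
           \<not> (\<exists>q \<Lambda>. generalized_solution_B \<alpha> \<beta> q0 \<infinity> q \<Lambda>) \<and>
           (\<forall>T' q \<Lambda>. generalized_solution_B \<alpha> \<beta> q0 T' q \<Lambda> \<longrightarrow>
              T' \<le> ereal (2 / (\<mu> * (\<mu> - 2 * \<beta>)) * ln ((LINT x:{0<..}|lebesgue. q0 x) /
                        (LINT x:{0<..}|lebesgue. exp (- \<mu> * x) * q0 x))))))"
proof (intro conjI allI impI)
  fix \<alpha> :: real and p0 :: "real \<Rightarrow> real"
  let ?M = "\<lambda>\<mu>. LINT x:{0<..}|lebesgue. exp (- \<mu> * x) * p0 x"
  assume \<alpha>: "\<alpha> > 0" and dens: "density_on_pos p0"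
  {
    fix \<mu> :: real assume \<mu>: "0 < \<mu>" and crit: "1 \<le> \<mu> * \<alpha> * ?M \<mu>"
    show "T' \<le> ereal (2 / \<mu>\<^sup>2 * ln ((LINT x:{0<..}|lebesgue. p0 x) / ?M \<mu>))"
      if "weak_solution_A \<alpha> p0 T' p N" for T' p N
      by (rule weak_solution_A_time_bound[OF \<alpha> dens \<mu> crit that])
    \<comment> \<open>A finite bound on the lifetime excludes the value \<infinity>.\<close>
    show "\<not> (\<exists>p N. weak_solution_A \<alpha> p0 \<infinity> p N)"
      using weak_solution_A_time_bound[OF \<alpha> dens \<mu> crit, of \<infinity>] by force
  }
  note none = this
  show "\<not> (\<exists>p N. weak_solution_A \<alpha> p0 \<infinity> p N)"
    if "set_integrable lebesgue {0<..} (\<lambda>x. x * p0 x) \<and> \<alpha> > 2 * (LINT x:{0<..}|lebesgue. x * p0 x)"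
    using no_global_weak_solution_first_moment[OF \<alpha> dens] that by blast
  show "\<not> (\<exists>p N. weak_solution_A \<alpha> p0 \<infinity> p N)" if "\<exists>\<mu>>0. \<alpha> > inverse (\<mu> * ?M \<mu>)"
  proof -
    from that obtain \<mu> where \<mu>: "0 < \<mu>" "inverse (\<mu> * ?M \<mu>) < \<alpha>" by (elim exE conjE)
    \<comment> \<open>Positivity rules out the default inverse of 0, so the strict inequality can be
      multiplied out.\<close>
    have "0 < \<mu> * ?M \<mu>" using density_exp_moment_pos[OF dens, of \<mu>] \<mu>(1) by simp
    with \<mu>(2) have "1 < \<alpha> * (\<mu> * ?M \<mu>)" by (metis inverse_eq_divide pos_divide_less_eq)
    then have "1 \<le> \<mu> * \<alpha> * ?M \<mu>" by (simp add: ac_simps)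
    with \<mu>(1) show ?thesis by (rule none)
  qed
next
  fix \<alpha> \<beta> \<mu> :: real and q0 :: "real \<Rightarrow> real"
  let ?M = "LINT x:{0<..}|lebesgue. exp (- \<mu> * x) * q0 x"
  assume \<alpha>: "\<alpha> > 0" and dens: "density_on_pos q0"
    and h: "\<mu> > 0 \<and> \<mu> > 2 * \<beta> \<and> (1 + \<alpha> * \<mu>) * ?M \<ge> (LINT x:{0<..}|lebesgue. q0 x)"
  note \<mu> = h[THEN conjunct1] h[THEN conjunct2, THEN conjunct1]
    and crit = h[THEN conjunct2, THEN conjunct2, unfolded density_on_posD(2)[OF dens]]
  show "T' \<le> ereal (2 / (\<mu> * (\<mu> - 2 * \<beta>)) * ln ((LINT x:{0<..}|lebesgue. q0 x) / ?M))"
    if "generalized_solution_B \<alpha> \<beta> q0 T' q \<Lambda>" for T' q \<Lambda>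
    by (rule generalized_solution_B_time_bound[OF \<alpha> dens \<mu> crit that])
  show "\<not> (\<exists>q \<Lambda>. generalized_solution_B \<alpha> \<beta> q0 \<infinity> q \<Lambda>)"
    using generalized_solution_B_time_bound[OF \<alpha> dens \<mu> crit, of \<infinity>] by force
qed

end
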